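(* Let $G(z)$ and $H(z)$ be power series satisfying the standing assumptions in the context, with singular exponents $\lambda_G<0$ and $0<\lambda_H<1$; let $\tau_H:=H(\rho_H)$ and $q_c:=\rho_G/\tau_H$. For real $q>0$ and $n\ge 0$ let $X_n=X_n(q)$ be the random variable with \[\mathbb{P}(X_n(q)=k)=\frac{[z^nu^k]\,G\big(quH(z)\big)}{[z^n]\,G\big(qH(z)\big)},\qquad k\ge 0.\] Then, as $n\to\infty$: (1) (Subcritical regime, $0<q<q_c$.) $X_n-1$ converges in distribution to a discrete (Boltzmann) distribution: for every $k\ge 0$, \[\mathbb{P}(X_n-1=k)\to [v^k]\frac{G'(vq\tau_H)}{G'(q\tau_H)}.\] In particular, if $G(z)=(1-z)^{-m}$, the limit law of $X_n-1$ is the negative binomial distribution $\mathrm{NegBin}(m+1,1-q\tau_H)$, where $X\sim\mathrm{NegBin}(r,p)$ means $\mathbb{P}(X=k)=\binom{k+r-1}{k}p^r(1-p)^k$ for $k\ge 0$. (2) (Critical regime, $q=q_c$.) \[\frac{-c_H X_n}{\tau_H\, n^{\lambda_H}}\xrightarrow{\mathcal{L}} X,\] where $X$ follows the two-parameter Mittag-Leffler distribution $\mathrm{ML}(\alpha,\beta)$ with $\alpha:=\lambda_H$, $\beta:=-\lambda_G\lambda_H$, i.e. the law with density $f_X(x)=\frac{\Gamma(\beta+1)}{\alpha\Gamma(\beta/\alpha+1)}\sum_{n=1}^{\infty}\frac{(-1)^n}{n!\,\Gamma(-n\alpha)}x^{n+\beta/\alpha-1}$, which is determined by its moments $\mathbb{E}(X^r)=\frac{\Gamma(\beta)\Gamma(r+\beta/\alpha)}{\Gamma(\beta/\alpha)\Gamma(\alpha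 r+\beta)}$. In particular, for $\lambda_G=-1$ and $\lambda_H=\tfrac12$, $X$ follows the Rayleigh distribution $\mathcal{R}(\sqrt2)$, where $\mathcal{R}(\sigma)$ has density $\frac{x}{\sigma^2}e^{-x^2/(2\sigma^2)}$ for $x\ge 0$. (3) (Supercritical regime, $q>q_c$.) $(X_n-\mu_n)/\sigma_n$ converges in distribution to the standard normal distribution $\mathcal{N}(0,1)$, where the mean $\mu_n$ and variance $\sigma_n^2$ of $X_n$ satisfy, with $\rho=\rho(q)\in(0,\rho_H)$ the unique solution of $qH(\rho)=\rho_G$, \[\mu_n\sim\frac{\rho_G}{q\rho H'(\rho)}\,n,\qquad \sigma_n^2\sim\Big(\frac{\rho_G^2}{q^2\rho^2H'(\rho)^2}-\frac{\rho_G}{q\rho H'(\rho)}+\frac{\rho_G^2H''(\rho)}{q^2\rho H'(\rho)^3}\Big)n.\] In particular, \[\mathbb{E}(X_n)\sim\begin{cases}1+\dfrac{q\tau_H G''(q\tau_H)}{G'(q\tau_H)}, & 0<q<q_c,\\[2mm] \dfrac{\lambda_G\tau_H\Gamma(-\lambda_G\lambda_H)}{c_H\Gamma((1-\lambda_G)\lambda_H)}\,n^{\lambda_H}, & q=q_c,\\[2mm] \dfrac{\rho_G}{q\rho H'(\rho)}\,n, & q>q_c.\end{cases}\]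
   Context: Standing assumptions: $G(z)$ and $H(z)$ are power series with nonnegative real coefficients and aperiodic support, with finite positive radii of convergence $\rho_G$, $\rho_H$, each analytic in a $\Delta$-domain at its radius of convergence (a domain $\{z:|z|<R,\ z\neq\rho,\ |\arg(z-\rho)|>\phi\}$ with $R>\rho$, $0<\phi<\pi/2$), and having there a singular expansion $F(z)=P(1-z/\rho_F)+c_F(1-z/\rho_F)^{\lambda_F}(1+o(1))$ as $z\to\rho_F$, with singular exponent $\lambda_F\in\mathbb{R}\setminus\{0,1,2,\dots\}$, nonzero constant $c_F$, and polynomial $P$ ($P=0$ if $\lambda_F<0$, $P$ constant if $0<\lambda_F<1$). Thus $G(z)=c_G(1-z/\rho_G)^{\lambda_G}(1+o(1))$ near $\rho_G$ and $H(z)=\tau_H+c_H(1-z/\rho_H)^{\lambda_H}(1+o(1))$ near $\rho_H$, with $\tau_H=H(\rho_H)$. The law of $X_n(q)$ is the Gibbs distribution (weight $q^k$ on objects with $k$ components) of the number of $H$-components in the scheme $G(uH(z))$. *)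

theory Defs
  imports
    "HOL-Probability.Probability"
    "HOL-Complex_Analysis.Complex_Analysis"
    "HOL-Library.Landau_Symbols"
begin

section \<open>Power series with a singular expansion in a Delta-domain\<close>

text \<open>
  The support of an aperiodic series is not contained in any residue class
  modulo some \<open>d \<ge> 2\<close>.
\<close>

definition aperiodic_fps :: "real fps \<Rightarrow> bool" where
  "aperiodic_fps F \<longleftrightarrow>
     \<not> (\<exists>d\<ge>2. \<exists>r. \<forall>n. fps_nth F n \<noteq> 0 \<longrightarrow> n mod d = r mod (d::nat))"

definition delta_domain :: "real \<Rightarrow> real \<Rightarrow> real \<Rightarrow> complex set" where
  "delta_domain \<rho> R \<phi> =
     {z. norm z < R \<and> z \<noteq> of_real \<rho> \<and> \<bar>Arg (z - of_real \<rho>)\<bar> > \<phi>}"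

text \<open>
  On a Delta-domain at \<open>\<rho>\<close> the number \<open>1 - z/\<rho>\<close> is never a nonpositive real, so the
  principal branch \<open>powr\<close> is the intended power. The relation \<open>f \<sim> g\<close> says
  \<open>f = g (1 + o(1))\<close>. The polynomial \<open>P\<close> is in the variable \<open>1 - z/\<rho>\<close>. The function \<open>f\<close> is the
  analytic continuation of the series to the Delta-domain, which contains the open disc of
  convergence.
\<close>

definition delta_singular :: "real fps \<Rightarrow> real \<Rightarrow> real \<Rightarrow> real \<Rightarrow> bool" where
  "delta_singular F \<rho> lam c \<longleftrightarrow>
     (\<forall>n. fps_nth F n \<ge> 0) \<and> aperiodic_fps F \<and>
     \<rho> > 0 \<and> fps_conv_radius F = ereal \<rho> \<and>
     lam \<notin> \<nat> \<and> c \<noteq> 0 \<and>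
     (\<exists>R \<phi> f P. R > \<rho> \<and> 0 < \<phi> \<and> \<phi> < pi / 2 \<and>
        f analytic_on delta_domain \<rho> R \<phi> \<and>
        (\<forall>z. norm z < \<rho> \<longrightarrow> (\<lambda>n. of_real (fps_nth F n) * z ^ n) sums f z) \<and>
        (lam < 0 \<longrightarrow> P = 0) \<and> (0 < lam \<and> lam < 1 \<longrightarrow> degree P = 0) \<and>
        (\<lambda>z. f z - poly P (1 - z / of_real \<rho>))
          \<sim>[at (of_real \<rho>) within delta_domain \<rho> R \<phi>]
        (\<lambda>z. of_real c * (1 - z / of_real \<rho>) powr of_real lam))"


section \<open>The Gibbs law of the number of components\<close>

text \<open>
  \<open>scheme_coeff G H q n k\<close> is the coefficient of \<open>z\<^sup>n u\<^sup>k\<close> in \<open>G(q u H(z))\<close> and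
  \<open>scheme_total G H q n\<close> the coefficient of \<open>z\<^sup>n\<close> in \<open>G(q H(z))\<close>, obtained by setting \<open>u = 1\<close>.
  The sum over \<open>k\<close> is used instead of \<open>fps_compose\<close> so that \<open>H(0) \<noteq> 0\<close> is allowed; the two agree
  when \<open>H(0) = 0\<close>.
\<close>

definition scheme_coeff :: "real fps \<Rightarrow> real fps \<Rightarrow> real \<Rightarrow> nat \<Rightarrow> nat \<Rightarrow> real" where
  "scheme_coeff G H q n k = fps_nth (fps_const (fps_nth G k) * (fps_const q * H) ^ k) n"

definition scheme_total :: "real fps \<Rightarrow> real fps \<Rightarrow> real \<Rightarrow> nat \<Rightarrow> real" where
  "scheme_total G H q n = (\<Sum>k. scheme_coeff G H q n k)"

lemma scheme_coeff_eq_bivariate_coeff: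
  "scheme_coeff G H q n k =
     fps_nth (fps_nth (Abs_fps (\<lambda>j. fps_const (fps_nth G j)) oo
                        (fps_const (fps_const q * H) * fps_X)) k) n"
  unfolding scheme_coeff_def fps_compose_linear
  by (simp add: mult.commute)

lemma scheme_total_eq_fps_compose:
  assumes "fps_nth H 0 = 0"
  shows "scheme_total G H q n = fps_nth (G oo (fps_const q * H)) n"
proof -
  have z: "scheme_coeff G H q n k = 0" if "k \<notin> {0..n}" for k
    using that assms
    by (simp add: scheme_coeff_def startsby_zero_power_prefix)
  have "scheme_total G H q n = (\<Sum>k\<in>{0..n}. scheme_coeff G H q n k)"
    unfolding scheme_total_def by (rule suminf_finite) (use z in auto)
  then show ?thesis
    by (simp add: scheme_coeff_def fps_compose_nth)
qed

text \<open>
  As usual for \<open>embed_pmf\<close>, the law is only meaningful when the weights are normalisable; see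
  \<open>pmf_gibbs_pmf\<close>. The same applies to the two distributions defined after it.
\<close>

definition gibbs_pmf :: "real fps \<Rightarrow> real fps \<Rightarrow> real \<Rightarrow> nat \<Rightarrow> nat pmf" where
  "gibbs_pmf G H q n = embed_pmf (\<lambda>k. scheme_coeff G H q n k / scheme_total G H q n)"

lemma pmf_embed_pmf_sums:
  fixes f :: "nat \<Rightarrow> real"
  assumes "\<And>k. f k \<ge> 0" "f sums 1"
  shows "pmf (embed_pmf f) k = f k"
proof (rule pmf_embed_pmf)
  show "(\<integral>\<^sup>+ x. ennreal (f x) \<partial>count_space UNIV) = 1"
    using assms by (simp add: nn_integral_count_space_nat suminf_ennreal2 sums_iff)
qed (use assms in auto)

lemma pmf_gibbs_pmf:
  assumes "\<And>k. fps_nth G k \<ge> 0" "\<And>k. fps_nth H k \<ge> 0" "q \<ge> 0"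
    and "summable (scheme_coeff G H q n)" "scheme_total G H q n \<noteq> 0"
  shows "pmf (gibbs_pmf G H q n) k = scheme_coeff G H q n k / scheme_total G H q n"
proof -
  have pow: "fps_nth ((fps_const q * H) ^ i) j \<ge> 0" for i j
    by (induction i arbitrary: j)
       (auto simp: fps_mult_nth[of "fps_const q * H"] assms(2,3) intro!: sum_nonneg)
  then have nn: "scheme_coeff G H q n k \<ge> 0" for k
    by (simp add: scheme_coeff_def assms(1))
  then have "scheme_total G H q n \<ge> 0"
    unfolding scheme_total_def using assms(4) by (simp add: suminf_nonneg)
  moreover have "(\<lambda>k. scheme_coeff G H q n k / scheme_total G H q n) sums 1"
    using sums_divide[OF summable_sums[OF assms(4)], of "scheme_total G H q n"] assms(5)
    by (simp add: scheme_total_def)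
  ultimately show ?thesis
    unfolding gibbs_pmf_def using nn by (intro pmf_embed_pmf_sums) auto
qed


section \<open>Limit laws\<close>

definition boltzmann_pmf :: "real fps \<Rightarrow> real \<Rightarrow> nat pmf" where
  "boltzmann_pmf G x =
     embed_pmf (\<lambda>k. fps_nth (fps_deriv G oo (fps_const x * fps_X)) k / eval_fps (fps_deriv G) x)"

text \<open>Negative binomial law with a real first parameter.\<close>

definition negbin_pmf :: "real \<Rightarrow> real \<Rightarrow> nat pmf" where
  "negbin_pmf r p = embed_pmf (\<lambda>k. ((real k + r - 1) gchoose k) * p powr r * (1 - p) ^ k)"

lemma negbin_pmf_of_nat:
  assumes "0 < p" "p \<le> 1"
  shows "negbin_pmf (real m) p = neg_binomial_pmf m p"
proof -
  have eq: "((real k + real m - 1) gchoose k) = real ((k + m - 1) choose k)" for k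
  proof (cases "k + m = 0")
    case False
    then have "real k + real m - 1 = real (k + m - 1)"
      by (cases "k + m") (auto simp flip: of_nat_add)
    then show ?thesis by (simp only: binomial_gbinomial)
  qed auto
  have "(\<lambda>k. ((real k + real m - 1) gchoose k) * p powr real m * (1 - p) ^ k) =
          pmf (neg_binomial_pmf m p)"
    using assms by (auto simp: fun_eq_iff pmf_neg_binomial eq powr_realpow)
  then show ?thesis
    by (simp add: negbin_pmf_def type_definition.Rep_inverse[OF td_pmf_embed_pmf])
qed

text \<open>
  Two-parameter Mittag-Leffler law, supported on the positive reals. \<open>rGamma\<close> is the entire function
  \<open>1/\<Gamma>\<close>, so the terms for which \<open>n \<alpha>\<close> is an integer vanish.
\<close>

definition mittag_leffler_density :: "real \<Rightarrow> real \<Rightarrow> real \<Rightarrow> real" where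
  "mittag_leffler_density \<alpha> \<beta> x =
     (if x > 0 then
        Gamma (\<beta> + 1) / (\<alpha> * Gamma (\<beta> / \<alpha> + 1)) *
        (\<Sum>i. let n = Suc i in
           (-1) ^ n / fact n * rGamma (- (real n * \<alpha>)) * x powr (real n + \<beta> / \<alpha> - 1))
      else 0)"

definition mittag_leffler_distribution :: "real \<Rightarrow> real \<Rightarrow> real measure" where
  "mittag_leffler_distribution \<alpha> \<beta> =
     density lborel (\<lambda>x. ennreal (mittag_leffler_density \<alpha> \<beta> x))"

definition mittag_leffler_moment :: "real \<Rightarrow> real \<Rightarrow> nat \<Rightarrow> real" where
  "mittag_leffler_moment \<alpha> \<beta> r =
     Gamma \<beta> * Gamma (real r + \<beta> / \<alpha>) / (Gamma (\<beta> / \<alpha>) * Gamma (\<alpha> * real r + \<beta>))"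

definition rayleigh_distribution :: "real \<Rightarrow> real measure" where
  "rayleigh_distribution \<sigma> =
     density lborel
       (\<lambda>x. ennreal (if x \<ge> 0 then x / \<sigma>\<^sup>2 * exp (- x\<^sup>2 / (2 * \<sigma>\<^sup>2)) else 0))"

end

theory Submission
  imports Defs "HOL-Real_Asymp.Real_Asymp"
begin

text \<open>
  Put \<open>\<theta> = -\<lambda>\<^sub>G\<close>. Up to a constant factor, the weights \<open>g\<^sub>k \<rho>\<^sub>G\<^sup>k\<close> behave like the coefficients of \<open>(1 - u) powr -\<theta>\<close>,
  and a weight may be replaced by an asymptotically equivalent one as long as no single \<open>k\<close> carries a positive
  share of the total.

  In the subcritical regime \<open>G(qH)\<close> and every power of \<open>H\<close> have the same singular type at \<open>\<rho>\<^sub>H\<close>, and the law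
  converges pointwise with its mean. In the critical regime the \<open>r\<close>-th moment reduces to the coefficients of
  \<open>(1 - H/\<tau>) powr -(\<theta> + r)\<close>, hence to singularity analysis, and the limits are the Mittag-Leffler moments, which
  determine their law. The moments of the Mittag-Leffler density come from the Mellin transform of its series, which
  is a scaling limit of nonnegative coefficients of \<open>exp (-y (1 - z) powr \<alpha>)\<close>.

  In the supercritical regime the sum over \<open>k\<close> of \<open>g\<^sub>k \<rho>\<^sub>G\<^sup>k [z\<^sup>n] (H(sz)/H(s))\<^sup>k\<close> is of renewal type: its
  asymptotics is locally uniform in \<open>s\<close>, because \<open>1 - H(sz)/H(s)\<close> has only the zero \<open>z = 1\<close> in a disc of radius
  larger than \<open>1\<close>. Choosing \<open>s = \<rho>\<^sub>n\<close> with \<open>H(\<rho>)/H(\<rho>\<^sub>n) = exp (t/\<surd>n)\<close> turns the moment generating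
  function of the normalised law at \<open>t\<close> into an explicit quotient, which tends to that of a normal law.
\<close>

section \<open>Singularity analysis\<close>

text \<open>The image of \<open>H\<close> need not fit into a Delta-domain of \<open>G\<close>.
  Therefore the continuation of \<open>G\<close> is used only once, for the asymptotics of its
  coefficients. After the exchange of weights the outer function is an explicit power, which
  composes with \<open>H\<close> wherever \<open>1 - H/\<tau>\<close> avoids the slit. A factor
  \<open>k ^ r\<close> only raises the exponent from \<theta> to \<theta> + r, so all moments stay
  in one family of sums. In the supercritical regime the factor \<open>exp (t k / sqrt n)\<close> is
  geometric in \<open>k\<close>, and passing from \<open>H(rz)/H(r)\<close> to
  \<open>H(sz)/H(s)\<close> absorbs precisely such factors. The price is a parameter
  \<open>s\<close> that moves with \<open>n\<close>, so coefficient estimates must have errors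
  independent of \<open>s\<close>. Convergence in law says nothing about mean and variance; they are
  obtained from moment generating functions near 0. The Mittag-Leffler density is an alternating
  series, whose sign and integrability at infinity are not visible. Both are read off from
  nonnegative approximants with computable integrals, and this needs bounds for binomial
  coefficients that are explicit in the exponent.\<close>

definition pow_coeff :: "real \<Rightarrow> nat \<Rightarrow> real" where
  "pow_coeff a n = (-1) ^ n * (a gchoose n)"

lemma of_real_gbinomial:
  "of_real (a gchoose n) = (of_real a gchoose n :: complex)"
  by (simp add: gbinomial_prod_rev)

lemma pow_coeff_sums:
  fixes z :: complex
  assumes "norm z < 1"
  shows "(\<lambda>n. of_real (pow_coeff a n) * z ^ n) sums ((1 - z) powr of_real a)"
proof -
  have "(\<lambda>n. (of_real a gchoose n) * (-z) ^ n) sums ((1 + (-z)) powr of_real a)"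
    by (rule gen_binomial_complex) (use assms in simp)
  also have "(\<lambda>n. (of_real a gchoose n) * (-z) ^ n) = (\<lambda>n. of_real (pow_coeff a n) * z ^ n)"
    unfolding pow_coeff_def
    by (auto simp: fun_eq_iff of_real_gbinomial power_minus[of z])
  finally show ?thesis by simp
qed

text \<open>Covers every real exponent: for a natural number \<open>a\<close> the coefficients
  vanish eventually, and \<open>rGamma (- a) = 0\<close> agrees with that.\<close>

lemma pow_coeff_asymp:
  "(\<lambda>n. pow_coeff a n * real n powr (a + 1)) \<longlonglongrightarrow> rGamma (- a)"
proof -
  have "(\<lambda>n. (a gchoose n) / ((-1)^n / exp ((a+1) * of_real (ln (real n))))) \<longlonglongrightarrow> rGamma (- a)"
    using gbinomial_asymptotic[of a] by (simp add: rGamma_inverse_Gamma)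
  then show ?thesis
  proof (rule Lim_transform_eventually)
    show "\<forall>\<^sub>F n in sequentially. (a gchoose n) / ((-1)^n / exp ((a+1) * of_real (ln (real n))))
        = pow_coeff a n * real n powr (a + 1)"
      using eventually_gt_at_top[of 0]
      by eventually_elim
        (simp add: pow_coeff_def powr_def field_simps flip: power_mult_distrib)
  qed
qed

section \<open>Coefficient bounds from circles inside the unit disc\<close>

lemma cmod_powr_of_real: "w \<noteq> 0 \<Longrightarrow> norm (w powr complex_of_real a) = norm w powr a"
  by (simp add: powr_def)

text \<open>The squared distance equals \<open>(1 - r)^2 + 4 r sin^2 (\<pi> m)\<close> with
  \<open>m = min t (1 - t)\<close>. Bounding it linearly in \<open>1 - r\<close> and
  \<open>m\<close> turns circle integrals of powers of \<open>\<bar>1 - z\<bar>\<close> into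
  elementary ones.\<close>

lemma circle_dist_lower:
  fixes t r :: real
  assumes "t \<in> {0..1}" "1/2 \<le> r" "r < 1"
  shows "norm (1 - r * exp (2 * of_real pi * \<i> * t)) \<ge> ((1 - r) + min t (1 - t)) / 2"
proof -
  define m where "m = min t (1 - t)"
  have m: "0 \<le> m" "m \<le> 1/2" using assms by (auto simp: m_def min_def)
  \<comment> \<open>Jordan's inequality: the concave sine lies above its chord over
    [0, \<pi>/2].\<close>
  have "concave_on {0..pi/2} sin"
    by (rule f''_le0_imp_concave[of _ _ cos "\<lambda>x. - sin x"])
       (auto intro!: derivative_eq_intros sin_ge_zero)
  then have "sin ((1 - 2*m) *\<^sub>R 0 + (2*m) *\<^sub>R (pi/2)) \<ge> (1-2*m) * sin 0 + (2*m) * sin (pi/2)"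
    by (rule concave_onD) (use m in auto)
  then have s: "sin (pi * m) \<ge> 2 * m" by (simp add: mult.commute)
  have eq: "(sin (pi * t))\<^sup>2 = (sin (pi * m))\<^sup>2"
  proof (cases "t \<le> 1 - t")
    case False
    then have "m = 1 - t" by (simp add: m_def)
    then show ?thesis by (simp add: right_diff_distrib sin_diff)
  qed (simp add: m_def)
  have "exp (2 * of_real pi * \<i> * t) = cis (2 * pi * t)"
    by (simp add: cis_conv_exp mult_ac)
  then have "(norm (1 - r * exp (2 * of_real pi * \<i> * t)))\<^sup>2 = (1 - r * cos (2*pi*t))\<^sup>2 + (r * sin (2*pi*t))\<^sup>2"
    by (simp add: cmod_power2)
  also have "\<dots> = 1 - 2 * r * cos (2*pi*t) + r\<^sup>2 * ((sin (2*pi*t))\<^sup>2 + (cos (2*pi*t))\<^sup>2)"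
    by (simp only: power2_diff power_mult_distrib) (simp add: distrib_left del: sin_cos_squared_add)
  also have "\<dots> = 1 - 2 * r * cos (2*pi*t) + r\<^sup>2" by simp
  also have "cos (2*pi*t) = 1 - 2 * (sin (pi*t))\<^sup>2"
    using cos_double_sin[of "pi*t"] by (simp add: mult_ac)
  finally have A: "(norm (1 - r * exp (2 * of_real pi * \<i> * t)))\<^sup>2 = (1-r)\<^sup>2 + 4 * r * (sin (pi*m))\<^sup>2"
    by (simp add: eq) (simp add: power2_eq_square algebra_simps)
  have "(sin (pi*m))\<^sup>2 \<ge> (2*m)\<^sup>2" using s m by (intro power_mono) auto
  then have "4 * r * (sin (pi*m))\<^sup>2 \<ge> 4 * (1/2) * (2*m)\<^sup>2"
    by (intro mult_mono) (use assms in auto)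
  then have "(norm (1 - r * exp (2 * of_real pi * \<i> * t)))\<^sup>2 \<ge> (1-r)\<^sup>2 + 8 * m\<^sup>2"
    unfolding A by (simp add: power2_eq_square)
  moreover have "(1-r)\<^sup>2 + 8 * m\<^sup>2 \<ge> (((1-r) + m)/2)\<^sup>2"
  proof -
    have "(1-r)\<^sup>2 + 8 * m\<^sup>2 - (((1-r) + m)/2)\<^sup>2 = ((1-r-m)\<^sup>2 + 2 * (1-r)\<^sup>2 + 30 * m\<^sup>2) / 4"
      by (simp add: power2_eq_square field_simps)
    moreover have "\<dots> \<ge> 0" by simp
    ultimately show ?thesis by linarith
  qed
  ultimately have "(((1-r) + m)/2)\<^sup>2 \<le> (norm (1 - r * exp (2 * of_real pi * \<i> * t)))\<^sup>2" by linarith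
  then show ?thesis unfolding m_def[symmetric] by (rule power2_le_imp_le) simp
qed

text \<open>Cauchy's formula on the circle of radius \<open>r\<close>. The majorant may depend on
  the angle: for \<open>\<bar>1 - z\<bar> powr (- p)\<close> on the circle of radius
  \<open>1 - 1/n\<close>, its maximum has order \<open>n powr p\<close>, its mean only
  \<open>n powr (p - 1)\<close>.\<close>

lemma coeff_circle_integral_bound:
  assumes hol: "f holomorphic_on ball 0 R" and r: "0 < r" "r < R"
    and B: "B integrable_on {0..1}" "\<And>t::real. t \<in> {0..1} \<Longrightarrow> norm (f (r * exp (2 * of_real pi * \<i> * t))) \<le> B t"
  shows "norm ((deriv ^^ n) f 0 / fact n) * r ^ n \<le> integral {0..1} B"
proof -
  have 1: "f holomorphic_on ball 0 r" using hol by (rule holomorphic_on_subset) (use r in auto)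
  have 2: "continuous_on (cball 0 r) f"
    by (rule continuous_on_subset[OF holomorphic_on_imp_continuous_on[OF hol]]) (use r in auto)
  have "((\<lambda>u. f u / (u - 0)^(Suc n)) has_contour_integral ((2 * pi * \<i>) / fact n * (deriv ^^ n) f 0))
           (circlepath 0 r)"
    by (rule Cauchy_has_contour_integral_higher_derivative_circlepath) (use 1 2 r in auto)
  then have "((\<lambda>t::real. f (r * exp (2 * of_real pi * \<i> * t)) / (r * exp (2 * of_real pi * \<i> * t))^(Suc n) *
     (2 * pi * \<i> * r * exp (2 * of_real pi * \<i> * t))) has_integral ((2 * pi * \<i>) / fact n * (deriv ^^ n) f 0)) {0..1}"
    unfolding has_contour_integral_def
  proof (rule has_integral_eq[rotated])
    fix t :: real assume "t \<in> {0..1}"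
    have "circlepath 0 r t = r * exp (2 * of_real pi * \<i> * t)" by (simp add: circlepath)
    then show "f (circlepath 0 r t) / (circlepath 0 r t - 0) ^ Suc n * vector_derivative (circlepath 0 r) (at t within {0..1}) =
       f (r * exp (2 * of_real pi * \<i> * t)) / (r * exp (2 * of_real pi * \<i> * t))^(Suc n) *
     (2 * pi * \<i> * r * exp (2 * of_real pi * \<i> * t))"
      using \<open>t \<in> {0..1}\<close> by (simp add: vector_derivative_circlepath01)
  qed
  then have I: "((\<lambda>t::real. (f (r * exp (2 * of_real pi * \<i> * t)) / (r * exp (2 * of_real pi * \<i> * t))^(Suc n) *
     (2 * pi * \<i> * r * exp (2 * of_real pi * \<i> * t))) / (2 * pi * \<i>)) has_integral (((2 * pi * \<i>) / fact n * (deriv ^^ n) f 0) / (2 * pi * \<i>))) {0..1}"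
    by (rule has_integral_divide)
  have "norm (((2 * pi * \<i>) / fact n * (deriv ^^ n) f 0) / (2 * pi * \<i>)) \<le> integral {0..1} (\<lambda>t. B t / r ^ n)"
    unfolding integral_unique[OF I, symmetric]
  proof (rule integral_norm_bound_integral)
    show "(\<lambda>t. B t / r ^ n) integrable_on {0..1}" using B(1) has_integral_divide[of B _ "{0..1}" "r ^ n"]
      unfolding integrable_on_def by blast
    fix t :: real assume t: "t \<in> {0..1}"
    have e: "norm (exp (2 * of_real pi * \<i> * t)) = 1"
      using norm_exp_i_times[of "2*pi*t"] by (simp add: mult_ac)
    show "norm (f (r * exp (2 * of_real pi * \<i> * t)) / (r * exp (2 * of_real pi * \<i> * t))^(Suc n) *
     (2 * pi * \<i> * r * exp (2 * of_real pi * \<i> * t)) / (2 * pi * \<i>)) \<le> B t / r ^ n"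
      using B(2)[OF t] r by (simp add: norm_mult norm_divide norm_power e divide_simps)
  qed (use I in blast)
  then have "norm ((deriv ^^ n) f 0 / fact n) \<le> integral {0..1} B / r ^ n"
    by (simp add: norm_divide norm_mult mult_ac)
  then show ?thesis using r by (simp add: field_simps)
qed

text \<open>Used with \<open>b = 1 / n\<close>. The second integral is the reflection of the first,
  and \<open>p \<ge> 2\<close> lets the factor \<open>1 / (p - 1)\<close> of the antiderivative be
  replaced by 1.\<close>

lemma integral_shifted_powr_bound:
  fixes b p :: real
  assumes "b > 0" "p \<ge> 2"
  shows "(\<lambda>t. (b + t) powr (-p)) integrable_on {0..1}"
    and "(\<lambda>t. (b + (1 - t)) powr (-p)) integrable_on {0..1}"
    and "integral {0..1} (\<lambda>t. (b + t) powr (-p)) \<le> b powr (1 - p)"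
    and "integral {0..1} (\<lambda>t. (b + (1 - t)) powr (-p)) \<le> b powr (1 - p)"
proof -
  let ?F = "\<lambda>t. - ((b + t) powr (1 - p) / (p - 1))"
  have I: "((\<lambda>t. (b + t) powr (-p)) has_integral (?F 1 - ?F 0)) {0..1}"
  proof (rule fundamental_theorem_of_calculus)
    fix x :: real assume "x \<in> {0..1}"
    then have "b + x > 0" using assms by auto
    then have "(?F has_real_derivative - ((1-p) * (b + x) powr (1 - p - 1) * 1 / (p - 1))) (at x within {0..1})"
      using assms by (auto intro!: derivative_eq_intros)
    also have "- ((1-p) * (b + x) powr (1 - p - 1) * 1 / (p - 1)) = (b + x) powr (- p)"
      using assms by (simp add: divide_simps) (auto simp: algebra_simps)
    finally show "(?F has_vector_derivative (b + x) powr - p) (at x within {0..1})"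
      by (simp add: has_real_derivative_iff_has_vector_derivative)
  qed auto
  have "?F 1 - ?F 0 \<le> b powr (1 - p) / (p - 1)" using assms by (simp add: divide_simps)
  also have "\<dots> \<le> b powr (1 - p) / 1" by (rule divide_left_mono) (use assms in auto)
  finally have le: "?F 1 - ?F 0 \<le> b powr (1 - p)" by simp
  have J: "((\<lambda>t. (b + (1 - t)) powr (-p)) has_integral (?F 1 - ?F 0)) {0..1}"
    using has_integral_reflect_lemma_real[of "\<lambda>t. (b + t) powr (-p)"]
    using has_integral_affinity[OF I[folded cbox_interval], of "-1" 1]
    by (simp add: algebra_simps)
  show "(\<lambda>t. (b + t) powr (-p)) integrable_on {0..1}" using I by blast
  show "(\<lambda>t. (b + (1 - t)) powr (-p)) integrable_on {0..1}" using J by blast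
  show "integral {0..1} (\<lambda>t. (b + t) powr (-p)) \<le> b powr (1 - p)" using integral_unique[OF I] le by simp
  show "integral {0..1} (\<lambda>t. (b + (1 - t)) powr (-p)) \<le> b powr (1 - p)" using integral_unique[OF J] le by simp
qed

text \<open>What is used of a Delta-domain: near \<open>\<rho>\<close> it contains discs of radius proportional to the distance
  to \<open>\<rho>\<close>.\<close>

definition dented :: "real \<Rightarrow> complex set \<Rightarrow> bool" where
  "dented \<rho> S \<longleftrightarrow> open S \<and> cball 0 \<rho> - {of_real \<rho>} \<subseteq> S \<and>
     (\<forall>z\<in>S. 1 - z / of_real \<rho> \<notin> \<real>\<^sub>\<le>\<^sub>0) \<and>
     (\<exists>\<kappa>>0. \<exists>\<delta>>0. \<forall>z. norm z < \<rho> \<and> dist z (of_real \<rho>) < \<delta> \<longrightarrow>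
        ball z (\<kappa> * dist z (of_real \<rho>)) \<subseteq> S)"

lemma powr_comparable:
  fixes x y a :: real
  assumes "x > 0" "y > 0" "x \<le> 2 * y" "y \<le> 2 * x"
  shows "x powr a \<le> 2 powr \<bar>a\<bar> * y powr a"
proof (cases "a \<ge> 0")
  case True
  then have "x powr a \<le> (2 * y) powr a" by (intro powr_mono2) (use assms in auto)
  then show ?thesis using True assms by (simp add: powr_mult)
next
  case False
  then have "x powr a \<le> (y / 2) powr a" by (intro powr_mono2') (use assms in auto)
  then show ?thesis using False assms by (simp add: powr_divide powr_minus field_simps)
qed

text \<open>Cauchy's inequality on a disc around \<open>z\<close> of radius proportional to
  \<open>\<bar>1 - z\<bar>\<close>, which stays inside the dented set. Each differentiation costs
  one factor \<open>1 / \<bar>1 - z\<bar>\<close>, and the little-o survives.\<close>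

lemma deriv_small_near_dent:
  assumes S: "dented 1 S" and hol: "g holomorphic_on S"
    and lim: "((\<lambda>z. g z * (1 - z) powr of_real (-a)) \<longlongrightarrow> 0) (at 1 within S)"
    and e: "e > 0"
  shows "\<exists>d>0. \<forall>z. norm z < 1 \<and> dist z 1 < d \<longrightarrow>
           norm ((deriv ^^ j) g z) \<le> e * norm (1 - z) powr (a - real j)"
proof -
  obtain \<kappa>0 \<delta> where \<kappa>0: "\<kappa>0 > 0" "\<delta> > 0"
    and balls0: "\<And>z. norm z < 1 \<Longrightarrow> dist z 1 < \<delta> \<Longrightarrow> ball z (\<kappa>0 * dist z 1) \<subseteq> S"
    using S unfolding dented_def by auto
  \<comment> \<open>Halving fits the closed disc into the open one, and
    \<open>\<kappa> \<le> 1/2\<close> keeps all its points at a distance between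
    \<open>D / 2\<close> and \<open>2 * D\<close> from 1.\<close>
  define \<kappa> where "\<kappa> = min \<kappa>0 1 / 2"
  have \<kappa>: "\<kappa> > 0" "\<kappa> \<le> 1/2" "\<kappa> < \<kappa>0" using \<kappa>0 by (auto simp: \<kappa>_def)
  \<comment> \<open>Chosen so that the constants of Cauchy's inequality and of
    \<open>powr_comparable\<close> cancel and exactly \<open>e\<close> is left.\<close>
  define e' where "e' = e * \<kappa> ^ j / (fact j * 2 powr \<bar>a\<bar>)"
  have e': "e' > 0" using e \<kappa> by (simp add: e'_def)
  obtain d1 where d1: "d1 > 0"
    "\<And>w. w \<in> S \<Longrightarrow> w \<noteq> 1 \<Longrightarrow> dist w 1 < d1 \<Longrightarrow> norm (g w * (1 - w) powr of_real (-a)) < e'"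
    using tendstoD[OF lim e'] unfolding eventually_at by (auto simp: dist_norm)
  define d where "d = min \<delta> (d1 / 2)"
  show ?thesis
  proof (intro exI[of _ d] conjI allI impI)
    show "d > 0" using \<kappa>0 d1 by (auto simp: d_def)
    fix z :: complex assume z: "norm z < 1 \<and> dist z 1 < d"
    have z1: "z \<noteq> 1" using z by auto
    define D where "D = dist z 1"
    have D: "D > 0" "D < \<delta>" "D < d1 / 2" using z z1 by (auto simp: D_def d_def)
    have Dn: "D = norm (1 - z)" by (simp add: D_def dist_norm norm_minus_commute)
    have sub: "cball z (\<kappa> * D) \<subseteq> S"
    proof -
      have "\<kappa> * D < \<kappa>0 * D" using \<kappa> D by simp
      then have "cball z (\<kappa> * D) \<subseteq> ball z (\<kappa>0 * D)" by auto
      also have "\<dots> \<subseteq> S" using balls0[of z] z D by (simp add: D_def)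
      finally show ?thesis .
    qed
    have "norm ((deriv ^^ j) g z) \<le> fact j * (e' * (2 powr \<bar>a\<bar> * D powr a)) / (\<kappa> * D) ^ j"
    proof (rule Cauchy_inequality)
      show "g holomorphic_on ball z (\<kappa> * D)"
        by (rule holomorphic_on_subset[OF hol]) (use sub in auto)
      show "continuous_on (cball z (\<kappa> * D)) g"
        by (rule continuous_on_subset[OF holomorphic_on_imp_continuous_on[OF hol] sub])
      show "0 < \<kappa> * D" using \<kappa> D by simp
      fix w assume w: "norm (z - w) = \<kappa> * D"
      have wS: "w \<in> S" using sub w by (auto simp: dist_norm)
      have kd: "\<kappa> * D \<le> D / 2" using \<kappa> D by simp
      have n1: "norm (1 - w) \<le> D + \<kappa> * D"
        using norm_triangle_ineq[of "1 - z" "z - w"] w Dn by simp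
      have n2: "norm (1 - w) \<ge> D - \<kappa> * D"
        using norm_triangle_ineq2[of "1 - z" "w - z"] w Dn by (simp add: norm_minus_commute)
      have w1: "w \<noteq> 1" using n2 kd D by auto
      have "norm (1 - w) < d1" using n1 kd D by linarith
      then have "dist w 1 < d1" by (simp add: dist_norm norm_minus_commute)
      from d1(2)[OF wS w1 this] have "norm (g w) * norm (1 - w) powr (-a) < e'"
        using w1 cmod_powr_of_real[of "1 - w" "-a"] by (simp add: norm_mult)
      then have "norm (g w) \<le> e' * norm (1 - w) powr a"
        using w1 by (simp add: powr_minus field_simps)
      also have "norm (1 - w) powr a \<le> 2 powr \<bar>a\<bar> * D powr a"
      proof (rule powr_comparable)
        show "norm (1 - w) \<le> 2 * D" "D \<le> 2 * norm (1 - w)" using n1 n2 kd D by linarith+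
      qed (use w1 D in auto)
      finally show "norm (g w) \<le> e' * (2 powr \<bar>a\<bar> * D powr a)" using e' by simp
    qed
    also have "\<dots> = e * (D powr a / D ^ j)"
      using \<kappa> D by (simp add: e'_def field_simps power_mult_distrib)
    also have "D powr a / D ^ j = D powr (a - real j)"
      using D by (simp add: powr_diff powr_realpow)
    finally show "norm ((deriv ^^ j) g z) \<le> e * norm (1 - z) powr (a - real j)"
      by (simp add: Dn)
  qed
qed

text \<open>Integration over the circle of radius \<open>1 - 1/n\<close>. The neighbourhood of 1
  contributes \<open>e\<close> times \<open>n powr (p - 1)\<close>, the rest of the circle a
  constant, and dividing by \<open>r ^ n\<close> costs at most \<open>exp 2\<close>.\<close>

lemma coeff_bound_near_singularity:
  fixes p e B d :: real
  assumes hol: "h holomorphic_on ball 0 1" and p: "p \<ge> 2" and e: "e > 0" and B: "B \<ge> 0"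
    and near: "\<And>z. norm z < 1 \<Longrightarrow> dist z 1 < d \<Longrightarrow> norm (h z) \<le> e * norm (1 - z) powr (-p)"
    and far: "\<And>z. norm z < 1 \<Longrightarrow> dist z 1 \<ge> d \<Longrightarrow> norm (h z) \<le> B"
    and n: "n \<ge> 2"
  shows "norm ((deriv ^^ n) h 0 / fact n) \<le> exp 2 * (e * 2 powr (p + 1) * real n powr (p - 1) + B)"
proof -
  define b where "b = 1 / real n"
  define r where "r = 1 - b"
  have b: "0 < b" "b \<le> 1/2" using n by (auto simp: b_def field_simps)
  have r: "1/2 \<le> r" "r < 1" "0 < r" using b by (auto simp: r_def)
  let ?B = "\<lambda>t. e * 2 powr p * ((b + t) powr (-p) + (b + (1 - t)) powr (-p)) + B"
  note I = integral_shifted_powr_bound[OF b(1) p]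
  have "norm ((deriv ^^ n) h 0 / fact n) * r ^ n \<le> integral {0..1} ?B"
  proof (rule coeff_circle_integral_bound[OF hol])
    show "?B integrable_on {0..1}" using I(1,2)
      by (intro integrable_add integrable_on_mult_right integrable_const_ivl) auto
    fix t :: real assume t: "t \<in> {0..1}"
    let ?z = "r * exp (2 * of_real pi * \<i> * t)"
    have nz: "norm ?z = r"
      using r norm_exp_i_times[of "2*pi*t"] by (simp add: mult_ac norm_mult)
    have "norm (1 - ?z) \<ge> (b + min t (1 - t)) / 2"
      using circle_dist_lower[OF t r(1,2)] by (simp add: r_def)
    moreover have "min t (1 - t) \<ge> 0" using t by auto
    ultimately have "norm (1 - ?z) powr (-p) \<le> ((b + min t (1 - t)) / 2) powr (-p)"
      by (intro powr_mono2') (use b p in auto)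
    also have "\<dots> = 2 powr p * (b + min t (1 - t)) powr (-p)"
      using b \<open>min t (1 - t) \<ge> 0\<close> by (simp add: powr_divide powr_minus field_simps)
    \<comment> \<open>The sum of both branches of the minimum integrates without splitting the
      interval.\<close>
    also have "(b + min t (1 - t)) powr (-p) \<le> (b + t) powr (-p) + (b + (1 - t)) powr (-p)"
      by (auto simp: min_def)
    finally have le: "norm (1 - ?z) powr (-p) \<le> 2 powr p * ((b + t) powr (-p) + (b + (1 - t)) powr (-p))"
      by simp
    show "norm (h ?z) \<le> ?B t"
    proof (cases "dist ?z 1 < d")
      case True
      have "norm (h ?z) \<le> e * norm (1 - ?z) powr (-p)" using near[of ?z] nz r True by simp
      also have "\<dots> \<le> e * (2 powr p * ((b + t) powr (-p) + (b + (1 - t)) powr (-p)))"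
        by (rule mult_left_mono[OF le]) (use e in simp)
      finally show ?thesis using B by simp
    next
      case False
      have "norm (h ?z) \<le> B" using far[of ?z] nz r False by simp
      moreover have "e * 2 powr p * ((b + t) powr (-p) + (b + (1 - t)) powr (-p)) \<ge> 0" using e by simp
      ultimately show ?thesis by linarith
    qed
  qed (use r in auto)
  also have "integral {0..1} ?B = e * 2 powr p * (integral {0..1} (\<lambda>t. (b + t) powr (-p)) + integral {0..1} (\<lambda>t. (b + (1 - t)) powr (-p))) + B"
  proof (rule integral_unique)
    have "(?B has_integral e * 2 powr p * (integral {0..1} (\<lambda>t. (b + t) powr (-p)) + integral {0..1} (\<lambda>t. (b + (1 - t)) powr (-p)))
        + (1 - 0) *\<^sub>R B) {0..1}"
      using I(1,2) by (intro has_integral_add has_integral_mult_right has_integral_const_real integrable_integral)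
        (auto intro: has_integral_const_real[of B 0 1, simplified])
    then show "(?B has_integral e * 2 powr p * (integral {0..1} (\<lambda>t. (b + t) powr (-p)) + integral {0..1} (\<lambda>t. (b + (1 - t)) powr (-p)))
        + B) {0..1}" by simp
  qed
  also have "\<dots> \<le> e * 2 powr p * (b powr (1 - p) + b powr (1 - p)) + B"
    by (intro add_mono mult_left_mono I) (use e in auto)
  also have "\<dots> = e * 2 powr (p + 1) * real n powr (p - 1) + B"
    using n by (simp add: b_def powr_add powr_divide powr_diff field_simps)
  finally have A: "norm ((deriv ^^ n) h 0 / fact n) * r ^ n \<le> e * 2 powr (p + 1) * real n powr (p - 1) + B" .
  \<comment> \<open>Uses \<open>exp (- 2 b) \<le> 1 - b\<close> for \<open>b \<le> 1/2\<close>,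
    together with \<open>n * b = 1\<close>.\<close>
  have rn: "exp (-2) \<le> r ^ n"
  proof -
    have "1 \<le> (1 + 2 * b) * (1 - b)" using b by (simp add: algebra_simps)
    also have "\<dots> \<le> exp (2 * b) * (1 - b)"
      using b exp_ge_add_one_self[of "2 * b"] by (intro mult_right_mono) auto
    finally have "exp (-2 * b) \<le> r" by (simp add: r_def exp_minus field_simps)
    then have "exp (-2 * b) ^ n \<le> r ^ n" by (rule power_mono) simp
    also have "exp (-2 * b) ^ n = exp (-2)"
      using n by (simp add: b_def flip: exp_of_nat_mult)
    finally show ?thesis .
  qed
  let ?N = "norm ((deriv ^^ n) h 0 / fact n)"
  have "?N * exp (-2) \<le> ?N * r ^ n" by (rule mult_left_mono[OF rn]) simp
  with A have "?N * exp (-2) \<le> e * 2 powr (p + 1) * real n powr (p - 1) + B" by linarith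
  then show ?thesis by (simp add: exp_minus field_simps)
qed

text \<open>After enough differentiations the bound at the singularity is so large that the rest of the circle
  \<open>\<bar>z\<bar> = 1 - 1/n\<close> is negligible, so no contour outside the unit disc is needed.\<close>

lemma little_o_transfer:
  assumes S: "dented 1 S" and hol: "g holomorphic_on S"
    and lim: "((\<lambda>z. g z * (1 - z) powr of_real (-a)) \<longlongrightarrow> 0) (at 1 within S)"
  shows "(\<lambda>n. norm ((deriv ^^ n) g 0 / fact n) * real n powr (a + 1)) \<longlonglongrightarrow> 0"
proof -
  \<comment> \<open>Makes \<open>p = j - a\<close> at least 2: the circle integral then has the
    right order, and the contribution \<open>B\<close> of the far part is smaller by the factor
    \<open>n powr (1 - p)\<close>.\<close>
  define j where "j = nat \<lceil>a\<rceil> + 2"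
  define p where "p = real j - a"
  have p: "p \<ge> 2" by (simp add: p_def j_def) linarith
  define h where "h = (deriv ^^ j) g"
  have oS: "open S" and subS: "cball 0 1 - {1} \<subseteq> S" using S by (auto simp: dented_def)
  have holh: "h holomorphic_on S" unfolding h_def by (rule holomorphic_higher_deriv[OF hol oS])
  have ball: "ball 0 1 \<subseteq> S" using subS by auto
  \<comment> \<open>The coefficient of \<open>z ^ n\<close> in the \<open>j\<close>-th derivative is
    \<open>(n + j)! / n!\<close> times the coefficient of \<open>z ^ (n + j)\<close> in
    \<open>g\<close>. Since this factor is at least \<open>n ^ j\<close>, \<open>c n\<close> bounds
    the latter.\<close>
  define c where "c n = norm ((deriv ^^ n) h 0 / fact n) / real n ^ j" for n
  have c0: "(\<lambda>n. c n * real n powr (a + 1)) \<longlonglongrightarrow> 0"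
  proof (rule LIMSEQ_I)
    fix \<epsilon> :: real assume \<epsilon>: "\<epsilon> > 0"
    define e where "e = \<epsilon> / (2 * (exp 2 * 2 powr (p + 1)))"
    have e: "e > 0" using \<epsilon> by (simp add: e_def)
    obtain d where d: "d > 0" and near: "\<And>z. norm z < 1 \<Longrightarrow> dist z 1 < d \<Longrightarrow>
        norm (h z) \<le> e * norm (1 - z) powr (a - real j)"
      using deriv_small_near_dent[OF S hol lim e, of j] unfolding h_def by auto
    have "compact (cball 0 1 - ball 1 d :: complex set)"
      by (intro compact_diff) auto
    moreover have "continuous_on (cball 0 1 - ball 1 d) h"
      by (rule continuous_on_subset[OF holomorphic_on_imp_continuous_on[OF holh]])
         (use subS d in auto)
    ultimately have "bounded (h ` (cball 0 1 - ball 1 d))"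
      by (intro compact_imp_bounded compact_continuous_image)
    then obtain B where B: "B > 0" "\<And>z. z \<in> cball 0 1 - ball 1 d \<Longrightarrow> norm (h z) \<le> B"
      unfolding bounded_pos by blast
    have bd: "norm ((deriv ^^ n) h 0 / fact n) \<le> exp 2 * (e * 2 powr (p + 1) * real n powr (p - 1) + B)"
      if "n \<ge> 2" for n
    proof (rule coeff_bound_near_singularity[where d = d])
      show "h holomorphic_on ball 0 1" by (rule holomorphic_on_subset[OF holh ball])
      show "norm (h z) \<le> e * norm (1 - z) powr (-p)" if "norm z < 1" "dist z 1 < d" for z
        using near[OF that] by (simp add: p_def)
      show "norm (h z) \<le> B" if "norm z < 1" "dist z 1 \<ge> d" for z
        by (rule B(2)) (use that in \<open>auto simp: dist_commute\<close>)
    qed (use p e B that in auto)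
    have "(\<lambda>n. exp 2 * B * real n powr (1 - p)) \<longlonglongrightarrow> exp 2 * B * 0"
      by (intro tendsto_mult tendsto_const tendsto_neg_powr[OF _ filterlim_real_sequentially])
         (use p in auto)
    then have "\<forall>\<^sub>F n in sequentially. exp 2 * B * real n powr (1 - p) < \<epsilon> / 2"
      using \<epsilon> by (intro order_tendstoD(2)[of _ "exp 2 * B * 0"]) auto
    then have "\<forall>\<^sub>F n in sequentially. norm (c n * real n powr (a + 1) - 0) < \<epsilon>"
      using eventually_ge_at_top[of 2]
    proof eventually_elim
      case (elim n)
      have n0: "real n > 0" using elim by simp
      have nj: "real n ^ j = real n powr (p + a)" using n0 by (simp add: p_def powr_realpow)
      have "c n * real n powr (a + 1) \<le> exp 2 * (e * 2 powr (p + 1) * real n powr (p - 1) + B) / real n ^ j * real n powr (a + 1)"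
        unfolding c_def by (intro mult_right_mono divide_right_mono bd) (use elim in auto)
      also have "\<dots> = exp 2 * e * 2 powr (p + 1) * (real n powr (p - 1) * real n powr (a + 1) / real n powr (p + a))
            + exp 2 * B * (real n powr (a + 1) / real n powr (p + a))"
        unfolding nj by (simp add: field_simps add_divide_distrib)
      also have "real n powr (p - 1) * real n powr (a + 1) / real n powr (p + a) = 1"
        using n0 by (simp flip: powr_add powr_diff)
      also have "real n powr (a + 1) / real n powr (p + a) = real n powr (1 - p)"
        by (simp flip: powr_diff)
      also have "exp 2 * e * 2 powr (p + 1) * 1 = \<epsilon> / 2" by (simp add: e_def)
      finally have "c n * real n powr (a + 1) < \<epsilon>" using elim by simp
      moreover have "c n * real n powr (a + 1) \<ge> 0" by (simp add: c_def)
      ultimately show ?case by simp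
    qed
    then show "\<exists>no. \<forall>n\<ge>no. norm (c n * real n powr (a + 1) - 0) < \<epsilon>"
      by (simp add: eventually_sequentially)
  qed
  have "(\<lambda>n. norm ((deriv ^^ (n + j)) g 0 / fact (n + j)) * real (n + j) powr (a + 1)) \<longlonglongrightarrow> 0"
  proof (rule tendsto_sandwich[OF _ _ tendsto_const])
    have "(\<lambda>n. (real n + real j) powr (a + 1) / real n powr (a + 1)) \<longlonglongrightarrow> 1"
      by real_asymp
    from tendsto_mult[OF c0 this]
    show "(\<lambda>n. (c n * real n powr (a + 1)) * ((real n + real j) powr (a + 1) / real n powr (a + 1))) \<longlonglongrightarrow> 0"
      by simp
    show "\<forall>\<^sub>F n in sequentially. norm ((deriv ^^ (n + j)) g 0 / fact (n + j)) * real (n + j) powr (a + 1)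
        \<le> (c n * real n powr (a + 1)) * ((real n + real j) powr (a + 1) / real n powr (a + 1))"
      using eventually_gt_at_top[of 0]
    proof eventually_elim
      case (elim n)
      have "fact n * n ^ j \<le> fact (n + j)"
      proof (induction j)
        case (Suc j)
        have "fact n * n ^ Suc j = n * (fact n * n ^ j)" by simp
        also have "\<dots> \<le> (n + Suc j) * fact (n + j)" using Suc by (intro mult_mono) auto
        finally show ?case by simp
      qed simp
      then have le: "fact n * real n ^ j \<le> fact (n + j)"
        by (metis of_nat_fact of_nat_le_iff of_nat_mult of_nat_power)
      have "norm ((deriv ^^ (n + j)) g 0 / fact (n + j)) = norm ((deriv ^^ n) h 0) / fact (n + j)"
        by (simp add: h_def funpow_add norm_divide)
      also have "\<dots> \<le> norm ((deriv ^^ n) h 0) / (fact n * real n ^ j)"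
        by (rule divide_left_mono[OF le]) (use elim in auto)
      also have "\<dots> = c n" by (simp add: c_def norm_divide)
      finally have "norm ((deriv ^^ (n + j)) g 0 / fact (n + j)) * real (n + j) powr (a + 1) \<le> c n * real (n + j) powr (a + 1)"
        by (rule mult_right_mono) simp
      also have "\<dots> = (c n * real n powr (a + 1)) * ((real n + real j) powr (a + 1) / real n powr (a + 1))"
        using elim by simp
      finally show ?case .
    qed
  qed auto
  then show ?thesis by (rule LIMSEQ_offset)
qed

section \<open>From local expansions to coefficient asymptotics\<close>

lemma coeff_from_sums:
  fixes g :: "complex \<Rightarrow> complex"
  assumes "r > 0" "\<And>z. norm z < r \<Longrightarrow> (\<lambda>n. b n * z ^ n) sums g z"
  shows "(deriv ^^ n) g 0 / fact n = b n"
proof -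
  have "eventually (\<lambda>u. (\<lambda>n. fps_nth (Abs_fps b) n * u ^ n) sums g u) (nhds 0)"
    using eventually_nhds_in_open[of "ball 0 r" 0] assms
    by (auto elim!: eventually_mono)
  then have "g has_fps_expansion Abs_fps b" by (rule has_fps_expansionI)
  from fps_nth_fps_expansion[OF this, of n] show ?thesis by simp
qed

lemma one_minus_notin_nonpos_Reals: "norm z < 1 \<Longrightarrow> 1 - z \<notin> \<real>\<^sub>\<le>\<^sub>0" for z :: complex
  using complex_Re_le_cmod[of z] by (auto simp: complex_nonpos_Reals_iff)

lemma dentedI:
  assumes "open S" "cball 0 \<rho> - {of_real \<rho>} \<subseteq> S" "\<And>z. z \<in> S \<Longrightarrow> 1 - z / of_real \<rho> \<notin> \<real>\<^sub>\<le>\<^sub>0"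
    and "\<kappa> > 0" "\<delta> > 0" "\<And>z. norm z < \<rho> \<Longrightarrow> dist z (of_real \<rho>) < \<delta> \<Longrightarrow>
        ball z (\<kappa> * dist z (of_real \<rho>)) \<subseteq> S"
  shows "dented \<rho> S"
  using assms unfolding dented_def by blast

lemma dented_scale:
  assumes "dented \<rho> S" "\<rho> > 0"
  shows "dented 1 {z. of_real \<rho> * z \<in> S}"
proof -
  have S: "open S" "cball 0 \<rho> - {of_real \<rho>} \<subseteq> S" "\<And>z. z \<in> S \<Longrightarrow> 1 - z / of_real \<rho> \<notin> \<real>\<^sub>\<le>\<^sub>0"
    using assms(1) by (auto simp: dented_def)
  obtain \<kappa> \<delta> where k: "\<kappa> > 0" "\<delta> > 0" "\<And>z. norm z < \<rho> \<Longrightarrow> dist z (of_real \<rho>) < \<delta> \<Longrightarrow>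
        ball z (\<kappa> * dist z (of_real \<rho>)) \<subseteq> S"
    using assms(1) unfolding dented_def by metis
  have sc: "dist (of_real \<rho> * z) (of_real \<rho> * w) = \<rho> * dist z w" for z w :: complex
    using assms(2) by (simp add: dist_norm norm_mult flip: right_diff_distrib)
  have sc1: "dist (of_real \<rho> * z) (of_real \<rho>) = \<rho> * dist z 1" for z :: complex
    using sc[of z 1] by simp
  show ?thesis
  proof (rule dentedI[of _ _ \<kappa> "\<delta> / \<rho>"])
    have "open ((\<lambda>z. of_real \<rho> * z) -` S)"
      by (intro open_vimage S continuous_intros)
    then show "open {z. of_real \<rho> * z \<in> S}" by (simp add: vimage_def)
    show "cball 0 1 - {complex_of_real 1} \<subseteq> {z. of_real \<rho> * z \<in> S}"
      using S(2) assms(2) by (auto simp: norm_mult)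
    fix z assume "z \<in> {z. of_real \<rho> * z \<in> S}"
    then show "1 - z / complex_of_real 1 \<notin> \<real>\<^sub>\<le>\<^sub>0" using S(3)[of "of_real \<rho> * z"] assms(2) by auto
  next
    fix z :: complex assume z: "norm z < 1" "dist z (complex_of_real 1) < \<delta> / \<rho>"
    have "ball (of_real \<rho> * z) (\<kappa> * dist (of_real \<rho> * z) (of_real \<rho>)) \<subseteq> S"
    proof (rule k(3))
      show "dist (of_real \<rho> * z) (of_real \<rho>) < \<delta>"
        unfolding sc1 using z assms(2) by (simp add: pos_less_divide_eq mult.commute)
    qed (use z assms(2) in \<open>simp add: norm_mult\<close>)
    moreover have "of_real \<rho> * w \<in> ball (of_real \<rho> * z) (\<kappa> * dist (of_real \<rho> * z) (of_real \<rho>))"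
      if "w \<in> ball z (\<kappa> * dist z 1)" for w
      using that assms(2) by (simp add: sc sc1 mult.left_commute)
    ultimately show "ball z (\<kappa> * dist z (complex_of_real 1)) \<subseteq> {z. of_real \<rho> * z \<in> S}" by auto
  qed (use k assms(2) in auto)
qed

text \<open>After rescaling to radius 1, subtracting \<open>K\<close> and the pure power
  \<open>c * (1 - z) powr lam\<close> leaves a remainder to which \<open>little_o_transfer\<close>
  applies. The pure power has known coefficients, and \<open>K\<close> affects only the index
  0.\<close>

lemma singularity_transfer:
  fixes a :: "nat \<Rightarrow> real"
  assumes \<rho>: "\<rho> > 0" and S: "dented \<rho> S" and hol: "f holomorphic_on S"
    and sums: "\<And>z. norm z < \<rho> \<Longrightarrow> (\<lambda>n. of_real (a n) * z ^ n) sums f z"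
    and lim: "((\<lambda>z. (f z - K) * (1 - z / of_real \<rho>) powr of_real (-lam)) \<longlongrightarrow> of_real c)
                (at (of_real \<rho>) within S)"
  shows "(\<lambda>n. a n * \<rho> ^ n * real n powr (lam + 1)) \<longlonglongrightarrow> c * rGamma (- lam)"
proof -
  define S1 where "S1 = {z. of_real \<rho> * z \<in> S}"
  have S1: "dented 1 S1" unfolding S1_def by (rule dented_scale[OF S \<rho>])
  have nonpos: "1 - z \<notin> \<real>\<^sub>\<le>\<^sub>0" if "z \<in> S1" for z using S1 that by (auto simp: dented_def)
  define g where "g z = f (of_real \<rho> * z) - K - of_real c * (1 - z) powr of_real lam" for z
  have "g holomorphic_on S1"
  proof -
    have "(f \<circ> (\<lambda>z. of_real \<rho> * z)) holomorphic_on S1"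
      by (rule holomorphic_on_compose_gen[OF _ hol]) (auto simp: S1_def intro!: holomorphic_intros)
    then have "(\<lambda>z. f (of_real \<rho> * z)) holomorphic_on S1" by (simp add: o_def)
    then show ?thesis unfolding g_def
      by (intro holomorphic_intros) (use nonpos in auto)
  qed
  moreover have "((\<lambda>z. g z * (1 - z) powr of_real (-lam)) \<longlongrightarrow> 0) (at 1 within S1)"
  proof -
    have "filterlim (\<lambda>z. of_real \<rho> * z) (at (of_real \<rho>) within S) (at 1 within S1)"
      using \<rho> by (auto simp: filterlim_at eventually_at_filter S1_def intro!: tendsto_eq_intros)
    from filterlim_compose[OF lim this]
    have "((\<lambda>z. (f (of_real \<rho> * z) - K) * (1 - z) powr of_real (-lam)) \<longlongrightarrow> of_real c) (at 1 within S1)"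
      using \<rho> by simp
    from tendsto_diff[OF this tendsto_const[of "of_real c"]]
    have "((\<lambda>z. (f (of_real \<rho> * z) - K) * (1 - z) powr of_real (-lam) - of_real c) \<longlongrightarrow> 0) (at 1 within S1)"
      by simp
    then show ?thesis
    proof (rule Lim_transform_eventually)
      show "\<forall>\<^sub>F z in at 1 within S1. (f (of_real \<rho> * z) - K) * (1 - z) powr of_real (-lam) - of_real c = g z * (1 - z) powr of_real (-lam)"
        unfolding eventually_at_filter
      proof (intro always_eventually allI impI)
        fix z assume "z \<noteq> 1" "z \<in> S1"
        then have "(1 - z) powr of_real lam * (1 - z) powr of_real (-lam) = 1"
          by (simp flip: powr_add)
        then show "(f (of_real \<rho> * z) - K) * (1 - z) powr of_real (-lam) - of_real c = g z * (1 - z) powr of_real (-lam)"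
          unfolding g_def by (simp only: left_diff_distrib mult.assoc mult_1_right)
      qed
    qed
  qed
  ultimately have "(\<lambda>n. norm ((deriv ^^ n) g 0 / fact n) * real n powr (lam + 1)) \<longlonglongrightarrow> 0"
    by (rule little_o_transfer[OF S1])
  moreover have "(deriv ^^ n) g 0 / fact n = of_real (a n * \<rho> ^ n - c * pow_coeff lam n) - (if n = 0 then K else 0)" for n
  proof (rule coeff_from_sums[of 1 "\<lambda>n. of_real (a n * \<rho> ^ n - c * pow_coeff lam n) - (if n = 0 then K else 0)"])
    fix z :: complex assume z: "norm z < 1"
    have "(\<lambda>n. of_real (a n) * (of_real \<rho> * z) ^ n) sums f (of_real \<rho> * z)"
      by (rule sums) (use z \<rho> in \<open>simp add: norm_mult\<close>)
    moreover have "(\<lambda>n. (if n = 0 then K else 0)) sums K"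
      using sums_single[of 0 "\<lambda>_. K"] by simp
    moreover have "(\<lambda>n. of_real c * (of_real (pow_coeff lam n) * z ^ n)) sums (of_real c * (1 - z) powr of_real lam)"
      by (intro sums_mult pow_coeff_sums z)
    ultimately have "(\<lambda>n. of_real (a n) * (of_real \<rho> * z) ^ n - (if n = 0 then K else 0) - of_real c * (of_real (pow_coeff lam n) * z ^ n)) sums g z"
      unfolding g_def by (intro sums_diff)
    also have "(\<lambda>n. of_real (a n) * (of_real \<rho> * z) ^ n - (if n = 0 then K else 0) - of_real c * (of_real (pow_coeff lam n) * z ^ n)) =
       (\<lambda>n. (of_real (a n * \<rho> ^ n - c * pow_coeff lam n) - (if n = 0 then K else 0)) * z ^ n)"
      by (auto simp: fun_eq_iff power_mult_distrib algebra_simps)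
    finally show "(\<lambda>n. (of_real (a n * \<rho> ^ n - c * pow_coeff lam n) - (if n = 0 then K else 0)) * z ^ n) sums g z" .
  qed simp
  ultimately have "(\<lambda>n. norm (complex_of_real (a n * \<rho> ^ n - c * pow_coeff lam n) - (if n = 0 then K else 0)) * real n powr (lam + 1)) \<longlonglongrightarrow> 0"
    by simp
  then have "(\<lambda>n. norm ((a n * \<rho> ^ n - c * pow_coeff lam n) * real n powr (lam + 1))) \<longlonglongrightarrow> 0"
    by (rule Lim_transform_eventually)
       (use eventually_gt_at_top[of 0] in eventually_elim, simp add: norm_mult abs_mult del: of_real_diff of_real_mult)
  then have "(\<lambda>n. (a n * \<rho> ^ n - c * pow_coeff lam n) * real n powr (lam + 1)) \<longlonglongrightarrow> 0"
    by (rule tendsto_norm_zero_cancel)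
  from tendsto_add[OF this tendsto_mult_left[OF pow_coeff_asymp[of lam], of c]]
  show ?thesis by (simp add: algebra_simps)
qed

text \<open>Needed to shrink a Delta-domain to the set on which a composite function is analytic.
  Near \<rho> the sets \<open>S\<close> and \<open>T\<close> agree; capping the factor at 1 keeps
  each ball away from \<rho> and within twice the distance of its centre from \<rho>.\<close>

lemma dented_restrict:
  assumes S: "dented \<rho> S" and T: "T \<subseteq> S" "open T" "cball 0 \<rho> - {of_real \<rho>} \<subseteq> T"
    and ev: "\<forall>\<^sub>F z in at (of_real \<rho>) within S. z \<in> T"
  shows "dented \<rho> T"
proof -
  obtain \<kappa> \<delta> where k: "\<kappa> > 0" "\<delta> > 0" "\<And>z. norm z < \<rho> \<Longrightarrow> dist z (of_real \<rho>) < \<delta> \<Longrightarrow>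
        ball z (\<kappa> * dist z (of_real \<rho>)) \<subseteq> S"
    using S unfolding dented_def by metis
  obtain d where d: "d > 0" "\<And>z. z \<in> S \<Longrightarrow> z \<noteq> of_real \<rho> \<Longrightarrow> dist z (of_real \<rho>) < d \<Longrightarrow> z \<in> T"
    using ev unfolding eventually_at by auto
  have npos: "\<And>z. z \<in> S \<Longrightarrow> 1 - z / of_real \<rho> \<notin> \<real>\<^sub>\<le>\<^sub>0" using S by (auto simp: dented_def)
  show ?thesis
  proof (rule dentedI[of _ _ "min \<kappa> 1" "min \<delta> (d / 2)"])
    fix z assume "z \<in> T" then show "1 - z / complex_of_real \<rho> \<notin> \<real>\<^sub>\<le>\<^sub>0" using npos T by auto
  next
    fix z :: complex assume z: "norm z < \<rho>" "dist z (of_real \<rho>) < min \<delta> (d / 2)"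
    show "ball z (min \<kappa> 1 * dist z (of_real \<rho>)) \<subseteq> T"
    proof
      fix w assume w: "w \<in> ball z (min \<kappa> 1 * dist z (of_real \<rho>))"
      have 1: "min \<kappa> 1 * dist z (of_real \<rho>) \<le> \<kappa> * dist z (of_real \<rho>)"
        "min \<kappa> 1 * dist z (of_real \<rho>) \<le> 1 * dist z (of_real \<rho>)"
        by (rule mult_right_mono; simp)+
      have "dist z w < \<kappa> * dist z (of_real \<rho>)" and zw: "dist z w < dist z (of_real \<rho>)" using w 1 by auto
      then have "w \<in> S" using k(3)[of z] z by auto
      moreover have "w \<noteq> of_real \<rho>" using zw by auto
      moreover have "dist w (of_real \<rho>) < d"
        using zw z dist_triangle[of w "of_real \<rho>" z] by (simp add: dist_commute)
      ultimately show "w \<in> T" by (rule d(2))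
    qed
  qed (use k d T in auto)
qed

text \<open>The cosine is strictly decreasing on [0, \<pi>], so the condition on the argument
  becomes a strict inequality between continuous functions. It fails at \<open>z = \<rho>\<close> by
  itself, where it reads \<open>0 < 0\<close>.\<close>

lemma delta_domain_eq:
  assumes "0 < \<phi>" "\<phi> < pi / 2"
  shows "delta_domain \<rho> R \<phi> = {z. norm z < R \<and> Re (z - of_real \<rho>) < norm (z - of_real \<rho>) * cos \<phi>}"
proof -
  have "\<bar>Arg w\<bar> > \<phi> \<longleftrightarrow> Re w < norm w * cos \<phi>" if "w \<noteq> 0" for w
  proof -
    have "\<bar>Arg w\<bar> \<le> pi" using Arg_le_pi[of w] mpi_less_Arg[of w] by auto
    then have "\<bar>Arg w\<bar> > \<phi> \<longleftrightarrow> cos \<bar>Arg w\<bar> < cos \<phi>"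
      using assms by (intro cos_mono_less_eq[symmetric]) auto
    also have "cos \<bar>Arg w\<bar> = Re w / norm w" using cos_Arg[OF that] by simp
    finally show ?thesis using that by (simp add: field_simps)
  qed
  then have "(z \<noteq> of_real \<rho> \<and> \<bar>Arg (z - of_real \<rho>)\<bar> > \<phi>) =
      (Re (z - of_real \<rho>) < norm (z - of_real \<rho>) * cos \<phi>)" for z
    by (cases "z = of_real \<rho>") auto
  then show ?thesis unfolding delta_domain_def by simp
qed

lemma dented_delta_domain:
  assumes "0 < \<phi>" "\<phi> < pi / 2" "0 < \<rho>" "\<rho> < R"
  shows "dented \<rho> (delta_domain \<rho> R \<phi>)"
proof -
  \<comment> \<open>For \<open>w\<close> within \<open>k * D\<close> of \<open>z\<close>, where
    \<open>D = dist z \<rho>\<close>, the real part of \<open>w - \<rho>\<close> is below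
    \<open>k * D\<close> and its modulus above \<open>(1 - k) * D\<close>. So
    \<open>k \<le> (1 - k) * cos \<phi>\<close> is wanted, and half the cosine achieves it.\<close>
  define k where "k = cos \<phi> / 2"
  have c: "0 < cos \<phi>" "cos \<phi> < 1" using assms cos_gt_zero[of \<phi>] cos_monotone_0_pi[of 0 \<phi>] by auto
  then have k: "0 < k" "k \<le> 1/2" "k \<le> (1 - k) * cos \<phi>"
    using mult_right_mono[of "1/2" "1 - k" "cos \<phi>"] by (auto simp: k_def)
  show ?thesis
    unfolding delta_domain_eq[OF assms(1,2)]
  proof (rule dentedI[of _ _ k "R - \<rho>"])
    show "open {z. norm z < R \<and> Re (z - complex_of_real \<rho>) < norm (z - complex_of_real \<rho>) * cos \<phi>}"
      by (intro open_Collect_conj open_Collect_less continuous_intros)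
    show "cball 0 \<rho> - {complex_of_real \<rho>} \<subseteq> {z. norm z < R \<and> Re (z - complex_of_real \<rho>) < norm (z - complex_of_real \<rho>) * cos \<phi>}"
    proof
      fix z assume z: "z \<in> cball 0 \<rho> - {complex_of_real \<rho>}"
      have "Re z \<le> norm z" by (rule complex_Re_le_cmod)
      then have "Re (z - of_real \<rho>) \<le> 0" using z by auto
      moreover have "norm (z - complex_of_real \<rho>) * cos \<phi> > 0" using z c by auto
      ultimately show "z \<in> {z. norm z < R \<and> Re (z - complex_of_real \<rho>) < norm (z - complex_of_real \<rho>) * cos \<phi>}"
        using z assms by auto
    qed
  next
    fix z assume z: "z \<in> {z. norm z < R \<and> Re (z - complex_of_real \<rho>) < norm (z - complex_of_real \<rho>) * cos \<phi>}"
    show "1 - z / complex_of_real \<rho> \<notin> \<real>\<^sub>\<le>\<^sub>0"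
    proof
      assume "1 - z / complex_of_real \<rho> \<in> \<real>\<^sub>\<le>\<^sub>0"
      then have "Im z = 0" "Re z \<ge> \<rho>" using assms
        by (auto simp: complex_nonpos_Reals_iff field_simps)
      then have "norm (z - complex_of_real \<rho>) = Re (z - of_real \<rho>)"
        by (simp add: norm_complex_def)
      moreover have "Re (z - of_real \<rho>) * cos \<phi> \<le> Re (z - of_real \<rho>) * 1"
        using \<open>Re z \<ge> \<rho>\<close> c by (intro mult_left_mono) auto
      ultimately show False using z by simp
    qed
  next
    fix z :: complex assume z: "norm z < \<rho>" "dist z (of_real \<rho>) < R - \<rho>"
    let ?r = "of_real \<rho> :: complex"
    show "ball z (k * dist z ?r) \<subseteq> {z. norm z < R \<and> Re (z - ?r) < norm (z - ?r) * cos \<phi>}"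
    proof
      fix w assume "w \<in> ball z (k * dist z ?r)"
      then have w: "norm (w - z) < k * norm (z - ?r)" by (simp add: dist_norm norm_minus_commute)
      have D: "k * norm (z - ?r) \<le> 1 * norm (z - ?r)" by (rule mult_right_mono) (use k in auto)
      have "norm w \<le> norm z + norm (w - z)" by (metis norm_triangle_sub)
      then have 1: "norm w < R" using z w D by (simp add: dist_norm)
      have "Re (w - ?r) = Re (w - z) + Re (z - ?r)" by simp
      also have "Re (w - z) \<le> norm (w - z)" by (rule complex_Re_le_cmod)
      also have "Re (z - ?r) \<le> 0" using z complex_Re_le_cmod[of z] by simp
      finally have 2: "Re (w - ?r) < k * norm (z - ?r)" using w by linarith
      have "norm (z - ?r) \<le> norm (w - ?r) + norm (w - z)"
        using norm_triangle_ineq[of "w - ?r" "z - w"] by (simp add: norm_minus_commute)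
      then have "(1 - k) * norm (z - ?r) \<le> norm (w - ?r)" using w by (simp add: algebra_simps)
      then have "(1 - k) * norm (z - ?r) * cos \<phi> \<le> norm (w - ?r) * cos \<phi>"
        using c by (intro mult_right_mono) auto
      moreover have "k * norm (z - ?r) \<le> (1 - k) * cos \<phi> * norm (z - ?r)" by (rule mult_right_mono[OF k(3)]) simp
      ultimately have "Re (w - ?r) < norm (w - ?r) * cos \<phi>" using 2 by (simp add: mult_ac)
      with 1 show "w \<in> {z. norm z < R \<and> Re (z - ?r) < norm (z - ?r) * cos \<phi>}" by simp
    qed
  qed (use k assms in auto)
qed

section \<open>Power series with a singular expansion\<close>

definition cfps :: "real fps \<Rightarrow> complex fps" where
  "cfps F = Abs_fps (\<lambda>n. of_real (fps_nth F n))"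

lemma fps_nth_cfps [simp]: "fps_nth (cfps F) n = of_real (fps_nth F n)"
  by (simp add: cfps_def)

lemma cfps_mult: "cfps (F * G) = cfps F * cfps G"
  by (rule fps_ext) (simp add: fps_mult_nth)

lemma cfps_power: "cfps (F ^ k) = cfps F ^ k"
  by (induction k) (simp_all add: cfps_mult, simp add: cfps_def fps_one_def Abs_fps_inverse fps_eq_iff)

lemma cfps_deriv: "cfps (fps_deriv F) = fps_deriv (cfps F)"
  by (rule fps_ext) simp

lemma fps_conv_radius_cfps [simp]: "fps_conv_radius (cfps F) = fps_conv_radius F"
  by (simp add: fps_conv_radius_def conv_radius_def)

lemma eval_cfps_of_real:
  assumes "ereal \<bar>x\<bar> < fps_conv_radius F"
  shows "eval_fps (cfps F) (of_real x) = of_real (eval_fps F x)"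
proof -
  have "(\<lambda>n. fps_nth F n * x ^ n) sums eval_fps F x"
    using sums_eval_fps[of x F] assms by simp
  then have "(\<lambda>n. of_real (fps_nth F n * x ^ n)) sums complex_of_real (eval_fps F x)"
    by (rule sums_of_real)
  then show ?thesis by (simp add: eval_fps_def sums_iff)
qed

lemma nonneg_fps_power:
  fixes F :: "real fps"
  assumes "\<And>n. fps_nth F n \<ge> 0"
  shows "fps_nth (F ^ k) n \<ge> 0"
  by (induction k arbitrary: n) (auto simp: fps_mult_nth assms intro!: sum_nonneg mult_nonneg_nonneg)

lemma eval_fps_nonneg:
  fixes F :: "real fps"
  assumes "\<And>n. fps_nth F n \<ge> 0" "x \<ge> 0" "summable (\<lambda>n. fps_nth F n * x ^ n)"
  shows "eval_fps F x \<ge> 0"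
  unfolding eval_fps_def using assms by (intro suminf_nonneg) auto

text \<open>The double series is nonnegative at \<open>\<bar>z\<bar>\<close>, so Tonelli applies; \<open>H(0) \<noteq> 0\<close> is allowed.\<close>

lemma compose_coeffs:
  fixes \<phi> :: "nat \<Rightarrow> real" and H :: "real fps" and z :: complex
  assumes \<phi>: "\<And>k. \<phi> k \<ge> 0" and H: "\<And>n. fps_nth H n \<ge> 0"
    and z: "z \<noteq> 0" "ereal (norm z) < fps_conv_radius H"
    and sm: "summable (\<lambda>k. \<phi> k * eval_fps H (norm z) ^ k)"
  shows "summable (\<lambda>k. \<phi> k * fps_nth (H ^ k) n)"
    and "(\<lambda>n. of_real (\<Sum>k. \<phi> k * fps_nth (H ^ k) n) * z ^ n) sums (\<Sum>k. of_real (\<phi> k) * eval_fps (cfps H) z ^ k)"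
    and "summable (\<lambda>k. of_real (\<phi> k) * eval_fps (cfps H) z ^ k)"
proof -
  let ?x = "norm z"
  have nn: "fps_nth (H ^ k) n \<ge> 0" for k n by (rule nonneg_fps_power[OF H])
  have row: "(\<lambda>n. fps_nth (H ^ k) n * ?x ^ n) sums (eval_fps H ?x ^ k)" for k
    using sums_eval_fps[of ?x "H ^ k"] eval_fps_power[of ?x H k] z
    by (simp add: less_le_trans[OF _ fps_conv_radius_power])
  have rowc: "(\<lambda>n. of_real (fps_nth (H ^ k) n) * z ^ n) sums (eval_fps (cfps H) z ^ k)" for k
    using sums_eval_fps[of z "cfps H ^ k"] eval_fps_power[of z "cfps H" k] z
    by (simp add: less_le_trans[OF _ fps_conv_radius_power] flip: cfps_power)
  define f where "f = (\<lambda>(k, n). \<phi> k * (fps_nth (H ^ k) n * ?x ^ n))"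
  have h0: "eval_fps H ?x \<ge> 0" by (rule eval_fps_nonneg) (use row[of 1] H in \<open>auto simp: sums_iff\<close>)
  have fsum: "f summable_on (UNIV \<times> UNIV)"
  proof (rule summable_on_SigmaI)
    show "((\<lambda>n. f (k, n)) has_sum (\<phi> k * eval_fps H ?x ^ k)) UNIV" for k
      unfolding f_def by (auto intro!: has_sum_cmult_right sums_nonneg_imp_has_sum row mult_nonneg_nonneg nn)
    show "(\<lambda>k. \<phi> k * eval_fps H ?x ^ k) summable_on UNIV"
      using sm \<phi> h0 by (subst summable_on_UNIV_nonneg_real_iff) auto
    show "f (k, n) \<ge> 0" for k n unfolding f_def by (auto intro!: mult_nonneg_nonneg \<phi> nn)
  qed
  show S1: "summable (\<lambda>k. \<phi> k * fps_nth (H ^ k) n)" for n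
  proof -
    have "(\<lambda>(n, k). f (k, n)) summable_on (UNIV \<times> UNIV)" using fsum by (subst (asm) summable_on_swap)
    from summable_on_SigmaD1[OF this, of n] have "summable (\<lambda>k. f (k, n))"
      by (intro summable_on_imp_summable) simp
    then have "summable (\<lambda>k. f (k, n) / ?x ^ n)" by (rule summable_divide)
    then show ?thesis using z by (simp add: f_def)
  qed
  define g where "g = (\<lambda>(k, n). of_real (\<phi> k) * (of_real (fps_nth (H ^ k) n) * z ^ n))"
  have "(\<lambda>x. norm (g x)) = f"
  proof
    fix x :: "nat \<times> nat"
    show "norm (g x) = f x" using \<phi>[of "fst x"] nn[of "fst x" "snd x"]
      by (cases x) (simp add: g_def f_def norm_mult norm_power)
  qed
  then have gsum: "g summable_on (UNIV \<times> UNIV)" using fsum by (simp add: abs_summable_summable)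
  then obtain T where T: "(g has_sum T) (UNIV \<times> UNIV)" by (auto simp: summable_on_def)
  have "((\<lambda>k. of_real (\<phi> k) * eval_fps (cfps H) z ^ k) has_sum T) UNIV"
  proof (rule has_sum_SigmaD[OF T])
    fix k
    have "((\<lambda>n. of_real (fps_nth (H ^ k) n) * z ^ n) has_sum (eval_fps (cfps H) z ^ k)) UNIV"
      by (rule norm_summable_imp_has_sum[OF _ rowc])
         (use row[of k] nn in \<open>simp add: norm_mult norm_power sums_iff\<close>)
    then show "((\<lambda>n. g (k, n)) has_sum (of_real (\<phi> k) * eval_fps (cfps H) z ^ k)) UNIV"
      unfolding g_def by (auto intro: has_sum_cmult_right)
  qed
  then have A: "(\<lambda>k. of_real (\<phi> k) * eval_fps (cfps H) z ^ k) sums T" by (rule has_sum_imp_sums)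
  have T': "((\<lambda>(n, k). g (k, n)) has_sum T) (UNIV \<times> UNIV)" using T by (subst (asm) has_sum_swap)
  have "((\<lambda>n. of_real (\<Sum>k. \<phi> k * fps_nth (H ^ k) n) * z ^ n) has_sum T) UNIV"
  proof (rule has_sum_SigmaD[OF T'])
    fix n
    have "((\<lambda>k. \<phi> k * fps_nth (H ^ k) n) has_sum (\<Sum>k. \<phi> k * fps_nth (H ^ k) n)) UNIV"
      by (intro sums_nonneg_imp_has_sum summable_sums S1 mult_nonneg_nonneg \<phi> nn)
    then have "((\<lambda>k. of_real (\<phi> k * fps_nth (H ^ k) n)) has_sum complex_of_real (\<Sum>k. \<phi> k * fps_nth (H ^ k) n)) UNIV"
      by (rule has_sum_of_real)
    from has_sum_cmult_left[OF this, of "z ^ n"]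
    show "((\<lambda>k. (\<lambda>(n, k). g (k, n)) (n, k)) has_sum (of_real (\<Sum>k. \<phi> k * fps_nth (H ^ k) n) * z ^ n)) UNIV"
      by (simp add: g_def mult_ac)
  qed
  then have "(\<lambda>n. of_real (\<Sum>k. \<phi> k * fps_nth (H ^ k) n) * z ^ n) sums T" by (rule has_sum_imp_sums)
  with A show "(\<lambda>n. of_real (\<Sum>k. \<phi> k * fps_nth (H ^ k) n) * z ^ n) sums (\<Sum>k. of_real (\<phi> k) * eval_fps (cfps H) z ^ k)"
    and "summable (\<lambda>k. of_real (\<phi> k) * eval_fps (cfps H) z ^ k)"
    by (simp_all add: sums_iff)
qed

text \<open>Equality in the triangle inequality would give all nonzero terms the same argument. Then
  the powers of \<open>w = z / r\<close> agree on all exponents of the support, which confines the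
  support to one residue class modulo the order of \<open>w\<close>, or to a single exponent if
  \<open>w\<close> has infinite order.\<close>

lemma aperiodic_strict:
  fixes F :: "real fps" and z :: complex
  assumes ap: "aperiodic_fps F" and nn: "\<And>n. fps_nth F n \<ge> 0" and r: "r > 0"
    and sm: "summable (\<lambda>n. fps_nth F n * r ^ n)" and z: "norm z \<le> r" "z \<noteq> of_real r"
  shows "norm (\<Sum>n. of_real (fps_nth F n) * z ^ n) < (\<Sum>n. fps_nth F n * r ^ n)"
proof (rule ccontr)
  define S where "S = (\<Sum>n. of_real (fps_nth F n) * z ^ n)"
  define T where "T = (\<Sum>n. fps_nth F n * r ^ n)"
  assume "\<not> norm (\<Sum>n. of_real (fps_nth F n) * z ^ n) < (\<Sum>n. fps_nth F n * r ^ n)"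
  then have le: "T \<le> norm S" by (simp add: S_def T_def)
  have nle: "norm (of_real (fps_nth F n) * z ^ n) \<le> fps_nth F n * r ^ n" for n
    using nn[of n] z by (auto simp: norm_mult norm_power intro!: mult_left_mono power_mono)
  have smz: "summable (\<lambda>n. of_real (fps_nth F n) * z ^ n)"
    by (rule summable_comparison_test'[OF sm nle])
  \<comment> \<open>A support inside \<open>{0}\<close> would lie in one residue class modulo
    2.\<close>
  obtain m where m: "fps_nth F m \<noteq> 0" "m \<noteq> 0"
  proof (rule ccontr)
    assume "\<not> thesis"
    with that have "\<forall>n. fps_nth F n \<noteq> 0 \<longrightarrow> n mod 2 = 0 mod 2" by force
    with ap show False unfolding aperiodic_fps_def by blast
  qed
  have "fps_nth F m * r ^ m \<le> T" unfolding T_def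
    using sum_le_suminf[OF sm, of "{m}"] nn r by simp
  moreover have "fps_nth F m * r ^ m > 0" using m nn[of m] r by simp
  ultimately have T0: "T > 0" by linarith
  then have S0: "S \<noteq> 0" using le by auto
  \<comment> \<open>Rotates the sum \<open>S\<close> onto the positive real axis, so that real parts
    can be compared term by term.\<close>
  define u where "u = cnj S / of_real (norm S)"
  have u: "norm u = 1" "u * S = of_real (norm S)"
    using S0 by (auto simp: u_def norm_divide complex_norm_square[symmetric] power2_eq_square mult.commute)
  have sm2: "summable (\<lambda>n. fps_nth F n * Re (u * z ^ n))" and s2: "(\<Sum>n. fps_nth F n * Re (u * z ^ n)) = norm S"
  proof -
    have "(\<lambda>n. u * (of_real (fps_nth F n) * z ^ n)) sums (u * S)"
      unfolding S_def by (intro sums_mult summable_sums smz)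
    from sums_Re[OF this] have "(\<lambda>n. Re (u * (of_real (fps_nth F n) * z ^ n))) sums norm S" by (simp add: u)
    also have "(\<lambda>n. Re (u * (of_real (fps_nth F n) * z ^ n))) = (\<lambda>n. fps_nth F n * Re (u * z ^ n))"
      by (auto simp: fun_eq_iff algebra_simps)
    finally show "summable (\<lambda>n. fps_nth F n * Re (u * z ^ n))" "(\<Sum>n. fps_nth F n * Re (u * z ^ n)) = norm S"
      by (simp_all add: sums_iff)
  qed
  have nre: "norm (u * z ^ n) \<le> r ^ n" for n using u z by (simp add: norm_mult norm_power power_mono)
  then have re: "Re (u * z ^ n) \<le> r ^ n" for n using complex_Re_le_cmod[of "u * z ^ n"] by (meson order_trans)
  have sm3: "summable (\<lambda>n. fps_nth F n * r ^ n - fps_nth F n * Re (u * z ^ n))"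
    by (intro summable_diff sm sm2)
  have "(\<Sum>n. fps_nth F n * r ^ n - fps_nth F n * Re (u * z ^ n)) = T - norm S"
    unfolding suminf_diff[OF sm sm2, symmetric] s2 T_def ..
  moreover have nn3: "fps_nth F n * r ^ n - fps_nth F n * Re (u * z ^ n) \<ge> 0" for n
    using mult_left_mono[OF re[of n] nn[of n]] by simp
  ultimately have "(\<Sum>n. fps_nth F n * r ^ n - fps_nth F n * Re (u * z ^ n)) = 0"
    using le suminf_nonneg[OF sm3 nn3] by linarith
  then have all0: "fps_nth F n * r ^ n - fps_nth F n * Re (u * z ^ n) = 0" for n
    using suminf_eq_zero_iff[OF sm3 nn3] by simp
  have eq: "u * z ^ n = of_real (r ^ n)" if "fps_nth F n \<noteq> 0" for n
  proof -
    have R: "Re (u * z ^ n) = r ^ n" using all0[of n] that by (simp flip: right_diff_distrib)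
    have "(norm (u * z ^ n))\<^sup>2 \<le> (r ^ n)\<^sup>2" by (rule power_mono[OF nre]) simp
    then have "(Re (u * z ^ n))\<^sup>2 + (Im (u * z ^ n))\<^sup>2 \<le> (r ^ n)\<^sup>2" by (simp only: cmod_power2)
    then have "Im (u * z ^ n) = 0" unfolding R by simp
    with R show ?thesis by (simp add: complex_eq_iff)
  qed
  define w where "w = z / of_real r"
  have w1: "w \<noteq> 1" using z r by (simp add: w_def)
  have uw: "u * w ^ n = 1" if "fps_nth F n \<noteq> 0" for n
    using eq[OF that] r by (simp add: w_def power_divide)
  have w0: "w \<noteq> 0" using uw[OF m(1)] m(2) by (cases m) auto
  have u0: "u \<noteq> 0" using u by auto
  have ww: "w ^ i = w ^ j" if "fps_nth F i \<noteq> 0" "fps_nth F j \<noteq> 0" for i j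
  proof -
    have "u * w ^ i = u * w ^ j" unfolding uw[OF that(1)] uw[OF that(2)] by (rule refl)
    then show ?thesis unfolding mult_left_cancel[OF u0] .
  qed
  show False
  proof (cases "\<exists>d. d \<ge> 1 \<and> w ^ d = 1")
    case True
    \<comment> \<open>The order of \<open>w\<close> as a root of unity; it is at least 2 because
      \<open>w \<noteq> 1\<close>.\<close>
    define d where "d = (LEAST d. d \<ge> 1 \<and> w ^ d = 1)"
    have d: "d \<ge> 1 \<and> w ^ d = 1" unfolding d_def using LeastI_ex[OF True] .
    have "d \<noteq> 1" using d w1 by auto
    then have d2: "d \<ge> 2" using d by auto
    have dvd: "d dvd k" if "w ^ k = 1" for k
    proof -
      have "w ^ k = (w ^ d) ^ (k div d) * w ^ (k mod d)"
        by (simp flip: power_mult power_add)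
      then have "w ^ (k mod d) = 1" using d that by simp
      moreover have "k mod d < d" using d by simp
      ultimately have "\<not> k mod d \<ge> 1" using not_less_Least[of "k mod d" "\<lambda>d. d \<ge> 1 \<and> w ^ d = 1"]
        unfolding d_def by auto
      then show ?thesis by (simp add: dvd_eq_mod_eq_0)
    qed
    have *: "i mod d = j mod d" if "i \<le> j" "w ^ i = w ^ j" for i j
    proof -
      have "w ^ j = w ^ i * w ^ (j - i)" using power_add[of w i "j - i"] that(1) by simp
      then have "w ^ (j - i) = 1" using that w0 by simp
      then have "d dvd j - i" by (rule dvd)
      then have "j mod d = i mod d" using that(1) by (simp add: mod_eq_dvd_iff_nat)
      then show ?thesis by (rule sym)
    qed
    have "\<forall>n. fps_nth F n \<noteq> 0 \<longrightarrow> n mod d = m mod d"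
    proof (intro allI impI)
      fix n assume n: "fps_nth F n \<noteq> 0"
      show "n mod d = m mod d"
      proof (cases "n \<le> m")
        case True then show ?thesis by (rule *[OF _ ww[OF n m(1)]])
      next
        case False then show ?thesis by (intro *[OF _ ww[OF m(1) n], symmetric]) simp
      qed
    qed
    with ap d2 show False unfolding aperiodic_fps_def by blast
  next
    \<comment> \<open>Here the powers of \<open>w\<close> are pairwise distinct, so the support has
      one element, and modulus 2 contradicts aperiodicity.\<close>
    case False
    have *: "i = j" if "i \<le> j" "w ^ i = w ^ j" for i j
    proof (rule ccontr)
      assume "i \<noteq> j"
      have "w ^ j = w ^ i * w ^ (j - i)" using power_add[of w i "j - i"] that(1) by simp
      then have "w ^ (j - i) = 1" using that w0 by simp
      then show False using False \<open>i \<noteq> j\<close> that by auto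
    qed
    have "n mod 2 = m mod 2" if n: "fps_nth F n \<noteq> 0" for n
    proof (cases "n \<le> m")
      case True then have "n = m" by (rule *[OF _ ww[OF n m(1)]])
      then show ?thesis by simp
    next
      case False then have "m = n" by (intro *[OF _ ww[OF m(1) n]]) simp
      then show ?thesis by simp
    qed
    then have "\<exists>d\<ge>2. \<exists>r. \<forall>n. fps_nth F n \<noteq> 0 \<longrightarrow> n mod d = r mod (d::nat)"
      by (intro exI[of _ 2] conjI exI[of _ m]) auto
    then show False using ap unfolding aperiodic_fps_def by (rule notE[rotated])
  qed
qed

text \<open>For \<open>lam < 1\<close> the polynomial is a constant, since \<open>lam = 0\<close> is
  excluded along with the other naturals. The power never vanishes on the domain, so the asymptotic
  equivalence can be read as a genuine limit of a quotient.\<close>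

lemma delta_singular_expansion:
  assumes F: "delta_singular F \<rho> lam c" and lam: "lam < 1"
  obtains S f K where "dented \<rho> S" "f holomorphic_on S"
    "\<And>z. norm z < \<rho> \<Longrightarrow> (\<lambda>n. of_real (fps_nth F n) * z ^ n) sums f z"
    "((\<lambda>z. (f z - K) * (1 - z / of_real \<rho>) powr of_real (-lam)) \<longlongrightarrow> of_real c) (at (of_real \<rho>) within S)"
    "lam < 0 \<Longrightarrow> K = 0"
proof -
  obtain R \<phi> f P where *: "R > \<rho>" "0 < \<phi>" "\<phi> < pi / 2" "f analytic_on delta_domain \<rho> R \<phi>"
    "\<And>z. norm z < \<rho> \<Longrightarrow> (\<lambda>n. of_real (fps_nth F n) * z ^ n) sums f z"
    "lam < 0 \<Longrightarrow> P = 0" "0 < lam \<and> lam < 1 \<Longrightarrow> degree P = 0"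
    "(\<lambda>z. f z - poly P (1 - z / of_real \<rho>)) \<sim>[at (of_real \<rho>) within delta_domain \<rho> R \<phi>]
        (\<lambda>z. of_real c * (1 - z / of_real \<rho>) powr of_real lam)"
    using F unfolding delta_singular_def by auto
  have \<rho>: "\<rho> > 0" "c \<noteq> 0" "lam \<notin> \<nat>" using F by (auto simp: delta_singular_def)
  define S where "S = delta_domain \<rho> R \<phi>"
  have S: "dented \<rho> S" unfolding S_def by (rule dented_delta_domain) (use * \<rho> in auto)
  have "lam \<noteq> 0" using \<rho>(3) by auto
  then have "degree P = 0" using *(6,7) lam by (cases "lam < 0") auto
  then obtain a where "P = [:a:]" by (rule degree_eq_zeroE)
  then have P: "poly P x = coeff P 0" for x by simp
  let ?g = "\<lambda>z. of_real c * (1 - z / of_real \<rho>) powr of_real lam"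
  have nz: "1 - z / of_real \<rho> \<noteq> 0" if "z \<in> S" for z
    using S that unfolding dented_def by (metis nonpos_Reals_zero_I)
  have ne: "?g z \<noteq> 0" if "z \<in> S" for z using nz[OF that] \<rho> by auto
  have "((\<lambda>z. (f z - coeff P 0) / ?g z) \<longlongrightarrow> 1) (at (of_real \<rho>) within S)"
  proof -
    have "((\<lambda>z. if f z - coeff P 0 = 0 \<and> ?g z = 0 then 1 else (f z - coeff P 0) / ?g z) \<longlongrightarrow> 1) (at (of_real \<rho>) within S)"
      using *(8) unfolding asymp_equiv_def P S_def by simp
    then show ?thesis
      by (rule Lim_transform_eventually) (use ne in \<open>auto simp: eventually_at_filter intro!: always_eventually\<close>)
  qed
  from tendsto_mult_right[OF this, of "of_real c"]
  have "((\<lambda>z. (f z - coeff P 0) / ?g z * of_real c) \<longlongrightarrow> of_real c) (at (of_real \<rho>) within S)" by simp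
  then have "((\<lambda>z. (f z - coeff P 0) * (1 - z / of_real \<rho>) powr of_real (-lam)) \<longlongrightarrow> of_real c) (at (of_real \<rho>) within S)"
  proof (rule Lim_transform_eventually)
    show "\<forall>\<^sub>F z in at (of_real \<rho>) within S. (f z - coeff P 0) / ?g z * of_real c = (f z - coeff P 0) * (1 - z / of_real \<rho>) powr of_real (-lam)"
      unfolding eventually_at_filter
      by (intro always_eventually) (use nz \<rho> in \<open>auto simp: powr_minus field_simps\<close>)
  qed
  with S *(4,5,6) show ?thesis
    by (intro that[of S f "coeff P 0"]) (auto simp: S_def analytic_imp_holomorphic)
qed

lemma delta_singular_coeff_asymp:
  assumes F: "delta_singular F \<rho> lam c" and lam: "lam < 1"
  shows "(\<lambda>n. fps_nth F n * \<rho> ^ n * real n powr (lam + 1)) \<longlonglongrightarrow> c * rGamma (- lam)"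
proof -
  have \<rho>: "\<rho> > 0" using F by (auto simp: delta_singular_def)
  show ?thesis
    by (rule delta_singular_expansion[OF F lam]) (rule singularity_transfer[OF \<rho>])
qed

text \<open>The constant is a limit of nonnegative numbers and is nonzero because \<open>lam\<close>
  avoids the zeros of \<open>rGamma (- lam)\<close>. This recovers the sign of \<open>c\<close>,
  which the definition leaves open.\<close>

lemma delta_singular_coeff_const_pos:
  assumes F: "delta_singular F \<rho> lam c" and lam: "lam < 1"
  shows "c * rGamma (- lam) > 0"
proof -
  have *: "\<rho> > 0" "lam \<notin> \<nat>" "c \<noteq> 0" "\<And>n. fps_nth F n \<ge> 0" using F by (auto simp: delta_singular_def)
  have "c * rGamma (- lam) \<ge> 0"
    using delta_singular_coeff_asymp[OF F lam]
    by (rule LIMSEQ_le_const) (use * in \<open>auto intro!: mult_nonneg_nonneg\<close>)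
  moreover have "rGamma (- lam) \<noteq> 0"
  proof
    assume "rGamma (- lam) = 0"
    then have "- lam \<in> \<int>\<^sub>\<le>\<^sub>0" by (simp add: rGamma_eq_zero_iff)
    then obtain n where "lam = of_nat n" by (auto elim!: nonpos_Ints_cases')
    then show False using *(2) by simp
  qed
  ultimately show ?thesis using * by (simp add: order_le_less)
qed

text \<open>Adds the point \<open>z = 0\<close>, where \<open>compose_coeffs\<close> cannot divide
  by \<open>\<bar>z\<bar> ^ n\<close>: only the term of index 0 is left, and the constant
  coefficient of \<open>F ^ k\<close> is the \<open>k\<close>-th power of that of
  \<open>F\<close>.\<close>

lemma compose_coeffs_sums:
  fixes \<phi> :: "nat \<Rightarrow> real" and H :: "real fps" and z :: complex
  assumes \<phi>: "\<And>k. \<phi> k \<ge> 0" and H: "\<And>n. fps_nth H n \<ge> 0"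
    and z: "ereal (norm z) < fps_conv_radius H"
    and sm: "summable (\<lambda>k. \<phi> k * eval_fps H (norm z) ^ k)"
  shows "(\<lambda>n. of_real (\<Sum>k. \<phi> k * fps_nth (H ^ k) n) * z ^ n) sums (\<Sum>k. of_real (\<phi> k) * eval_fps (cfps H) z ^ k)"
proof (cases "z = 0")
  case True
  have "complex_of_real (\<Sum>k. \<phi> k * fps_nth (H ^ k) 0) = (\<Sum>k. of_real (\<phi> k * fps_nth (H ^ k) 0))"
    by (rule suminf_of_real) (use sm True in \<open>simp add: eval_fps_at_0 fps_power_zeroth\<close>)
  then have "(\<Sum>k. of_real (\<phi> k) * eval_fps (cfps H) z ^ k) = complex_of_real (\<Sum>k. \<phi> k * fps_nth (H ^ k) 0)"
    using True by (simp add: eval_fps_at_0 fps_power_zeroth)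
  moreover have "(\<lambda>n. of_real (\<Sum>k. \<phi> k * fps_nth (H ^ k) n) * z ^ n) =
      (\<lambda>n. if n = 0 then complex_of_real (\<Sum>k. \<phi> k * fps_nth (H ^ k) 0) else 0)"
    using True by (auto simp: fun_eq_iff)
  ultimately show ?thesis
    using sums_single[of 0 "\<lambda>_. complex_of_real (\<Sum>k. \<phi> k * fps_nth (H ^ k) 0)"] by simp
qed (rule compose_coeffs(2)[OF \<phi> H _ z sm])

lemma tendsto_radial:
  assumes S: "dented \<rho> S" and \<rho>: "\<rho> > 0"
  shows "filterlim (\<lambda>x. complex_of_real x) (at (of_real \<rho>) within S) (at_left \<rho>)"
proof -
  have "\<forall>\<^sub>F x in at_left \<rho>. 0 < x \<and> x < \<rho>"
    using \<rho> eventually_at_left_real by (auto elim!: eventually_mono)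
  then have "\<forall>\<^sub>F x in at_left \<rho>. complex_of_real x \<in> S \<and> complex_of_real x \<noteq> of_real \<rho>"
    by eventually_elim (use S in \<open>auto simp: dented_def\<close>)
  moreover have "((\<lambda>x. complex_of_real x) \<longlongrightarrow> of_real \<rho>) (at_left \<rho>)"
    by (intro tendsto_intros)
  ultimately show ?thesis by (simp add: filterlim_at)
qed

lemma dented_powr_tendsto_0:
  assumes "lam > 0" "dented \<rho> S" "\<rho> > 0"
  shows "((\<lambda>z. (1 - z / of_real \<rho>) powr complex_of_real lam) \<longlongrightarrow> 0) (at (of_real \<rho>) within S)"
proof (rule tendsto_norm_zero_cancel)
  have "((\<lambda>z. norm (1 - z / of_real \<rho>)) \<longlongrightarrow> norm (1 - of_real \<rho> / of_real \<rho> :: complex)) (at (of_real \<rho>) within S)"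
    by (intro tendsto_intros) (use assms in auto)
  then have "((\<lambda>z. norm (1 - z / of_real \<rho>) powr lam) \<longlongrightarrow> 0 powr lam) (at (of_real \<rho>) within S)"
    using assms by (intro tendsto_powr2 tendsto_const) auto
  then have A: "((\<lambda>z. norm (1 - z / of_real \<rho>) powr lam) \<longlongrightarrow> 0) (at (of_real \<rho>) within S)"
    using assms by simp
  have B: "\<forall>\<^sub>F z in at (of_real \<rho>) within S. norm (1 - z / of_real \<rho>) powr lam = norm ((1 - z / of_real \<rho>) powr complex_of_real lam)"
    unfolding eventually_at_filter
  proof (intro always_eventually allI impI)
    fix z :: complex assume "z \<noteq> of_real \<rho>" "z \<in> S"
    then have "1 - z / of_real \<rho> \<noteq> 0" using assms by (auto simp: field_simps)
    from cmod_powr_of_real[OF this]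
    show "norm (1 - z / of_real \<rho>) powr lam = norm ((1 - z / of_real \<rho>) powr complex_of_real lam)" by simp
  qed
  show "((\<lambda>z. norm ((1 - z / of_real \<rho>) powr complex_of_real lam)) \<longlongrightarrow> 0) (at (of_real \<rho>) within S)"
    by (rule Lim_transform_eventually[OF A B])
qed

text \<open>Identifies the constant of the expansion with the value of the series at \<rho>:
  nonnegative coefficients turn the radial limit into convergence at \<rho>. Aperiodicity then makes
  \<rho> the only point of the closed disc where the modulus could reach this value.\<close>

lemma delta_singular_boundary:
  assumes F: "delta_singular F \<rho> lam c" and lam: "0 < lam" "lam < 1"
  obtains S f where "dented \<rho> S" "f holomorphic_on S"
    "\<And>z. norm z < \<rho> \<Longrightarrow> f z = eval_fps (cfps F) z"
    "\<And>z. norm z \<le> \<rho> \<Longrightarrow> z \<noteq> of_real \<rho> \<Longrightarrow> norm (f z) < eval_fps F \<rho>"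
    "((\<lambda>z. (f z - of_real (eval_fps F \<rho>)) * (1 - z / of_real \<rho>) powr of_real (-lam)) \<longlongrightarrow> of_real c)
       (at (of_real \<rho>) within S)"
    "(f \<longlongrightarrow> of_real (eval_fps F \<rho>)) (at (of_real \<rho>) within S)"
    "c < 0" "summable (\<lambda>n. fps_nth F n * \<rho> ^ n)"
proof -
  have \<rho>: "\<rho> > 0" and c: "c \<noteq> 0" and nn: "\<And>n. fps_nth F n \<ge> 0" and ap: "aperiodic_fps F"
    and rad: "fps_conv_radius F = ereal \<rho>"
    using F by (auto simp: delta_singular_def)
  obtain S f K where *: "dented \<rho> S" "f holomorphic_on S"
    "\<And>z. norm z < \<rho> \<Longrightarrow> (\<lambda>n. of_real (fps_nth F n) * z ^ n) sums f z"
    "((\<lambda>z. (f z - K) * (1 - z / of_real \<rho>) powr of_real (-lam)) \<longlongrightarrow> of_real c) (at (of_real \<rho>) within S)"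
    "lam < 0 \<Longrightarrow> K = 0"
    by (rule delta_singular_expansion[OF F lam(2)]) blast
  have npos: "1 - z / of_real \<rho> \<notin> \<real>\<^sub>\<le>\<^sub>0" if "z \<in> S" for z using *(1) that by (auto simp: dented_def)
  have feq: "f z = eval_fps (cfps F) z" if "norm z < \<rho>" for z
    using *(3)[OF that] by (simp add: eval_fps_def sums_iff)
  have fK: "(f \<longlongrightarrow> K) (at (of_real \<rho>) within S)"
  proof -
    have "((\<lambda>z. (f z - K) * (1 - z / of_real \<rho>) powr of_real (-lam) * (1 - z / of_real \<rho>) powr complex_of_real lam + K) \<longlongrightarrow> of_real c * 0 + K) (at (of_real \<rho>) within S)"
      by (intro tendsto_intros *(4) dented_powr_tendsto_0 lam *(1) \<rho>)
    then have "((\<lambda>z. (f z - K) * (1 - z / of_real \<rho>) powr of_real (-lam) * (1 - z / of_real \<rho>) powr complex_of_real lam + K) \<longlongrightarrow> K) (at (of_real \<rho>) within S)"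
      by simp
    then show ?thesis
    proof (rule Lim_transform_eventually)
      show "\<forall>\<^sub>F z in at (of_real \<rho>) within S. (f z - K) * (1 - z / of_real \<rho>) powr of_real (-lam) * (1 - z / of_real \<rho>) powr complex_of_real lam + K = f z"
        unfolding eventually_at_filter
      proof (intro always_eventually allI impI)
        fix z assume "z \<noteq> of_real \<rho>" "z \<in> S"
        then have "1 - z / of_real \<rho> \<noteq> 0" using npos[of z] by auto
        then have "(1 - z / of_real \<rho>) powr of_real (-lam) * (1 - z / of_real \<rho>) powr complex_of_real lam = 1"
          by (simp flip: powr_add)
        then show "(f z - K) * (1 - z / of_real \<rho>) powr of_real (-lam) * (1 - z / of_real \<rho>) powr complex_of_real lam + K = f z"
          by (simp only: mult.assoc) simp
      qed
    qed
  qed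
  have evx: "\<forall>\<^sub>F x in at_left \<rho>. 0 < x \<and> x < \<rho>"
    using \<rho> eventually_at_left_real by (auto elim!: eventually_mono)
  have freal: "f (of_real x) = of_real (eval_fps F x)" if "0 < x" "x < \<rho>" for x
    using that feq[of "of_real x"] eval_cfps_of_real[of x F] rad by simp
  have K: "((\<lambda>x. f (of_real x)) \<longlongrightarrow> K) (at_left \<rho>)"
    by (rule filterlim_compose[OF fK tendsto_radial[OF *(1) \<rho>]])
  have K1: "((\<lambda>x. complex_of_real (eval_fps F x)) \<longlongrightarrow> K) (at_left \<rho>)"
    by (rule Lim_transform_eventually[OF K]) (use evx in eventually_elim, simp add: freal)
  define p where "p = Re K"
  have K2: "((\<lambda>x. eval_fps F x) \<longlongrightarrow> p) (at_left \<rho>)"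
    using tendsto_Re[OF K1] by (simp add: p_def)
  have "Im K = 0"
    using tendsto_unique[OF _ tendsto_Im[OF K1], of 0] \<rho> by simp
  then have Kp: "K = of_real p" by (simp add: p_def complex_eq_iff)
  have nb: "at_left \<rho> \<noteq> bot" by simp
  have sx: "summable (\<lambda>n. fps_nth F n * x ^ n)" if "0 < x" "x < \<rho>" for x
    using summable_fps[of x F] rad that by simp
  \<comment> \<open>A finite partial sum is continuous at \<rho> and lies below the series at every
    \<open>x < \<rho>\<close>, so the radial limit bounds it.\<close>
  have part: "(\<Sum>n<N. fps_nth F n * \<rho> ^ n) \<le> p" for N
  proof (rule tendsto_le[OF nb K2])
    show "((\<lambda>x. \<Sum>n<N. fps_nth F n * x ^ n) \<longlongrightarrow> (\<Sum>n<N. fps_nth F n * \<rho> ^ n)) (at_left \<rho>)"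
      by (intro tendsto_intros)
    show "\<forall>\<^sub>F x in at_left \<rho>. (\<Sum>n<N. fps_nth F n * x ^ n) \<le> eval_fps F x"
      using evx unfolding eval_fps_def
      by eventually_elim (intro sum_le_suminf sx; use nn in auto)
  qed
  have sm: "summable (\<lambda>n. fps_nth F n * \<rho> ^ n)"
  proof (rule bounded_imp_summable[of _ p])
    show "(\<Sum>k\<le>N. fps_nth F k * \<rho> ^ k) \<le> p" for N
      using part[of "Suc N"] by (simp only: lessThan_Suc_atMost)
  qed (use nn \<rho> in auto)
  have \<tau>1: "eval_fps F \<rho> \<le> p" unfolding eval_fps_def by (rule suminf_le_const[OF sm part])
  have mono: "eval_fps F x \<le> eval_fps F \<rho>" if "0 < x" "x < \<rho>" for x
    unfolding eval_fps_def
    by (intro suminf_le sx sm that mult_left_mono power_mono nn) (use that in auto)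
  have "p \<le> eval_fps F \<rho>"
    by (rule tendsto_upperbound[OF K2]) (use evx in \<open>auto elim!: eventually_mono intro: mono\<close>)
  with \<tau>1 have p: "p = eval_fps F \<rho>" by simp
  have strict: "norm (f z) < eval_fps F \<rho>" if z: "norm z \<le> \<rho>" "z \<noteq> of_real \<rho>" for z
  proof -
    \<comment> \<open>On the circle itself \<open>f\<close> is only a continuation. It agrees with
      the series there because both are continuous along the radial points \<open>q m\<close>, where
      they coincide.\<close>
    have "f z = (\<Sum>n. of_real (fps_nth F n) * z ^ n)"
    proof -
      define h where "h w = (\<Sum>n. of_real (fps_nth F n) * w ^ n)" for w :: complex
      have hc: "continuous_on (cball 0 \<rho>) h"
        unfolding h_def
      proof (rule uniform_limit_theorem[where f = "\<lambda>N w. \<Sum>n<N. of_real (fps_nth F n) * w ^ n" and F = sequentially])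
        show "uniform_limit (cball 0 \<rho>) (\<lambda>N w. \<Sum>n<N. complex_of_real (fps_nth F n) * w ^ n) (\<lambda>w. \<Sum>n. of_real (fps_nth F n) * w ^ n) sequentially"
          by (rule Weierstrass_m_test[OF _ sm])
             (use nn in \<open>auto simp: norm_mult norm_power intro!: mult_left_mono power_mono\<close>)
      qed (auto intro!: always_eventually continuous_intros)
      define q where "q m = of_real (1 - 1 / real (Suc m)) * z" for m
      have "(\<lambda>m. of_real (1 - 1 / real (Suc m)) * z) \<longlonglongrightarrow> of_real 1 * z"
        by (intro tendsto_intros) real_asymp
      then have q: "q \<longlonglongrightarrow> z" by (simp add: q_def[abs_def])
      have nq: "norm (q m) < \<rho>" for m
      proof (cases "z = 0")
        case False
        have "norm (q m) = (1 - 1 / real (Suc m)) * norm z" 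
          unfolding q_def norm_mult norm_of_real by (subst abs_of_nonneg) auto
        also have "\<dots> < 1 * norm z" by (rule mult_strict_right_mono) (use False in auto)
        finally show ?thesis using z by simp
      qed (use \<rho> in \<open>simp add: q_def\<close>)
      have zS: "z \<in> S" using *(1) z by (auto simp: dented_def)
      have "(\<lambda>m. f (q m)) \<longlonglongrightarrow> f z"
      proof -
        have "isCont f z"
          using *(1,2) zS by (auto simp: dented_def intro: holomorphic_on_imp_continuous_on continuous_on_interior[of S] simp: interior_open)
        then show ?thesis using q by (rule isCont_tendsto_compose)
      qed
      moreover have "(\<lambda>m. h (q m)) \<longlonglongrightarrow> h z"
        by (rule continuous_on_tendsto_compose[OF hc q]) (use z nq in \<open>auto intro!: always_eventually simp: less_imp_le\<close>)
      moreover have "f (q m) = h (q m)" for m using *(3)[OF nq[of m]] by (simp add: h_def sums_iff)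
      ultimately have "f z = h z" using LIMSEQ_unique by auto
      then show ?thesis by (simp add: h_def)
    qed
    then show ?thesis unfolding eval_fps_def using aperiodic_strict[OF ap nn \<rho> sm z] by simp
  qed
  \<comment> \<open>The series stays below its value at \<rho> on the real axis, so the real
    quotient that tends to \<open>c\<close> is nonpositive.\<close>
  have "c < 0"
  proof -
    have A: "((\<lambda>x. (f (of_real x) - K) * (1 - of_real x / of_real \<rho>) powr of_real (-lam)) \<longlongrightarrow> of_real c) (at_left \<rho>)"
      by (rule filterlim_compose[OF *(4) tendsto_radial[OF *(1) \<rho>]])
    have "((\<lambda>x. (eval_fps F x - p) * (1 - x / \<rho>) powr (-lam)) \<longlongrightarrow> c) (at_left \<rho>)"
    proof (rule Lim_transform_eventually)
      show "((\<lambda>x. Re ((f (of_real x) - K) * (1 - of_real x / of_real \<rho>) powr of_real (-lam))) \<longlongrightarrow> c) (at_left \<rho>)"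
        using tendsto_Re[OF A] by simp
      show "\<forall>\<^sub>F x in at_left \<rho>. Re ((f (of_real x) - K) * (1 - of_real x / of_real \<rho>) powr of_real (-lam)) = (eval_fps F x - p) * (1 - x / \<rho>) powr (-lam)"
        using evx
      proof eventually_elim
        case (elim x)
        have "(1 - of_real x / of_real \<rho>) powr complex_of_real (-lam) = of_real ((1 - x / \<rho>) powr (-lam))"
          using elim \<rho> powr_of_real[of "1 - x / \<rho>" "- lam"] by simp
        then show ?case using elim by (simp add: freal Kp flip: of_real_diff of_real_mult)
      qed
    qed
    then have "c \<le> 0"
      by (rule tendsto_upperbound)
         (use evx in \<open>auto elim!: eventually_mono intro!: mult_nonpos_nonneg simp: p mono\<close>)
    then show ?thesis using c by simp
  qed
  with * Kp p feq strict fK sm show ?thesis by (intro that[of S f]) auto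
qed

section \<open>Coefficients of composites, and the exchange of weights\<close>

lemma pow_coeff_pochhammer: "pow_coeff a k = pochhammer (- a) k / fact k"
  by (simp add: pow_coeff_def gbinomial_pochhammer flip: power_mult_distrib)

lemma pow_coeff_neg_pos: "s > 0 \<Longrightarrow> pow_coeff (- s) k > 0"
  by (simp add: pow_coeff_pochhammer pochhammer_pos)

lemma fps_conv_radius_const_mult:
  fixes F :: "real fps"
  assumes "c \<noteq> 0"
  shows "fps_conv_radius (fps_const c * F) = fps_conv_radius F"
  using conv_radius_cmult_left[OF assms, of "fps_nth F"] by (simp add: fps_conv_radius_def)

text \<open>Near \<rho> one has \<open>1 - F/\<tau> = B * (1 - z/\<rho>) powr lam\<close> with
  \<open>B\<close> tending to \<open>- c / \<tau> > 0\<close>. Raising this to the power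
  \<open>- s\<close> gives a singularity of exponent \<open>- lam * s\<close>, provided that
  logarithms add without a multiple of 2 \<pi> i.\<close>

lemma critical_coeff_asymp:
  assumes F: "delta_singular F \<rho> lam c" and lam: "0 < lam" "lam < 1" and s: "s > 0"
  defines "\<tau> \<equiv> eval_fps F \<rho>"
  shows "(\<lambda>n. (\<Sum>k. pow_coeff (-s) k * fps_nth ((fps_const (1 / \<tau>) * F) ^ k) n) * \<rho> ^ n * real n powr (1 - lam * s))
           \<longlonglongrightarrow> (- c / \<tau>) powr (-s) * rGamma (lam * s)"
    and "summable (\<lambda>k. pow_coeff (-s) k * fps_nth ((fps_const (1 / \<tau>) * F) ^ k) n)"
    and "0 < \<tau>" and "c < 0"
proof -
  have \<rho>: "\<rho> > 0" and nn: "\<And>n. fps_nth F n \<ge> 0" and rad: "fps_conv_radius F = ereal \<rho>"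
    using F by (auto simp: delta_singular_def)
  obtain S f where *: "dented \<rho> S" "f holomorphic_on S"
    "\<And>z. norm z < \<rho> \<Longrightarrow> f z = eval_fps (cfps F) z"
    "\<And>z. norm z \<le> \<rho> \<Longrightarrow> z \<noteq> of_real \<rho> \<Longrightarrow> norm (f z) < \<tau>"
    "((\<lambda>z. (f z - of_real \<tau>) * (1 - z / of_real \<rho>) powr of_real (-lam)) \<longlongrightarrow> of_real c) (at (of_real \<rho>) within S)"
    "(f \<longlongrightarrow> of_real \<tau>) (at (of_real \<rho>) within S)"
    and c: "c < 0" and "summable (\<lambda>n. fps_nth F n * \<rho> ^ n)"
    unfolding \<tau>_def by (rule delta_singular_boundary[OF F lam]) blast
  show "c < 0" by fact
  show \<tau>: "\<tau> > 0" using *(4)[of 0] \<rho> by (auto intro: le_less_trans[OF norm_ge_zero])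
  have npos: "1 - z / of_real \<rho> \<notin> \<real>\<^sub>\<le>\<^sub>0" if "z \<in> S" for z using *(1) that by (auto simp: dented_def)
  define b where "b = - c / \<tau>"
  have b: "b > 0" using c \<tau> by (simp add: b_def divide_neg_pos)
  define A where "A z = 1 - f z / of_real \<tau>" for z
  define B where "B z = A z * (1 - z / of_real \<rho>) powr of_real (-lam)" for z
  have Blim: "(B \<longlongrightarrow> of_real b) (at (of_real \<rho>) within S)"
  proof -
    have "B = (\<lambda>z. ((f z - of_real \<tau>) * (1 - z / of_real \<rho>) powr of_real (-lam)) * (- 1 / of_real \<tau>))"
      using \<tau> by (auto simp: fun_eq_iff B_def A_def field_simps)
    moreover have "complex_of_real b = of_real c * (- 1 / of_real \<tau>)" by (simp add: b_def)
    ultimately show ?thesis using tendsto_mult_right[OF *(5), of "- 1 / of_real \<tau>"] by simp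
  qed
  have Lnb: "complex_of_real b \<notin> \<real>\<^sub>\<le>\<^sub>0" using b by simp
  have LnB: "((\<lambda>z. Im (Ln (B z))) \<longlongrightarrow> 0) (at (of_real \<rho>) within S)"
    using tendsto_Im[OF tendsto_Ln[OF Blim Lnb]] b by (simp add: Ln_of_real)
  \<comment> \<open>The logarithm of \<open>1 - z/\<rho>\<close>, multiplied by \<open>lam\<close>,
    has imaginary part at most \<open>lam * pi\<close>. The remaining room below \<pi> is
    \<open>(1 - lam) * pi\<close>, which is where \<open>lam < 1\<close> enters.\<close>
  have ev1: "\<forall>\<^sub>F z in at (of_real \<rho>) within S. \<bar>Im (Ln (B z))\<bar> < (1 - lam) * pi"
    using tendstoD[OF LnB, of "(1 - lam) * pi"] lam by simp
  have ev2: "\<forall>\<^sub>F z in at (of_real \<rho>) within S. B z \<noteq> 0"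
    using tendsto_imp_eventually_ne[OF Blim, of 0] b by simp
  have evS: "\<forall>\<^sub>F z in at (of_real \<rho>) within S. z \<in> S"
    by (auto simp: eventually_at_filter)
  have ev: "\<forall>\<^sub>F z in at (of_real \<rho>) within S. z \<in> S \<and> A z \<notin> \<real>\<^sub>\<le>\<^sub>0 \<and> Ln (A z) = Ln (B z) + of_real lam * Ln (1 - z / of_real \<rho>)"
    using ev1 ev2 evS
  proof eventually_elim
    case (elim z)
    let ?w = "1 - z / of_real \<rho>"
    have w: "?w \<noteq> 0" using npos[of z] elim by auto
    have Az: "A z = B z * ?w powr of_real lam"
    proof -
      have "?w powr of_real (-lam) * ?w powr complex_of_real lam = 1" using w by (simp flip: powr_add)
      then show ?thesis by (simp only: B_def mult.assoc mult_1_right)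
    qed
    have "\<bar>Im (of_real lam * Ln ?w)\<bar> \<le> lam * pi"
      using lam mpi_less_Im_Ln[OF w] Im_Ln_le_pi[OF w] by (auto simp: abs_mult)
    with elim have I: "\<bar>Im (Ln (B z) + of_real lam * Ln ?w)\<bar> < pi" by (simp add: algebra_simps)
    have "exp (Ln (B z) + of_real lam * Ln ?w) = A z"
      using elim w Az by (simp add: exp_add powr_def)
    then have L: "Ln (A z) = Ln (B z) + of_real lam * Ln ?w"
      using I by (intro Ln_unique) auto
    have "A z \<noteq> 0" using Az elim w by simp
    have "A z \<notin> \<real>\<^sub>\<le>\<^sub>0"
    proof
      assume "A z \<in> \<real>\<^sub>\<le>\<^sub>0"
      then have "Im (A z) = 0" "Re (A z) < 0" using \<open>A z \<noteq> 0\<close> by (auto simp: complex_nonpos_Reals_iff complex_eq_iff)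
      then have "Im (Ln (A z)) = pi" using Im_Ln_eq_pi \<open>A z \<noteq> 0\<close> by blast
      then show False using I L by simp
    qed
    with L elim show ?case by simp
  qed
  \<comment> \<open>The set on which the principal power of \<open>A\<close> is analytic. It
    contains the punctured closed disc because \<open>\<bar>f z\<bar> < \<tau>\<close>
    there.\<close>
  define S' where "S' = {z\<in>S. A z \<notin> \<real>\<^sub>\<le>\<^sub>0}"
  have holA: "A holomorphic_on S" unfolding A_def[abs_def] by (intro holomorphic_intros *(2)) (use \<tau> in auto)
  have oS: "open S" using *(1) by (simp add: dented_def)
  have re: "norm (f z / of_real \<tau>) < 1" if "norm z \<le> \<rho>" "z \<noteq> of_real \<rho>" for z
    using *(4)[OF that] \<tau> by (simp add: norm_divide)
  have S'd: "dented \<rho> S'"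
  proof (rule dented_restrict[OF *(1)])
    have "S' = S \<inter> A -` (- \<real>\<^sub>\<le>\<^sub>0)" by (auto simp: S'_def)
    also have "open \<dots>"
      by (rule continuous_open_preimage[OF holomorphic_on_imp_continuous_on[OF holA] oS])
         (simp add: open_Compl)
    finally show "open S'" .
    show "cball 0 \<rho> - {of_real \<rho>} \<subseteq> S'"
    proof
      fix z assume z: "z \<in> cball 0 \<rho> - {complex_of_real \<rho>}"
      then have "z \<in> S" using *(1) by (auto simp: dented_def)
      moreover have "A z \<notin> \<real>\<^sub>\<le>\<^sub>0" unfolding A_def
        by (rule one_minus_notin_nonpos_Reals[OF re]) (use z in auto)
      ultimately show "z \<in> S'" by (simp add: S'_def)
    qed
    show "\<forall>\<^sub>F z in at (of_real \<rho>) within S. z \<in> S'" using ev by eventually_elim (simp add: S'_def)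
  qed (auto simp: S'_def)
  let ?f = "\<lambda>z. A z powr of_real (-s)"
  let ?a = "\<lambda>n. (\<Sum>k. pow_coeff (-s) k * fps_nth ((fps_const (1 / \<tau>) * F) ^ k) n)"
  define Ft where "Ft = fps_const (1 / \<tau>) * F"
  have radt: "fps_conv_radius Ft = ereal \<rho>" using \<tau> rad by (simp add: Ft_def fps_conv_radius_const_mult)
  have nnt: "fps_nth Ft n \<ge> 0" for n using \<tau> nn by (simp add: Ft_def)
  have evt: "eval_fps (cfps Ft) z = f z / of_real \<tau>" if "norm z < \<rho>" for z
  proof -
    have "cfps Ft = fps_const (1 / of_real \<tau>) * cfps F" by (rule fps_ext) (simp add: Ft_def)
    then show ?thesis using *(3)[OF that] that rad by (simp add: eval_fps_mult)
  qed
  have smA: "summable (\<lambda>k. pow_coeff (-s) k * eval_fps Ft (norm z) ^ k)"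
    if "norm z < \<rho>" for z :: complex
  proof -
    have e: "complex_of_real (eval_fps Ft (norm z)) = f (of_real (norm z)) / of_real \<tau>"
      using evt[of "of_real (norm z)"] eval_cfps_of_real[of "norm z" Ft] that radt by simp
    have "norm (complex_of_real (eval_fps Ft (norm z))) < 1"
      unfolding e by (rule re) (use that in auto)
    then have "summable (\<lambda>k. of_real (pow_coeff (-s) k) * complex_of_real (eval_fps Ft (norm z)) ^ k)"
      using pow_coeff_sums by (auto simp: sums_iff)
    then have "summable (\<lambda>k. complex_of_real (pow_coeff (-s) k * eval_fps Ft (norm z) ^ k))" by simp
    then show ?thesis by (simp only: summable_of_real_iff)
  qed
  note cc = compose_coeffs[of "pow_coeff (-s)" Ft, OF less_imp_le[OF pow_coeff_neg_pos[OF s]] nnt]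
  show "summable (\<lambda>k. pow_coeff (-s) k * fps_nth ((fps_const (1 / \<tau>) * F) ^ k) n)"
    unfolding Ft_def[symmetric]
    by (rule cc(1)[of "of_real (\<rho> / 2)"]) (use \<rho> radt smA[of "of_real (\<rho>/2)"] in auto)
  have "(\<lambda>n. ?a n * \<rho> ^ n * real n powr (- lam * s + 1)) \<longlonglongrightarrow> b powr (-s) * rGamma (- (- lam * s))"
  proof (rule singularity_transfer[OF \<rho> S'd])
    show "?f holomorphic_on S'"
      by (intro holomorphic_intros holomorphic_on_subset[OF holA]) (auto simp: S'_def)
    show "(\<lambda>n. of_real (?a n) * z ^ n) sums ?f z" if z: "norm z < \<rho>" for z
    proof -
      have w: "norm (f z / of_real \<tau>) < 1" by (rule re) (use z in auto)
      have P: "(\<Sum>k. of_real (pow_coeff (-s) k) * (f z / of_real \<tau>) ^ k) = ?f z"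
        using pow_coeff_sums[OF w, of "-s"] by (simp add: sums_iff A_def)
      show ?thesis
        using compose_coeffs_sums[OF less_imp_le[OF pow_coeff_neg_pos[OF s]] nnt _ smA[OF z]] z radt evt[OF z] P
        by (simp add: Ft_def)
    qed
    show "((\<lambda>z. (?f z - 0) * (1 - z / of_real \<rho>) powr of_real (- (- lam * s))) \<longlongrightarrow> of_real (b powr (-s))) (at (of_real \<rho>) within S')"
    proof (rule tendsto_within_subset[of _ _ _ S])
      have "((\<lambda>z. B z powr of_real (-s)) \<longlongrightarrow> of_real b powr of_real (-s)) (at (of_real \<rho>) within S)"
        by (intro tendsto_powr_complex Blim tendsto_const Lnb)
      also have "complex_of_real b powr of_real (-s) = of_real (b powr (-s))"
        using b powr_of_real[of b "-s"] by simp
      finally show "((\<lambda>z. (?f z - 0) * (1 - z / of_real \<rho>) powr of_real (- (- lam * s))) \<longlongrightarrow> of_real (b powr (-s))) (at (of_real \<rho>) within S)"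
      proof (rule Lim_transform_eventually)
        show "\<forall>\<^sub>F z in at (of_real \<rho>) within S. B z powr of_real (-s) = (?f z - 0) * (1 - z / of_real \<rho>) powr of_real (- (- lam * s))"
          using ev ev2
        proof eventually_elim
          case (elim z)
          have w: "1 - z / of_real \<rho> \<noteq> 0" using npos[of z] elim by auto
          have "A z \<noteq> 0" using elim by auto
          then show ?case using elim w by (simp add: powr_def algebra_simps flip: exp_add)
        qed
      qed
    qed (auto simp: S'_def)
  qed
  then show "(\<lambda>n. ?a n * \<rho> ^ n * real n powr (1 - lam * s)) \<longlonglongrightarrow> (- c / \<tau>) powr (-s) * rGamma (lam * s)"
    by (simp add: b_def)
qed

text \<open>The outer function is analytic at \<open>F(\<rho>)\<close>, so composition keeps the
  exponent \<open>lam\<close> and multiplies the constant by the derivative of the outer function at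
  that point.\<close>

lemma subcritical_coeff_asymp:
  assumes F: "delta_singular F \<rho> lam c" and lam: "0 < lam" "lam < 1"
    and \<phi>: "\<And>k. fps_nth \<Phi> k \<ge> 0" and rad\<Phi>: "ereal (eval_fps F \<rho>) < fps_conv_radius \<Phi>"
  shows "(\<lambda>n. (\<Sum>k. fps_nth \<Phi> k * fps_nth (F ^ k) n) * \<rho> ^ n * real n powr (lam + 1))
           \<longlonglongrightarrow> c * eval_fps (fps_deriv \<Phi>) (eval_fps F \<rho>) * rGamma (- lam)"
    and "summable (\<lambda>k. fps_nth \<Phi> k * fps_nth (F ^ k) n)"
proof -
  define \<tau> where "\<tau> = eval_fps F \<rho>"
  have \<rho>: "\<rho> > 0" and nn: "\<And>n. fps_nth F n \<ge> 0" and rad: "fps_conv_radius F = ereal \<rho>"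
    using F by (auto simp: delta_singular_def)
  obtain S f where *: "dented \<rho> S" "f holomorphic_on S"
    "\<And>z. norm z < \<rho> \<Longrightarrow> f z = eval_fps (cfps F) z"
    "\<And>z. norm z \<le> \<rho> \<Longrightarrow> z \<noteq> of_real \<rho> \<Longrightarrow> norm (f z) < \<tau>"
    "((\<lambda>z. (f z - of_real \<tau>) * (1 - z / of_real \<rho>) powr of_real (-lam)) \<longlongrightarrow> of_real c) (at (of_real \<rho>) within S)"
    "(f \<longlongrightarrow> of_real \<tau>) (at (of_real \<rho>) within S)"
    and c: "c < 0" and "summable (\<lambda>n. fps_nth F n * \<rho> ^ n)"
    unfolding \<tau>_def by (rule delta_singular_boundary[OF F lam]) blast
  have \<tau>: "\<tau> > 0" using *(4)[of 0] \<rho> by (auto intro: le_less_trans[OF norm_ge_zero])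
  define E where "E = eball (0::complex) (fps_conv_radius \<Phi>)"
  have \<tau>E: "of_real \<tau> \<in> E" using rad\<Phi> \<tau> by (simp add: E_def \<tau>_def[symmetric])
  have small: "w \<in> E" if "norm w \<le> \<tau>" for w
    using rad\<Phi> that unfolding E_def \<tau>_def[symmetric] by (auto intro: le_less_trans[of _ "ereal \<tau>"])
  have oE: "open E" by (simp add: E_def)
  let ?P = "eval_fps (cfps \<Phi>)"
  have holP: "?P holomorphic_on E" unfolding E_def by (rule holomorphic_on_eval_fps) simp
  define S' where "S' = {z\<in>S. f z \<in> E}"
  have S'd: "dented \<rho> S'"
  proof (rule dented_restrict[OF *(1)])
    have oS: "open S" using *(1) by (simp add: dented_def)
    have "S' = S \<inter> f -` E" by (auto simp: S'_def)
    also have "open \<dots>"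
      by (rule continuous_open_preimage[OF holomorphic_on_imp_continuous_on[OF *(2)] oS oE])
    finally show "open S'" .
    show "cball 0 \<rho> - {of_real \<rho>} \<subseteq> S'"
    proof
      fix z assume z: "z \<in> cball 0 \<rho> - {complex_of_real \<rho>}"
      then have "z \<in> S" using *(1) by (auto simp: dented_def)
      moreover have "f z \<in> E" by (rule small[OF less_imp_le[OF *(4)]]) (use z in auto)
      ultimately show "z \<in> S'" by (simp add: S'_def)
    qed
    have "\<forall>\<^sub>F z in at (of_real \<rho>) within S. f z \<in> E" by (rule topological_tendstoD[OF *(6) oE \<tau>E])
    moreover have "\<forall>\<^sub>F z in at (of_real \<rho>) within S. z \<in> S" by (auto simp: eventually_at_filter)
    ultimately show "\<forall>\<^sub>F z in at (of_real \<rho>) within S. z \<in> S'" by eventually_elim (simp add: S'_def)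
  qed (auto simp: S'_def)
  have h: "0 \<le> eval_fps F (norm z) \<and> eval_fps F (norm z) \<le> \<tau>" if "norm z < \<rho>" for z :: complex
  proof -
    have "complex_of_real (eval_fps F (norm z)) = f (of_real (norm z))"
      using *(3)[of "of_real (norm z)"] eval_cfps_of_real[of "norm z" F] that rad by simp
    moreover have "norm (f (of_real (norm z))) < \<tau>" by (rule *(4)) (use that in auto)
    ultimately have "norm (complex_of_real (eval_fps F (norm z))) < \<tau>" by simp
    moreover have "eval_fps F (norm z) \<ge> 0"
      by (rule eval_fps_nonneg) (use nn that rad in \<open>auto intro!: summable_fps\<close>)
    ultimately show ?thesis by simp
  qed
  have sm: "summable (\<lambda>k. fps_nth \<Phi> k * eval_fps F (norm z) ^ k)" if "norm z < \<rho>" for z :: complex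
    using h[OF that] rad\<Phi> by (intro summable_fps) (auto simp: \<tau>_def intro: le_less_trans[of _ "ereal \<tau>"])
  show "summable (\<lambda>k. fps_nth \<Phi> k * fps_nth (F ^ k) n)"
    by (rule compose_coeffs(1)[OF \<phi> nn, of "of_real (\<rho> / 2)"]) (use \<rho> rad sm[of "of_real (\<rho>/2)"] in auto)
  let ?D = "eval_fps (fps_deriv \<Phi>) \<tau>"
  have D: "eval_fps (fps_deriv (cfps \<Phi>)) (of_real \<tau>) = of_real ?D"
    unfolding cfps_deriv[symmetric]
    by (rule eval_cfps_of_real) (use rad\<Phi> \<tau> in \<open>simp add: \<tau>_def[symmetric] less_le_trans[OF _ fps_conv_radius_deriv]\<close>)
  have "(?P has_field_derivative of_real ?D) (at (of_real \<tau>))"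
    unfolding D[symmetric] by (rule has_field_derivative_eval_fps) (use rad\<Phi> \<tau> in \<open>simp add: \<tau>_def[symmetric]\<close>)
  \<comment> \<open>Caratheodory's form of the derivative factors the increment exactly, with no
    remainder term.\<close>
  then obtain g where g: "\<And>w. ?P w - ?P (of_real \<tau>) = g w * (w - of_real \<tau>)" "isCont g (of_real \<tau>)" "g (of_real \<tau>) = of_real ?D"
    unfolding CARAT_DERIV by blast
  have "(\<lambda>n. (\<Sum>k. fps_nth \<Phi> k * fps_nth (F ^ k) n) * \<rho> ^ n * real n powr (lam + 1)) \<longlonglongrightarrow> (?D * c) * rGamma (- lam)"
  proof (rule singularity_transfer[OF \<rho> S'd, where f = "\<lambda>z. ?P (f z)" and K = "?P (of_real \<tau>)"])
    have "(?P \<circ> f) holomorphic_on S'"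
      by (rule holomorphic_on_compose_gen[OF _ holP]) (auto simp: S'_def intro: holomorphic_on_subset[OF *(2)])
    then show "(\<lambda>z. ?P (f z)) holomorphic_on S'" by (simp add: o_def)
    show "(\<lambda>n. of_real (\<Sum>k. fps_nth \<Phi> k * fps_nth (F ^ k) n) * z ^ n) sums ?P (f z)" if z: "norm z < \<rho>" for z
      using compose_coeffs_sums[OF \<phi> nn _ sm[OF z]] z rad *(3)[OF z] by (simp add: eval_fps_def[of "cfps \<Phi>"])
    have "((\<lambda>z. g (f z) * ((f z - of_real \<tau>) * (1 - z / of_real \<rho>) powr of_real (-lam))) \<longlongrightarrow> of_real ?D * of_real c) (at (of_real \<rho>) within S)"
      using isCont_tendsto_compose[OF g(2) *(6)] unfolding g(3) by (intro tendsto_mult *(5))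
    then show "((\<lambda>z. (?P (f z) - ?P (of_real \<tau>)) * (1 - z / of_real \<rho>) powr of_real (-lam)) \<longlongrightarrow> of_real (?D * c)) (at (of_real \<rho>) within S')"
      unfolding g(1) mult.assoc of_real_mult by (rule tendsto_within_subset) (auto simp: S'_def)
  qed
  then show "(\<lambda>n. (\<Sum>k. fps_nth \<Phi> k * fps_nth (F ^ k) n) * \<rho> ^ n * real n powr (lam + 1))
           \<longlonglongrightarrow> c * eval_fps (fps_deriv \<Phi>) (eval_fps F \<rho>) * rGamma (- lam)"
    by (simp add: \<tau>_def mult_ac)
qed

text \<open>A Toeplitz averaging argument: for each \<open>n\<close> the numbers
  \<open>b k * w n k\<close>, divided by their sum, are weights on \<open>k\<close>, and the weight
  of each fixed \<open>k\<close> tends to 0. The averages of \<open>a k / b k\<close> therefore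
  inherit the limit \<open>L\<close>.\<close>

lemma weighted_ratio_limit:
  fixes a b :: "nat \<Rightarrow> real" and w :: "nat \<Rightarrow> nat \<Rightarrow> real"
  assumes b: "\<And>k. b k > 0" and ab: "(\<lambda>k. a k / b k) \<longlonglongrightarrow> L" and w: "\<And>n k. w n k \<ge> 0"
    and sm: "\<And>n. summable (\<lambda>k. b k * w n k)"
    and pos: "\<forall>\<^sub>F n in sequentially. (\<Sum>k. b k * w n k) > 0"
    and neg: "\<And>k. (\<lambda>n. w n k / (\<Sum>k. b k * w n k)) \<longlonglongrightarrow> 0"
  shows "(\<lambda>n. (\<Sum>k. a k * w n k) / (\<Sum>k. b k * w n k)) \<longlonglongrightarrow> L"
    and "\<And>n. summable (\<lambda>k. a k * w n k)"
proof -
  define W where "W n = (\<Sum>k. b k * w n k)" for n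
  define e where "e k = a k / b k - L" for k
  have e0: "e \<longlonglongrightarrow> 0" using LIM_zero[OF ab] by (simp add: e_def[abs_def])
  have a: "a k * w n k = L * (b k * w n k) + e k * (b k * w n k)" for n k
    using b[of k] by (simp add: e_def field_simps)
  have "Bseq e" using e0 convergentI convergent_imp_Bseq by blast
  then obtain Ce where Ce: "\<And>k. \<bar>e k\<bar> \<le> Ce" by (auto simp: Bseq_def)
  have sme: "summable (\<lambda>k. e k * (b k * w n k))" for n
  proof (rule summable_comparison_test'[of "\<lambda>k. Ce * (b k * w n k)" 0])
    show "summable (\<lambda>k. Ce * (b k * w n k))" by (intro summable_mult sm)
    fix k
    show "norm (e k * (b k * w n k)) \<le> Ce * (b k * w n k)"
      using Ce[of k] b[of k] w[of n k] by (auto simp: abs_mult intro!: mult_right_mono)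
  qed
  show sma: "summable (\<lambda>k. a k * w n k)" for n
    unfolding a by (intro summable_add summable_mult sm sme)
  have eq: "(\<Sum>k. a k * w n k) = L * W n + (\<Sum>k. e k * (b k * w n k))" for n
    unfolding a W_def by (subst suminf_add[symmetric]) (auto intro!: summable_mult sm sme simp: suminf_mult[OF sm])
  have "(\<lambda>n. (\<Sum>k. e k * (b k * w n k)) / W n) \<longlonglongrightarrow> 0"
  proof (rule LIMSEQ_I)
    fix \<epsilon> :: real assume \<epsilon>: "\<epsilon> > 0"
    obtain N where N: "\<And>k. k \<ge> N \<Longrightarrow> \<bar>e k\<bar> < \<epsilon> / 2"
      using LIMSEQ_D[OF e0, of "\<epsilon> / 2"] \<epsilon> by auto
    have "(\<lambda>n. \<Sum>k<N. \<bar>e k\<bar> * b k * (w n k / W n)) \<longlonglongrightarrow> (\<Sum>k<N. \<bar>e k\<bar> * b k * 0)"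
      by (intro tendsto_intros) (use neg in \<open>simp add: W_def\<close>)
    then have "\<forall>\<^sub>F n in sequentially. (\<Sum>k<N. \<bar>e k\<bar> * b k * (w n k / W n)) < \<epsilon> / 2"
      by (rule order_tendstoD) (use \<epsilon> in simp)
    with pos have "\<forall>\<^sub>F n in sequentially. norm ((\<Sum>k. e k * (b k * w n k)) / W n - 0) < \<epsilon>"
    proof eventually_elim
      case (elim n)
      have Wn: "W n > 0" using elim by (simp add: W_def)
      have nn: "b k * w n k \<ge> 0" for k using b[of k] w[of n k] by simp
      have fin: "summable (\<lambda>k. if k < N then \<bar>e k\<bar> * (b k * w n k) else 0)"
        by (rule summable_finite[of "{..<N}"]) auto
      have "\<bar>\<Sum>k. e k * (b k * w n k)\<bar> \<le> (\<Sum>k. (if k < N then \<bar>e k\<bar> * (b k * w n k) else 0) + \<epsilon> / 2 * (b k * w n k))"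
      proof (rule norm_suminf_le[where 'a = real, unfolded real_norm_def])
        show "summable (\<lambda>k. (if k < N then \<bar>e k\<bar> * (b k * w n k) else 0) + \<epsilon> / 2 * (b k * w n k))"
          by (intro summable_add fin summable_mult sm)
        fix k
        have "\<bar>e k * (b k * w n k)\<bar> = \<bar>e k\<bar> * (b k * w n k)"
          by (simp only: abs_mult[of "e k"] abs_of_nonneg[OF nn])
        moreover have "\<bar>e k\<bar> * (b k * w n k) \<le> \<epsilon> / 2 * (b k * w n k)" if "\<not> k < N"
          using N[of k] that nn[of k] by (intro mult_right_mono) auto
        moreover have "\<epsilon> / 2 * (b k * w n k) \<ge> 0" using \<epsilon> nn[of k] by simp
        ultimately show "\<bar>e k * (b k * w n k)\<bar> \<le> (if k < N then \<bar>e k\<bar> * (b k * w n k) else 0) + \<epsilon> / 2 * (b k * w n k)"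
          by auto
      qed
      also have "\<dots> = (\<Sum>k. if k < N then \<bar>e k\<bar> * (b k * w n k) else 0) + \<epsilon> / 2 * W n"
        unfolding W_def suminf_mult[OF sm, symmetric]
        by (rule suminf_add[OF fin summable_mult[OF sm], symmetric])
      also have "(\<Sum>k. if k < N then \<bar>e k\<bar> * (b k * w n k) else 0) = (\<Sum>k<N. \<bar>e k\<bar> * (b k * w n k))"
        by (subst suminf_finite[of "{..<N}"]) auto
      finally have "\<bar>\<Sum>k. e k * (b k * w n k)\<bar> / W n \<le> ((\<Sum>k<N. \<bar>e k\<bar> * (b k * w n k)) + \<epsilon> / 2 * W n) / W n"
        using Wn by (intro divide_right_mono) auto
      also have "\<dots> = (\<Sum>k<N. \<bar>e k\<bar> * b k * (w n k / W n)) + \<epsilon> / 2"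
        using Wn by (simp add: add_divide_distrib sum_divide_distrib mult.assoc)
      also have "\<dots> < \<epsilon>" using elim by simp
      finally show ?case using Wn by simp
    qed
    then show "\<exists>no. \<forall>n\<ge>no. norm ((\<Sum>k. e k * (b k * w n k)) / W n - 0) < \<epsilon>"
      by (simp add: eventually_sequentially)
  qed
  then have "(\<lambda>n. L + (\<Sum>k. e k * (b k * w n k)) / W n) \<longlonglongrightarrow> L + 0" by (intro tendsto_intros)
  then have "(\<lambda>n. L + (\<Sum>k. e k * (b k * w n k)) / W n) \<longlonglongrightarrow> L" by simp
  then show "(\<lambda>n. (\<Sum>k. a k * w n k) / (\<Sum>k. b k * w n k)) \<longlonglongrightarrow> L"
    unfolding W_def[symmetric]
    by (rule Lim_transform_eventually) (use pos in eventually_elim, simp add: eq field_simps W_def[symmetric])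
qed

section \<open>Moments\<close>

text \<open>Characteristic functions are replaced by Taylor polynomials of even degree
  \<open>2 * R\<close>, where the absolute moment in the remainder is an ordinary moment.
  \<open>growth\<close> makes the remainder of the limit law small, and convergence of the moment of
  order \<open>2 * R\<close> transfers this to all large \<open>n\<close>.\<close>

lemma method_of_moments:
  fixes M :: "nat \<Rightarrow> real measure" and m :: "nat \<Rightarrow> real"
  assumes M: "\<And>n. real_distribution (M n)" and M': "real_distribution M'"
    and int: "\<And>n r. integrable (M n) (\<lambda>x. x ^ r)" and int': "\<And>r. integrable M' (\<lambda>x. x ^ r)"
    and lim: "\<And>r. (\<lambda>n. \<integral>x. x ^ r \<partial>M n) \<longlonglongrightarrow> m r" and m': "\<And>r. (\<integral>x. x ^ r \<partial>M') = m r"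
    and growth: "\<And>t. (\<lambda>r. \<bar>t\<bar> ^ r * m r / fact r) \<longlonglongrightarrow> 0"
  shows "weak_conv_m M M'"
proof (rule levy_continuity[OF M M'])
  fix t :: real
  define P where "P N \<mu> = (\<Sum>k\<le>N. ((\<i> * of_real t)^k / fact k) * of_real (\<integral>x. x ^ k \<partial>(\<mu> :: real measure)))" for N \<mu>
  have approx: "cmod (char \<mu> t - P (2 * R) \<mu>) \<le> 2 * (\<bar>t\<bar> ^ (2 * R) * (\<integral>x. x ^ (2 * R) \<partial>\<mu>) / fact (2 * R))"
    if "real_distribution \<mu>" "\<And>r. integrable \<mu> (\<lambda>x. x ^ r)" for \<mu> R
    using real_distribution.char_approx1[OF that(1), of "2 * R" t] that(2)
    by (simp add: P_def power_mult)
  show "(\<lambda>n. char (M n) t) \<longlonglongrightarrow> char M' t"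
  proof (rule LIMSEQ_I)
    fix \<epsilon> :: real assume \<epsilon>: "\<epsilon> > 0"
    have "(\<lambda>R. \<bar>t\<bar> ^ (2 * R) * m (2 * R) / fact (2 * R)) \<longlonglongrightarrow> 0"
      using LIMSEQ_subseq_LIMSEQ[OF growth[of t], of "\<lambda>R. 2 * R"] by (simp add: strict_mono_def o_def)
    then have "\<forall>\<^sub>F R in sequentially. \<bar>t\<bar> ^ (2 * R) * m (2 * R) / fact (2 * R) < \<epsilon> / 8"
      by (rule order_tendstoD) (use \<epsilon> in simp)
    then obtain R where R: "\<bar>t\<bar> ^ (2 * R) * m (2 * R) / fact (2 * R) < \<epsilon> / 8"
      by (auto simp: eventually_sequentially)
    have "(\<lambda>n. \<bar>t\<bar> ^ (2 * R) * (\<integral>x. x ^ (2 * R) \<partial>M n) / fact (2 * R)) \<longlonglongrightarrow> \<bar>t\<bar> ^ (2 * R) * m (2 * R) / fact (2 * R)"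
      by (intro tendsto_intros lim) auto
    then have e1: "\<forall>\<^sub>F n in sequentially. \<bar>t\<bar> ^ (2 * R) * (\<integral>x. x ^ (2 * R) \<partial>M n) / fact (2 * R) < \<epsilon> / 8"
      using R by (rule order_tendstoD)
    have "(\<lambda>n. P (2 * R) (M n)) \<longlonglongrightarrow> P (2 * R) M'"
      unfolding P_def m' by (intro tendsto_intros lim)
    then have e2: "\<forall>\<^sub>F n in sequentially. cmod (P (2 * R) (M n) - P (2 * R) M') < \<epsilon> / 4"
      using tendstoD[of _ "P (2 * R) M'" sequentially "\<epsilon> / 4"] \<epsilon> by (simp add: dist_norm)
    have "\<forall>\<^sub>F n in sequentially. cmod (char (M n) t - char M' t) < \<epsilon>"
      using e1 e2
    proof eventually_elim
      case (elim n)
      have A: "cmod (char (M n) t - P (2 * R) (M n)) \<le> \<epsilon> / 4"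
        using approx[OF M int, of n R] elim(1) by linarith
      have B: "cmod (char M' t - P (2 * R) M') \<le> \<epsilon> / 4"
        using approx[OF M' int', of R] R unfolding m' by linarith
      have "char (M n) t - char M' t = (char (M n) t - P (2 * R) (M n)) + (P (2 * R) (M n) - P (2 * R) M') - (char M' t - P (2 * R) M')"
        by simp
      also have "cmod \<dots> \<le> cmod (char (M n) t - P (2 * R) (M n)) + cmod (P (2 * R) (M n) - P (2 * R) M') + cmod (char M' t - P (2 * R) M')"
        by (meson add_mono_thms_linordered_semiring(3) norm_triangle_ineq norm_triangle_ineq4 order_trans)
      finally show ?case using A B elim \<epsilon> by linarith
    qed
    then show "\<exists>no. \<forall>n\<ge>no. cmod (char (M n) t - char M' t) < \<epsilon>" by (simp add: eventually_sequentially)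
  qed
qed

text \<open>The previous lemma applied to a constant sequence.\<close>

lemma moments_determine:
  assumes M: "real_distribution M" and M': "real_distribution M'"
    and int: "\<And>r. integrable M (\<lambda>x. x ^ r)" and int': "\<And>r. integrable M' (\<lambda>x. x ^ r)"
    and m: "\<And>r. (\<integral>x. x ^ r \<partial>M) = m r" and m': "\<And>r. (\<integral>x. x ^ r \<partial>M') = m r"
    and growth: "\<And>t. (\<lambda>r. \<bar>t\<bar> ^ r * m r / fact r) \<longlonglongrightarrow> 0"
  shows "M = M'"
proof (rule Levy_uniqueness[OF M M'])
  have "weak_conv_m (\<lambda>_. M) M'"
    by (rule method_of_moments[OF M M' int int' _ m' growth]) (simp add: m)
  then have "(\<lambda>_. char M t) \<longlonglongrightarrow> char M' t" for t
    by (rule levy_continuity1[rotated -1]) (use M M' in auto)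
  then show "char M = char M'" by (auto simp: fun_eq_iff LIMSEQ_const_iff)
qed

text \<open>Only the part \<open>t \<ge> A\<close> of the Gamma integral is kept. Since
  \<open>A\<close> is free, Gamma outgrows every geometric sequence.\<close>

lemma Gamma_lower_bound:
  fixes A y :: real
  assumes "A > 0" "y \<ge> 1"
  shows "A powr (y - 1) * exp (- A) \<le> Gamma y"
proof -
  have G: "((\<lambda>t. t powr (y - 1) / exp t) has_integral Gamma y) {0..}"
    using Gamma_integral_real[of y] assms by simp
  have "((\<lambda>t. exp (- 1 * t)) has_integral exp (- 1 * A) / 1) {A..}"
    by (rule has_integral_exp_minus_to_infinity) simp
  then have "((\<lambda>t. A powr (y - 1) * exp (- t)) has_integral A powr (y - 1) * exp (- A)) {A..}"
    by (intro has_integral_mult_right) simp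
  then have "((\<lambda>t. if t \<in> {A..} then A powr (y - 1) * exp (- t) else 0) has_integral A powr (y - 1) * exp (- A)) {0..}"
    by (subst has_integral_restrict) (use assms in auto)
  then show ?thesis
    by (rule has_integral_le[OF _ G])
       (use assms in \<open>auto simp: exp_minus field_simps intro!: powr_mono2\<close>)
qed

text \<open>Divided by \<open>fact r\<close>, the moment is a binomial coefficient of polynomial
  growth times \<open>Gamma \<beta> / Gamma (\<alpha> r + \<beta>)\<close>, which decays faster than
  any geometric sequence.\<close>

lemma mittag_leffler_moment_growth:
  assumes \<alpha>: "0 < \<alpha>" and \<beta>: "\<beta> > 0"
  shows "(\<lambda>r. \<bar>t\<bar> ^ r * mittag_leffler_moment \<alpha> \<beta> r / fact r) \<longlonglongrightarrow> 0"
proof -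
  define \<theta> where "\<theta> = \<beta> / \<alpha>"
  have \<theta>: "\<theta> > 0" using assms by (simp add: \<theta>_def)
  \<comment> \<open>Gives \<open>A powr (\<alpha> * r) = (2 * (\<bar>t\<bar> + 1)) ^ r\<close>,
    which absorbs \<open>\<bar>t\<bar> ^ r\<close> and leaves \<open>(1/2) ^ r\<close>.\<close>
  define A where "A = (2 * (\<bar>t\<bar> + 1)) powr (1 / \<alpha>)"
  have A: "A > 0" by (simp add: A_def)
  define C where "C = Gamma \<beta> / (A powr (\<beta> - 1) * exp (- A))"
  have G\<beta>: "Gamma \<beta> > 0" "Gamma \<theta> > 0" using \<beta> \<theta> by (auto intro: Gamma_real_pos)
  have mom: "mittag_leffler_moment \<alpha> \<beta> r / fact r = pow_coeff (-\<theta>) r * (Gamma \<beta> / Gamma (\<alpha> * real r + \<beta>))" for r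
  proof -
    have "\<theta> \<notin> \<int>\<^sub>\<le>\<^sub>0" using \<theta> by (auto elim!: nonpos_Ints_cases)
    then have "Gamma (\<theta> + real r) = pochhammer \<theta> r * Gamma \<theta>"
      using pochhammer_Gamma[of \<theta> r] G\<beta> by (simp add: field_simps)
    then show ?thesis using G\<beta> unfolding mittag_leffler_moment_def \<theta>_def[symmetric]
      by (simp add: pow_coeff_pochhammer add.commute mult.commute)
  qed
  have lim: "(\<lambda>r. (pow_coeff (-\<theta>) r * real r powr (-\<theta> + 1)) * (C * (real r powr (\<theta> - 1) * (1/2) ^ r))) \<longlonglongrightarrow> rGamma (-(-\<theta>)) * (C * 0)"
  proof (intro tendsto_mult tendsto_const pow_coeff_asymp)
    show "(\<lambda>r. real r powr (\<theta> - 1) * (1/2) ^ r) \<longlonglongrightarrow> 0" by real_asymp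
  qed
  show ?thesis
  proof (rule Lim_null_comparison[rotated])
    show "(\<lambda>r. (pow_coeff (-\<theta>) r * real r powr (-\<theta> + 1)) * (C * (real r powr (\<theta> - 1) * (1/2) ^ r))) \<longlonglongrightarrow> 0"
      using lim by simp
    have "\<forall>\<^sub>F r in sequentially. \<alpha> * real r + \<beta> \<ge> 1" using \<alpha> by real_asymp
    then show "\<forall>\<^sub>F r in sequentially. norm (\<bar>t\<bar> ^ r * mittag_leffler_moment \<alpha> \<beta> r / fact r)
       \<le> (pow_coeff (-\<theta>) r * real r powr (-\<theta> + 1)) * (C * (real r powr (\<theta> - 1) * (1/2) ^ r))"
      using eventually_gt_at_top[of 0]
    proof eventually_elim
      case (elim r)
      let ?y = "\<alpha> * real r + \<beta>"
      have y: "?y > 0" using \<alpha> \<beta> by (simp add: add_nonneg_pos)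
      have "A powr (?y - 1) * exp (-A) \<le> Gamma ?y" by (rule Gamma_lower_bound[OF A]) (use elim in simp)
      also have "A powr (?y - 1) = A powr (\<alpha> * real r) * A powr (\<beta> - 1)"
        by (simp add: algebra_simps flip: powr_add)
      also have "A powr (\<alpha> * real r) = (2 * (\<bar>t\<bar> + 1)) ^ r"
        using \<alpha> by (simp add: A_def powr_powr powr_realpow)
      finally have "(2 * (\<bar>t\<bar> + 1)) ^ r * (A powr (\<beta> - 1) * exp (-A)) \<le> Gamma ?y" by (simp add: mult_ac)
      moreover have "(2 * \<bar>t\<bar>) ^ r \<le> (2 * (\<bar>t\<bar> + 1)) ^ r" by (rule power_mono) auto
      ultimately have "(2 * \<bar>t\<bar>) ^ r * (A powr (\<beta> - 1) * exp (-A)) \<le> Gamma ?y"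
        by (meson mult_right_mono order_trans powr_ge_zero exp_ge_zero mult_nonneg_nonneg)
      then have "\<bar>t\<bar> ^ r * (Gamma \<beta> / Gamma ?y) \<le> C * (1/2) ^ r"
        using G\<beta> A Gamma_real_pos[OF y] by (simp add: C_def field_simps power_mult_distrib)
      then have "pow_coeff (-\<theta>) r * (\<bar>t\<bar> ^ r * (Gamma \<beta> / Gamma ?y)) \<le> pow_coeff (-\<theta>) r * (C * (1/2) ^ r)"
        by (rule mult_left_mono) (use pow_coeff_neg_pos[OF \<theta>] in \<open>simp add: less_imp_le\<close>)
      also have "\<dots> = (pow_coeff (-\<theta>) r * real r powr (-\<theta> + 1)) * (C * (real r powr (\<theta> - 1) * (1/2) ^ r))"
      proof -
        have "real r powr (-\<theta> + 1) * real r powr (\<theta> - 1) = 1" using elim by (simp flip: powr_add)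
        then show ?thesis by (simp add: algebra_simps)
      qed
      finally have "\<bar>t\<bar> ^ r * (pow_coeff (-\<theta>) r * (Gamma \<beta> / Gamma ?y)) \<le> \<dots>" by (simp add: mult_ac)
      moreover have "\<bar>t\<bar> ^ r * (pow_coeff (-\<theta>) r * (Gamma \<beta> / Gamma ?y)) \<ge> 0"
        using pow_coeff_neg_pos[OF \<theta>, of r] G\<beta> Gamma_real_pos[OF y] by (intro mult_nonneg_nonneg) auto
      moreover have "\<bar>t\<bar> ^ r * mittag_leffler_moment \<alpha> \<beta> r / fact r = \<bar>t\<bar> ^ r * (pow_coeff (-\<theta>) r * (Gamma \<beta> / Gamma ?y))"
        unfolding mom[symmetric] by simp
      ultimately show ?case by (simp only: real_norm_def abs_of_nonneg)
    qed
  qed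
qed

section \<open>The Mittag-Leffler law\<close>

text \<open>By induction: with \<open>u = 1 / (N + 1)\<close> the new factor
  \<open>1 - (1 - b) u\<close> is at most \<open>(1 + u) powr (b - 1)\<close>. The constant 1 serves
  all \<open>N\<close> and \<open>b\<close>, which an asymptotic formula would not give.\<close>

lemma pow_coeff_pos_pochhammer_bound:
  fixes b :: real
  assumes "0 < b" "b \<le> 1"
  shows "pochhammer b N / fact N \<le> (real N + 1) powr (b - 1)"
proof (induction N)
  case (Suc N)
  define u where "u = 1 / (real N + 1)"
  have u: "u > 0" by (simp add: u_def)
  have "(b + real N) / (real N + 1) = 1 - (1 - b) * u"
    by (simp add: u_def field_simps)
  also have "\<dots> \<le> exp (- ((1 - b) * u))" using exp_ge_add_one_self[of "- ((1 - b) * u)"] by simp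
  also have "\<dots> \<le> exp (- ((1 - b) * ln (1 + u)))"
    using assms u ln_add_one_self_le_self[of u] by (auto intro!: mult_left_mono)
  also have "\<dots> = (1 + u) powr (b - 1)" using u by (simp add: powr_def algebra_simps)
  also have "1 + u = (real N + 2) / (real N + 1)" by (simp add: u_def field_simps)
  finally have le: "(b + real N) / (real N + 1) \<le> ((real N + 2) / (real N + 1)) powr (b - 1)" .
  have "pochhammer b (Suc N) / fact (Suc N) = (pochhammer b N / fact N) * ((b + real N) / (real N + 1))"
    by (simp add: pochhammer_Suc field_simps)
  also have "\<dots> \<le> (real N + 1) powr (b - 1) * ((real N + 2) / (real N + 1)) powr (b - 1)"
    by (rule mult_mono[OF Suc le]) (use assms in auto)
  also have "\<dots> = (real (Suc N) + 1) powr (b - 1)" by (simp add: powr_divide add.commute)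
  finally show ?case .
qed simp

text \<open>\<open>pochhammer (- a) n\<close> is split after \<open>m\<close> factors. The first
  ones have modulus at most \<open>m - i\<close>, with product \<open>fact m\<close>; the others
  form \<open>pochhammer b N\<close> with \<open>b = m - a\<close> in (0, 1], where the preceding
  bound applies.\<close>

lemma pow_coeff_bound_large:
  fixes a :: real
  assumes a: "0 < a" and m: "m = nat \<lfloor>a\<rfloor> + 1" and n: "n \<ge> 2 * m"
  shows "\<bar>pow_coeff a n\<bar> * real n powr (a + 1) \<le> fact m * 2 powr (a + 1)"
proof -
  have am: "a < real m" "real m \<le> a + 1" using a m by linarith+
  define N where "N = n - m"
  have nN: "n = m + N" "real N + 1 \<ge> real n / 2" using n by (auto simp: N_def)
  define b where "b = real m - a"
  have b: "0 < b" "b \<le> 1" using am by (auto simp: b_def)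
  have p1: "\<bar>pochhammer (- a) m\<bar> \<le> fact m"
  proof -
    have "\<bar>pochhammer (- a) m\<bar> = (\<Prod>i=0..<m. \<bar>- a + real i\<bar>)"
      by (simp add: pochhammer_prod abs_prod)
    also have "\<dots> \<le> (\<Prod>i=0..<m. real (m - i))"
    proof (rule prod_mono)
      fix i assume "i \<in> {0..<m}"
      then have "real i \<le> a" using m a by auto linarith
      then show "0 \<le> \<bar>- a + real i\<bar> \<and> \<bar>- a + real i\<bar> \<le> real (m - i)"
        using am \<open>i \<in> {0..<m}\<close> by auto
    qed
    also have "\<dots> = fact m" by (simp add: fact_prod_rev)
    finally show ?thesis .
  qed
  have "pochhammer (- a) n = pochhammer (- a) m * pochhammer b N"
    unfolding nN(1) pochhammer_product' by (simp add: b_def)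
  then have "\<bar>pow_coeff a n\<bar> = \<bar>pochhammer (- a) m\<bar> * (pochhammer b N / fact N) * (fact N / fact n)"
    using pochhammer_pos[OF b(1), of N] by (simp add: pow_coeff_pochhammer abs_mult)
  also have "\<dots> \<le> fact m * (real N + 1) powr (b - 1) * (1 / (real N + 1) ^ m)"
  proof (intro mult_mono p1 pow_coeff_pos_pochhammer_bound b)
    have "fact N * (N + 1) ^ m \<le> fact (N + m)"
    proof (induction m)
      case (Suc k)
      have "fact N * (N + 1) ^ Suc k = (N + 1) * (fact N * (N + 1) ^ k)" by (simp add: algebra_simps)
      also have "\<dots> \<le> (N + Suc k) * fact (N + k)" using Suc by (intro mult_mono) auto
      finally show ?case by simp
    qed simp
    then have "real (fact N * (N + 1) ^ m) \<le> real (fact (N + m))" by (rule of_nat_mono)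
    then show "fact N / fact n \<le> 1 / (real N + 1) ^ m"
      by (simp add: nN(1) field_simps add.commute)
  qed (use b pochhammer_pos[OF b(1), of N] in auto)
  also have "\<dots> = fact m * (real N + 1) powr (- (a + 1))"
  proof -
    have "(real N + 1) ^ m = (real N + 1) powr real m" by (rule powr_realpow[symmetric]) simp
    then show ?thesis by (simp add: b_def powr_minus powr_diff powr_add field_simps)
  qed
  also have "(real N + 1) powr (- (a + 1)) \<le> (real n / 2) powr (- (a + 1))"
  proof (rule powr_mono2')
    have "real n > 0" using n m by simp
    then show "0 < real n / 2" by simp
  qed (use nN a in auto)
  finally have "\<bar>pow_coeff a n\<bar> \<le> fact m * (real n / 2) powr (- (a + 1))" by simp
  then have "\<bar>pow_coeff a n\<bar> * real n powr (a + 1) \<le> fact m * (real n / 2) powr (- (a + 1)) * real n powr (a + 1)"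
    by (rule mult_right_mono) simp
  also have "\<dots> = fact m * 2 powr (a + 1)"
  proof -
    have x: "real n / 2 > 0" using n m by simp
    have "real n powr (a + 1) = (2 * (real n / 2)) powr (a + 1)" by simp
    also have "\<dots> = 2 powr (a + 1) * (real n / 2) powr (a + 1)" by (rule powr_mult)
    finally have "(real n / 2) powr (- (a + 1)) * real n powr (a + 1) =
        2 powr (a + 1) * ((real n / 2) powr (- (a + 1)) * (real n / 2) powr (a + 1))" by (simp only: mult_ac)
    also have "(real n / 2) powr (- (a + 1)) * (real n / 2) powr (a + 1) = 1"
      using x unfolding powr_add[symmetric] by simp
    finally show ?thesis by (simp only: mult.assoc mult_1_right)
  qed
  finally show ?thesis .
qed

text \<open>Every factor \<open>\<bar>i - a\<bar>\<close> is at most \<open>m + i\<close>, and the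
  product becomes a binomial coefficient, hence at most a power of 2.\<close>

lemma pow_coeff_bound_small:
  fixes a :: real
  assumes a: "0 < a" and am: "a < real m" "m \<ge> 1" and n: "n < 2 * m" "n \<ge> 1"
  shows "\<bar>pow_coeff a n\<bar> \<le> 2 ^ (3 * m)"
proof -
  have "\<bar>pochhammer (- a) n\<bar> = (\<Prod>i=0..<n. \<bar>- a + real i\<bar>)"
    by (simp add: pochhammer_prod abs_prod)
  also have "\<dots> \<le> (\<Prod>i=0..<n. real m + real i)"
    by (rule prod_mono) (use a am in auto)
  also have "\<dots> = pochhammer (real m) n" by (simp add: pochhammer_prod)
  finally have "\<bar>pow_coeff a n\<bar> \<le> pochhammer (real m) n / fact n"
    by (simp add: pow_coeff_pochhammer divide_right_mono)
  also have "\<dots> = real ((m + n - 1) choose n)"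
    using am n by (simp add: binomial_gbinomial gbinomial_pochhammer' of_nat_diff)
  also have "\<dots> \<le> 2 ^ (m + n - 1)" by (metis binomial_le_pow2 of_nat_le_iff of_nat_numeral of_nat_power)
  also have "\<dots> \<le> 2 ^ (3 * m)" by (rule power_increasing) (use n in auto)
  finally show ?thesis .
qed

text \<open>An upper estimate for \<open>8 ^ m * (2 * m) ^ (m + 1)\<close> with
  \<open>m \<le> a + 1\<close>; the \<open>8 ^ m\<close> is the \<open>2 ^ (3 * m)\<close> of the
  small indices.\<close>

definition pow_bound :: "real \<Rightarrow> real" where
  "pow_bound a = 8 powr (a + 1) * (2 * (a + 1)) powr (a + 2)"

text \<open>Terms with exponent \<open>a = \<alpha> * j\<close> will be summed over \<open>j\<close>
  while \<open>n\<close> tends to infinity. This needs a majorant independent of \<open>n\<close>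
  and explicit in \<open>a\<close>, since \<open>pow_coeff_asymp\<close> treats one exponent at a
  time.\<close>

lemma pow_coeff_bound:
  assumes a: "0 \<le> a" and n: "n \<ge> 1"
  shows "\<bar>pow_coeff a n\<bar> * real n powr (a + 1) \<le> pow_bound a"
proof (cases "a = 0")
  case True
  then show ?thesis using n by (simp add: pow_coeff_pochhammer pow_bound_def pochhammer_0_left)
next
  case False
  then have a: "a > 0" using a by simp
  define m where "m = nat \<lfloor>a\<rfloor> + 1"
  have am: "a < real m" "real m \<le> a + 1" "m \<ge> 1" using a by (auto simp: m_def) linarith+
  have K: "8 ^ m * (2 * real m) ^ (m + 1) \<le> pow_bound a"
  proof -
    have "8 ^ m * (2 * real m) ^ (m + 1) = 8 powr real m * (2 * real m) powr (real m + 1)"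
      using am powr_realpow[of 8 m] powr_realpow[of "2 * real m" "m + 1"] by (simp add: add.commute)
    also have "\<dots> \<le> 8 powr (a + 1) * ((2 * (a + 1)) powr (a + 2))"
    proof (intro mult_mono powr_mono)
      have "(2 * real m) powr (real m + 1) \<le> (2 * (a + 1)) powr (real m + 1)"
        by (rule powr_mono2) (use am in auto)
      also have "\<dots> \<le> (2 * (a + 1)) powr (a + 2)" by (rule powr_mono) (use am a in auto)
      finally show "(2 * real m) powr (real m + 1) \<le> (2 * (a + 1)) powr (a + 2)" .
    qed (use am in auto)
    finally show ?thesis by (simp add: pow_bound_def)
  qed
  show ?thesis
  proof (cases "n \<ge> 2 * m")
    case True
    have "\<bar>pow_coeff a n\<bar> * real n powr (a + 1) \<le> fact m * 2 powr (a + 1)"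
      by (rule pow_coeff_bound_large[OF a m_def True])
    also have "\<dots> \<le> real m ^ m * 2 ^ (m + 1)"
    proof (rule mult_mono)
      show "fact m \<le> real m ^ m" using fact_le_power[of m, where 'a = real] by simp
      have "2 powr (a + 1) \<le> 2 powr real (m + 1)" by (rule powr_mono) (use am in auto)
      also have "\<dots> = 2 ^ (m + 1)" by (rule powr_realpow) simp
      finally show "2 powr (a + 1) \<le> 2 ^ (m + 1)" .
    qed auto
    also have "\<dots> = (2 * real m) ^ m * 2" by (simp add: power_mult_distrib)
    also have "\<dots> \<le> (2 * real m) ^ m * (2 * real m)" using am by (intro mult_left_mono) auto
    also have "\<dots> = 1 * (2 * real m) ^ (m + 1)" by simp
    also have "\<dots> \<le> 8 ^ m * (2 * real m) ^ (m + 1)" by (rule mult_right_mono) auto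
    finally show ?thesis using K by linarith
  next
    case False
    have "\<bar>pow_coeff a n\<bar> * real n powr (a + 1) \<le> 2 ^ (3 * m) * (2 * real m) ^ (m + 1)"
    proof (rule mult_mono)
      show "\<bar>pow_coeff a n\<bar> \<le> 2 ^ (3 * m)" by (rule pow_coeff_bound_small) (use a am n False in auto)
      have "real n powr (a + 1) \<le> real n powr (real (m + 1))" by (rule powr_mono) (use am n in auto)
      also have "\<dots> = real n ^ (m + 1)" by (rule powr_realpow) (use n in simp)
      also have "\<dots> \<le> (2 * real m) ^ (m + 1)" by (rule power_mono) (use False in auto)
      finally show "real n powr (a + 1) \<le> (2 * real m) ^ (m + 1)" .
    qed auto
    also have "(2::real) ^ (3 * m) = 8 ^ m" by (simp add: power_mult)
    finally show ?thesis using K by linarith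
  qed
qed

text \<open>Up to geometric and polynomial factors \<open>pow_bound (\<alpha> * j)\<close> has the
  size \<open>j powr (\<alpha> * j)\<close>, and \<open>fact j\<close> outgrows it because
  \<open>\<alpha> < 1\<close>.\<close>

lemma pow_bound_summable:
  assumes \<alpha>: "0 < \<alpha>" "\<alpha> < 1" and x: "x \<ge> 0"
  shows "summable (\<lambda>j. x ^ j * pow_bound (\<alpha> * real j) / fact j)"
proof (rule summable_comparison_test_ev)
  \<comment> \<open>The shift keeps the logarithm meaningful at \<open>x = 0\<close>.\<close>
  define X where "X = x + 1"
  have X: "X > 0" "x \<le> X" using x by (auto simp: X_def)
  \<comment> \<open>Collects the linear rates: \<open>X ^ j\<close>, the factor
    \<open>8 powr (\<alpha> * j)\<close>, the estimate \<open>j ^ j / fact j \<le> exp j\<close>,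
    and the comparison with \<open>(1/2) ^ j\<close>.\<close>
  define C where "C = ln X + \<alpha> * ln 8 + 1 + ln 2"
  have "(\<lambda>j::nat. exp (C * real j + ln 8 + (\<alpha> * real j + 2) * ln (2 * (\<alpha> * real j + 1)) - real j * ln (real j))) \<longlonglongrightarrow> 0"
    using \<alpha> by real_asymp
  then have "\<forall>\<^sub>F j in sequentially. exp (C * real j + ln 8 + (\<alpha> * real j + 2) * ln (2 * (\<alpha> * real j + 1)) - real j * ln (real j)) < 1"
    by (rule order_tendstoD) simp
  then show "\<forall>\<^sub>F j in sequentially. norm (x ^ j * pow_bound (\<alpha> * real j) / fact j) \<le> (1/2) ^ j"
    using eventually_gt_at_top[of 0]
  proof eventually_elim
    case (elim j)
    have j: "real j > 0" using elim by simp
    have fj: "real j ^ j / fact j \<le> exp (real j)"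
    proof -
      have s: "(\<lambda>n. real j ^ n /\<^sub>R fact n) sums exp (real j)" by (rule exp_converges)
      show ?thesis using sum_le_suminf[OF sums_summable[OF s], of "{j}"] s
        by (simp add: sums_iff field_simps)
    qed
    have p0: "\<alpha> * real j + 1 > 0" using \<alpha> by (simp add: add_nonneg_pos)
    have "x ^ j * pow_bound (\<alpha> * real j) / fact j = x ^ j * pow_bound (\<alpha> * real j) / real j ^ j * (real j ^ j / fact j)"
      using j by simp
    also have "\<dots> \<le> X ^ j * pow_bound (\<alpha> * real j) / real j ^ j * exp (real j)"
      using fj x X by (intro mult_mono divide_right_mono power_mono) (auto simp: pow_bound_def)
    also have "\<dots> = exp (C * real j + ln 8 + (\<alpha> * real j + 2) * ln (2 * (\<alpha> * real j + 1)) - real j * ln (real j)) * (1/2) ^ j"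
    proof -
      have e: "y ^ j = exp (real j * ln y)" if "y > 0" for y :: real
        using that by (simp add: exp_of_nat_mult)
      have "(1/2::real) ^ j = exp (- (real j * ln 2))" by (subst e) (simp_all add: ln_div)
      then show ?thesis using p0 j X
        by (simp add: pow_bound_def powr_def e C_def flip: exp_add exp_diff) (simp add: algebra_simps)
    qed
    also have "\<dots> \<le> 1 * (1/2) ^ j" by (rule mult_right_mono) (use elim in auto)
    finally show ?case using x by (simp add: pow_bound_def)
  qed
qed (simp add: summable_geometric)


section \<open>Discrete stable series and their Mellin transforms\<close>

lemma pow_fps_mult: "Abs_fps (pow_coeff a) * Abs_fps (pow_coeff b) = Abs_fps (pow_coeff (a + b))"
proof (rule fps_ext)
  fix n
  have "(\<Sum>i=0..n. pow_coeff a i * pow_coeff b (n - i)) = (\<Sum>i=0..n. (-1) ^ n * ((a gchoose i) * (b gchoose (n - i))))"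
    by (rule sum.cong) (auto simp: pow_coeff_def simp flip: power_add)
  also have "\<dots> = pow_coeff (a + b) n"
    by (simp add: pow_coeff_def gbinomial_Vandermonde flip: sum_distrib_left)
  finally show "fps_nth (Abs_fps (pow_coeff a) * Abs_fps (pow_coeff b)) n = fps_nth (Abs_fps (pow_coeff (a + b))) n"
    by (simp add: fps_mult_nth)
qed

lemma pow_fps_power: "Abs_fps (pow_coeff a) ^ j = Abs_fps (pow_coeff (a * real j))"
proof (induction j)
  case 0
  show ?case by (rule fps_ext) (simp add: pow_coeff_pochhammer pochhammer_0_left)
next
  case (Suc j)
  then show ?case by (simp add: pow_fps_mult algebra_simps)
qed

text \<open>For \<open>0 < \<alpha> < 1\<close> this is the probability generating function of the
  Sibuya law, \<open>1 - (1 - z) powr \<alpha>\<close>; compounding it with a Poisson law gives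
  \<open>exp (- y (1 - z) powr \<alpha>)\<close>.\<close>

definition stable_fps :: "real \<Rightarrow> real fps" where
  "stable_fps \<alpha> = 1 - Abs_fps (pow_coeff \<alpha>)"

lemma stable_fps_nth_0 [simp]: "fps_nth (stable_fps \<alpha>) 0 = 0"
  by (simp add: stable_fps_def pow_coeff_def)

lemma stable_fps_nonneg:
  assumes "0 < \<alpha>" "\<alpha> < 1"
  shows "fps_nth (stable_fps \<alpha>) n \<ge> 0"
proof (cases n)
  case (Suc m)
  have "fps_nth (stable_fps \<alpha>) n = \<alpha> * pochhammer (1 - \<alpha>) m / fact n"
    by (simp add: stable_fps_def Suc pow_coeff_pochhammer pochhammer_rec)
  then show ?thesis using assms by (simp add: pochhammer_nonneg)
qed simp

lemma stable_fps_radius: "fps_conv_radius (stable_fps \<alpha>) \<ge> 1"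
proof -
  have "fps_conv_radius (Abs_fps (pow_coeff \<alpha>)) \<ge> 1"
    unfolding fps_conv_radius_def
  proof (rule conv_radius_geI_ex')
    fix r :: real assume r: "0 < r" "ereal r < 1"
    have "summable (\<lambda>n. complex_of_real (pow_coeff \<alpha> n) * of_real r ^ n)"
      using pow_coeff_sums[of "of_real r" \<alpha>] r by (auto simp: sums_iff)
    then have "summable (\<lambda>n. complex_of_real (pow_coeff \<alpha> n * r ^ n))" by simp
    then have "summable (\<lambda>n. pow_coeff \<alpha> n * r ^ n)" by (simp only: summable_of_real_iff)
    then show "summable (\<lambda>n. fps_nth (Abs_fps (pow_coeff \<alpha>)) n * of_real r ^ n)" by simp
  qed
  moreover have "fps_conv_radius (1 - Abs_fps (pow_coeff \<alpha>)) \<ge> min (fps_conv_radius (1 :: real fps)) (fps_conv_radius (Abs_fps (pow_coeff \<alpha>)))"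
    by (rule fps_conv_radius_diff)
  ultimately show ?thesis by (simp add: stable_fps_def)
qed

lemma stable_fps_eval:
  assumes "norm z < 1"
  shows "eval_fps (cfps (stable_fps \<alpha>)) z = 1 - (1 - z) powr of_real \<alpha>"
proof -
  have "(\<lambda>n. (if n = 0 then 1 else 0) - of_real (pow_coeff \<alpha> n) * z ^ n) sums (1 - (1 - z) powr of_real \<alpha>)"
    using sums_single[of 0 "\<lambda>_. 1::complex"] by (intro sums_diff pow_coeff_sums assms) simp
  moreover have "(\<lambda>n. (if n = 0 then 1 else 0) - of_real (pow_coeff \<alpha> n) * z ^ n) = (\<lambda>n. fps_nth (cfps (stable_fps \<alpha>)) n * z ^ n)"
    by (auto simp: fun_eq_iff stable_fps_def)
  ultimately show ?thesis by (simp add: eval_fps_def sums_iff)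
qed

text \<open>Coefficients of the identity
  \<open>(1 - S) powr (- s) = (1 - z) powr (- \<alpha> s)\<close>, where \<open>S\<close> is the
  Sibuya series. The powers compose because \<alpha> times an argument stays below \<pi>; the sum is
  finite since the \<open>k\<close>-th power of \<open>S\<close> starts at
  \<open>z ^ k\<close>.\<close>

lemma stable_fps_pow_coeff_sum:
  assumes \<alpha>: "0 < \<alpha>" "\<alpha> < 1" and s: "s > 0"
  shows "(\<Sum>k\<le>n. pow_coeff (-s) k * fps_nth (stable_fps \<alpha> ^ k) n) = pow_coeff (- (\<alpha> * s)) n"
proof -
  let ?a = "\<lambda>n. (\<Sum>k. pow_coeff (-s) k * fps_nth (stable_fps \<alpha> ^ k) n)"
  define g where "g z = (1 - z) powr of_real (- (\<alpha> * s))" for z :: complex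
  have s1: "(\<lambda>n. of_real (?a n) * z ^ n) sums g z" if z: "norm z < 1" for z
  proof -
    have rad: "ereal (norm z) < fps_conv_radius (stable_fps \<alpha>)"
      by (rule less_le_trans[OF _ stable_fps_radius]) (use z in simp)
    have w: "norm (eval_fps (cfps (stable_fps \<alpha>)) z) \<le> eval_fps (stable_fps \<alpha>) (norm z)"
      unfolding eval_fps_def
    proof (rule norm_suminf_le)
      show "norm (fps_nth (cfps (stable_fps \<alpha>)) n * z ^ n) \<le> fps_nth (stable_fps \<alpha>) n * norm z ^ n" for n
        using stable_fps_nonneg[OF \<alpha>, of n] by (simp add: norm_mult norm_power)
      show "summable (\<lambda>n. fps_nth (stable_fps \<alpha>) n * norm z ^ n)"
        by (rule summable_fps) (use rad in simp)
    qed
    have h: "eval_fps (stable_fps \<alpha>) (norm z) = 1 - (1 - norm z) powr \<alpha>"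
    proof -
      have "complex_of_real (eval_fps (stable_fps \<alpha>) (norm z)) = 1 - (1 - of_real (norm z)) powr of_real \<alpha>"
        using eval_cfps_of_real[of "norm z" "stable_fps \<alpha>"] stable_fps_eval[of "of_real (norm z)" \<alpha>] rad z by simp
      also have "(1 - of_real (norm z)) powr of_real \<alpha> = complex_of_real ((1 - norm z) powr \<alpha>)"
        using powr_of_real[of "1 - norm z" \<alpha>] z by simp
      finally show ?thesis by (metis of_real_1 of_real_diff of_real_eq_iff)
    qed
    have h0: "0 \<le> eval_fps (stable_fps \<alpha>) (norm z)" using w norm_ge_zero by (rule order_trans[rotated])
    have h1: "eval_fps (stable_fps \<alpha>) (norm z) < 1" unfolding h using z by simp
    have sm: "summable (\<lambda>k. pow_coeff (-s) k * eval_fps (stable_fps \<alpha>) (norm z) ^ k)"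
    proof -
      have "summable (\<lambda>k. of_real (pow_coeff (-s) k) * complex_of_real (eval_fps (stable_fps \<alpha>) (norm z)) ^ k)"
        using pow_coeff_sums[of "of_real (eval_fps (stable_fps \<alpha>) (norm z))" "-s"] h0 h1 by (auto simp: sums_iff)
      then have "summable (\<lambda>k. complex_of_real (pow_coeff (-s) k * eval_fps (stable_fps \<alpha>) (norm z) ^ k))" by simp
      then show ?thesis by (simp only: summable_of_real_iff)
    qed
    have "(\<lambda>n. of_real (?a n) * z ^ n) sums (\<Sum>k. of_real (pow_coeff (-s) k) * eval_fps (cfps (stable_fps \<alpha>)) z ^ k)"
      by (rule compose_coeffs_sums) (use pow_coeff_neg_pos[OF s] stable_fps_nonneg[OF \<alpha>] rad sm in \<open>auto simp: less_imp_le\<close>)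
    also have "(\<Sum>k. of_real (pow_coeff (-s) k) * eval_fps (cfps (stable_fps \<alpha>)) z ^ k) =
        (1 - eval_fps (cfps (stable_fps \<alpha>)) z) powr of_real (-s)"
      using pow_coeff_sums[of "eval_fps (cfps (stable_fps \<alpha>)) z" "-s"] w h1 by (simp add: sums_iff)
    also have "1 - eval_fps (cfps (stable_fps \<alpha>)) z = (1 - z) powr of_real \<alpha>"
      using stable_fps_eval[OF z] by simp
    also have "((1 - z) powr of_real \<alpha>) powr of_real (-s) = g z"
    proof -
      have z1: "1 - z \<noteq> 0" using z by auto
      have "\<bar>Im (of_real \<alpha> * Ln (1 - z))\<bar> \<le> \<alpha> * pi"
        using \<alpha> mpi_less_Im_Ln[OF z1] Im_Ln_le_pi[OF z1] by (auto simp: abs_mult)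
      also have "\<dots> < pi" using \<alpha> by simp
      finally have "Ln ((1 - z) powr of_real \<alpha>) = of_real \<alpha> * Ln (1 - z)"
        using z1 by (simp add: powr_def)
      then show ?thesis using z1 by (simp add: powr_def g_def mult_ac)
    qed
    finally show ?thesis .
  qed
  have "complex_of_real (?a n) = (deriv ^^ n) g 0 / fact n"
    by (rule coeff_from_sums[symmetric, of 1 "\<lambda>n. complex_of_real (?a n)"]) (use s1 in auto)
  also have "\<dots> = complex_of_real (pow_coeff (- (\<alpha> * s)) n)"
    by (rule coeff_from_sums[of 1 "\<lambda>n. complex_of_real (pow_coeff (- (\<alpha> * s)) n)"]) (auto simp: g_def intro: pow_coeff_sums simp del: of_real_minus of_real_mult)
  finally have "?a n = pow_coeff (- (\<alpha> * s)) n" by (simp only: of_real_eq_iff)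
  moreover have "?a n = (\<Sum>k\<le>n. pow_coeff (-s) k * fps_nth (stable_fps \<alpha> ^ k) n)"
    by (rule suminf_finite) (auto simp: startsby_zero_power_prefix)
  ultimately show ?thesis by simp
qed

text \<open>Expanding \<open>exp (- y (1 - z) ^ \<alpha>)\<close> in two ways: directly, and as
  \<open>exp (- y) exp (y (1 - (1 - z) ^ \<alpha>))\<close>, where all coefficients are nonnegative.\<close>

definition stable_coeff :: "real \<Rightarrow> nat \<Rightarrow> real \<Rightarrow> real" where
  "stable_coeff \<alpha> n y = exp (- y) * (\<Sum>k\<le>n. y ^ k / fact k * fps_nth (stable_fps \<alpha> ^ k) n)"

lemma stable_coeff_nonneg:
  assumes "0 < \<alpha>" "\<alpha> < 1" "y \<ge> 0"
  shows "stable_coeff \<alpha> n y \<ge> 0"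
  unfolding stable_coeff_def
  by (intro mult_nonneg_nonneg sum_nonneg divide_nonneg_nonneg nonneg_fps_power stable_fps_nonneg assms) (use assms in auto)

lemma stable_fps_power_nth:
  "fps_nth (stable_fps \<alpha> ^ k) n = (\<Sum>i\<le>k. real (k choose i) * (-1) ^ i * pow_coeff (\<alpha> * real i) n)"
proof -
  have "stable_fps \<alpha> ^ k = (- Abs_fps (pow_coeff \<alpha>) + 1) ^ k" by (simp add: stable_fps_def)
  also have "\<dots> = (\<Sum>i\<le>k. of_nat (k choose i) * (- Abs_fps (pow_coeff \<alpha>)) ^ i)"
    by (subst binomial_ring) simp
  also have "\<dots> = (\<Sum>i\<le>k. fps_const (real (k choose i) * (-1) ^ i) * Abs_fps (pow_coeff (\<alpha> * real i)))"
  proof (rule sum.cong)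
    fix i
    have "(- Abs_fps (pow_coeff \<alpha>)) ^ i = fps_const ((-1) ^ i) * Abs_fps (pow_coeff (\<alpha> * real i))"
      by (subst power_minus) (simp add: pow_fps_power fps_const_power[symmetric] fps_const_neg[symmetric] del: fps_const_neg fps_const_power)
    then show "of_nat (k choose i) * (- Abs_fps (pow_coeff \<alpha>)) ^ i = fps_const (real (k choose i) * (-1) ^ i) * Abs_fps (pow_coeff (\<alpha> * real i))"
      by (simp add: fps_of_nat[symmetric] mult.assoc[symmetric])
  qed simp
  finally show ?thesis by (simp add: fps_sum_nth)
qed

text \<open>The direct expansion is alternating but absolutely convergent by
  \<open>pow_bound_summable\<close>. Its Cauchy product with the series of \<open>exp y\<close>
  groups into the binomial expansions of the powers of \<open>stable_fps\<close>.\<close>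

lemma stable_coeff_series:
  assumes \<alpha>: "0 < \<alpha>" "\<alpha> < 1" and y: "y \<ge> 0" and n: "n \<ge> 1"
  shows "(\<lambda>j. (-y) ^ j / fact j * pow_coeff (\<alpha> * real j) n) sums stable_coeff \<alpha> n y"
proof -
  define c where "c j = (-y) ^ j / fact j * pow_coeff (\<alpha> * real j) n" for j
  have sc: "summable (\<lambda>j. norm (c j))"
  proof (rule summable_comparison_test'[OF pow_bound_summable[OF \<alpha> y], of 0])
    fix j
    have "\<bar>pow_coeff (\<alpha> * real j) n\<bar> * 1 \<le> \<bar>pow_coeff (\<alpha> * real j) n\<bar> * real n powr (\<alpha> * real j + 1)"
      using n \<alpha> by (intro mult_left_mono ge_one_powr_ge_zero) auto
    also have "\<dots> \<le> pow_bound (\<alpha> * real j)" by (rule pow_coeff_bound) (use \<alpha> n in auto)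
    finally have "y ^ j * \<bar>pow_coeff (\<alpha> * real j) n\<bar> / fact j \<le> y ^ j * pow_bound (\<alpha> * real j) / fact j"
      using y by (intro divide_right_mono mult_left_mono) auto
    then show "norm (norm (c j)) \<le> y ^ j * pow_bound (\<alpha> * real j) / fact j"
      using y by (simp add: c_def abs_mult power_abs)
  qed
  have se: "(\<lambda>i. y ^ i / fact i) sums exp y"
    using exp_converges[of y] by (simp add: field_simps)
  have see: "summable (\<lambda>i. norm (y ^ i / fact i))" using se y by (simp add: sums_iff)
  have "(\<lambda>k. \<Sum>i\<le>k. c i * (y ^ (k - i) / fact (k - i))) sums (suminf c * exp y)"
    using Cauchy_product_sums[OF sc see] se by (simp add: sums_iff)
  also have "(\<lambda>k. \<Sum>i\<le>k. c i * (y ^ (k - i) / fact (k - i))) = (\<lambda>k. y ^ k / fact k * fps_nth (stable_fps \<alpha> ^ k) n)"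
  proof
    fix k
    show "(\<Sum>i\<le>k. c i * (y ^ (k - i) / fact (k - i))) = y ^ k / fact k * fps_nth (stable_fps \<alpha> ^ k) n"
      unfolding stable_fps_power_nth sum_distrib_left
    proof (rule sum.cong)
      fix i assume i: "i \<in> {..k}"
      have "y ^ k = y ^ i * y ^ (k - i)" using i by (simp flip: power_add)
      moreover have "real (k choose i) = fact k / (fact i * fact (k - i))"
        using i by (intro binomial_fact) auto
      ultimately show "c i * (y ^ (k - i) / fact (k - i)) = y ^ k / fact k * (real (k choose i) * (- 1) ^ i * pow_coeff (\<alpha> * real i) n)"
        by (simp add: c_def power_minus[of y])
    qed simp
  qed
  finally have "(\<lambda>k. y ^ k / fact k * fps_nth (stable_fps \<alpha> ^ k) n) sums (suminf c * exp y)" .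
  moreover have "(\<lambda>k. y ^ k / fact k * fps_nth (stable_fps \<alpha> ^ k) n) sums (\<Sum>k\<le>n. y ^ k / fact k * fps_nth (stable_fps \<alpha> ^ k) n)"
    by (rule sums_finite) (auto simp: startsby_zero_power_prefix)
  ultimately have "suminf c * exp y = (\<Sum>k\<le>n. y ^ k / fact k * fps_nth (stable_fps \<alpha> ^ k) n)"
    using sums_unique2 by blast
  then have "suminf c = stable_coeff \<alpha> n y"
    by (simp add: stable_coeff_def exp_minus field_simps)
  moreover have "summable c" using sc by (rule summable_norm_cancel)
  ultimately show ?thesis by (simp add: sums_iff c_def[abs_def])
qed

text \<open>The Mellin transform in \<open>y\<close>, where only finitely many Gamma integrals
  occur: the \<open>k\<close>-th gives \<open>Gamma (s + k) = Gamma s * pochhammer s k\<close>, and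
  \<open>stable_fps_pow_coeff_sum\<close> adds them up.\<close>

lemma stable_coeff_integral:
  assumes \<alpha>: "0 < \<alpha>" "\<alpha> < 1" and s: "s > 0"
  shows "((\<lambda>y. y powr (s - 1) * stable_coeff \<alpha> n y) has_integral Gamma s * pow_coeff (- (\<alpha> * s)) n) {0..}"
proof -
  have G: "((\<lambda>y. y powr (s - 1) * (exp (- y) * (y ^ k / fact k * p))) has_integral Gamma s * (pow_coeff (-s) k * p)) {0..}"
    for k p
  proof -
    have "((\<lambda>t. (t powr (s + real k - 1) / exp t) * (p / fact k)) has_integral Gamma (s + real k) * (p / fact k)) {0..}"
      by (intro has_integral_mult_left Gamma_integral_real) (use s in auto)
    also have "Gamma (s + real k) * (p / fact k) = Gamma s * (pow_coeff (-s) k * p)"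
    proof -
      have "s \<notin> \<int>\<^sub>\<le>\<^sub>0" using s by (auto elim!: nonpos_Ints_cases)
      then have "Gamma (s + real k) = pochhammer s k * Gamma s"
        using pochhammer_Gamma[of s k] Gamma_real_pos[OF s] by (simp add: field_simps)
      then show ?thesis by (simp add: pow_coeff_pochhammer)
    qed
    finally show ?thesis
    proof (rule has_integral_spike[of "{0}", rotated 2])
      fix y :: real assume "y \<in> {0..} - {0}"
      then have y: "y > 0" by auto
      then have "y powr (s + real k - 1) = y powr (s - 1) * y ^ k"
        by (simp add: powr_realpow[symmetric] algebra_simps flip: powr_add)
      then show "y powr (s - 1) * (exp (- y) * (y ^ k / fact k * p)) = (y powr (s + real k - 1) / exp y) * (p / fact k)"
        by (simp add: exp_minus field_simps)
    qed simp
  qed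
  have "((\<lambda>y. \<Sum>k\<le>n. y powr (s - 1) * (exp (- y) * (y ^ k / fact k * fps_nth (stable_fps \<alpha> ^ k) n)))
     has_integral (\<Sum>k\<le>n. Gamma s * (pow_coeff (-s) k * fps_nth (stable_fps \<alpha> ^ k) n))) {0..}"
    by (intro has_integral_sum G) auto
  then show ?thesis
    by (simp only: stable_coeff_def sum_distrib_left[symmetric] stable_fps_pow_coeff_sum[OF \<alpha> s])
qed

text \<open>The Wright function with parameters \<open>- \<alpha>\<close> and 0, taken at
  \<open>- x\<close>. Its term \<open>j = 0\<close> vanishes because \<open>rGamma 0 = 0\<close>, so
  it matches a series starting at index 1.\<close>

definition ml_series :: "real \<Rightarrow> real \<Rightarrow> real" where
  "ml_series \<alpha> x = (\<Sum>j. (-x) ^ j / fact j * rGamma (- (\<alpha> * real j)))"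

text \<open>With \<open>y = x * n powr \<alpha>\<close> the \<open>j\<close>-th term becomes
  \<open>pow_coeff (\<alpha> * j) n * n powr (\<alpha> * j + 1)\<close> up to fixed factors, which
  converges. \<open>pow_bound\<close> is the majorant for Tannery's theorem and also yields the
  bound uniform in \<open>n\<close>.\<close>

lemma scaled_stable_coeff_limit:
  assumes \<alpha>: "0 < \<alpha>" "\<alpha> < 1" and x: "x \<ge> 0"
  shows "(\<lambda>n. real n * stable_coeff \<alpha> n (x * real n powr \<alpha>)) \<longlonglongrightarrow> ml_series \<alpha> x"
    and "summable (\<lambda>j. (-x) ^ j / fact j * rGamma (- (\<alpha> * real j)))"
    and "\<And>n. n \<ge> 1 \<Longrightarrow> \<bar>real n * stable_coeff \<alpha> n (x * real n powr \<alpha>)\<bar> \<le> (\<Sum>j. x ^ j * pow_bound (\<alpha> * real j) / fact j)"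
proof -
  define a where "a j n = (-x) ^ j / fact j * (pow_coeff (\<alpha> * real j) n * real n powr (\<alpha> * real j + 1))" for j n
  have bd: "norm (a j n) \<le> x ^ j * pow_bound (\<alpha> * real j) / fact j" if n: "n \<ge> 1" for j n
  proof -
    have "norm (a j n) = x ^ j / fact j * (\<bar>pow_coeff (\<alpha> * real j) n\<bar> * real n powr (\<alpha> * real j + 1))"
      using x by (simp add: a_def abs_mult power_abs)
    also have "\<dots> \<le> x ^ j / fact j * pow_bound (\<alpha> * real j)"
      by (intro mult_left_mono pow_coeff_bound) (use \<alpha> x n in auto)
    finally show ?thesis by simp
  qed
  have eq: "(\<lambda>j. a j n) sums (real n * stable_coeff \<alpha> n (x * real n powr \<alpha>))" if n: "n \<ge> 1" for n
  proof -
    have "(\<lambda>j. (- (x * real n powr \<alpha>)) ^ j / fact j * pow_coeff (\<alpha> * real j) n) sums stable_coeff \<alpha> n (x * real n powr \<alpha>)"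
      by (rule stable_coeff_series) (use \<alpha> x n in auto)
    from sums_mult[OF this, of "real n"]
    have "(\<lambda>j. real n * ((- (x * real n powr \<alpha>)) ^ j / fact j * pow_coeff (\<alpha> * real j) n)) sums (real n * stable_coeff \<alpha> n (x * real n powr \<alpha>))" .
    also have "(\<lambda>j. real n * ((- (x * real n powr \<alpha>)) ^ j / fact j * pow_coeff (\<alpha> * real j) n)) = (\<lambda>j. a j n)"
    proof
      fix j
      have "(- (x * real n powr \<alpha>)) ^ j = (-x) ^ j * (real n powr \<alpha>) ^ j"
        by (simp flip: power_mult_distrib)
      also have "(real n powr \<alpha>) ^ j = real n powr (\<alpha> * real j)"
        using n by (simp add: powr_powr flip: powr_realpow)
      finally have "(- (x * real n powr \<alpha>)) ^ j = (-x) ^ j * real n powr (\<alpha> * real j)" .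
      then show "real n * ((- (x * real n powr \<alpha>)) ^ j / fact j * pow_coeff (\<alpha> * real j) n) = a j n"
        using n by (simp add: a_def powr_add)
    qed
    finally show ?thesis .
  qed
  have T: "eventually (\<lambda>n. summable (\<lambda>k. norm (a k n))) sequentially \<and>
        summable (\<lambda>j. norm ((-x) ^ j / fact j * rGamma (- (\<alpha> * real j)))) \<and>
        ((\<lambda>n. suminf (\<lambda>k. a k n)) \<longlonglongrightarrow> suminf (\<lambda>j. (-x) ^ j / fact j * rGamma (- (\<alpha> * real j))))"
  proof (rule tannerys_theorem)
    show "(\<lambda>n. a k n) \<longlonglongrightarrow> (-x) ^ k / fact k * rGamma (- (\<alpha> * real k))" for k
      unfolding a_def by (intro tendsto_mult_left pow_coeff_asymp)
    show "\<forall>\<^sub>F (k, n) in at_top \<times>\<^sub>F sequentially. norm (a k n) \<le> x ^ k * pow_bound (\<alpha> * real k) / fact k"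
    proof -
      have "\<forall>\<^sub>F p in at_top \<times>\<^sub>F sequentially. snd p \<ge> (1::nat)"
        by (rule eventually_compose_filterlim[OF eventually_ge_at_top filterlim_snd])
      then show ?thesis unfolding case_prod_beta by (rule eventually_mono) (rule bd)
    qed
    show "summable (\<lambda>j. x ^ j * pow_bound (\<alpha> * real j) / fact j)" by (rule pow_bound_summable[OF \<alpha> x])
  qed simp
  show "summable (\<lambda>j. (-x) ^ j / fact j * rGamma (- (\<alpha> * real j)))"
    by (rule summable_norm_cancel) (use T in simp)
  have "(\<lambda>n. suminf (\<lambda>k. a k n)) \<longlonglongrightarrow> ml_series \<alpha> x" using T by (simp add: ml_series_def)
  then show "(\<lambda>n. real n * stable_coeff \<alpha> n (x * real n powr \<alpha>)) \<longlonglongrightarrow> ml_series \<alpha> x"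
    by (rule Lim_transform_eventually)
       (use eventually_ge_at_top[of 1] in eventually_elim, use eq in \<open>simp add: sums_iff\<close>)
  show "\<bar>real n * stable_coeff \<alpha> n (x * real n powr \<alpha>)\<bar> \<le> (\<Sum>j. x ^ j * pow_bound (\<alpha> * real j) / fact j)"
    if n: "n \<ge> 1" for n
    using norm_suminf_le[OF bd[OF n] pow_bound_summable[OF \<alpha> x]] eq[OF n] by (simp add: sums_iff)
qed

text \<open>Invisible in the alternating series, but inherited from the nonnegative
  \<open>stable_coeff\<close>.\<close>

lemma ml_series_nonneg:
  assumes "0 < \<alpha>" "\<alpha> < 1" "x \<ge> 0"
  shows "ml_series \<alpha> x \<ge> 0"
  by (rule tendsto_lowerbound[OF scaled_stable_coeff_limit(1)[OF assms]])
     (auto intro!: always_eventually mult_nonneg_nonneg stable_coeff_nonneg assms)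

lemma scaled_stable_coeff_integral:
  assumes \<alpha>: "0 < \<alpha>" "\<alpha> < 1" and s: "s > 0" and n: "n \<ge> 1"
  shows "((\<lambda>x. x powr (s - 1) * (real n * stable_coeff \<alpha> n (x * real n powr \<alpha>))) has_integral
     Gamma s * (pow_coeff (- (\<alpha> * s)) n * real n powr (- (\<alpha> * s) + 1))) {0..}"
proof -
  define c where "c = real n powr \<alpha>"
  have c: "c > 0" using n by (simp add: c_def)
  define f where "f y = y powr (s - 1) * stable_coeff \<alpha> n y" for y
  have f: "(f has_integral Gamma s * pow_coeff (- (\<alpha> * s)) n) {0..}"
    unfolding f_def by (rule stable_coeff_integral[OF \<alpha> s])
  have "f absolutely_integrable_on {0..}"
    by (rule nonnegative_absolutely_integrable_1) (use f in \<open>auto simp: f_def intro!: mult_nonneg_nonneg stable_coeff_nonneg \<alpha>\<close>)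
  moreover have img: "(\<lambda>x. c * x) ` {0..} = {0..}"
  proof (intro equalityI subsetI)
    fix y assume "y \<in> {0::real..}"
    then show "y \<in> (\<lambda>x. c * x) ` {0..}" using c by (intro image_eqI[of _ _ "y / c"]) auto
  qed (use c in auto)
  moreover have inj: "inj_on (\<lambda>x. c * x) {0..}" using c by (auto simp: inj_on_def)
  moreover have der: "((\<lambda>x. c * x) has_field_derivative c) (at x within {0..})" for x
    by (auto intro!: derivative_eq_intros)
  ultimately have "(\<lambda>x. \<bar>c\<bar> * f (c * x)) absolutely_integrable_on {0..} \<and>
      integral {0..} (\<lambda>x. \<bar>c\<bar> * f (c * x)) = Gamma s * pow_coeff (- (\<alpha> * s)) n"
    using integral_unique[OF f]
    by (subst has_absolute_integral_change_of_variables_1'[OF _ der inj]) auto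
  then have "((\<lambda>x. \<bar>c\<bar> * f (c * x)) has_integral Gamma s * pow_coeff (- (\<alpha> * s)) n) {0..}"
    using has_integral_integrable_integral absolutely_integrable_on_def by blast
  from has_integral_mult_right[OF this, of "1 / c"] c
  have "((\<lambda>x. (c * x) powr (s - 1) * stable_coeff \<alpha> n (c * x)) has_integral (Gamma s * pow_coeff (- (\<alpha> * s)) n) / c) {0..}"
    by (simp add: f_def)
  from has_integral_mult_left[OF this, of "real n / c powr (s - 1)"]
  have I: "((\<lambda>x. (c * x) powr (s - 1) * stable_coeff \<alpha> n (c * x) * (real n / c powr (s - 1))) has_integral
      (Gamma s * pow_coeff (- (\<alpha> * s)) n) / c * (real n / c powr (s - 1))) {0..}" .
  have "1 / c * (real n / c powr (s - 1)) = real n / (c powr (s - 1) * c powr 1)" using c by simp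
  also have "c powr (s - 1) * c powr 1 = c powr s" unfolding powr_add[symmetric] by simp
  also have "c powr s = real n powr (\<alpha> * s)" by (simp add: c_def powr_powr)
  also have "real n / real n powr (\<alpha> * s) = real n powr (- (\<alpha> * s) + 1)"
    by (simp only: powr_add powr_minus divide_inverse) (use n in simp)
  finally have e: "1 / c * (real n / c powr (s - 1)) = real n powr (- (\<alpha> * s) + 1)" .
  have e2: "(Gamma s * pow_coeff (- (\<alpha> * s)) n) / c * (real n / c powr (s - 1)) = Gamma s * (pow_coeff (- (\<alpha> * s)) n * real n powr (- (\<alpha> * s) + 1))"
    unfolding e[symmetric] by (simp only: times_divide_eq_left times_divide_eq_right mult_1_left mult_1_right mult.assoc)
  show ?thesis
  proof (rule has_integral_eq[OF _ I[unfolded e2]])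
    fix x :: real assume "x \<in> {0..}"
    then have "(c * x) powr (s - 1) = c powr (s - 1) * x powr (s - 1)" by (intro powr_mult)
    then show "(c * x) powr (s - 1) * stable_coeff \<alpha> n (c * x) * (real n / c powr (s - 1)) =
       x powr (s - 1) * (real n * stable_coeff \<alpha> n (x * real n powr \<alpha>))"
      using c by (simp add: c_def mult.commute[of x])
  qed
qed

text \<open>Passes to the limit in the Mellin transforms of the approximants. On
  \<open>{0..A}\<close> dominated convergence applies; beyond \<open>A\<close> the transform at
  \<open>s + 1\<close> controls the tail uniformly in \<open>n\<close>. The index is shifted by one
  to keep \<open>n \<ge> 1\<close>.\<close>

lemma ml_series_mellin:
  assumes \<alpha>: "0 < \<alpha>" "\<alpha> < 1" and s: "s > 0"
  shows "((\<lambda>x. x powr (s - 1) * ml_series \<alpha> x) has_integral Gamma s * rGamma (\<alpha> * s)) {0..}"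
proof -
  define F where "F s n x = x powr (s - 1) * (real (Suc n) * stable_coeff \<alpha> (Suc n) (x * real (Suc n) powr \<alpha>))" for s n x
  define G where "G s x = x powr (s - 1) * ml_series \<alpha> x" for s x
  define mn where "mn s n = Gamma s * (pow_coeff (- (\<alpha> * s)) (Suc n) * real (Suc n) powr (- (\<alpha> * s) + 1))" for s n
  define m where "m s = Gamma s * rGamma (\<alpha> * s)" for s
  have FI: "(F s n has_integral mn s n) {0..}" if "s > 0" for s n
    unfolding F_def mn_def by (rule scaled_stable_coeff_integral[OF \<alpha> that]) simp
  have F0: "F s n x \<ge> 0" if "x \<ge> 0" for s n x
    unfolding F_def by (intro mult_nonneg_nonneg stable_coeff_nonneg \<alpha>) (use that in auto)
  have G0: "G s x \<ge> 0" if "x \<ge> 0" for s x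
    unfolding G_def by (intro mult_nonneg_nonneg ml_series_nonneg \<alpha>) (use that in auto)
  have mlim: "mn s \<longlonglongrightarrow> m s" for s
    unfolding mn_def m_def
    using LIMSEQ_Suc[OF tendsto_mult_left[OF pow_coeff_asymp[of "- (\<alpha> * s)"], of "Gamma s"]] by simp
  have FA: "F s n integrable_on {0..A}" if "s > 0" for s n A
  proof (rule integrable_on_subinterval)
    show "F s n integrable_on {0..}" using FI[OF that] by blast
  qed auto
  have FG: "(\<lambda>n. F s n x) \<longlonglongrightarrow> G s x" if "x \<ge> 0" for s x
    unfolding F_def G_def
    by (intro tendsto_mult_left LIMSEQ_Suc[OF scaled_stable_coeff_limit(1)] \<alpha> that)
  have DC: "G s integrable_on {0..A} \<and> (\<lambda>n. integral {0..A} (F s n)) \<longlonglongrightarrow> integral {0..A} (G s)"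
    if s: "s > 0" and A: "A \<ge> 0" for s A
  proof -
    define B where "B = (\<Sum>j. A ^ j * pow_bound (\<alpha> * real j) / fact j)"
    have hI: "(\<lambda>x. x powr (s - 1) * B) integrable_on {0..A}"
      using integrable_on_powr_from_0[of "s - 1" A] s A by (intro integrable_on_mult_left) auto
    have bd: "norm (F s n x) \<le> x powr (s - 1) * B" if x: "x \<in> {0..A}" for n x
    proof -
      have "\<bar>real (Suc n) * stable_coeff \<alpha> (Suc n) (x * real (Suc n) powr \<alpha>)\<bar> \<le> (\<Sum>j. x ^ j * pow_bound (\<alpha> * real j) / fact j)"
        by (rule scaled_stable_coeff_limit(3)) (use \<alpha> x in auto)
      also have "\<dots> \<le> B" unfolding B_def
        by (intro suminf_le pow_bound_summable \<alpha> divide_right_mono mult_right_mono power_mono)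
           (use x A in \<open>auto simp: pow_bound_def\<close>)
      finally show ?thesis unfolding F_def by (simp add: abs_mult mult_left_mono)
    qed
    have lim: "(\<lambda>n. F s n x) \<longlonglongrightarrow> G s x" if "x \<in> {0..A}" for x using that by (intro FG) simp
    show ?thesis
      by (rule conjI[OF dominated_convergence(1)[OF FA[OF s] hI bd lim] dominated_convergence(2)[OF FA[OF s] hI bd lim]])
  qed
  have upper: "integral {0..A} (G s) \<le> m s" and lower: "m s - m (s + 1) / A \<le> integral {0..A} (G s)"
    if A: "A > 0" for A
  proof -
    have le1: "integral {0..A} (F s n) \<le> mn s n" for n
    proof -
      have "integral {0..A} (F s n) \<le> integral {0..} (F s n)"
        by (rule integral_subset_le) (use FA[OF s] FI[OF s] F0 in \<open>auto simp: integrable_on_def\<close>)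
      then show ?thesis using integral_unique[OF FI[OF s]] by simp
    qed
    \<comment> \<open>Markov's inequality: for \<open>x > A\<close> the integrand at
      \<open>s\<close> is at most that at \<open>s + 1\<close>, divided by \<open>A\<close>.\<close>
    have le2: "mn s n - mn (s + 1) n / A \<le> integral {0..A} (F s n)" for n
    proof -
      have "((\<lambda>x. (if x \<in> {0..A} then F s n x else 0) + F (s + 1) n x * (1 / A)) has_integral integral {0..A} (F s n) + mn (s + 1) n * (1 / A)) {0..}"
      proof (intro has_integral_add has_integral_mult_left FI)
        show "((\<lambda>x. if x \<in> {0..A} then F s n x else 0) has_integral integral {0..A} (F s n)) {0..}"
          by (subst has_integral_restrict) (use FA[OF s] in auto)
      qed (use s in auto)
      then have "mn s n \<le> integral {0..A} (F s n) + mn (s + 1) n * (1 / A)"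
      proof (rule has_integral_le[OF FI[OF s]])
        fix x :: real assume x: "x \<in> {0..}"
        show "F s n x \<le> (if x \<in> {0..A} then F s n x else 0) + F (s + 1) n x * (1 / A)"
        proof (cases "x \<le> A")
          case True then show ?thesis using x F0[of x "s + 1" n] A by simp
        next
          case False
          then have x': "x > 0" "x / A \<ge> 1" using A by auto
          have "F (s + 1) n x = x * F s n x"
          proof -
            have "x powr (s + 1 - 1) = x * x powr (s - 1)" using x' by (simp add: powr_diff)
            then show ?thesis by (simp add: F_def)
          qed
          moreover have "1 * F s n x \<le> x / A * F s n x" by (rule mult_right_mono[OF x'(2)]) (use F0 x' in simp)
          ultimately show ?thesis using False by simp
        qed
      qed
      then show ?thesis by simp
    qed
    have c: "(\<lambda>n. integral {0..A} (F s n)) \<longlonglongrightarrow> integral {0..A} (G s)" using DC[OF s, of A] A by simp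
    show "integral {0..A} (G s) \<le> m s" by (rule LIMSEQ_le[OF c mlim]) (use le1 in auto)
    have "(\<lambda>n. mn s n - mn (s + 1) n / A) \<longlonglongrightarrow> m s - m (s + 1) / A"
      by (intro tendsto_intros mlim) (use A in auto)
    then show "m s - m (s + 1) / A \<le> integral {0..A} (G s)" by (rule LIMSEQ_le[OF _ c]) (use le2 in auto)
  qed
  \<comment> \<open>From here on only \<open>G s \<ge> 0\<close> is used: the truncated integrals
    are bounded, and monotone convergence gives the integral over the half-line.\<close>
  have lim: "(\<lambda>k. integral {0..real (Suc k)} (G s)) \<longlonglongrightarrow> m s"
  proof (rule tendsto_sandwich[of "\<lambda>k. m s - m (s + 1) / real (Suc k)" _ _ "\<lambda>_. m s"])
    have "(\<lambda>k. m s - m (s + 1) * (1 / real (Suc k))) \<longlonglongrightarrow> m s - m (s + 1) * 0"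
      by (intro tendsto_intros) real_asymp
    then show "(\<lambda>k. m s - m (s + 1) / real (Suc k)) \<longlonglongrightarrow> m s" by simp
  qed (use upper lower in \<open>auto intro!: always_eventually simp del: of_nat_Suc\<close>)
  define g where "g k x = (if x \<in> {0..real (Suc k)} then G s x else 0)" for k x
  have gI: "(g k has_integral integral {0..real (Suc k)} (G s)) {0..}" for k
    unfolding g_def by (subst has_integral_restrict) (use DC[OF s, of "real (Suc k)"] in auto)
  have "G s integrable_on {0..} \<and> (\<lambda>k. integral {0..} (g k)) \<longlonglongrightarrow> integral {0..} (G s)"
  proof (rule monotone_convergence_increasing)
    show "g k integrable_on {0..}" for k using gI by blast
    show "g k x \<le> g (Suc k) x" if "x \<in> {0..}" for k x using that G0[of x s] by (auto simp: g_def)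
    show "(\<lambda>k. g k x) \<longlonglongrightarrow> G s x" if "x \<in> {0..}" for x
    proof (rule Lim_transform_eventually[OF tendsto_const])
      show "\<forall>\<^sub>F k in sequentially. G s x = g k x"
        using eventually_ge_at_top[of "nat \<lceil>x\<rceil>"]
      proof eventually_elim
        case (elim k)
        then have "x \<le> real (Suc k)" by linarith
        then show ?case using that by (simp add: g_def)
      qed
    qed
    have "bounded (range (\<lambda>k. integral {0..real (Suc k)} (G s)))"
      using convergent_imp_bounded[OF lim] .
    then show "bounded (range (\<lambda>k. integral {0..} (g k)))" by (simp add: integral_unique[OF gI])
  qed
  then have "G s integrable_on {0..}" and "(\<lambda>k. integral {0..real (Suc k)} (G s)) \<longlonglongrightarrow> integral {0..} (G s)"
    by (simp_all add: integral_unique[OF gI])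
  with LIMSEQ_unique[OF lim] have "(G s has_integral m s) {0..}"
    by (simp add: has_integral_iff)
  then show ?thesis by (simp add: G_def[abs_def] m_def)
qed

text \<open>Factoring \<open>x powr (\<theta> - 1)\<close> out of the series leaves the Wright
  function without its zero term; the constant simplifies by the functional equation of Gamma. Here
  \<theta> stands for \<open>\<beta> / \<alpha>\<close>.\<close>

lemma mittag_leffler_density_eq:
  assumes \<alpha>: "0 < \<alpha>" "\<alpha> < 1" and \<theta>: "\<theta> > 0" and x: "x > 0"
  shows "mittag_leffler_density \<alpha> (\<alpha> * \<theta>) x = Gamma (\<alpha> * \<theta>) / Gamma \<theta> * (x powr (\<theta> - 1) * ml_series \<alpha> x)"
proof -
  have G: "Gamma (\<alpha> * \<theta> + 1) / (\<alpha> * Gamma (\<theta> + 1)) = Gamma (\<alpha> * \<theta>) / Gamma \<theta>"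
  proof -
    have "\<theta> \<notin> \<int>\<^sub>\<le>\<^sub>0" "\<alpha> * \<theta> \<notin> \<int>\<^sub>\<le>\<^sub>0"
      using \<theta> mult_pos_pos[OF \<alpha>(1) \<theta>] by (auto elim!: nonpos_Ints_cases)
    then have "Gamma (\<theta> + 1) = \<theta> * Gamma \<theta>" "Gamma (\<alpha> * \<theta> + 1) = \<alpha> * \<theta> * Gamma (\<alpha> * \<theta>)"
      by (simp_all add: Gamma_plus1)
    then show ?thesis using \<alpha> \<theta> by simp
  qed
  let ?t = "\<lambda>j. (-x) ^ j / fact j * rGamma (- (\<alpha> * real j))"
  have sm: "summable ?t" using scaled_stable_coeff_limit(2)[OF \<alpha>, of x] x by simp
  have "ml_series \<alpha> x = (\<Sum>j. ?t (Suc j)) + ?t 0"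
    unfolding ml_series_def using suminf_split_head[OF sm] by simp
  then have S: "ml_series \<alpha> x = (\<Sum>j. ?t (Suc j))" by simp
  have "(\<Sum>i. let n = Suc i in (-1) ^ n / fact n * rGamma (- (real n * \<alpha>)) * x powr (real n + \<alpha> * \<theta> / \<alpha> - 1)) =
     (\<Sum>j. x powr (\<theta> - 1) * ?t (Suc j))"
  proof (rule suminf_cong)
    fix i
    have "x powr (real (Suc i) + \<alpha> * \<theta> / \<alpha> - 1) = x powr (\<theta> - 1) * x powr real (Suc i)"
      using \<alpha> by (simp add: algebra_simps flip: powr_add)
    also have "x powr real (Suc i) = x ^ Suc i" using x by (rule powr_realpow)
    finally show "(let n = Suc i in (-1) ^ n / fact n * rGamma (- (real n * \<alpha>)) * x powr (real n + \<alpha> * \<theta> / \<alpha> - 1)) =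
      x powr (\<theta> - 1) * ?t (Suc i)"
      by (simp add: Let_def power_minus[of x] mult_ac del: of_nat_Suc)
  qed
  also have "\<dots> = x powr (\<theta> - 1) * ml_series \<alpha> x"
    unfolding S by (rule suminf_mult[OF iffD2[OF summable_Suc_iff[of ?t] sm]])
  finally show ?thesis using x G \<alpha> by (simp add: mittag_leffler_density_def)
qed

lemma mittag_leffler_density_nonneg:
  assumes \<alpha>: "0 < \<alpha>" "\<alpha> < 1" and \<theta>: "\<theta> > 0"
  shows "mittag_leffler_density \<alpha> (\<alpha> * \<theta>) x \<ge> 0"
proof (cases "x > 0")
  case True
  then show ?thesis unfolding mittag_leffler_density_eq[OF \<alpha> \<theta> True]
    by (intro mult_nonneg_nonneg divide_nonneg_nonneg ml_series_nonneg \<alpha>)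
       (use \<alpha> \<theta> in \<open>auto intro!: less_imp_le[OF Gamma_real_pos]\<close>)
qed (simp add: mittag_leffler_density_def)

lemma measurable_mittag_leffler_density [measurable]: "mittag_leffler_density \<alpha> \<beta> \<in> borel_measurable borel"
  unfolding mittag_leffler_density_def Let_def by measurable

text \<open>The moment of order \<open>r\<close> is the Mellin transform of \<open>ml_series\<close>
  at \<open>\<theta> + r\<close>.\<close>

lemma mittag_leffler_moments:
  assumes \<alpha>: "0 < \<alpha>" "\<alpha> < 1" and \<beta>: "\<beta> > 0"
  shows "has_bochner_integral (mittag_leffler_distribution \<alpha> \<beta>) (\<lambda>x. x ^ r) (mittag_leffler_moment \<alpha> \<beta> r)"
proof -
  define \<theta> where "\<theta> = \<beta> / \<alpha>"
  have \<theta>: "\<theta> > 0" "\<alpha> * \<theta> = \<beta>" using \<alpha> \<beta> by (auto simp: \<theta>_def)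
  let ?f = "mittag_leffler_density \<alpha> \<beta>"
  have f0: "?f x \<ge> 0" for x using mittag_leffler_density_nonneg[OF \<alpha> \<theta>(1)] \<theta> by simp
  have f00: "?f x = 0" if "x \<le> 0" for x using that by (simp add: mittag_leffler_density_def)
  have M: "mittag_leffler_moment \<alpha> \<beta> r = Gamma \<beta> / Gamma \<theta> * (Gamma (\<theta> + real r) * rGamma (\<alpha> * (\<theta> + real r)))"
  proof -
    have "\<alpha> * (\<theta> + real r) = \<alpha> * real r + \<beta>" using \<theta>(2) by (simp add: distrib_left)
    then show ?thesis
      by (simp add: mittag_leffler_moment_def rGamma_inverse_Gamma divide_inverse add.commute mult_ac \<theta>_def)
  qed
  have "((\<lambda>x. Gamma \<beta> / Gamma \<theta> * (x powr (\<theta> + real r - 1) * ml_series \<alpha> x)) has_integral mittag_leffler_moment \<alpha> \<beta> r) {0..}"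
    unfolding M by (intro has_integral_mult_right ml_series_mellin \<alpha>) (use \<theta> in auto)
  then have "((\<lambda>x. x ^ r * ?f x) has_integral mittag_leffler_moment \<alpha> \<beta> r) {0..}"
  proof (rule has_integral_spike[of "{0}", rotated 2])
    fix x :: real assume "x \<in> {0..} - {0}"
    then have x: "x > 0" by auto
    have "x powr (\<theta> + real r - 1) = x ^ r * x powr (\<theta> - 1)"
      using x by (simp add: powr_realpow[symmetric] algebra_simps flip: powr_add)
    then show "x ^ r * ?f x = Gamma \<beta> / Gamma \<theta> * (x powr (\<theta> + real r - 1) * ml_series \<alpha> x)"
      using mittag_leffler_density_eq[OF \<alpha> \<theta>(1) x] \<theta>(2) by simp
  qed simp
  then have "((\<lambda>x. if x \<in> {0..} then x ^ r * ?f x else 0) has_integral mittag_leffler_moment \<alpha> \<beta> r) UNIV"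
    by (simp only: has_integral_restrict_UNIV)
  also have "(\<lambda>x. if x \<in> {0..} then x ^ r * ?f x else 0) = (\<lambda>x. x ^ r * ?f x)"
    using f00 by (auto simp: fun_eq_iff)
  finally have I: "((\<lambda>x. x ^ r * ?f x) has_integral mittag_leffler_moment \<alpha> \<beta> r) UNIV" .
  have nn: "0 \<le> x ^ r * ?f x" for x using f0[of x] f00[of x] by (cases "x \<le> 0") auto
  have "integral\<^sup>N lborel (\<lambda>x. x ^ r * ?f x) = mittag_leffler_moment \<alpha> \<beta> r"
    by (rule nn_integral_has_integral_lborel[OF _ nn I]) measurable
  moreover have "mittag_leffler_moment \<alpha> \<beta> r \<ge> 0" using has_integral_nonneg[OF I nn] by simp
  ultimately have "has_bochner_integral lborel (\<lambda>x. x ^ r * ?f x) (mittag_leffler_moment \<alpha> \<beta> r)"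
    by (intro has_bochner_integral_nn_integral) (use nn in auto)
  then have "has_bochner_integral lborel (\<lambda>x. ?f x *\<^sub>R x ^ r) (mittag_leffler_moment \<alpha> \<beta> r)"
    by (simp add: mult.commute)
  then show ?thesis unfolding mittag_leffler_distribution_def
    by (subst has_bochner_integral_density) (use f0 in auto)
qed

text \<open>The total mass is the moment of order 0, which evaluates to 1.\<close>

lemma real_distribution_mittag_leffler:
  assumes \<alpha>: "0 < \<alpha>" "\<alpha> < 1" and \<beta>: "\<beta> > 0"
  shows "real_distribution (mittag_leffler_distribution \<alpha> \<beta>)"
proof -
  let ?M = "mittag_leffler_distribution \<alpha> \<beta>"
  have "mittag_leffler_moment \<alpha> \<beta> 0 = 1"
  proof -
    have "Gamma \<beta> > 0" "Gamma (\<beta> / \<alpha>) > 0" using \<alpha> \<beta> by (auto intro!: Gamma_real_pos)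
    then show ?thesis by (simp add: mittag_leffler_moment_def)
  qed
  then have hb: "has_bochner_integral ?M (\<lambda>x. 1::real) 1"
    using mittag_leffler_moments[OF assms, of 0] by simp
  have "prob_space ?M"
  proof
    have fin: "emeasure ?M (space ?M) < \<infinity>"
      using hb by (simp add: has_bochner_integral_iff integrable_iff_bounded)
    have "measure ?M (space ?M) = 1" using hb by (simp add: has_bochner_integral_iff)
    then show "emeasure ?M (space ?M) = 1" using fin by (simp add: emeasure_eq_ennreal_measure)
  qed
  then show ?thesis
    by (simp add: real_distribution_def real_distribution_axioms_def mittag_leffler_distribution_def)
qed

text \<open>Even indices vanish because \<open>rGamma\<close> is zero at the nonpositive integers.
  For odd ones the functional equation of \<open>rGamma\<close> gives a two-step recurrence, whose
  solution is an exponential series in \<open>- x^2 / 4\<close>.\<close>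

lemma sums_rayleigh_series:
  fixes x :: real
  shows "ml_series (1/2) x = x / 2 * exp (- x\<^sup>2 / 4) / sqrt pi"
proof -
  define t where "t j = (-x) ^ j / fact j * rGamma (- (1 / 2 * real j))" for j
  have odd: "t (2 * i + 1) = x / (2 * sqrt pi) * ((- x\<^sup>2 / 4) ^ i / fact i)" for i
  proof (induction i)
    case 0
    have "rGamma (- (1/2) :: real) = - (1/2) * rGamma (1/2)"
      using rGamma_plus1[of "- (1/2) :: real"] by simp
    also have "rGamma (1/2 :: real) = 1 / sqrt pi"
      unfolding rGamma_inverse_Gamma Gamma_one_half_real by (rule inverse_eq_divide)
    finally show ?case by (simp add: t_def)
  next
    case (Suc i)
    have "rGamma (- (1 / 2 * real (2 * Suc i + 1))) = - (1 / 2 * real (2 * Suc i + 1)) * rGamma (- (1 / 2 * real (2 * i + 1)))"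
      using rGamma_plus1[of "- (1 / 2 * real (2 * Suc i + 1))"] by (simp add: algebra_simps)
    then have "t (2 * Suc i + 1) = t (2 * i + 1) * (x\<^sup>2 / ((2 * real i + 2) * (2 * real i + 3)) * (- (1 / 2 * (2 * real i + 3))))"
    proof -
      assume r: "rGamma (- (1 / 2 * real (2 * Suc i + 1))) = - (1 / 2 * real (2 * Suc i + 1)) * rGamma (- (1 / 2 * real (2 * i + 1)))"
      have F: "(fact (2 * Suc i + 1) :: real) = (2 * real i + 3) * ((2 * real i + 2) * fact (2 * i + 1))"
        by (simp add: algebra_simps)
      have X: "(-x) ^ (2 * Suc i + 1) = x\<^sup>2 * (-x) ^ (2 * i + 1)" by (simp add: power2_eq_square)
      have n: "real (2 * Suc i + 1) = 2 * real i + 3" by simp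
      show ?thesis unfolding t_def F X r unfolding n
        by (simp only: times_divide_eq_right times_divide_eq_left divide_divide_eq_left mult_ac mult_minus_left mult_minus_right)
    qed
    also have "x\<^sup>2 / ((2 * real i + 2) * (2 * real i + 3)) * (- (1 / 2 * (2 * real i + 3))) = - x\<^sup>2 / 4 / (real i + 1)"
      by (simp add: divide_simps)
    finally show ?case unfolding Suc by (simp add: field_simps)
  qed
  have "(\<lambda>i. x / (2 * sqrt pi) * ((- x\<^sup>2 / 4) ^ i / fact i)) sums (x / (2 * sqrt pi) * exp (- x\<^sup>2 / 4))"
    using exp_converges[of "- x\<^sup>2 / 4"] by (intro sums_mult) (simp add: field_simps)
  then have "(\<lambda>i. t (2 * i + 1)) sums (x / (2 * sqrt pi) * exp (- x\<^sup>2 / 4))" by (simp only: odd)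
  moreover have "t j = 0" if "j \<notin> range (\<lambda>i. 2 * i + 1)" for j
  proof -
    have "even j" using that by (metis oddE rangeI)
    then obtain i where "j = 2 * i" by (rule evenE)
    then have "rGamma (- (1 / 2 * real j)) = 0" by (simp add: rGamma_eq_zero_iff)
    then show ?thesis by (simp add: t_def)
  qed
  ultimately have "t sums (x / (2 * sqrt pi) * exp (- x\<^sup>2 / 4))"
    using sums_mono_reindex[of "\<lambda>i. 2 * i + 1" t] by (simp add: strict_mono_def)
  then show ?thesis by (simp add: ml_series_def t_def[abs_def] sums_iff)
qed

lemma mittag_leffler_rayleigh: "mittag_leffler_distribution (1/2) (1/2) = rayleigh_distribution (sqrt 2)"
proof -
  have "mittag_leffler_density (1/2) (1/2) x = (if x \<ge> 0 then x / (sqrt 2)\<^sup>2 * exp (- x\<^sup>2 / (2 * (sqrt 2)\<^sup>2)) else 0)" for x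
  proof (cases "x > 0")
    case True
    have "mittag_leffler_density (1/2) (1/2) x = Gamma (1/2) / Gamma 1 * (x powr (1 - 1) * ml_series (1/2) x)"
      using mittag_leffler_density_eq[of "1/2" 1 x] True by simp
    then show ?thesis using True by (simp add: sums_rayleigh_series Gamma_one_half_real)
  qed (auto simp: mittag_leffler_density_def)
  then show ?thesis by (simp add: mittag_leffler_distribution_def rayleigh_distribution_def)
qed

section \<open>The subcritical regime\<close>

lemma pmf_nat_expectation:
  fixes p :: "nat pmf" and f :: "nat \<Rightarrow> 'a :: {banach, second_countable_topology}"
  assumes "summable (\<lambda>k. pmf p k * norm (f k))"
  shows "integrable (measure_pmf p) f"
    and "measure_pmf.expectation p f = (\<Sum>k. pmf p k *\<^sub>R f k)"
proof -
  have I: "integrable (count_space UNIV) (\<lambda>k. pmf p k *\<^sub>R f k)"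
    using assms by (simp add: integrable_count_space_nat_iff)
  show "integrable (measure_pmf p) f"
    unfolding measure_pmf_eq_density using I by (subst integrable_density) auto
  show "measure_pmf.expectation p f = (\<Sum>k. pmf p k *\<^sub>R f k)"
    unfolding measure_pmf_eq_density using integral_count_space_nat[OF I]
    by (subst integral_density) auto
qed

lemma cdf_distr_pmf: "cdf (distr (measure_pmf p) borel f) x = measure_pmf.prob p {k. f k \<le> x}"
  by (simp add: cdf_def measure_distr vimage_def)

text \<open>Below any \<open>x\<close> lie only finitely many atoms, so the distribution function is
  a finite sum of point masses and pointwise convergence suffices.\<close>

lemma weak_conv_shifted_pmf:
  fixes p :: "nat \<Rightarrow> nat pmf" and P :: "nat pmf"
  assumes "(\<lambda>n. pmf (p n) 0) \<longlonglongrightarrow> 0" and "\<And>j. (\<lambda>n. pmf (p n) (Suc j)) \<longlonglongrightarrow> pmf P j"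
  shows "weak_conv_m (\<lambda>n. distr (measure_pmf (p n)) borel (\<lambda>k. real k - 1)) (distr (measure_pmf P) borel real)"
  unfolding weak_conv_m_def weak_conv_def cdf_distr_pmf
proof (intro allI impI)
  fix x :: real
  define A where "A = {j. real j \<le> x}"
  have "A \<subseteq> {..nat \<lceil>x\<rceil>}" by (auto simp: A_def) linarith
  then have fin: "finite A" by (rule finite_subset) simp
  \<comment> \<open>The atom \<open>k = 0\<close>, moved to \<open>- 1\<close> by the shift, has no
    counterpart in the limit; its mass tends to 0.\<close>
  define z where "z = (if -1 \<le> x then {0::nat} else {})"
  have eq: "{k. real k - 1 \<le> x} = z \<union> Suc ` A"
  proof (intro equalityI subsetI)
    fix k assume k: "k \<in> {k. real k - 1 \<le> x}"
    show "k \<in> z \<union> Suc ` A" using k by (cases k) (auto simp: z_def A_def)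
  qed (auto simp: z_def A_def split: if_splits)
  have "measure_pmf.prob (p n) {k. real k - 1 \<le> x} = (\<Sum>k\<in>z. pmf (p n) k) + (\<Sum>j\<in>A. pmf (p n) (Suc j))" for n
  proof -
    have "measure_pmf.prob (p n) {k. real k - 1 \<le> x} = sum (pmf (p n)) (z \<union> Suc ` A)"
      unfolding eq by (rule measure_measure_pmf_finite) (use fin in \<open>auto simp: z_def\<close>)
    also have "\<dots> = sum (pmf (p n)) z + sum (pmf (p n)) (Suc ` A)"
      by (rule sum.union_disjoint) (use fin in \<open>auto simp: z_def\<close>)
    also have "sum (pmf (p n)) (Suc ` A) = (\<Sum>j\<in>A. pmf (p n) (Suc j))"
      by (subst sum.reindex) (auto simp: o_def)
    finally show ?thesis .
  qed
  moreover have "(\<lambda>n. (\<Sum>k\<in>z. pmf (p n) k) + (\<Sum>j\<in>A. pmf (p n) (Suc j))) \<longlonglongrightarrow> (\<Sum>k\<in>z. 0) + (\<Sum>j\<in>A. pmf P j)"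
    by (intro tendsto_add tendsto_sum assms(2)) (use assms(1) in \<open>auto simp: z_def split: if_splits\<close>)
  moreover have "measure_pmf.prob P {k. real k \<le> x} = (\<Sum>j\<in>A. pmf P j)"
    unfolding A_def[symmetric] by (rule measure_measure_pmf_finite[OF fin])
  ultimately show "(\<lambda>n. measure_pmf.prob (p n) {k. real k - 1 \<le> x}) \<longlonglongrightarrow> measure_pmf.prob P {k. real k \<le> x}"
    by simp
qed

definition scale_fps :: "real \<Rightarrow> real fps \<Rightarrow> real fps" where
  "scale_fps q F = Abs_fps (\<lambda>k. q ^ k * fps_nth F k)"

lemma scale_fps_nth [simp]: "fps_nth (scale_fps q F) k = q ^ k * fps_nth F k"
  by (simp add: scale_fps_def)

lemma scale_fps_radius:
  assumes "q > 0" "fps_conv_radius F = ereal \<rho>"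
  shows "fps_conv_radius (scale_fps q F) = ereal (\<rho> / q)"
  using assms conv_radius_mult_power[of q "fps_nth F"] by (simp add: fps_conv_radius_def scale_fps_def)

lemma eval_const_scale_fps:
  fixes F :: "real fps"
  assumes "ereal (norm (q * x)) < fps_conv_radius F"
  shows "eval_fps (fps_const c * scale_fps q F) x = c * eval_fps F (q * x)"
proof -
  have "summable (\<lambda>n. fps_nth F n * (q * x) ^ n)" by (rule summable_fps[OF assms])
  from suminf_mult[OF this, of c] show ?thesis
    by (simp add: eval_fps_def power_mult_distrib mult_ac)
qed

lemma deriv_scale_fps: "fps_deriv (scale_fps q F) = fps_const q * scale_fps q (fps_deriv F)"
  by (rule fps_ext) (simp add: mult_ac)

lemma eval_fps_pos:
  fixes F :: "real fps"
  assumes "\<And>n. fps_nth F n \<ge> 0" "x > 0" "ereal x < fps_conv_radius F" "fps_nth F m \<noteq> 0"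
  shows "eval_fps F x > 0"
proof -
  have sm: "summable (\<lambda>n. fps_nth F n * x ^ n)" by (rule summable_fps) (use assms in simp)
  have "fps_nth F m > 0" using le_neq_trans[OF assms(1) assms(4)[symmetric]] .
  then have "0 < fps_nth F m * x ^ m" using assms(2) by simp
  also have "\<dots> \<le> eval_fps F x" unfolding eval_fps_def
    using sum_le_suminf[OF sm, of "{m}"] assms by simp
  finally show ?thesis .
qed

lemma scheme_coeff_eq: "scheme_coeff G H q n k = q ^ k * fps_nth G k * fps_nth (H ^ k) n"
  by (simp add: scheme_coeff_def power_mult_distrib fps_const_power mult_ac)

text \<open>A finite radius of convergence rules out a polynomial. Later this supplies nonzero
  coefficients of positive index for strict monotonicity and positivity.\<close>

lemma delta_singular_nonpoly:
  assumes "delta_singular F \<rho> lam c"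
  shows "\<exists>n\<ge>N. fps_nth F n \<noteq> 0"
proof (rule ccontr)
  assume "\<not> ?thesis"
  then have z: "fps_nth F n = 0" if "n \<ge> N" for n using that by auto
  have "fps_conv_radius F = \<infinity>"
  proof -
    have "eventually (\<lambda>n. fps_nth F n = 0) sequentially"
      using eventually_ge_at_top[of N] by eventually_elim (rule z)
    then have "conv_radius (fps_nth F) = conv_radius (\<lambda>_. 0 :: real)" by (rule conv_radius_cong')
    then show ?thesis by (simp add: fps_conv_radius_def)
  qed
  then show False using assms by (simp add: delta_singular_def)
qed

lemma gibbs_pmf_nth:
  assumes "\<And>k. fps_nth G k \<ge> 0" "\<And>k. fps_nth H k \<ge> 0" "q > 0"
    and "summable (\<lambda>k. q ^ k * fps_nth G k * fps_nth (H ^ k) n)" "(\<Sum>k. q ^ k * fps_nth G k * fps_nth (H ^ k) n) > 0"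
  shows "pmf (gibbs_pmf G H q n) k =
    q ^ k * fps_nth G k * fps_nth (H ^ k) n / (\<Sum>k. q ^ k * fps_nth G k * fps_nth (H ^ k) n)"
proof -
  have "scheme_coeff G H q n = (\<lambda>k. q ^ k * fps_nth G k * fps_nth (H ^ k) n)"
    by (rule ext) (rule scheme_coeff_eq)
  then show ?thesis using pmf_gibbs_pmf[of G H q n k] assms by (simp add: scheme_total_def)
qed

text \<open>The outer function \<open>fps_X ^ k\<close> in \<open>subcritical_coeff_asymp\<close>.
  It serves for the limit law below the critical point and shows at the critical point that no
  single \<open>k\<close> matters.\<close>

lemma power_coeff_asymp:
  assumes H: "delta_singular H \<rho> lam c" and lam: "0 < lam" "lam < 1"
  shows "(\<lambda>n. fps_nth (H ^ k) n * \<rho> ^ n * real n powr (lam + 1)) \<longlonglongrightarrow>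
           (c * rGamma (- lam)) * (real k * eval_fps H \<rho> ^ (k - 1))"
proof -
  let ?X = "fps_X ^ k :: real fps"
  have "fps_conv_radius ?X = \<infinity>" using fps_conv_radius_power[of "fps_X :: real fps" k] by simp
  then have r: "ereal (eval_fps H \<rho>) < fps_conv_radius ?X" by simp
  have nn: "fps_nth ?X i \<ge> 0" for i by (simp add: fps_X_power_nth)
  have "eval_fps (fps_deriv ?X) (eval_fps H \<rho>) = real k * eval_fps H \<rho> ^ (k - 1)"
  proof (cases k)
    case (Suc j)
    have "fps_deriv ?X = fps_const (real k) * fps_X ^ j"
      unfolding Suc by (rule fps_ext) (auto simp: fps_X_power_nth)
    then show ?thesis unfolding Suc by (simp add: eval_fps_mult eval_fps_power less_le_trans[OF _ fps_conv_radius_power])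
  qed simp
  moreover have "(\<Sum>i. fps_nth ?X i * fps_nth (H ^ i) n) = fps_nth (H ^ k) n" for n
    by (subst suminf_finite[of "{k}"]) (auto simp: fps_X_power_nth)
  ultimately show ?thesis
    using subcritical_coeff_asymp(1)[OF H lam nn r] by (simp add: mult_ac)
qed

text \<open>Numerators and denominator of the point masses, as well as the weighted sum for the
  mean, all carry the same factor \<open>\<rho>H powr (- n) * n powr (- lam - 1)\<close>, so only
  ratios of derivatives of outer functions at \<open>H(\<rho>H)\<close> remain.\<close>

lemma subcritical_pmf:
  assumes G: "delta_singular G \<rho>G lamG cG"
    and H: "delta_singular H \<rho>H lam c" and lam: "0 < lam" "lam < 1"
    and q: "0 < q" "q < \<rho>G / eval_fps H \<rho>H"
  defines "x \<equiv> q * eval_fps H \<rho>H"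
  shows "(\<lambda>n. pmf (gibbs_pmf G H q n) 0) \<longlonglongrightarrow> 0"
    and "(\<lambda>n. pmf (gibbs_pmf G H q n) (Suc j)) \<longlonglongrightarrow> fps_nth (fps_deriv G) j * x ^ j / eval_fps (fps_deriv G) x"
    and "(\<lambda>n. measure_pmf.expectation (gibbs_pmf G H q n) real) \<longlonglongrightarrow>
           1 + x * eval_fps (fps_deriv (fps_deriv G)) x / eval_fps (fps_deriv G) x"
    and "0 < x" "x < \<rho>G" "eval_fps (fps_deriv G) x > 0"
proof -
  define \<tau> where "\<tau> = eval_fps H \<rho>H"
  have Gn: "\<And>k. fps_nth G k \<ge> 0" and radG: "fps_conv_radius G = ereal \<rho>G" and \<rho>G: "\<rho>G > 0"
    using G by (auto simp: delta_singular_def)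
  have Hn: "\<And>k. fps_nth H k \<ge> 0" and \<rho>H: "\<rho>H > 0" using H by (auto simp: delta_singular_def)
  have \<tau>: "\<tau> > 0" unfolding \<tau>_def by (rule critical_coeff_asymp(3)[OF H lam, of 1]) simp
  have x: "x = q * \<tau>" by (simp add: x_def \<tau>_def)
  show x0: "0 < x" using q \<tau> by (simp add: x)
  show x1: "x < \<rho>G" using q \<tau> by (simp add: x \<tau>_def[symmetric] field_simps)
  have radG1: "ereal x < fps_conv_radius (fps_deriv G)" using fps_conv_radius_deriv[of G] x1 radG
    by (metis ereal_less(2) less_ereal.simps(1) less_le_trans)
  have radG2: "ereal x < fps_conv_radius (fps_deriv (fps_deriv G))"
    using radG1 fps_conv_radius_deriv[of "fps_deriv G"] by (rule less_le_trans)
  obtain m where "m \<ge> 1" "fps_nth G m \<noteq> 0" using delta_singular_nonpoly[OF G, of 1] by auto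
  then have "fps_nth (fps_deriv G) (m - 1) \<noteq> 0" by simp
  then show G'0: "eval_fps (fps_deriv G) x > 0"
    by (intro eval_fps_pos[of "fps_deriv G" x "m - 1"]) (use Gn x0 radG1 in auto)
  define L where "L = c * rGamma (- lam)"
  have L: "L > 0" unfolding L_def by (rule delta_singular_coeff_const_pos[OF H lam(2)])
  define \<Phi> where "\<Phi> = scale_fps q G"
  \<comment> \<open>The outer function whose coefficients carry the extra factor \<open>k\<close>,
    for the mean.\<close>
  define \<Phi>2 where "\<Phi>2 = fps_X * fps_deriv \<Phi>"
  have \<Phi>n: "fps_nth \<Phi> k \<ge> 0" for k using Gn q by (simp add: \<Phi>_def)
  have \<Phi>2n: "fps_nth \<Phi>2 k = real k * fps_nth \<Phi> k" for k
    by (cases k) (simp_all add: \<Phi>2_def)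
  have rad\<Phi>: "ereal \<tau> < fps_conv_radius \<Phi>"
    using scale_fps_radius[OF q(1) radG] x1 q by (simp add: \<Phi>_def x field_simps)
  have rad\<Phi>1: "ereal \<tau> < fps_conv_radius (fps_deriv \<Phi>)" using rad\<Phi> fps_conv_radius_deriv by (rule less_le_trans)
  have rad\<Phi>11: "ereal \<tau> < fps_conv_radius (fps_deriv (fps_deriv \<Phi>))" using rad\<Phi>1 fps_conv_radius_deriv by (rule less_le_trans)
  have rad\<Phi>2: "ereal \<tau> < fps_conv_radius \<Phi>2"
    unfolding \<Phi>2_def using fps_conv_radius_mult[of fps_X "fps_deriv \<Phi>"] rad\<Phi>1 by (auto intro: less_le_trans)
  have D1: "eval_fps (fps_deriv \<Phi>) \<tau> = q * eval_fps (fps_deriv G) x"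
    unfolding \<Phi>_def deriv_scale_fps x by (rule eval_const_scale_fps) (use radG1 q \<tau> in \<open>simp add: x\<close>)
  have D2: "eval_fps (fps_deriv (fps_deriv \<Phi>)) \<tau> = q * (q * eval_fps (fps_deriv (fps_deriv G)) x)"
  proof -
    have "fps_deriv (fps_deriv \<Phi>) = fps_const (q * q) * scale_fps q (fps_deriv (fps_deriv G))"
      by (rule fps_ext) (simp add: \<Phi>_def mult_ac)
    moreover have "eval_fps (fps_const (q * q) * scale_fps q (fps_deriv (fps_deriv G))) \<tau> = q * q * eval_fps (fps_deriv (fps_deriv G)) (q * \<tau>)"
      by (rule eval_const_scale_fps) (use radG2 q \<tau> in \<open>simp add: x\<close>)
    ultimately show ?thesis by (simp add: x)
  qed
  have D3: "eval_fps (fps_deriv \<Phi>2) \<tau> = q * eval_fps (fps_deriv G) x + \<tau> * (q * (q * eval_fps (fps_deriv (fps_deriv G)) x))"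
  proof -
    have "fps_deriv \<Phi>2 = fps_deriv \<Phi> + fps_X * fps_deriv (fps_deriv \<Phi>)" by (simp add: \<Phi>2_def)
    moreover have "eval_fps (fps_X * fps_deriv (fps_deriv \<Phi>)) \<tau> = \<tau> * eval_fps (fps_deriv (fps_deriv \<Phi>)) \<tau>"
      by (subst eval_fps_mult) (use rad\<Phi>11 \<tau> in auto)
    moreover have "ereal \<tau> < fps_conv_radius (fps_X * fps_deriv (fps_deriv \<Phi>))"
      using fps_conv_radius_mult[of fps_X "fps_deriv (fps_deriv \<Phi>)"] rad\<Phi>11 by (auto intro: less_le_trans)
    ultimately show ?thesis using rad\<Phi>1 \<tau> by (simp add: eval_fps_add D1 D2)
  qed
  define T where "T n = (\<Sum>k. fps_nth \<Phi> k * fps_nth (H ^ k) n)" for n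
  define T2 where "T2 n = (\<Sum>k. fps_nth \<Phi>2 k * fps_nth (H ^ k) n)" for n
  have smT: "summable (\<lambda>k. fps_nth \<Phi> k * fps_nth (H ^ k) n)" for n
    by (rule subcritical_coeff_asymp(2)[OF H lam \<Phi>n rad\<Phi>[unfolded \<tau>_def]])
  have Tlim: "(\<lambda>n. T n * \<rho>H ^ n * real n powr (lam + 1)) \<longlonglongrightarrow> L * (q * eval_fps (fps_deriv G) x)"
    using subcritical_coeff_asymp(1)[OF H lam \<Phi>n rad\<Phi>[unfolded \<tau>_def]]
    by (simp add: T_def L_def D1[symmetric] \<tau>_def[symmetric] mult_ac)
  have \<Phi>2nn: "fps_nth \<Phi>2 k \<ge> 0" for k using \<Phi>n by (simp add: \<Phi>2n)
  have smT2: "summable (\<lambda>k. fps_nth \<Phi>2 k * fps_nth (H ^ k) n)" for n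
    by (rule subcritical_coeff_asymp(2)[OF H lam \<Phi>2nn rad\<Phi>2[unfolded \<tau>_def]])
  have T2lim: "(\<lambda>n. T2 n * \<rho>H ^ n * real n powr (lam + 1)) \<longlonglongrightarrow> L * (q * eval_fps (fps_deriv G) x + \<tau> * (q * (q * eval_fps (fps_deriv (fps_deriv G)) x)))"
    using subcritical_coeff_asymp(1)[OF H lam \<Phi>2nn rad\<Phi>2[unfolded \<tau>_def]]
    by (simp add: T2_def L_def D3[symmetric] \<tau>_def[symmetric] mult_ac)
  have klim: "(\<lambda>n. fps_nth (H ^ k) n * \<rho>H ^ n * real n powr (lam + 1)) \<longlonglongrightarrow> L * (real k * \<tau> ^ (k - 1))" for k
    by (rule power_coeff_asymp[OF H lam, of k, folded \<tau>_def L_def])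
  have den: "L * (q * eval_fps (fps_deriv G) x) > 0" using L q G'0 by simp
  have Tpos: "\<forall>\<^sub>F n in sequentially. T n * \<rho>H ^ n * real n powr (lam + 1) > 0"
    by (rule order_tendstoD(1)[OF Tlim den])
  have pmf: "\<forall>\<^sub>F n in sequentially. T n > 0 \<and> n > 0 \<and> (\<forall>k. pmf (gibbs_pmf G H q n) k = fps_nth \<Phi> k * fps_nth (H ^ k) n / T n)"
    using Tpos eventually_gt_at_top[of 0]
  proof eventually_elim
    case (elim n)
    have "T n > 0" using elim \<rho>H by (simp add: zero_less_mult_iff)
    then show ?case using gibbs_pmf_nth[OF Gn Hn q(1), of n] smT[of n] elim by (simp add: \<Phi>_def T_def)
  qed
  have ratio: "(\<lambda>n. a n / T n) \<longlonglongrightarrow> A / (L * (q * eval_fps (fps_deriv G) x))"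
    if "(\<lambda>n. a n * \<rho>H ^ n * real n powr (lam + 1)) \<longlonglongrightarrow> A" for a A
  proof (rule Lim_transform_eventually[OF tendsto_divide[OF that Tlim]])
    show "\<forall>\<^sub>F n in sequentially. (a n * \<rho>H ^ n * real n powr (lam + 1)) / (T n * \<rho>H ^ n * real n powr (lam + 1)) = a n / T n"
      using eventually_gt_at_top[of 0] by eventually_elim (use \<rho>H in simp)
  qed (rule less_imp_neq[OF den, symmetric])
  have P: "(\<lambda>n. pmf (gibbs_pmf G H q n) k) \<longlonglongrightarrow> fps_nth \<Phi> k * (L * (real k * \<tau> ^ (k - 1))) / (L * (q * eval_fps (fps_deriv G) x))" for k
  proof (rule Lim_transform_eventually[OF ratio])
    show "(\<lambda>n. fps_nth \<Phi> k * fps_nth (H ^ k) n * \<rho>H ^ n * real n powr (lam + 1)) \<longlonglongrightarrow> fps_nth \<Phi> k * (L * (real k * \<tau> ^ (k - 1)))"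
      using tendsto_mult_left[OF klim[of k], of "fps_nth \<Phi> k"] by (simp add: mult_ac)
    show "\<forall>\<^sub>F n in sequentially. fps_nth \<Phi> k * fps_nth (H ^ k) n / T n = pmf (gibbs_pmf G H q n) k"
      using pmf by eventually_elim simp
  qed
  show "(\<lambda>n. pmf (gibbs_pmf G H q n) 0) \<longlonglongrightarrow> 0" using P[of 0] by simp
  have "fps_nth \<Phi> (Suc j) * (L * (real (Suc j) * \<tau> ^ (Suc j - 1))) / (L * (q * eval_fps (fps_deriv G) x)) = fps_nth (fps_deriv G) j * x ^ j / eval_fps (fps_deriv G) x"
    using L q by (simp add: \<Phi>_def x power_mult_distrib mult_ac)
  with P[of "Suc j"] show "(\<lambda>n. pmf (gibbs_pmf G H q n) (Suc j)) \<longlonglongrightarrow> fps_nth (fps_deriv G) j * x ^ j / eval_fps (fps_deriv G) x"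
    by simp
  have "(\<lambda>n. T2 n / T n) \<longlonglongrightarrow> (L * (q * eval_fps (fps_deriv G) x + \<tau> * (q * (q * eval_fps (fps_deriv (fps_deriv G)) x)))) / (L * (q * eval_fps (fps_deriv G) x))"
    by (rule ratio[OF T2lim])
  also have "(L * (q * eval_fps (fps_deriv G) x + \<tau> * (q * (q * eval_fps (fps_deriv (fps_deriv G)) x)))) / (L * (q * eval_fps (fps_deriv G) x)) =
     1 + x * eval_fps (fps_deriv (fps_deriv G)) x / eval_fps (fps_deriv G) x"
    using L q G'0 by (simp add: x add_divide_distrib distrib_left)
  finally have lim: "(\<lambda>n. T2 n / T n) \<longlonglongrightarrow> 1 + x * eval_fps (fps_deriv (fps_deriv G)) x / eval_fps (fps_deriv G) x" .
  show "(\<lambda>n. measure_pmf.expectation (gibbs_pmf G H q n) real) \<longlonglongrightarrow>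
           1 + x * eval_fps (fps_deriv (fps_deriv G)) x / eval_fps (fps_deriv G) x"
  proof (rule Lim_transform_eventually[OF lim])
    show "\<forall>\<^sub>F n in sequentially. T2 n / T n = measure_pmf.expectation (gibbs_pmf G H q n) real"
      using pmf
    proof eventually_elim
      case (elim n)
      have e: "pmf (gibbs_pmf G H q n) k * real k = fps_nth \<Phi>2 k * fps_nth (H ^ k) n / T n" for k
        using elim by (simp add: \<Phi>2n)
      have "summable (\<lambda>k. pmf (gibbs_pmf G H q n) k * norm (real k))"
        using summable_divide[OF smT2[of n], of "T n"] by (simp add: e)
      from pmf_nat_expectation(2)[OF this]
      show ?case using suminf_divide[OF smT2[of n], of "T n"] by (simp add: e T2_def)
    qed
  qed
qed

section \<open>The Boltzmann law and its negative binomial case\<close>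

lemma deriv_compose_linear_nth:
  "fps_nth (fps_deriv G oo (fps_const x * fps_X)) k = fps_nth (fps_deriv G) k * x ^ k" for G :: "real fps"
  unfolding fps_compose_linear by (simp add: mult.commute)

lemma pmf_boltzmann:
  assumes "\<And>k. fps_nth G k \<ge> 0" "0 < x" "ereal x < fps_conv_radius G" "eval_fps (fps_deriv G) x > 0"
  shows "pmf (boltzmann_pmf G x) k = fps_nth (fps_deriv G) k * x ^ k / eval_fps (fps_deriv G) x"
proof -
  have "ereal x < fps_conv_radius (fps_deriv G)"
    using assms(3) fps_conv_radius_deriv by (rule less_le_trans)
  then have "(\<lambda>k. fps_nth (fps_deriv G) k * x ^ k) sums eval_fps (fps_deriv G) x"
    using sums_eval_fps[of x "fps_deriv G"] assms by simp
  from sums_divide[OF this, of "eval_fps (fps_deriv G) x"] assms(4)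
  have "(\<lambda>k. fps_nth (fps_deriv G) k * x ^ k / eval_fps (fps_deriv G) x) sums 1" by simp
  then show ?thesis
    unfolding boltzmann_pmf_def deriv_compose_linear_nth
    by (intro pmf_embed_pmf_sums) (use assms in auto)
qed

lemma pow_coeff_sums_real:
  assumes "\<bar>x\<bar> < 1"
  shows "(\<lambda>n. pow_coeff a n * x ^ n) sums ((1 - x) powr a)"
proof -
  have "(\<lambda>n. complex_of_real (pow_coeff a n) * of_real x ^ n) sums ((1 - of_real x) powr of_real a)"
    by (rule pow_coeff_sums) (use assms in simp)
  also have "(1 - of_real x) powr of_real a = complex_of_real ((1 - x) powr a)"
    using powr_of_real[of "1 - x" a] assms by simp
  also have "(\<lambda>n. complex_of_real (pow_coeff a n) * of_real x ^ n) = (\<lambda>n. of_real (pow_coeff a n * x ^ n))" by simp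
  finally show ?thesis by (simp only: sums_of_real_iff)
qed

text \<open>For a real \<open>m\<close>, the assumptions on \<open>G\<close> force
  \<open>m > 0\<close> and \<open>x < 1\<close>. Then both laws are \<open>embed_pmf\<close> of one
  and the same function.\<close>

lemma boltzmann_eq_negbin:
  assumes G: "delta_singular G \<rho>G lamG cG" and lamG: "lamG < 0"
    and Gm: "G = fps_binomial (- m) oo (- fps_X)" and x: "0 < x" "x < \<rho>G"
  shows "boltzmann_pmf G x = negbin_pmf (m + 1) (1 - x)"
proof -
  have Gn: "\<And>k. fps_nth G k \<ge> 0" and radG: "fps_conv_radius G = ereal \<rho>G" and \<rho>G: "\<rho>G > 0"
    using G by (auto simp: delta_singular_def)
  have Gk: "fps_nth G k = pow_coeff (- m) k" for k
  proof -
    have "- fps_X = fps_const (-1) * (fps_X :: real fps)" by simp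
    then show ?thesis unfolding Gm pow_coeff_def by (simp only: fps_compose_linear) simp
  qed
  have m0: "m > 0"
  proof -
    have "m \<ge> 0" using Gn[of 1] by (simp add: Gk pow_coeff_pochhammer)
    moreover have "m \<noteq> 0"
    proof
      assume "m = 0"
      then have "fps_nth G k = 0" if "k \<ge> 1" for k using that by (simp add: Gk pow_coeff_pochhammer pochhammer_0_left)
      then show False using delta_singular_nonpoly[OF G, of 1] by auto
    qed
    ultimately show ?thesis by simp
  qed
  \<comment> \<open>If \<open>\<rho>G > 1\<close>, the coefficients, of order
    \<open>n powr (m - 1)\<close>, multiplied by \<open>\<rho>G ^ n * n powr (lamG + 1)\<close>
    would be unbounded, whereas this product converges.\<close>
  have "\<rho>G \<le> 1"
  proof (rule ccontr)
    assume "\<not> \<rho>G \<le> 1"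
    then have g1: "\<rho>G > 1" by simp
    have A: "(\<lambda>n. pow_coeff (-m) n * real n powr (- m + 1)) \<longlonglongrightarrow> rGamma (- (- m))" by (rule pow_coeff_asymp)
    have "rGamma m > 0" using Gamma_real_pos[OF m0] by (simp add: rGamma_inverse_Gamma)
    moreover have "filterlim (\<lambda>n::nat. \<rho>G ^ n * real n powr (lamG + m)) at_top sequentially"
      using g1 by real_asymp
    ultimately have "filterlim (\<lambda>n. (pow_coeff (-m) n * real n powr (- m + 1)) * (\<rho>G ^ n * real n powr (lamG + m))) at_top sequentially"
      by (intro filterlim_tendsto_pos_mult_at_top[OF A]) auto
    moreover have "\<forall>\<^sub>F n in sequentially. (pow_coeff (-m) n * real n powr (- m + 1)) * (\<rho>G ^ n * real n powr (lamG + m)) = fps_nth G n * \<rho>G ^ n * real n powr (lamG + 1)"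
      using eventually_gt_at_top[of 0]
    proof eventually_elim
      case (elim n)
      have "real n powr (- m + 1) * real n powr (lamG + m) = real n powr (lamG + 1)"
        unfolding powr_add[symmetric] by (simp add: algebra_simps)
      then show ?case by (simp add: Gk mult_ac)
    qed
    ultimately have "filterlim (\<lambda>n. fps_nth G n * \<rho>G ^ n * real n powr (lamG + 1)) at_top sequentially"
      by (rule filterlim_cong[OF refl refl, THEN iffD1, rotated])
    then have "filterlim (\<lambda>n. fps_nth G n * \<rho>G ^ n * real n powr (lamG + 1)) at_infinity sequentially"
      by (rule filterlim_at_top_imp_at_infinity)
    moreover have "(\<lambda>n. fps_nth G n * \<rho>G ^ n * real n powr (lamG + 1)) \<longlonglongrightarrow> cG * rGamma (- lamG)"
      by (rule delta_singular_coeff_asymp[OF G]) (use lamG in simp)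
    ultimately show False using not_tendsto_and_filterlim_at_infinity[OF sequentially_bot] by blast
  qed
  then have x1: "x < 1" using x by simp
  have G'k: "fps_nth (fps_deriv G) k = m * pow_coeff (- (m + 1)) k" for k
    by (simp add: Gk pow_coeff_pochhammer pochhammer_rec add.commute del: of_nat_Suc)
  have "(\<lambda>k. m * (pow_coeff (- (m + 1)) k * x ^ k)) sums (m * (1 - x) powr (- (m + 1)))"
    by (intro sums_mult pow_coeff_sums_real) (use x x1 in auto)
  then have G': "eval_fps (fps_deriv G) x = m * (1 - x) powr (- (m + 1))"
    unfolding eval_fps_def G'k by (simp add: sums_iff mult.assoc)
  have "(real k + (m + 1) - 1) gchoose k = pow_coeff (- (m + 1)) k" for k
    by (simp add: gbinomial_pochhammer' pow_coeff_pochhammer add.commute)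
  then have "fps_nth (fps_deriv G oo (fps_const x * fps_X)) k / eval_fps (fps_deriv G) x =
      ((real k + (m + 1) - 1) gchoose k) * (1 - x) powr (m + 1) * (1 - (1 - x)) ^ k" for k
    unfolding deriv_compose_linear_nth G'k G' powr_minus using m0 x1 by (simp add: divide_inverse mult_ac)
  then show ?thesis unfolding boltzmann_pmf_def negbin_pmf_def by simp
qed

lemma subcritical_regime:
  assumes G: "delta_singular G \<rho>G lamG cG" and lamG: "lamG < 0"
    and H: "delta_singular H \<rho>H lam c" and lam: "0 < lam" "lam < 1"
    and q: "0 < q" "q < \<rho>G / eval_fps H \<rho>H"
  defines "x \<equiv> q * eval_fps H \<rho>H"
  shows "weak_conv_m (\<lambda>n. distr (gibbs_pmf G H q n) borel (\<lambda>k. real k - 1)) (distr (boltzmann_pmf G x) borel real)"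
    and "(\<lambda>n. measure_pmf.prob (gibbs_pmf G H q n) {j. real j - 1 = real k}) \<longlonglongrightarrow>
            fps_nth (fps_deriv G oo (fps_const x * fps_X)) k / eval_fps (fps_deriv G) x"
    and "G = fps_binomial (- m) oo (- fps_X) \<Longrightarrow>
          weak_conv_m (\<lambda>n. distr (gibbs_pmf G H q n) borel (\<lambda>k. real k - 1)) (distr (negbin_pmf (m + 1) (1 - x)) borel real)"
    and "(\<lambda>n. measure_pmf.expectation (gibbs_pmf G H q n) real) \<sim>[sequentially]
          (\<lambda>n. 1 + x * eval_fps (fps_deriv (fps_deriv G)) x / eval_fps (fps_deriv G) x)"
proof -
  note S = subcritical_pmf[OF G H lam q, folded x_def]
  have Gn: "\<And>k. fps_nth G k \<ge> 0" and radG: "fps_conv_radius G = ereal \<rho>G"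
    using G by (auto simp: delta_singular_def)
  show W: "weak_conv_m (\<lambda>n. distr (gibbs_pmf G H q n) borel (\<lambda>k. real k - 1)) (distr (boltzmann_pmf G x) borel real)"
  proof (rule weak_conv_shifted_pmf[OF S(1)])
    show "(\<lambda>n. pmf (gibbs_pmf G H q n) (Suc j)) \<longlonglongrightarrow> pmf (boltzmann_pmf G x) j" for j
      using S(2)[of j] pmf_boltzmann[of G x j] S(4-6) Gn radG by simp
  qed
  have "{j. real j - 1 = real k} = {Suc k}" by auto
  then show "(\<lambda>n. measure_pmf.prob (gibbs_pmf G H q n) {j. real j - 1 = real k}) \<longlonglongrightarrow>
            fps_nth (fps_deriv G oo (fps_const x * fps_X)) k / eval_fps (fps_deriv G) x"
    unfolding deriv_compose_linear_nth using S(2)[of k] by (simp add: measure_pmf_single)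
  show "weak_conv_m (\<lambda>n. distr (gibbs_pmf G H q n) borel (\<lambda>k. real k - 1)) (distr (negbin_pmf (m + 1) (1 - x)) borel real)"
    if "G = fps_binomial (- m) oo (- fps_X)"
    using W boltzmann_eq_negbin[OF G lamG that S(4,5)] by simp
  have radG2: "ereal x < fps_conv_radius (fps_deriv (fps_deriv G))"
    using S(5) radG fps_conv_radius_deriv[of G] fps_conv_radius_deriv[of "fps_deriv G"]
    by (metis less_ereal.simps(1) less_le_trans)
  have "eval_fps (fps_deriv (fps_deriv G)) x \<ge> 0"
  proof (rule eval_fps_nonneg)
    show "summable (\<lambda>n. fps_nth (fps_deriv (fps_deriv G)) n * x ^ n)"
      by (rule summable_fps) (use S(4) radG2 in simp)
  qed (use Gn S(4) in auto)
  then have "1 + x * eval_fps (fps_deriv (fps_deriv G)) x / eval_fps (fps_deriv G) x > 0"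
    using S(4,6) by (intro add_pos_nonneg) auto
  then have "1 + x * eval_fps (fps_deriv (fps_deriv G)) x / eval_fps (fps_deriv G) x \<noteq> 0" by simp
  from tendsto_imp_asymp_equiv_const[OF S(3) this]
  show "(\<lambda>n. measure_pmf.expectation (gibbs_pmf G H q n) real) \<sim>[sequentially]
          (\<lambda>n. 1 + x * eval_fps (fps_deriv (fps_deriv G)) x / eval_fps (fps_deriv G) x)" .
qed

section \<open>The critical regime\<close>

text \<open>The factor \<open>k ^ r\<close> shifts the exponent: the weighted coefficients of
  \<open>G\<close> are comparable to those of \<open>(1 - u) powr (lamG - r)\<close>, and the
  constant picks up \<open>Gamma (- lamG + r)\<close>.\<close>

lemma singular_coeff_ratio:
  assumes G: "delta_singular G \<rho>G lamG cG" and lamG: "lamG < 0"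
  shows "(\<lambda>k. fps_nth G k * \<rho>G ^ k * real k ^ r / pow_coeff (- (- lamG + real r)) k) \<longlonglongrightarrow>
           cG * rGamma (- lamG) * Gamma (- lamG + real r)"
proof -
  define s where "s = - lamG + real r"
  have s: "s > 0" using lamG by (simp add: s_def)
  have Gs: "Gamma s > 0" by (rule Gamma_real_pos[OF s])
  have "(\<lambda>k. (fps_nth G k * \<rho>G ^ k * real k powr (lamG + 1)) / (pow_coeff (-s) k * real k powr (-s + 1))) \<longlonglongrightarrow>
     (cG * rGamma (- lamG)) / rGamma (- (- s))"
    by (intro tendsto_divide delta_singular_coeff_asymp[OF G] pow_coeff_asymp)
       (use lamG Gs in \<open>auto simp: rGamma_inverse_Gamma\<close>)
  also have "(cG * rGamma (- lamG)) / rGamma (- (- s)) = cG * rGamma (- lamG) * Gamma s"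
    by (simp only: minus_minus rGamma_inverse_Gamma[of s] divide_inverse inverse_inverse_eq)
  finally show ?thesis unfolding s_def[symmetric]
  proof (rule Lim_transform_eventually)
    show "\<forall>\<^sub>F k in sequentially. (fps_nth G k * \<rho>G ^ k * real k powr (lamG + 1)) / (pow_coeff (-s) k * real k powr (-s + 1)) =
       fps_nth G k * \<rho>G ^ k * real k ^ r / pow_coeff (-s) k"
      using eventually_gt_at_top[of 0]
    proof eventually_elim
      case (elim k)
      have "real k powr (lamG + 1) = real k powr (-s + 1) * real k powr real r"
        unfolding powr_add[symmetric] by (simp add: s_def)
      also have "real k powr real r = real k ^ r" using elim by (intro powr_realpow) simp
      finally show ?case using elim by simp
    qed
  qed
qed

text \<open>The moment of order \<open>r\<close> is a quotient \<open>T r n / T 0 n\<close>. Each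
  sum is reduced by \<open>weighted_ratio_limit\<close> to the coefficients of
  \<open>(1 - H/\<tau>) powr - (\<theta> + r)\<close>, and the constant of \<open>G\<close> cancels
  in the quotient.\<close>

lemma critical_moments:
  assumes G: "delta_singular G \<rho>G lamG cG" and lamG: "lamG < 0"
    and H: "delta_singular H \<rho>H lam c" and lam: "0 < lam" "lam < 1"
  defines "\<tau> \<equiv> eval_fps H \<rho>H"
  defines "X \<equiv> gibbs_pmf G H (\<rho>G / \<tau>)"
  shows "(\<lambda>n. measure_pmf.expectation (X n) (\<lambda>k. real k ^ r) / real n powr (lam * real r)) \<longlonglongrightarrow>
           mittag_leffler_moment lam (- lamG * lam) r / (- c / \<tau>) ^ r"
    and "\<forall>\<^sub>F n in sequentially. \<forall>r. integrable (measure_pmf (X n)) (\<lambda>k. real k ^ r)"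
    and "\<tau> > 0" "c < 0"
proof -
  have Gn: "\<And>k. fps_nth G k \<ge> 0" and \<rho>G: "\<rho>G > 0"
    using G by (auto simp: delta_singular_def)
  have Hn: "\<And>k. fps_nth H k \<ge> 0" and \<rho>H: "\<rho>H > 0" using H by (auto simp: delta_singular_def)
  define \<theta> where "\<theta> = - lamG"
  have \<theta>: "\<theta> > 0" using lamG by (simp add: \<theta>_def)
  define Ht where "Ht = fps_const (1 / \<tau>) * H"
  note CA = critical_coeff_asymp[OF H lam, folded \<tau>_def, folded Ht_def]
  show \<tau>: "\<tau> > 0" and c: "c < 0" using CA(3,4)[of 1] by auto
  define b where "b = - c / \<tau>"
  have b: "b > 0" using c \<tau> by (simp add: b_def divide_neg_pos)
  define w where "w n k = fps_nth (Ht ^ k) n" for n k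
  have w0: "w n k \<ge> 0" for n k unfolding w_def Ht_def by (rule nonneg_fps_power) (use Hn \<tau> in simp)
  have wH: "w n k = fps_nth (H ^ k) n / \<tau> ^ k" for n k
    unfolding w_def Ht_def by (simp add: power_mult_distrib fps_const_power power_divide)
  define W where "W s n = (\<Sum>k. pow_coeff (-s) k * w n k)" for s n
  have smW: "summable (\<lambda>k. pow_coeff (-s) k * w n k)" if "s > 0" for s n
    unfolding w_def by (rule CA(2)[OF that])
  have Wlim: "(\<lambda>n. W s n * \<rho>H ^ n * real n powr (1 - lam * s)) \<longlonglongrightarrow> b powr (-s) * rGamma (lam * s)" if "s > 0" for s
    unfolding W_def w_def b_def by (rule CA(1)[OF that])
  have Wc: "b powr (-s) * rGamma (lam * s) > 0" if "s > 0" for s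
    using b lam that Gamma_real_pos[of "lam * s"] by (simp add: rGamma_inverse_Gamma)
  have Wpos: "\<forall>\<^sub>F n in sequentially. W s n > 0" if "s > 0" for s
    using order_tendstoD(1)[OF Wlim[OF that] Wc[OF that]] eventually_gt_at_top[of 0]
    by eventually_elim (use \<rho>H in \<open>simp add: zero_less_mult_iff\<close>)
  \<comment> \<open>For fixed \<open>k\<close> the numerator has order
    \<open>n powr (- lam - 1)\<close> and the sum order \<open>n powr (lam * s - 1)\<close>, up to a
    common exponential factor; the quotient decays like
    \<open>n powr (- lam - lam * s)\<close>.\<close>
  have neg: "(\<lambda>n. w n k / W s n) \<longlonglongrightarrow> 0" if s: "s > 0" for s k
  proof -
    have K: "(\<lambda>n. fps_nth (H ^ k) n * \<rho>H ^ n * real n powr (lam + 1) / \<tau> ^ k) \<longlonglongrightarrow> (c * rGamma (- lam)) * (real k * eval_fps H \<rho>H ^ (k - 1)) / \<tau> ^ k"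
      by (intro tendsto_divide power_coeff_asymp[OF H lam] tendsto_const) (use \<tau> in auto)
    have A: "(\<lambda>n. (fps_nth (H ^ k) n * \<rho>H ^ n * real n powr (lam + 1) / \<tau> ^ k) / (W s n * \<rho>H ^ n * real n powr (1 - lam * s))) \<longlonglongrightarrow>
        (c * rGamma (- lam)) * (real k * eval_fps H \<rho>H ^ (k - 1)) / \<tau> ^ k / (b powr (-s) * rGamma (lam * s))"
      by (rule tendsto_divide[OF K Wlim[OF s] less_imp_neq[OF Wc[OF s], symmetric]])
    have "lam + lam * s > 0" using lam s by (simp add: add_pos_pos)
    then have "(\<lambda>n. real n powr (- (lam + lam * s))) \<longlonglongrightarrow> 0"
      by (intro tendsto_neg_powr filterlim_real_sequentially) simp
    from tendsto_mult[OF A this]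
    have "(\<lambda>n. (fps_nth (H ^ k) n * \<rho>H ^ n * real n powr (lam + 1) / \<tau> ^ k) / (W s n * \<rho>H ^ n * real n powr (1 - lam * s)) * real n powr (- (lam + lam * s))) \<longlonglongrightarrow> 0"
      by simp
    then show ?thesis
    proof (rule Lim_transform_eventually)
      show "\<forall>\<^sub>F n in sequentially. (fps_nth (H ^ k) n * \<rho>H ^ n * real n powr (lam + 1) / \<tau> ^ k) / (W s n * \<rho>H ^ n * real n powr (1 - lam * s)) * real n powr (- (lam + lam * s)) = w n k / W s n"
        using eventually_gt_at_top[of 0]
      proof eventually_elim
        case (elim n)
        have "real n powr (lam + 1) * real n powr (- (lam + lam * s)) = real n powr (1 - lam * s)"
          unfolding powr_add[symmetric] by simp
        then have e: "real n powr (- (lam + lam * s)) = real n powr (1 - lam * s) / real n powr (lam + 1)"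
          using elim by (simp add: field_simps)
        show ?case unfolding e using elim \<rho>H by (simp add: wH)
      qed
    qed
  qed
  define C where "C = cG * rGamma (- lamG)"
  have C: "C > 0" unfolding C_def by (rule delta_singular_coeff_const_pos[OF G]) (use lamG in simp)
  define T where "T r n = (\<Sum>k. (fps_nth G k * \<rho>G ^ k * real k ^ r) * w n k)" for r n
  have Trat: "(\<lambda>n. T r n / W (\<theta> + real r) n) \<longlonglongrightarrow> C * Gamma (\<theta> + real r)"
    and smT: "summable (\<lambda>k. (fps_nth G k * \<rho>G ^ k * real k ^ r) * w n k)" for r n
  proof -
    have s: "\<theta> + real r > 0" using \<theta> by simp
    note R = weighted_ratio_limit[of "pow_coeff (- (\<theta> + real r))" "\<lambda>k. fps_nth G k * \<rho>G ^ k * real k ^ r" "C * Gamma (\<theta> + real r)" w,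
       OF pow_coeff_neg_pos[OF s] _ w0 smW[OF s] Wpos[OF s, unfolded W_def] neg[OF s, unfolded W_def]]
    have L: "(\<lambda>k. fps_nth G k * \<rho>G ^ k * real k ^ r / pow_coeff (- (\<theta> + real r)) k) \<longlonglongrightarrow> C * Gamma (\<theta> + real r)"
      using singular_coeff_ratio[OF G lamG, of r] by (simp add: \<theta>_def C_def)
    show "(\<lambda>n. T r n / W (\<theta> + real r) n) \<longlonglongrightarrow> C * Gamma (\<theta> + real r)"
      unfolding T_def W_def by (rule R(1)[OF L])
    show "summable (\<lambda>k. (fps_nth G k * \<rho>G ^ k * real k ^ r) * w n k)" by (rule R(2)[OF L])
  qed
  have Tlim: "(\<lambda>n. T r n * \<rho>H ^ n * real n powr (1 - lam * (\<theta> + real r))) \<longlonglongrightarrow>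
      C * Gamma (\<theta> + real r) * (b powr (- (\<theta> + real r)) * rGamma (lam * (\<theta> + real r)))" for r
  proof -
    have s: "\<theta> + real r > 0" using \<theta> by simp
    show ?thesis
      by (rule Lim_transform_eventually[OF tendsto_mult[OF Trat Wlim[OF s]]])
         (use Wpos[OF s] in eventually_elim, simp)
  qed
  have T0: "T 0 n = (\<Sum>k. fps_nth G k * \<rho>G ^ k * w n k)" for n by (simp add: T_def)
  have cpos: "C * Gamma (\<theta> + real 0) * (b powr (- (\<theta> + real 0)) * rGamma (lam * (\<theta> + real 0))) > 0"
    using C \<theta> Wc[OF \<theta>] Gamma_real_pos[OF \<theta>] by simp
  have Tpos: "\<forall>\<^sub>F n in sequentially. T 0 n > 0"
    using order_tendstoD(1)[OF Tlim[of 0] cpos] eventually_gt_at_top[of 0]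
    by eventually_elim (use \<rho>H in \<open>simp add: zero_less_mult_iff\<close>)
  have sc: "(\<rho>G / \<tau>) ^ k * fps_nth G k * fps_nth (H ^ k) n = fps_nth G k * \<rho>G ^ k * w n k" for k n
    using \<tau> by (simp add: wH power_divide)
  have pmf: "\<forall>\<^sub>F n in sequentially. T 0 n > 0 \<and> (\<forall>k. pmf (X n) k = fps_nth G k * \<rho>G ^ k * w n k / T 0 n)"
    using Tpos
  proof eventually_elim
    case (elim n)
    have "pmf (X n) k = fps_nth G k * \<rho>G ^ k * w n k / T 0 n" for k
      using gibbs_pmf_nth[OF Gn Hn, of "\<rho>G / \<tau>" n k] \<rho>G \<tau> smT[of 0 n] elim
      by (simp add: X_def sc T0)
    then show ?case using elim by simp
  qed
  have exp: "\<forall>\<^sub>F n in sequentially. \<forall>r. integrable (measure_pmf (X n)) (\<lambda>k. real k ^ r) \<and>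
      measure_pmf.expectation (X n) (\<lambda>k. real k ^ r) = T r n / T 0 n"
    using pmf
  proof eventually_elim
    case (elim n)
    show ?case
    proof
      fix r
      have e: "pmf (X n) k * real k ^ r = (fps_nth G k * \<rho>G ^ k * real k ^ r) * w n k / T 0 n" for k
        using elim by simp
      have "summable (\<lambda>k. pmf (X n) k * norm (real k ^ r))"
        using summable_divide[OF smT[of r n], of "T 0 n"] by (simp add: e)
      from pmf_nat_expectation[OF this]
      show "integrable (measure_pmf (X n)) (\<lambda>k. real k ^ r) \<and>
         measure_pmf.expectation (X n) (\<lambda>k. real k ^ r) = T r n / T 0 n"
        using suminf_divide[OF smT[of r n], of "T 0 n"] by (simp add: e T_def[symmetric])
    qed
  qed
  then show "\<forall>\<^sub>F n in sequentially. \<forall>r. integrable (measure_pmf (X n)) (\<lambda>k. real k ^ r)"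
    by eventually_elim simp
  \<comment> \<open>In the quotient of limits the powers of \<open>b\<close> leave
    \<open>1 / b ^ r\<close>, and the four Gamma values form the Mittag-Leffler moment.\<close>
  have "(\<lambda>n. (T r n * \<rho>H ^ n * real n powr (1 - lam * (\<theta> + real r))) / (T 0 n * \<rho>H ^ n * real n powr (1 - lam * (\<theta> + real 0)))) \<longlonglongrightarrow>
     (C * Gamma (\<theta> + real r) * (b powr (- (\<theta> + real r)) * rGamma (lam * (\<theta> + real r)))) /
     (C * Gamma (\<theta> + real 0) * (b powr (- (\<theta> + real 0)) * rGamma (lam * (\<theta> + real 0))))"
    by (rule tendsto_divide[OF Tlim Tlim less_imp_neq[OF cpos, symmetric]])
  also have "(C * Gamma (\<theta> + real r) * (b powr (- (\<theta> + real r)) * rGamma (lam * (\<theta> + real r)))) /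
     (C * Gamma (\<theta> + real 0) * (b powr (- (\<theta> + real 0)) * rGamma (lam * (\<theta> + real 0)))) =
     mittag_leffler_moment lam (- lamG * lam) r / b ^ r"
  proof -
    have "b powr (- (\<theta> + real r)) = b powr (-\<theta>) / b ^ r"
      using b by (simp add: powr_diff powr_realpow)
    moreover have "- lamG * lam / lam = \<theta>" using lam by (simp add: \<theta>_def)
    moreover have "lam * (\<theta> + real r) = lam * real r + - lamG * lam" "lam * (\<theta> + real 0) = - lamG * lam"
      by (simp_all add: \<theta>_def algebra_simps)
    ultimately show ?thesis using C b Gamma_real_pos[OF \<theta>]
      by (simp add: mittag_leffler_moment_def rGamma_inverse_Gamma divide_inverse mult_ac add.commute)
  qed
  finally show "(\<lambda>n. measure_pmf.expectation (X n) (\<lambda>k. real k ^ r) / real n powr (lam * real r)) \<longlonglongrightarrow>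
           mittag_leffler_moment lam (- lamG * lam) r / (- c / \<tau>) ^ r"
    unfolding b_def[symmetric]
  proof (rule Lim_transform_eventually)
    show "\<forall>\<^sub>F n in sequentially. (T r n * \<rho>H ^ n * real n powr (1 - lam * (\<theta> + real r))) / (T 0 n * \<rho>H ^ n * real n powr (1 - lam * (\<theta> + real 0))) =
       measure_pmf.expectation (X n) (\<lambda>k. real k ^ r) / real n powr (lam * real r)"
      using exp eventually_gt_at_top[of 0]
    proof eventually_elim
      case (elim n)
      have "real n powr (1 - lam * (\<theta> + real r)) * real n powr (lam * real r) = real n powr (1 - lam * (\<theta> + real 0))"
        unfolding powr_add[symmetric] by (simp add: algebra_simps)
      then have e: "real n powr (1 - lam * (\<theta> + real r)) = real n powr (1 - lam * (\<theta> + real 0)) / real n powr (lam * real r)"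
        using elim by (simp add: field_simps)
      show ?case unfolding e using elim \<rho>H by simp
    qed
  qed
qed

lemma critical_regime:
  assumes G: "delta_singular G \<rho>G lamG cG" and lamG: "lamG < 0"
    and H: "delta_singular H \<rho>H lam c" and lam: "0 < lam" "lam < 1"
  defines "\<tau> \<equiv> eval_fps H \<rho>H"
  defines "X \<equiv> gibbs_pmf G H (\<rho>G / \<tau>)"
  shows "weak_conv_m (\<lambda>n. distr (X n) borel (\<lambda>k. - c * real k / (\<tau> * real n powr lam)))
         (mittag_leffler_distribution lam (- lamG * lam))"
    and "(\<lambda>n. measure_pmf.expectation (X n) real) \<sim>[sequentially]
         (\<lambda>n. lamG * \<tau> * Gamma (- lamG * lam) / (c * Gamma ((1 - lamG) * lam)) * real n powr lam)"
proof -
  note M = critical_moments[OF G lamG H lam, folded \<tau>_def, folded X_def]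
  have \<tau>: "\<tau> > 0" and c: "c < 0" using M(3,4) by auto
  define b where "b = - c / \<tau>"
  have b: "b > 0" using c \<tau> by (simp add: b_def divide_neg_pos)
  have \<beta>: "- lamG * lam > 0" using lamG lam by (simp add: mult_neg_pos)
  let ?D = "mittag_leffler_distribution lam (- lamG * lam)"
  let ?m = "mittag_leffler_moment lam (- lamG * lam)"
  let ?Y = "\<lambda>n k. - c * real k / (\<tau> * real n powr lam)"
  have Y: "?Y n k = b / real n powr lam * real k" for n k by (simp add: b_def)
  obtain N where N: "\<And>n r. n \<ge> N \<Longrightarrow> integrable (measure_pmf (X n)) (\<lambda>k. real k ^ r)"
    using M(2) by (auto simp: eventually_sequentially)
  \<comment> \<open>Moments are known to exist only for large \<open>n\<close>, hence the shift by
    \<open>N\<close>; \<open>LIMSEQ_offset\<close> undoes it afterwards.\<close>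
  have "weak_conv_m (\<lambda>n. distr (X (n + N)) borel (?Y (n + N))) ?D"
  proof (rule method_of_moments[where m = ?m])
    show "real_distribution (distr (X (n + N)) borel (?Y (n + N)))" for n
      by (rule prob_space.real_distribution_distr[OF prob_space_measure_pmf]) simp
    show "real_distribution ?D" by (rule real_distribution_mittag_leffler[OF lam \<beta>])
    show "integrable (distr (X (n + N)) borel (?Y (n + N))) (\<lambda>x. x ^ r)" for n r
    proof -
      have "integrable (measure_pmf (X (n + N))) (\<lambda>k. (b / real (n + N) powr lam * real k) ^ r)"
        unfolding power_mult_distrib by (intro integrable_mult_right N) simp
      then show ?thesis unfolding Y by (subst integrable_distr_eq) auto
    qed
    show "integrable ?D (\<lambda>x. x ^ r)" "(\<integral>x. x ^ r \<partial>?D) = ?m r" for r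
      using mittag_leffler_moments[OF lam \<beta>, of r] by (auto simp: has_bochner_integral_iff)
    show "(\<lambda>r. \<bar>t\<bar> ^ r * ?m r / fact r) \<longlonglongrightarrow> 0" for t
      by (rule mittag_leffler_moment_growth[OF lam(1) \<beta>])
    show "(\<lambda>n. \<integral>x. x ^ r \<partial>distr (X (n + N)) borel (?Y (n + N))) \<longlonglongrightarrow> ?m r" for r
    proof -
      have "(\<lambda>n. b ^ r * (measure_pmf.expectation (X n) (\<lambda>k. real k ^ r) / real n powr (lam * real r))) \<longlonglongrightarrow> b ^ r * (?m r / (- c / \<tau>) ^ r)"
        by (intro tendsto_mult_left M(1))
      moreover have "b ^ r * (?m r / (- c / \<tau>) ^ r) = ?m r" unfolding b_def[symmetric] using b by simp
      ultimately have A: "(\<lambda>n. b ^ r * (measure_pmf.expectation (X n) (\<lambda>k. real k ^ r) / real n powr (lam * real r))) \<longlonglongrightarrow> ?m r"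
        by (simp only:)
      have "(\<lambda>n. \<integral>x. x ^ r \<partial>distr (X n) borel (?Y n)) \<longlonglongrightarrow> ?m r"
      proof (rule Lim_transform_eventually[OF A])
        show "\<forall>\<^sub>F n in sequentially. b ^ r * (measure_pmf.expectation (X n) (\<lambda>k. real k ^ r) / real n powr (lam * real r)) = (\<integral>x. x ^ r \<partial>distr (X n) borel (?Y n))"
          using eventually_gt_at_top[of 0]
        proof eventually_elim
          case (elim n)
          have "(real n powr lam) ^ r = real n powr (lam * real r)"
            using elim by (simp add: powr_powr flip: powr_realpow)
          then show ?case unfolding Y
            by (subst integral_distr) (auto simp: power_mult_distrib power_divide)
        qed
      qed
      then show ?thesis by (rule LIMSEQ_ignore_initial_segment)
    qed
  qed
  then show "weak_conv_m (\<lambda>n. distr (X n) borel (?Y n)) ?D"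
    unfolding weak_conv_m_def weak_conv_def using LIMSEQ_offset[of "\<lambda>n. cdf (distr (X n) borel (?Y n)) _" N] by blast
  have E: "(\<lambda>n. measure_pmf.expectation (X n) real / real n powr lam) \<longlonglongrightarrow> ?m 1 / b"
    using M(1)[of 1] by (simp add: b_def)
  have m1: "?m 1 / b = lamG * \<tau> * Gamma (- lamG * lam) / (c * Gamma ((1 - lamG) * lam))"
  proof -
    have "- lamG > 0" using lamG by simp
    then have "- lamG \<notin> \<int>\<^sub>\<le>\<^sub>0" "Gamma (- lamG) > 0" by (auto elim!: nonpos_Ints_cases intro: Gamma_real_pos)
    then have "Gamma (1 + - lamG) = - lamG * Gamma (- lamG)" using Gamma_plus1[of "- lamG"] by (simp add: add.commute)
    moreover have "- lamG * lam / lam = - lamG" using lam by simp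
    moreover have "lam * real 1 + - lamG * lam = (1 - lamG) * lam" by (simp add: algebra_simps)
    ultimately show ?thesis using \<open>Gamma (- lamG) > 0\<close> \<tau> c
      by (simp add: mittag_leffler_moment_def b_def mult_ac)
  qed
  have "Gamma (- lamG * lam) > 0" "Gamma ((1 - lamG) * lam) > 0" using \<beta> lam lamG by (auto intro!: Gamma_real_pos mult_pos_pos)
  then have nz: "?m 1 / b \<noteq> 0" unfolding m1 using lamG \<tau> c by simp
  have "(\<lambda>n. measure_pmf.expectation (X n) real / real n powr lam * real n powr lam) \<sim>[sequentially] (\<lambda>n. ?m 1 / b * real n powr lam)"
    by (intro asymp_equiv_mult tendsto_imp_asymp_equiv_const[OF E nz]) simp
  moreover have "\<forall>\<^sub>F n in sequentially. measure_pmf.expectation (X n) real / real n powr lam * real n powr lam = measure_pmf.expectation (X n) real"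
    using eventually_gt_at_top[of 0] by eventually_elim simp
  ultimately show "(\<lambda>n. measure_pmf.expectation (X n) real) \<sim>[sequentially]
         (\<lambda>n. lamG * \<tau> * Gamma (- lamG * lam) / (c * Gamma ((1 - lamG) * lam)) * real n powr lam)"
    unfolding m1 by (rule asymp_equiv_transfer) simp
qed

section \<open>A central limit theorem\<close>

text \<open>A form of Vitali's theorem. If convergence failed along a subsequence, Montel's theorem
  would extract a locally uniform limit from it; this limit equals \<open>g\<close> on a real
  interval, hence on the whole disc by the identity theorem.\<close>

lemma vitali_real_axis:
  fixes M :: "nat \<Rightarrow> complex \<Rightarrow> complex"
  assumes B: "B > 0" and hol: "\<And>n. M n holomorphic_on ball 0 B" and g: "g holomorphic_on ball 0 B"
    and bd: "\<And>n z. z \<in> ball 0 B \<Longrightarrow> norm (M n z) \<le> C"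
    and lim: "\<And>s::real. \<bar>s\<bar> < B \<Longrightarrow> (\<lambda>n. M n (of_real s)) \<longlonglongrightarrow> g (of_real s)"
    and K: "compact K" "K \<subseteq> ball 0 B"
  shows "uniform_limit K M g sequentially"
proof (rule ccontr)
  assume "\<not> uniform_limit K M g sequentially"
  then obtain e where e: "e > 0" "\<not> (\<forall>\<^sub>F n in sequentially. \<forall>x\<in>K. dist (M n x) (g x) < e)"
    by (auto simp: uniform_limit_iff)
  obtain \<phi> :: "nat \<Rightarrow> nat" where \<phi>: "strict_mono \<phi>" "\<And>n. \<not> (\<forall>x\<in>K. dist (M (\<phi> n) x) (g x) < e)"
    using not_eventually_sequentiallyD[OF e(2)] by blast
  have bd': "\<exists>C. \<forall>h\<in>range (M \<circ> \<phi>). \<forall>z\<in>K'. norm (h z) \<le> C" if "K' \<subseteq> ball 0 B" for K'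
    using that bd by (intro exI[of _ C]) auto
  obtain g' r where g': "g' holomorphic_on ball 0 B" "strict_mono (r :: nat \<Rightarrow> nat)"
    "\<And>x. x \<in> ball 0 B \<Longrightarrow> (\<lambda>n. (M \<circ> \<phi>) (r n) x) \<longlonglongrightarrow> g' x"
    "\<And>K. compact K \<Longrightarrow> K \<subseteq> ball 0 B \<Longrightarrow> uniform_limit K ((M \<circ> \<phi>) \<circ> r) g' sequentially"
    by (rule Montel[of "ball 0 B" "range (M \<circ> \<phi>)" "M \<circ> \<phi>"]) (use hol bd' in auto)
  have eqr: "g' (of_real s) = g (of_real s)" if "\<bar>s\<bar> < B" for s :: real
  proof -
    have "strict_mono (\<phi> \<circ> r)" using \<phi>(1) g'(2) by (rule strict_mono_o)
    from LIMSEQ_subseq_LIMSEQ[OF lim[OF that] this]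
    have "(\<lambda>n. (M \<circ> \<phi>) (r n) (of_real s)) \<longlonglongrightarrow> g (of_real s)" by (simp add: o_def)
    moreover have "(\<lambda>n. (M \<circ> \<phi>) (r n) (of_real s)) \<longlonglongrightarrow> g' (of_real s)" by (rule g'(3)) (use that in simp)
    ultimately show ?thesis using LIMSEQ_unique by blast
  qed
  have eq: "g' z = g z" if z: "z \<in> ball 0 B" for z
  proof -
    have "g' z - g z = 0"
    proof (rule analytic_continuation[of "\<lambda>z. g' z - g z" "ball 0 B" "of_real ` {-B<..<B}" 0])
      show "(\<lambda>z. g' z - g z) holomorphic_on ball 0 B" by (intro holomorphic_intros g' g)
      show "complex_of_real ` {-B<..<B} \<subseteq> ball 0 B" by auto
      show "(0::complex) islimpt of_real ` {-B<..<B}"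
        unfolding islimpt_sequential
      proof (intro exI[of _ "\<lambda>n. complex_of_real (B / (real n + 2))"] conjI allI)
        fix n
        have b: "B / (real n + 2) < B" "0 < B / (real n + 2)" using B by (auto simp: field_simps add_pos_nonneg)
        have "- B < B / (real n + 2)" using b B by linarith
        with b show "complex_of_real (B / (real n + 2)) \<in> complex_of_real ` {-B<..<B} - {0}"
          by (intro DiffI imageI) (simp_all del: of_real_divide of_real_add)
      next
        have "(\<lambda>n. B / (real n + 2)) \<longlonglongrightarrow> 0" by real_asymp
        then have "(\<lambda>n. complex_of_real (B / (real n + 2))) \<longlonglongrightarrow> of_real 0" by (rule tendsto_of_real)
        then show "(\<lambda>n. complex_of_real (B / (real n + 2))) \<longlonglongrightarrow> 0" by (simp only: of_real_0)
      qed
      show "g' z - g z = 0" if "z \<in> of_real ` {-B<..<B}" for z using that eqr by auto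
    qed (use B z in auto)
    then show ?thesis by simp
  qed
  have "uniform_limit K ((M \<circ> \<phi>) \<circ> r) g' sequentially" by (rule g'(4)[OF K])
  then have "\<forall>\<^sub>F n in sequentially. \<forall>x\<in>K. dist (((M \<circ> \<phi>) \<circ> r) n x) (g' x) < e"
    using e(1) by (auto simp: uniform_limit_iff)
  then obtain n where "\<forall>x\<in>K. dist (((M \<circ> \<phi>) \<circ> r) n x) (g' x) < e" by (auto simp: eventually_sequentially)
  then show False using \<phi>(2)[of "r n"] eq K by (auto simp: subset_iff)
qed

text \<open>Summability at \<open>norm z\<close> and \<open>- norm z\<close> bounds the sum with
  \<open>exp (norm z * \<bar>Y k\<bar>)\<close>, so the double series over \<open>k\<close> and the
  exponential series may be interchanged. The moment generating function is thus a power series with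
  the moments as coefficients.\<close>

lemma mgf_power_series:
  fixes p :: "nat pmf" and Y :: "nat \<Rightarrow> real" and z :: complex
  assumes sm: "\<And>s. \<bar>s\<bar> \<le> norm z \<Longrightarrow> summable (\<lambda>k. pmf p k * exp (s * Y k))"
  shows "(\<lambda>m. of_real (\<Sum>k. pmf p k * Y k ^ m) / fact m * z ^ m) sums (\<Sum>k. of_real (pmf p k) * exp (z * of_real (Y k)))"
    and "z \<noteq> 0 \<Longrightarrow> summable (\<lambda>k. pmf p k * norm (Y k ^ m))"
    and "norm (\<Sum>k. of_real (pmf p k) * exp (z * of_real (Y k))) \<le>
           (\<Sum>k. pmf p k * exp (norm z * Y k)) + (\<Sum>k. pmf p k * exp (- norm z * Y k))"
proof -
  let ?x = "norm z"
  have s1: "summable (\<lambda>k. pmf p k * exp (?x * Y k))" and s2: "summable (\<lambda>k. pmf p k * exp (- ?x * Y k))"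
    using sm[of ?x] sm[of "- ?x"] by auto
  have le: "exp (?x * \<bar>y\<bar>) \<le> exp (?x * y) + exp (- ?x * y)" for y :: real
    by (cases "y \<ge> 0") (auto simp: abs_if)
  have sabs: "summable (\<lambda>k. pmf p k * exp (?x * \<bar>Y k\<bar>))"
  proof (rule summable_comparison_test'[of _ 0])
    show "summable (\<lambda>k. pmf p k * exp (?x * Y k) + pmf p k * exp (- ?x * Y k))" by (intro summable_add s1 s2)
    show "norm (pmf p k * exp (?x * \<bar>Y k\<bar>)) \<le> pmf p k * exp (?x * Y k) + pmf p k * exp (- ?x * Y k)" for k
      using mult_left_mono[OF le[of "Y k"] pmf_nonneg[of p k]] by (simp add: distrib_left)
  qed
  define f where "f = (\<lambda>(k, m). pmf p k * ((?x * \<bar>Y k\<bar>) ^ m / fact m))"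
  have fsum: "f summable_on (UNIV \<times> UNIV)"
  proof (rule summable_on_SigmaI)
    show "((\<lambda>m. f (k, m)) has_sum (pmf p k * exp (?x * \<bar>Y k\<bar>))) UNIV" for k
    proof -
      have "(\<lambda>m. (?x * \<bar>Y k\<bar>) ^ m / fact m) sums exp (?x * \<bar>Y k\<bar>)"
        using exp_converges[of "?x * \<bar>Y k\<bar>"] by (simp add: field_simps)
      then have "((\<lambda>m. (?x * \<bar>Y k\<bar>) ^ m / fact m) has_sum exp (?x * \<bar>Y k\<bar>)) UNIV"
        by (rule sums_nonneg_imp_has_sum) simp
      then show ?thesis unfolding f_def prod.case by (rule has_sum_cmult_right)
    qed
    show "(\<lambda>k. pmf p k * exp (?x * \<bar>Y k\<bar>)) summable_on UNIV"
      using sabs by (subst summable_on_UNIV_nonneg_real_iff) auto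
    show "f (k, m) \<ge> 0" for k m by (simp add: f_def)
  qed
  have fm: "summable (\<lambda>k. f (k, m))" for m
  proof -
    have "(\<lambda>(m, k). f (k, m)) summable_on (UNIV \<times> UNIV)" using fsum by (subst (asm) summable_on_swap)
    from summable_on_SigmaD1[OF this, of m] show ?thesis by (intro summable_on_imp_summable) simp
  qed
  show sY: "summable (\<lambda>k. pmf p k * norm (Y k ^ m))" if "z \<noteq> 0" for m
  proof -
    have "summable (\<lambda>k. f (k, m) * (fact m / ?x ^ m))" by (rule summable_mult2[OF fm])
    then show ?thesis using that by (simp add: f_def power_mult_distrib power_abs)
  qed
  define g where "g = (\<lambda>(k, m). of_real (pmf p k) * ((z * of_real (Y k)) ^ m / fact m))"
  have "(\<lambda>x. norm (g x)) = f"
  proof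
    fix x show "norm (g x) = f x"
      by (cases x) (simp add: g_def f_def norm_mult norm_divide norm_power)
  qed
  then have gsum: "g summable_on (UNIV \<times> UNIV)" using fsum by (simp add: abs_summable_summable)
  then obtain T where T: "(g has_sum T) (UNIV \<times> UNIV)" by (auto simp: summable_on_def)
  have "((\<lambda>k. of_real (pmf p k) * exp (z * of_real (Y k))) has_sum T) UNIV"
  proof (rule has_sum_SigmaD[OF T])
    fix k
    have e: "(\<lambda>m. (z * of_real (Y k)) ^ m / fact m) sums exp (z * of_real (Y k))"
      using exp_converges[of "z * of_real (Y k)"] by (simp add: scaleR_conv_of_real field_simps)
    have "summable (\<lambda>m. norm ((z * of_real (Y k)) ^ m / fact m))"
      using summable_norm_exp[of "z * of_real (Y k)"] by (simp add: norm_divide field_simps)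
    from norm_summable_imp_has_sum[OF this e]
    show "((\<lambda>m. g (k, m)) has_sum (of_real (pmf p k) * exp (z * of_real (Y k)))) UNIV"
      unfolding g_def prod.case by (rule has_sum_cmult_right)
  qed
  then have A: "(\<lambda>k. of_real (pmf p k) * exp (z * of_real (Y k))) sums T" by (rule has_sum_imp_sums)
  have T': "((\<lambda>(m, k). g (k, m)) has_sum T) (UNIV \<times> UNIV)" using T by (subst (asm) has_sum_swap)
  have "((\<lambda>m. of_real (\<Sum>k. pmf p k * Y k ^ m) / fact m * z ^ m) has_sum T) UNIV"
  proof (rule has_sum_SigmaD[OF T'])
    fix m
    show "((\<lambda>k. (\<lambda>(m, k). g (k, m)) (m, k)) has_sum (of_real (\<Sum>k. pmf p k * Y k ^ m) / fact m * z ^ m)) UNIV"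
    proof (cases "z = 0 \<and> m > 0")
      case True
      then show ?thesis by (simp add: g_def power_0_left)
    next
      case False
      have "summable (\<lambda>k. norm (pmf p k * Y k ^ m))"
      proof (cases "z = 0")
        case True
        then have "m = 0" using False by simp
        then show ?thesis using fm[of 0] by (simp add: f_def)
      next
        case False
        then show ?thesis using sY[of m] by (simp add: abs_mult)
      qed
      then have "((\<lambda>k. pmf p k * Y k ^ m) has_sum (\<Sum>k. pmf p k * Y k ^ m)) UNIV"
        by (intro norm_summable_imp_has_sum[OF _ summable_sums[OF summable_norm_cancel]])
      then have "((\<lambda>k. of_real (pmf p k * Y k ^ m)) has_sum complex_of_real (\<Sum>k. pmf p k * Y k ^ m)) UNIV"
        by (rule has_sum_of_real)
      from has_sum_cmult_left[OF this, of "z ^ m / fact m"]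
      show ?thesis by (simp add: g_def power_mult_distrib mult_ac)
    qed
  qed
  then have "(\<lambda>m. of_real (\<Sum>k. pmf p k * Y k ^ m) / fact m * z ^ m) sums T" by (rule has_sum_imp_sums)
  with A show "(\<lambda>m. of_real (\<Sum>k. pmf p k * Y k ^ m) / fact m * z ^ m) sums (\<Sum>k. of_real (pmf p k) * exp (z * of_real (Y k)))"
    by (simp add: sums_iff)
  have "norm (\<Sum>k. of_real (pmf p k) * exp (z * of_real (Y k))) \<le> (\<Sum>k. pmf p k * exp (?x * Y k) + pmf p k * exp (- ?x * Y k))"
  proof (rule norm_suminf_le)
    show "summable (\<lambda>k. pmf p k * exp (?x * Y k) + pmf p k * exp (- ?x * Y k))" by (intro summable_add s1 s2)
    fix k
    have "norm (exp (z * of_real (Y k))) = exp (Re z * Y k)" by simp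
    also have "\<dots> \<le> exp (?x * \<bar>Y k\<bar>)"
      using abs_Re_le_cmod[of z] mult_mono[of "\<bar>Re z\<bar>" ?x "\<bar>Y k\<bar>" "\<bar>Y k\<bar>"] abs_ge_self[of "Re z * Y k"]
      by (simp add: abs_mult)
    also have "\<dots> \<le> exp (?x * Y k) + exp (- ?x * Y k)" by (rule le)
    finally show "norm (of_real (pmf p k) * exp (z * of_real (Y k))) \<le> pmf p k * exp (?x * Y k) + pmf p k * exp (- ?x * Y k)"
      using mult_left_mono[of _ _ "pmf p k"] by (simp add: norm_mult flip: distrib_left)
  qed
  also have "\<dots> = (\<Sum>k. pmf p k * exp (?x * Y k)) + (\<Sum>k. pmf p k * exp (- ?x * Y k))"
    by (rule suminf_add[OF s1 s2, symmetric])
  finally show "norm (\<Sum>k. of_real (pmf p k) * exp (z * of_real (Y k))) \<le>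
           (\<Sum>k. pmf p k * exp (norm z * Y k)) + (\<Sum>k. pmf p k * exp (- norm z * Y k))" .
qed

text \<open>Monotonicity of cosh on the nonnegative reals; it bounds the moment generating function
  on a whole disc by its values at \<open>B\<close> and \<open>- B\<close>.\<close>

lemma exp_cosh_mono:
  fixes x B y :: real
  assumes "0 \<le> x" "x \<le> B"
  shows "exp (x * y) + exp (- x * y) \<le> exp (B * y) + exp (- B * y)"
proof -
  have "cosh \<bar>x * y\<bar> \<le> cosh \<bar>B * y\<bar>"
    by (subst cosh_real_nonneg_le_iff) (use assms in \<open>auto simp: abs_mult intro!: mult_right_mono\<close>)
  then have "cosh (x * y) \<le> cosh (B * y)" by simp
  then show ?thesis by (simp add: cosh_def)
qed

lemma pmf_sums: "pmf p sums (1 :: real)" for p :: "nat pmf"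
proof -
  have "summable (pmf p)"
    using integrable_pmf[of UNIV p] by (simp add: integrable_count_space_nat_iff)
  then show ?thesis using pmf_nat_expectation(2)[of p "\<lambda>_. 1 :: real"] by (simp add: sums_iff)
qed

text \<open>Curtiss' theorem with convergence of the first two moments: by Montel's theorem, convergence
  of the moment generating functions on the real axis extends to the complex plane.\<close>

lemma clt_from_mgf:
  fixes p :: "nat \<Rightarrow> nat pmf" and Y :: "nat \<Rightarrow> nat \<Rightarrow> real"
  assumes \<sigma>: "\<sigma> > 0"
    and sm: "\<And>s. \<forall>\<^sub>F n in sequentially. summable (\<lambda>k. pmf (p n) k * exp (s * Y n k))"
    and lim: "\<And>s. (\<lambda>n. \<Sum>k. pmf (p n) k * exp (s * Y n k)) \<longlonglongrightarrow> exp (\<sigma>\<^sup>2 * s\<^sup>2 / 2)"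
  defines "E \<equiv> \<lambda>n. measure_pmf.expectation (p n) (Y n)"
    and "V \<equiv> \<lambda>n. measure_pmf.expectation (p n) (\<lambda>k. (Y n k - measure_pmf.expectation (p n) (Y n))\<^sup>2)"
  shows "E \<longlonglongrightarrow> 0" and "V \<longlonglongrightarrow> \<sigma>\<^sup>2"
    and "\<forall>\<^sub>F n in sequentially. integrable (measure_pmf (p n)) (Y n)"
    and "weak_conv_m (\<lambda>n. distr (p n) borel (\<lambda>k. (Y n k - E n) / sqrt (V n))) std_normal_distribution"
proof -
  define M where "M n z = (\<Sum>k. of_real (pmf (p n) k) * exp (z * of_real (Y n k)))" for n and z :: complex
  define g where "g z = exp (of_real (\<sigma>\<^sup>2) * z\<^sup>2 / 2)" for z :: complex
  define smB where "smB B n \<longleftrightarrow> (\<forall>s. \<bar>s\<bar> \<le> B \<longrightarrow> summable (\<lambda>k. pmf (p n) k * exp (s * Y n k)))" for B n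
  have ev_smB: "\<forall>\<^sub>F n in sequentially. smB B n" for B
    using sm[of B] sm[of "-B"]
  proof eventually_elim
    case (elim n)
    show ?case unfolding smB_def
    proof (intro allI impI)
      fix s assume s: "\<bar>s\<bar> \<le> B"
      show "summable (\<lambda>k. pmf (p n) k * exp (s * Y n k))"
      proof (rule summable_comparison_test'[of _ 0])
        show "summable (\<lambda>k. pmf (p n) k * exp (B * Y n k) + pmf (p n) k * exp (- B * Y n k))"
          by (intro summable_add elim)
        fix k
        have "s * Y n k \<le> B * \<bar>Y n k\<bar>"
          using s abs_ge_zero[of s] order_trans[OF abs_ge_zero[of s] s] mult_mono[of "\<bar>s\<bar>" B "\<bar>Y n k\<bar>" "\<bar>Y n k\<bar>"] abs_ge_self[of "s * Y n k"] by (simp add: abs_mult)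
        then have "exp (s * Y n k) \<le> exp (B * Y n k) + exp (- B * Y n k)"
          by (cases "Y n k \<ge> 0") (auto simp: abs_if intro: order_trans add_increasing add_increasing2)
        from mult_left_mono[OF this pmf_nonneg[of "p n" k]]
        show "norm (pmf (p n) k * exp (s * Y n k)) \<le> pmf (p n) k * exp (B * Y n k) + pmf (p n) k * exp (- B * Y n k)"
          by (simp add: distrib_left)
      qed
    qed
  qed
  have series: "(\<lambda>m. of_real (\<Sum>k. pmf (p n) k * Y n k ^ m) / fact m * z ^ m) sums M n z"
    if "smB B n" "norm z \<le> B" for n B z
    unfolding M_def by (rule mgf_power_series(1)) (use that in \<open>auto simp: smB_def\<close>)
  have holg: "g holomorphic_on A" for A unfolding g_def by (intro holomorphic_intros) auto
  have Mreal: "M n (of_real s) = of_real (\<Sum>k. pmf (p n) k * exp (s * Y n k))" if "smB B n" "\<bar>s\<bar> \<le> B" for n s B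
  proof -
    have "complex_of_real (\<Sum>k. pmf (p n) k * exp (s * Y n k)) = (\<Sum>k. of_real (pmf (p n) k * exp (s * Y n k)))"
      by (rule suminf_of_real) (use that in \<open>simp add: smB_def\<close>)
    then show ?thesis unfolding M_def by (simp add: exp_of_real[symmetric])
  qed
  have unif: "uniform_limit (cball 0 R) M g sequentially" if R: "R > 0" for R
  proof -
    \<comment> \<open>The larger disc contains the compact disc of radius \<open>R\<close>, as
      Montel's theorem requires.\<close>
    define B where "B = R + 1"
    have B: "B > 0" using R by (simp add: B_def)
    have lb: "(\<lambda>n. (\<Sum>k. pmf (p n) k * exp (B * Y n k)) + (\<Sum>k. pmf (p n) k * exp (- B * Y n k))) \<longlonglongrightarrow>
        exp (\<sigma>\<^sup>2 * B\<^sup>2 / 2) + exp (\<sigma>\<^sup>2 * (- B)\<^sup>2 / 2)"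
      by (intro tendsto_add lim)
    define C where "C = 2 * exp (\<sigma>\<^sup>2 * B\<^sup>2 / 2) + 1"
    have "\<forall>\<^sub>F n in sequentially. (\<Sum>k. pmf (p n) k * exp (B * Y n k)) + (\<Sum>k. pmf (p n) k * exp (- B * Y n k)) < C"
      by (rule order_tendstoD(2)[OF lb]) (simp add: C_def)
    with ev_smB[of B] have "\<forall>\<^sub>F n in sequentially. smB B n \<and> (\<Sum>k. pmf (p n) k * exp (B * Y n k)) + (\<Sum>k. pmf (p n) k * exp (- B * Y n k)) < C"
      by eventually_elim (rule conjI)
    then obtain N where N': "\<forall>n\<ge>N. smB B n \<and> (\<Sum>k. pmf (p n) k * exp (B * Y n k)) + (\<Sum>k. pmf (p n) k * exp (- B * Y n k)) < C"
      unfolding eventually_sequentially by (elim exE)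
    have N: "smB B n" "(\<Sum>k. pmf (p n) k * exp (B * Y n k)) + (\<Sum>k. pmf (p n) k * exp (- B * Y n k)) < C" if "n \<ge> N" for n
      using N'[rule_format, OF that] by (rule conjunct1) (use N'[rule_format, OF that] in \<open>rule conjunct2\<close>)
    \<comment> \<open>Summability and the bound \<open>C\<close> hold only from \<open>N\<close> on,
      so the shifted sequence is treated first.\<close>
    have "uniform_limit (cball 0 R) (\<lambda>n. M (n + N)) g sequentially"
    proof (rule vitali_real_axis[of B])
      show "M (n + N) holomorphic_on ball 0 B" for n
        by (rule power_series_holomorphic[of 0 B "\<lambda>m. of_real (\<Sum>k. pmf (p (n + N)) k * Y (n + N) k ^ m) / fact m"])
           (use series[of B "n + N"] N(1)[of "n + N"] in auto)
      show "norm (M (n + N) z) \<le> C" if z: "z \<in> ball 0 B" for n z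
      proof -
        have smn: "smB B (n + N)" by (rule N(1)) simp
        have mono: "(\<Sum>k. pmf (p (n + N)) k * exp (x * Y (n + N) k)) + (\<Sum>k. pmf (p (n + N)) k * exp (- x * Y (n + N) k)) \<le>
             (\<Sum>k. pmf (p (n + N)) k * exp (B * Y (n + N) k)) + (\<Sum>k. pmf (p (n + N)) k * exp (- B * Y (n + N) k))"
          if x: "0 \<le> x" "x \<le> B" for x
        proof -
          have s: "summable (\<lambda>k. pmf (p (n + N)) k * exp (y * Y (n + N) k))" if "\<bar>y\<bar> \<le> B" for y
            using smn that by (simp add: smB_def)
          have "exp (x * y) + exp (- x * y) \<le> exp (B * y) + exp (- B * y)" for y :: real
            by (rule exp_cosh_mono[OF x])
          from mult_left_mono[OF this pmf_nonneg]
          have "(\<Sum>k. pmf (p (n + N)) k * exp (x * Y (n + N) k) + pmf (p (n + N)) k * exp (- x * Y (n + N) k)) \<le>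
             (\<Sum>k. pmf (p (n + N)) k * exp (B * Y (n + N) k) + pmf (p (n + N)) k * exp (- B * Y (n + N) k))"
            by (intro suminf_le summable_add s) (use x in \<open>auto simp: distrib_left\<close>)
          then show ?thesis
            using s[of x] s[of "-x"] s[of B] s[of "-B"] x by (simp add: suminf_add)
        qed
        have "norm (M (n + N) z) \<le> (\<Sum>k. pmf (p (n + N)) k * exp (norm z * Y (n + N) k)) + (\<Sum>k. pmf (p (n + N)) k * exp (- norm z * Y (n + N) k))"
          unfolding M_def by (rule mgf_power_series(3)) (use smn z in \<open>auto simp: smB_def\<close>)
        also have "\<dots> \<le> (\<Sum>k. pmf (p (n + N)) k * exp (B * Y (n + N) k)) + (\<Sum>k. pmf (p (n + N)) k * exp (- B * Y (n + N) k))"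
          by (rule mono) (use z in auto)
        also have "\<dots> < C" by (rule N(2)) simp
        finally show ?thesis by simp
      qed
      show "(\<lambda>n. M (n + N) (of_real s)) \<longlonglongrightarrow> g (of_real s)" if s: "\<bar>s\<bar> < B" for s :: real
      proof -
        have "M (n + N) (of_real s) = of_real (\<Sum>k. pmf (p (n + N)) k * exp (s * Y (n + N) k))" for n
          by (rule Mreal[OF N(1)]) (use s in auto)
        moreover have "g (of_real s) = of_real (exp (\<sigma>\<^sup>2 * s\<^sup>2 / 2))"
          by (simp add: g_def exp_of_real[symmetric])
        ultimately show ?thesis
          using tendsto_of_real[OF LIMSEQ_ignore_initial_segment[OF lim[of s], of N]] by simp
      qed
    qed (use B R in \<open>auto simp: B_def holg\<close>)
    then show ?thesis
      unfolding uniform_limit_iff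
      using iffD1[OF eventually_sequentially_seg[of "\<lambda>n. \<forall>x\<in>cball 0 R. dist (M n x) (g x) < e" N for e]] by blast
  qed
  define mom where "mom m n = (\<Sum>k. pmf (p n) k * Y n k ^ m)" for m n
  have ev1: "\<forall>\<^sub>F n in sequentially. smB 1 n" by (rule ev_smB)
  have dM: "(deriv ^^ m) (M n) 0 / fact m = of_real (mom m n) / fact m" if "smB 1 n" for m n
    unfolding mom_def
    by (rule coeff_from_sums[of 1 "\<lambda>m. of_real (\<Sum>k. pmf (p n) k * Y n k ^ m) / fact m"]) (use series[OF that] in auto)
  have holM: "M n holomorphic_on ball 0 1" if "smB 1 n" for n
    by (rule power_series_holomorphic[of 0 1 "\<lambda>m. of_real (\<Sum>k. pmf (p n) k * Y n k ^ m) / fact m"])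
       (use series[OF that] in auto)
  \<comment> \<open>Uniform convergence of holomorphic functions carries over to derivatives at 0,
    which are the moments.\<close>
  have momlim: "(\<lambda>n. mom m n) \<longlonglongrightarrow> Re ((deriv ^^ m) g 0)" for m
  proof -
    have "(\<lambda>n. (deriv ^^ m) (M n) 0) \<longlonglongrightarrow> (deriv ^^ m) g 0"
    proof (rule higher_deriv_complex_uniform_limit[where A = "ball 0 1"])
      show "uniform_limit (ball 0 1) M g sequentially"
        by (rule uniform_limit_on_subset[OF unif[of 1]]) auto
      show "\<forall>\<^sub>F n in sequentially. M n holomorphic_on ball 0 1" using ev1 by eventually_elim (rule holM)
    qed auto
    then have "(\<lambda>n. Re ((deriv ^^ m) (M n) 0)) \<longlonglongrightarrow> Re ((deriv ^^ m) g 0)" by (rule tendsto_Re)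
    then show ?thesis
      by (rule Lim_transform_eventually) (use ev1 in eventually_elim, use dM[of _ m] in simp)
  qed
  have g1: "deriv g 0 = 0" and g2: "deriv (deriv g) 0 = of_real (\<sigma>\<^sup>2)"
  proof -
    have d: "deriv g z = of_real (\<sigma>\<^sup>2) * z * g z" for z
      unfolding g_def by (rule DERIV_imp_deriv) (auto intro!: derivative_eq_intros simp: field_simps)
    show "deriv g 0 = 0" by (simp add: d)
    have "(g has_field_derivative deriv g 0) (at 0)"
      using holg[of UNIV] by (auto intro: holomorphic_derivI)
    then have "((\<lambda>z. of_real (\<sigma>\<^sup>2) * z * g z) has_field_derivative of_real (\<sigma>\<^sup>2) * g 0) (at 0)"
      by (auto intro!: derivative_eq_intros)
    then show "deriv (deriv g) 0 = of_real (\<sigma>\<^sup>2)"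
      unfolding d[abs_def] by (simp add: DERIV_imp_deriv g_def)
  qed
  have int: "\<forall>\<^sub>F n in sequentially. \<forall>m. integrable (measure_pmf (p n)) (\<lambda>k. Y n k ^ m) \<and> measure_pmf.expectation (p n) (\<lambda>k. Y n k ^ m) = mom m n"
    using ev1
  proof eventually_elim
    case (elim n)
    show ?case
    proof
      fix m
      have s: "summable (\<lambda>k. pmf (p n) k * norm (Y n k ^ m))"
        by (rule mgf_power_series(2)[of 1]) (use elim in \<open>auto simp: smB_def\<close>)
      show "integrable (measure_pmf (p n)) (\<lambda>k. Y n k ^ m) \<and> measure_pmf.expectation (p n) (\<lambda>k. Y n k ^ m) = mom m n"
        using pmf_nat_expectation[OF s] by (simp add: mom_def)
    qed
  qed
  then show ev_int: "\<forall>\<^sub>F n in sequentially. integrable (measure_pmf (p n)) (Y n)"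
  proof eventually_elim
    case (elim n)
    show ?case using elim[rule_format, of 1] by simp
  qed
  have EV: "\<forall>\<^sub>F n in sequentially. E n = mom 1 n \<and> V n = mom 2 n - (mom 1 n)\<^sup>2"
    using int
  proof eventually_elim
    case (elim n)
    have i1: "integrable (measure_pmf (p n)) (Y n)" and e1: "measure_pmf.expectation (p n) (Y n) = mom 1 n"
      using elim[rule_format, of 1] by simp_all
    have i2: "integrable (measure_pmf (p n)) (\<lambda>k. (Y n k)\<^sup>2)" and e2: "measure_pmf.expectation (p n) (\<lambda>k. (Y n k)\<^sup>2) = mom 2 n"
      using elim[rule_format, of 2] by simp_all
    show ?case unfolding E_def V_def using measure_pmf.variance_eq[OF i1 i2] e1 e2 by simp
  qed
  have m1: "(\<lambda>n. mom 1 n) \<longlonglongrightarrow> 0" using momlim[of 1] g1 by simp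
  have m2: "(\<lambda>n. mom 2 n) \<longlonglongrightarrow> \<sigma>\<^sup>2" using momlim[of 2] g2 by (simp add: numeral_2_eq_2)
  show E0: "E \<longlonglongrightarrow> 0"
    by (rule Lim_transform_eventually[OF m1]) (use EV in eventually_elim, simp)
  have "(\<lambda>n. mom 2 n - (mom 1 n)\<^sup>2) \<longlonglongrightarrow> \<sigma>\<^sup>2 - 0\<^sup>2" by (intro tendsto_intros m1 m2)
  then have "(\<lambda>n. mom 2 n - (mom 1 n)\<^sup>2) \<longlonglongrightarrow> \<sigma>\<^sup>2" by simp
  then show V\<sigma>: "V \<longlonglongrightarrow> \<sigma>\<^sup>2"
    by (rule Lim_transform_eventually) (use EV in eventually_elim, simp)
  show "weak_conv_m (\<lambda>n. distr (p n) borel (\<lambda>k. (Y n k - E n) / sqrt (V n))) std_normal_distribution"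
  proof (rule levy_continuity)
    show "real_distribution (distr (p n) borel (\<lambda>k. (Y n k - E n) / sqrt (V n)))" for n
      by (rule prob_space.real_distribution_distr[OF prob_space_measure_pmf]) simp
    show "real_distribution std_normal_distribution" by (rule real_dist_normal_dist)
    fix t :: real
    define s where "s n = sqrt (V n)" for n
    have s: "s \<longlonglongrightarrow> \<sigma>" using tendsto_real_sqrt[OF V\<sigma>] \<sigma> by (simp add: s_def[abs_def])
    \<comment> \<open>Normalising by the actual mean and standard deviation turns the characteristic
      function into \<open>M n\<close> at the imaginary point \<open>i t / s n\<close>, times a
      phase that tends to 1.\<close>
    have char: "char (distr (p n) borel (\<lambda>k. (Y n k - E n) / s n)) t = exp (- \<i> * of_real (t * E n / s n)) * M n (\<i> * of_real (t / s n))" for n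
    proof -
      have sp: "summable (\<lambda>k. pmf (p n) k * norm (iexp (t * ((Y n k - E n) / s n))))"
        using sums_summable[OF pmf_sums] by simp
      have "char (distr (p n) borel (\<lambda>k. (Y n k - E n) / s n)) t = measure_pmf.expectation (p n) (\<lambda>k. iexp (t * ((Y n k - E n) / s n)))"
        unfolding char_def by (subst integral_distr) auto
      also have "\<dots> = (\<Sum>k. pmf (p n) k *\<^sub>R iexp (t * ((Y n k - E n) / s n)))"
        by (rule pmf_nat_expectation(2)[OF sp])
      also have "\<dots> = (\<Sum>k. exp (- \<i> * of_real (t * E n / s n)) * (of_real (pmf (p n) k) * exp (\<i> * of_real (t / s n) * of_real (Y n k))))"
      proof (rule suminf_cong)
        fix k
        have "exp (- \<i> * of_real (t * E n / s n)) * exp (\<i> * of_real (t / s n) * of_real (Y n k)) = iexp (t * ((Y n k - E n) / s n))"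
          unfolding exp_add[symmetric] by (simp add: diff_divide_distrib algebra_simps)
        then show "pmf (p n) k *\<^sub>R iexp (t * ((Y n k - E n) / s n)) = exp (- \<i> * of_real (t * E n / s n)) * (of_real (pmf (p n) k) * exp (\<i> * of_real (t / s n) * of_real (Y n k)))"
          by (simp only: scaleR_conv_of_real mult_ac)
      qed
      also have "\<dots> = exp (- \<i> * of_real (t * E n / s n)) * M n (\<i> * of_real (t / s n))"
        unfolding M_def
      proof (rule suminf_mult, rule summable_norm_cancel)
        show "summable (\<lambda>k. norm (complex_of_real (pmf (p n) k) * exp (\<i> * of_real (t / s n) * of_real (Y n k))))"
          using sums_summable[OF pmf_sums] by (simp add: norm_mult)
      qed
      finally show ?thesis .
    qed
    have zlim: "(\<lambda>n. \<i> * complex_of_real (t / s n)) \<longlonglongrightarrow> \<i> * of_real (t / \<sigma>)"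
      by (intro tendsto_intros s) (use \<sigma> in simp)
    \<comment> \<open>The argument \<open>i t / s n\<close> moves with \<open>n\<close>; it stays in
      a fixed disc, where the convergence of \<open>M n\<close> is uniform.\<close>
    define R where "R = \<bar>t / \<sigma>\<bar> + 1"
    have R: "R > 0" unfolding R_def by (rule add_nonneg_pos) auto
    have inK: "\<forall>\<^sub>F n in sequentially. \<i> * complex_of_real (t / s n) \<in> cball 0 R"
    proof -
      have "(\<lambda>n. norm (\<i> * complex_of_real (t / s n))) \<longlonglongrightarrow> norm (\<i> * complex_of_real (t / \<sigma>))" by (intro tendsto_norm zlim)
      then have "\<forall>\<^sub>F n in sequentially. norm (\<i> * complex_of_real (t / s n)) < R"
        by (rule order_tendstoD) (simp add: R_def norm_mult norm_divide)
      then show ?thesis by eventually_elim simp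
    qed
    have "(\<lambda>n. M n (\<i> * complex_of_real (t / s n)) - g (\<i> * complex_of_real (t / s n))) \<longlonglongrightarrow> 0"
    proof (rule tendstoI)
      fix e :: real assume e: "e > 0"
      have "\<forall>\<^sub>F n in sequentially. \<forall>x\<in>cball 0 R. dist (M n x) (g x) < e"
        using unif[OF R] e by (auto simp: uniform_limit_iff)
      then show "\<forall>\<^sub>F n in sequentially. dist (M n (\<i> * complex_of_real (t / s n)) - g (\<i> * complex_of_real (t / s n))) 0 < e"
        using inK by eventually_elim (auto simp: dist_norm)
    qed
    moreover have "(\<lambda>n. g (\<i> * complex_of_real (t / s n))) \<longlonglongrightarrow> g (\<i> * of_real (t / \<sigma>))"
      unfolding g_def by (intro tendsto_intros zlim) auto
    ultimately have "(\<lambda>n. (M n (\<i> * complex_of_real (t / s n)) - g (\<i> * complex_of_real (t / s n))) + g (\<i> * complex_of_real (t / s n))) \<longlonglongrightarrow> 0 + g (\<i> * of_real (t / \<sigma>))"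
      by (rule tendsto_add)
    then have "(\<lambda>n. M n (\<i> * complex_of_real (t / s n))) \<longlonglongrightarrow> g (\<i> * of_real (t / \<sigma>))" by simp
    moreover have "(\<lambda>n. exp (- \<i> * complex_of_real (t * E n / s n))) \<longlonglongrightarrow> exp (- \<i> * complex_of_real (t * 0 / \<sigma>))"
      by (intro tendsto_intros E0 s) (use \<sigma> in simp)
    ultimately have "(\<lambda>n. exp (- \<i> * complex_of_real (t * E n / s n)) * M n (\<i> * complex_of_real (t / s n))) \<longlonglongrightarrow> exp (- \<i> * complex_of_real (t * 0 / \<sigma>)) * g (\<i> * of_real (t / \<sigma>))"
      by (intro tendsto_mult)
    also have "exp (- \<i> * complex_of_real (t * 0 / \<sigma>)) * g (\<i> * of_real (t / \<sigma>)) = char std_normal_distribution t"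
      using \<sigma> by (simp add: g_def char_std_normal_distribution power_mult_distrib power_divide exp_of_real[symmetric])
    finally have X: "(\<lambda>n. exp (- \<i> * complex_of_real (t * E n / s n)) * M n (\<i> * complex_of_real (t / s n))) \<longlonglongrightarrow> char std_normal_distribution t" .
    have "(\<lambda>n. char (distr (p n) borel (\<lambda>k. (Y n k - E n) / s n)) t) \<longlonglongrightarrow> char std_normal_distribution t"
      unfolding char by (rule X)
    then show "(\<lambda>n. char (distr (p n) borel (\<lambda>k. (Y n k - E n) / sqrt (V n))) t) \<longlonglongrightarrow> char std_normal_distribution t"
      by (simp only: s_def)
  qed
qed

section \<open>The supercritical regime\<close>

text \<open>\<open>K\<close> has no zero on a disc, so it has a holomorphic logarithm there, valid
  beyond the unit circle. Principal powers are not multiplicative in general, hence the detour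
  through logarithms that differ by a constant.\<close>

lemma fractional_power_factor:
  fixes F K :: "complex \<Rightarrow> complex"
  assumes R: "R > 1" and K: "K holomorphic_on ball 0 R" and K0: "\<And>z. z \<in> ball 0 R \<Longrightarrow> K z \<noteq> 0"
    and F: "\<And>z. norm z < 1 \<Longrightarrow> F z = (1 - z) * K z" and Fpos: "\<And>z. norm z < 1 \<Longrightarrow> Re (F z) > 0"
  obtains L where "L holomorphic_on ball 0 R"
    "\<And>z. z \<in> ball 0 R \<Longrightarrow> norm (L z) = norm (K z) powr (- \<theta>)"
    "\<And>z. norm z < 1 \<Longrightarrow> F z powr of_real (- \<theta>) = (1 - z) powr of_real (- \<theta>) * L z"
proof -
  obtain g where g: "g holomorphic_on ball 0 R" "\<And>z. z \<in> ball 0 R \<Longrightarrow> K z = exp (g z)"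
    using contractible_imp_holomorphic_log[OF K convex_imp_contractible[OF convex_ball] K0] by blast
  have sub: "ball 0 1 \<subseteq> ball (0::complex) R" using R by auto
  have holF: "F holomorphic_on ball 0 1"
  proof (rule holomorphic_transform)
    show "(\<lambda>z. (1 - z) * K z) holomorphic_on ball 0 1"
      by (intro holomorphic_intros holomorphic_on_subset[OF K sub])
  qed (use F in auto)
  have Fn: "F z \<notin> \<real>\<^sub>\<le>\<^sub>0" if "norm z < 1" for z using Fpos[OF that] by (auto simp: complex_nonpos_Reals_iff)
  \<comment> \<open>The defect of additivity of the three logarithms. Its exponential is 1, so it is
    a constant multiple of 2 \<pi> i; being imaginary, it does not change
    \<open>norm (L z)\<close>.\<close>
  define d where "d z = Ln (F z) - Ln (1 - z) - g z" for z
  have hold: "d holomorphic_on ball 0 1"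
    unfolding d_def
    by (intro holomorphic_intros holF holomorphic_on_subset[OF g(1) sub])
       (use Fn one_minus_notin_nonpos_Reals in auto)
  have ed: "exp (d z) = 1" if z: "norm z < 1" for z
  proof -
    have z1: "1 - z \<noteq> 0" using z by auto
    have F0: "F z \<noteq> 0" using Fn[OF z] by auto
    have zR: "z \<in> ball 0 R" using z R by simp
    have "exp (d z) = F z / (1 - z) / K z"
      using z1 F0 g(2)[OF zR] by (simp add: d_def exp_diff)
    then show ?thesis using F[OF z] z1 K0[OF zR] by simp
  qed
  have "(d has_field_derivative 0) (at z within ball 0 1)" if z: "z \<in> ball 0 1" for z
  proof -
    have D: "(d has_field_derivative deriv d z) (at z)"
      using holomorphic_derivI[OF hold open_ball z] .
    then have "((\<lambda>w. exp (d w)) has_field_derivative exp (d z) * deriv d z) (at z)"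
      by (auto intro!: derivative_eq_intros)
    moreover have "((\<lambda>w. exp (d w)) has_field_derivative 0) (at z)"
      by (rule has_field_derivative_transform_within_open[OF DERIV_const[of 1] open_ball z])
         (use ed in auto)
    ultimately have "exp (d z) * deriv d z = 0" by (rule DERIV_unique)
    then have "deriv d z = 0" by simp
    with D show ?thesis by (metis has_field_derivative_at_within)
  qed
  then obtain c where c: "\<And>z. z \<in> ball 0 1 \<Longrightarrow> d z = c"
    using has_field_derivative_zero_constant[of "ball 0 1" d] convex_ball by blast
  have ec: "exp c = 1" using ed[of 0] c[of 0] by simp
  then have Rec: "Re c = 0" by (simp add: exp_eq_1)
  define L where "L z = exp (- of_real \<theta> * (g z + c))" for z
  show ?thesis
  proof (rule that[of L])
    show "L holomorphic_on ball 0 R" unfolding L_def by (intro holomorphic_intros g(1))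
    show "norm (L z) = norm (K z) powr (- \<theta>)" if "z \<in> ball 0 R" for z
      using g(2)[OF that] Rec by (simp add: L_def powr_def)
    show "F z powr of_real (- \<theta>) = (1 - z) powr of_real (- \<theta>) * L z" if z: "norm z < 1" for z
    proof -
      have z1: "1 - z \<noteq> 0" using z by auto
      have F0: "F z \<noteq> 0" using Fn[OF z] by auto
      have "g z + c = Ln (F z) - Ln (1 - z)" using c[of z] z by (simp add: d_def algebra_simps)
      then have "(1 - z) powr of_real (- \<theta>) * L z = exp (of_real (- \<theta>) * Ln (1 - z)) * exp (- of_real \<theta> * (Ln (F z) - Ln (1 - z)))"
        using z1 by (simp add: L_def powr_def)
      also have "\<dots> = exp (of_real (- \<theta>) * Ln (F z))" unfolding exp_add[symmetric] by (simp add: algebra_simps)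
      finally show ?thesis using F0 by (simp add: powr_def)
    qed
  qed
qed

text \<open>The coefficient is the convolution of \<open>e\<close> with the Taylor coefficients
  \<open>l i\<close> of \<open>L\<close>, while the main term is \<open>e n\<close> times their sum
  \<open>L 1\<close>. Cauchy's inequality bounds \<open>l i\<close> through \<open>c0\<close> and
  \<open>R'\<close> alone, so the error is the same for all \<open>F\<close> sharing these two
  constants.\<close>

lemma fractional_power_coeffs:
  fixes F K :: "complex \<Rightarrow> complex" and a :: "nat \<Rightarrow> real"
  assumes R: "1 < R'" "R' < R" and K: "K holomorphic_on ball 0 R" and c0: "c0 > 0"
    and Kc0: "\<And>z. z \<in> ball 0 R \<Longrightarrow> norm (K z) \<ge> c0"
    and F: "\<And>z. norm z < 1 \<Longrightarrow> F z = (1 - z) * K z" and Fpos: "\<And>z. norm z < 1 \<Longrightarrow> Re (F z) > 0"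
    and Freal: "\<And>x::real. 0 < x \<Longrightarrow> x < 1 \<Longrightarrow> Im (F (of_real x)) = 0"
    and a: "\<And>z. norm z < 1 \<Longrightarrow> (\<lambda>n. of_real (a n) * z ^ n) sums (F z powr of_real (- \<theta>))" and \<theta>: "\<theta> > 0"
  defines "e \<equiv> pow_coeff (- \<theta>)"
  shows "summable (\<lambda>i. (if i \<le> n then \<bar>e (n - i) - e n\<bar> else e n) / R' ^ i)"
    and "\<bar>a n - e n * norm (K 1) powr (- \<theta>)\<bar> \<le>
      c0 powr (- \<theta>) * (\<Sum>i. (if i \<le> n then \<bar>e (n - i) - e n\<bar> else e n) / R' ^ i)"
proof -
  have K0: "K z \<noteq> 0" if "z \<in> ball 0 R" for z using Kc0[OF that] c0 by auto
  have "\<exists>L. L holomorphic_on ball 0 R \<and> (\<forall>z\<in>ball 0 R. norm (L z) = norm (K z) powr (- \<theta>)) \<and>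
     (\<forall>z. norm z < 1 \<longrightarrow> F z powr of_real (- \<theta>) = (1 - z) powr of_real (- \<theta>) * L z)"
  proof (rule fractional_power_factor[of R K F \<theta>])
    fix L
    assume "L holomorphic_on ball 0 R" "\<And>z. z \<in> ball 0 R \<Longrightarrow> norm (L z) = norm (K z) powr (- \<theta>)"
      "\<And>z. norm z < 1 \<Longrightarrow> F z powr of_real (- \<theta>) = (1 - z) powr of_real (- \<theta>) * L z"
    then show ?thesis by (intro exI[of _ L] conjI ballI allI impI)
  qed (use R K K0 F Fpos in auto)
  then obtain L where L: "L holomorphic_on ball 0 R"
    "\<And>z. z \<in> ball 0 R \<Longrightarrow> norm (L z) = norm (K z) powr (- \<theta>)"
    "\<And>z. norm z < 1 \<Longrightarrow> F z powr of_real (- \<theta>) = (1 - z) powr of_real (- \<theta>) * L z"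
    by blast
  have e0: "e n > 0" for n unfolding e_def by (rule pow_coeff_neg_pos[OF \<theta>])
  define l where "l i = (deriv ^^ i) L 0 / fact i" for i
  have Lb: "norm (L z) \<le> c0 powr (- \<theta>)" if "z \<in> ball 0 R" for z
    unfolding L(2)[OF that] by (rule powr_mono2') (use that c0 Kc0 \<theta> in auto)
  have lb: "norm (l i) \<le> c0 powr (- \<theta>) / R' ^ i" for i
  proof -
    have "norm ((deriv ^^ i) L 0) \<le> fact i * c0 powr (- \<theta>) / R' ^ i"
    proof (rule Cauchy_inequality)
      show "L holomorphic_on ball 0 R'" by (rule holomorphic_on_subset[OF L(1)]) (use R in auto)
      show "continuous_on (cball 0 R') L"
        by (rule continuous_on_subset[OF holomorphic_on_imp_continuous_on[OF L(1)]]) (use R in auto)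
      show "norm (L x) \<le> c0 powr (- \<theta>)" if "norm (0 - x) = R'" for x
        by (rule Lb) (use that R in simp)
    qed (use R in auto)
    then show ?thesis by (simp add: l_def norm_divide field_simps)
  qed
  have lsum: "l sums L 1"
    using holomorphic_power_series[OF L(1), of 1] R by (simp add: l_def[abs_def])
  \<comment> \<open>\<open>norm (L z)\<close> is known but not the phase. At 1 the phase is trivial,
    because \<open>L\<close> is real and nonnegative on the real interval (0, 1).\<close>
  have L1: "L 1 = of_real (norm (K 1) powr (- \<theta>))"
  proof -
    have cont: "isCont L 1"
      using L(1) R by (intro continuous_on_interior[OF holomorphic_on_imp_continuous_on[OF L(1)]]) auto
    have "((\<lambda>x. complex_of_real x) \<longlongrightarrow> 1) (at_left 1)" using tendsto_of_real[OF tendsto_ident_at, of 1] by simp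
    then have lim: "((\<lambda>x. L (of_real x)) \<longlongrightarrow> L 1) (at_left 1)"
      by (rule isCont_tendsto_compose[OF cont])
    have ev: "\<forall>\<^sub>F x in at_left 1. 0 < x \<and> x < (1::real)"
      using eventually_at_left_real[of 0 1] by (auto elim!: eventually_mono)
    have val: "Im (L (of_real x)) = 0 \<and> Re (L (of_real x)) \<ge> 0" if x: "0 < x" "x < 1" for x
    proof -
      have nx: "norm (complex_of_real x) < 1" using x by simp
      have Fr: "F (of_real x) = of_real (Re (F (of_real x)))" using Freal[OF x] by (simp add: complex_eq_iff)
      have "F (of_real x) powr of_real (- \<theta>) = of_real (Re (F (of_real x)) powr (- \<theta>))"
        by (subst Fr) (rule powr_of_real[OF less_imp_le[OF Fpos[OF nx]]])
      moreover have "(1 - of_real x) powr of_real (- \<theta>) = complex_of_real ((1 - x) powr (- \<theta>))"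
        using powr_of_real[of "1 - x" "- \<theta>"] x by simp
      ultimately have "of_real (Re (F (of_real x)) powr (- \<theta>)) = complex_of_real ((1 - x) powr (- \<theta>)) * L (of_real x)"
        using L(3)[OF nx] by simp
      then have "L (of_real x) = of_real (Re (F (of_real x)) powr (- \<theta>) / (1 - x) powr (- \<theta>))"
        using x by (simp add: field_simps)
      then show ?thesis by simp
    qed
    have "Im (L 1) = 0"
    proof (rule tendsto_unique[OF _ tendsto_Im[OF lim]])
      show "((\<lambda>x. Im (L (of_real x))) \<longlongrightarrow> 0) (at_left 1)"
        by (rule Lim_transform_eventually[OF tendsto_const]) (use ev in eventually_elim, use val in simp)
    qed simp
    moreover have "Re (L 1) \<ge> 0"
      by (rule tendsto_lowerbound[OF tendsto_Re[OF lim]]) (use ev val in \<open>auto elim!: eventually_mono\<close>)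
    ultimately have "L 1 = of_real (norm (L 1))" by (simp add: complex_eq_iff norm_complex_def)
    then show ?thesis using L(2)[of 1] R by simp
  qed
  have conv: "of_real (a n) = (\<Sum>i\<le>n. of_real (e (n - i)) * l i)"
  proof -
    have nb: "eventually (\<lambda>z. z \<in> ball (0::complex) 1) (nhds 0)" by (rule eventually_nhds_in_open) auto
    have "(\<lambda>z. (1 - z) powr of_real (- \<theta>)) has_fps_expansion Abs_fps (\<lambda>n. complex_of_real (e n))"
      by (rule has_fps_expansionI) (use nb in eventually_elim, use pow_coeff_sums[of _ "- \<theta>"] in \<open>simp add: e_def\<close>)
    moreover have "L has_fps_expansion Abs_fps l"
    proof (rule has_fps_expansionI)
      show "\<forall>\<^sub>F u in nhds 0. (\<lambda>n. fps_nth (Abs_fps l) n * u ^ n) sums L u"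
        using nb
      proof eventually_elim
        case (elim u)
        then show ?case using holomorphic_power_series[OF L(1), of u] R by (simp add: l_def)
      qed
    qed
    ultimately have 1: "(\<lambda>z. (1 - z) powr of_real (- \<theta>) * L z) has_fps_expansion Abs_fps (\<lambda>n. complex_of_real (e n)) * Abs_fps l"
      by (rule has_fps_expansion_mult)
    have 2: "(\<lambda>z. (1 - z) powr of_real (- \<theta>) * L z) has_fps_expansion Abs_fps (\<lambda>n. complex_of_real (a n))"
    proof (rule has_fps_expansionI)
      show "\<forall>\<^sub>F u in nhds 0. (\<lambda>n. fps_nth (Abs_fps (\<lambda>n. complex_of_real (a n))) n * u ^ n) sums ((1 - u) powr of_real (- \<theta>) * L u)"
        using nb
      proof eventually_elim
        case (elim u)
        then show ?case using a[of u] L(3)[of u] by simp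
      qed
    qed
    have "complex_of_real (a n) = fps_nth (Abs_fps (\<lambda>n. complex_of_real (e n)) * Abs_fps l) n"
      using fps_nth_fps_expansion[OF 1, of n] fps_nth_fps_expansion[OF 2, of n] by simp
    also have "\<dots> = (\<Sum>i=0..n. of_real (e i) * l (n - i))" by (simp add: fps_mult_nth)
    also have "\<dots> = (\<Sum>i\<le>n. of_real (e (n - i)) * l i)"
      unfolding atLeast0AtMost by (rule sum.reindex_bij_witness[of _ "\<lambda>i. n - i" "\<lambda>i. n - i"]) auto
    finally show ?thesis .
  qed
  \<comment> \<open>For \<open>i > n\<close> the convolution has no term, so the whole
    \<open>e n\<close> is counted as error there.\<close>
  define t where "t i = (if i \<le> n then e (n - i) - e n else - e n)" for i
  have at: "\<bar>t i\<bar> = (if i \<le> n then \<bar>e (n - i) - e n\<bar> else e n)" for i using e0[of n] by (simp add: t_def)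
  show st: "summable (\<lambda>i. (if i \<le> n then \<bar>e (n - i) - e n\<bar> else e n) / R' ^ i)"
  proof (rule summable_comparison_test_ev)
    have "summable (\<lambda>i. (1 / R') ^ i)" using R by (intro summable_geometric) auto
    then show "summable (\<lambda>i. e n * (1 / R') ^ i)" by (rule summable_mult)
    show "\<forall>\<^sub>F i in sequentially. norm ((if i \<le> n then \<bar>e (n - i) - e n\<bar> else e n) / R' ^ i) \<le> e n * (1 / R') ^ i"
      using eventually_gt_at_top[of n]
      by eventually_elim (use e0[of n] R in \<open>simp add: power_divide\<close>)
  qed
  have fin: "(\<lambda>i. if i \<le> n then of_real (e (n - i)) * l i else 0) sums (\<Sum>i\<le>n. of_real (e (n - i)) * l i)"
    using sums_If_finite_set[of "{..n}" "\<lambda>i. of_real (e (n - i)) * l i"] by simp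
  have "(\<lambda>i. (if i \<le> n then of_real (e (n - i)) * l i else 0) - of_real (e n) * l i) sums (of_real (a n) - of_real (e n) * L 1)"
    unfolding conv by (intro sums_diff fin sums_mult lsum)
  also have "(\<lambda>i. (if i \<le> n then of_real (e (n - i)) * l i else 0) - of_real (e n) * l i) = (\<lambda>i. of_real (t i) * l i)"
    by (auto simp: fun_eq_iff t_def algebra_simps)
  finally have S: "(\<lambda>i. of_real (t i) * l i) sums (of_real (a n) - of_real (e n) * L 1)" .
  have "norm (of_real (a n) - of_real (e n) * L 1) \<le> (\<Sum>i. c0 powr (- \<theta>) * ((if i \<le> n then \<bar>e (n - i) - e n\<bar> else e n) / R' ^ i))"
    unfolding sums_unique[OF S]
  proof (rule norm_suminf_le)
    show "summable (\<lambda>i. c0 powr (- \<theta>) * ((if i \<le> n then \<bar>e (n - i) - e n\<bar> else e n) / R' ^ i))"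
      by (rule summable_mult[OF st])
    fix i
    have "norm (of_real (t i) * l i) = \<bar>t i\<bar> * norm (l i)" by (simp add: norm_mult)
    also have "\<dots> \<le> \<bar>t i\<bar> * (c0 powr (- \<theta>) / R' ^ i)" by (rule mult_left_mono[OF lb]) simp
    finally show "norm (of_real (t i) * l i) \<le> c0 powr (- \<theta>) * ((if i \<le> n then \<bar>e (n - i) - e n\<bar> else e n) / R' ^ i)"
      unfolding at[symmetric] by (simp add: mult_ac)
  qed
  also have "\<dots> = c0 powr (- \<theta>) * (\<Sum>i. (if i \<le> n then \<bar>e (n - i) - e n\<bar> else e n) / R' ^ i)"
    by (rule suminf_mult[OF st])
  also have "of_real (a n) - of_real (e n) * L 1 = complex_of_real (a n - e n * norm (K 1) powr (- \<theta>))"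
    by (simp add: L1)
  finally show "\<bar>a n - e n * norm (K 1) powr (- \<theta>)\<bar> \<le>
      c0 powr (- \<theta>) * (\<Sum>i. (if i \<le> n then \<bar>e (n - i) - e n\<bar> else e n) / R' ^ i)"
    by (simp only: norm_of_real)
qed

text \<open>For fixed \<open>i\<close> the increment \<open>e (n - i) - e n\<close> is of smaller
  order than \<open>n powr (\<theta> - 1)\<close>; the geometric factor provides a summable majorant
  for Tannery's theorem.\<close>

lemma pow_coeff_increments_vanish:
  assumes \<theta>: "\<theta> > 0" and R: "R > 1"
  defines "e \<equiv> pow_coeff (- \<theta>)"
  shows "(\<lambda>n. real n powr (1 - \<theta>) * (\<Sum>i. (if i \<le> n then \<bar>e (n - i) - e n\<bar> else e n) / R ^ i)) \<longlonglongrightarrow> 0"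
proof -
  have e0: "e n > 0" for n unfolding e_def by (rule pow_coeff_neg_pos[OF \<theta>])
  have elim: "(\<lambda>n. e n * real n powr (1 - \<theta>)) \<longlonglongrightarrow> rGamma \<theta>"
    using pow_coeff_asymp[of "- \<theta>"] by (simp add: e_def)
  then have "Bseq (\<lambda>n. e n * real n powr (1 - \<theta>))" using convergentI convergent_imp_Bseq by blast
  then obtain C where C: "C > 0" "\<And>n. \<bar>e n * real n powr (1 - \<theta>)\<bar> \<le> C" by (auto simp: Bseq_def)
  \<comment> \<open>The absolute value treats increasing and decreasing \<open>e\<close>
    together.\<close>
  define p where "p = \<bar>1 - \<theta>\<bar>"
  have b1: "real n powr (1 - \<theta>) * e (n - i) \<le> (C + 1) * (real i + 1) powr p" if i: "i \<le> n" "n \<ge> 1" for i n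
  proof (cases "i = n")
    case True
    have "real n powr (1 - \<theta>) \<le> real n powr p" by (rule powr_mono) (use i in \<open>auto simp: p_def\<close>)
    also have "\<dots> \<le> (real i + 1) powr p" by (rule powr_mono2) (use True in \<open>auto simp: p_def\<close>)
    also have "\<dots> \<le> (C + 1) * (real i + 1) powr p" using C by (simp add: mult_le_cancel_right1)
    finally show ?thesis using True by (simp add: e_def pow_coeff_def)
  next
    case False
    then have ni: "n - i \<ge> 1" using i by simp
    define x where "x = real n / real (n - i)"
    \<comment> \<open>Bounds the quotient \<open>n / (n - i)\<close> by \<open>i + 1\<close>, so the
      majorant is polynomial in \<open>i\<close> and independent of \<open>n\<close>.\<close>
    have "n \<le> (i + 1) * (n - i)"
    proof -
      obtain m where m: "n - i = Suc m" using ni by (cases "n - i") auto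
      then have "n = i + Suc m" using i by simp
      then show ?thesis using m by (simp add: algebra_simps)
    qed
    then have "real n \<le> (real i + 1) * real (n - i)" by (metis of_nat_1 of_nat_add of_nat_le_iff of_nat_mult)
    then have x: "1 \<le> x" "x \<le> real i + 1" using ni i by (auto simp: x_def field_simps)
    have "real n powr (1 - \<theta>) = x powr (1 - \<theta>) * real (n - i) powr (1 - \<theta>)"
      unfolding x_def using ni by (simp flip: powr_mult)
    then have "real n powr (1 - \<theta>) * e (n - i) = x powr (1 - \<theta>) * (e (n - i) * real (n - i) powr (1 - \<theta>))" by simp
    also have "\<dots> \<le> (real i + 1) powr p * C"
    proof (rule mult_mono)
      have "x powr (1 - \<theta>) \<le> x powr p" by (rule powr_mono) (use x in \<open>auto simp: p_def\<close>)
      also have "\<dots> \<le> (real i + 1) powr p" by (rule powr_mono2) (use x in \<open>auto simp: p_def\<close>)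
      finally show "x powr (1 - \<theta>) \<le> (real i + 1) powr p" .
      show "e (n - i) * real (n - i) powr (1 - \<theta>) \<le> C" using C(2)[of "n - i"] by simp
      show "0 \<le> e (n - i) * real (n - i) powr (1 - \<theta>)" using e0[of "n - i"] by simp
    qed simp
    also have "\<dots> \<le> (C + 1) * (real i + 1) powr p" by (simp add: algebra_simps)
    finally show ?thesis .
  qed
  have b2: "real n powr (1 - \<theta>) * e n \<le> (C + 1) * (real i + 1) powr p" if "n \<ge> 1" for i n
  proof -
    have "real n powr (1 - \<theta>) * e n \<le> C * 1" using C(2)[of n] by (simp add: mult.commute)
    also have "\<dots> \<le> (C + 1) * (real i + 1) powr p"
      by (rule mult_mono) (use C in \<open>auto simp: p_def intro!: ge_one_powr_ge_zero\<close>)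
    finally show ?thesis .
  qed
  define M where "M i = 2 * (C + 1) * (real i + 1) powr p / R ^ i" for i
  define a where "a i n = real n powr (1 - \<theta>) * ((if i \<le> n then \<bar>e (n - i) - e n\<bar> else e n) / R ^ i)" for i n
  have bd: "norm (a i n) \<le> M i" if n: "n \<ge> 1" for i n
  proof -
    have "real n powr (1 - \<theta>) * (if i \<le> n then \<bar>e (n - i) - e n\<bar> else e n) \<le> 2 * (C + 1) * (real i + 1) powr p"
    proof (cases "i \<le> n")
      case True
      have "\<bar>e (n - i) - e n\<bar> \<le> e (n - i) + e n" using e0[of n] e0[of "n - i"] by simp
      then have "real n powr (1 - \<theta>) * \<bar>e (n - i) - e n\<bar> \<le> real n powr (1 - \<theta>) * (e (n - i) + e n)"
        by (rule mult_left_mono) simp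
      also have "\<dots> \<le> (C + 1) * (real i + 1) powr p + (C + 1) * (real i + 1) powr p"
        unfolding distrib_left by (intro add_mono b1[OF True n] b2[OF n])
      also have "\<dots> = 2 * (C + 1) * (real i + 1) powr p" by (simp add: algebra_simps)
      finally show ?thesis using True by simp
    next
      case False
      have "(C + 1) * (real i + 1) powr p \<ge> 0" using C by simp
      moreover have "2 * (C + 1) * (real i + 1) powr p = (C + 1) * (real i + 1) powr p + (C + 1) * (real i + 1) powr p"
        by (simp add: algebra_simps)
      ultimately have "real n powr (1 - \<theta>) * e n \<le> 2 * (C + 1) * (real i + 1) powr p"
        using b2[OF n, of i] by linarith
      then show ?thesis using False by simp
    qed
    then have "real n powr (1 - \<theta>) * (if i \<le> n then \<bar>e (n - i) - e n\<bar> else e n) / R ^ i \<le> M i"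
      unfolding M_def by (rule divide_right_mono) (use R in simp)
    moreover have "a i n \<ge> 0" unfolding a_def using R e0[of n] by (intro mult_nonneg_nonneg divide_nonneg_nonneg) auto
    ultimately show ?thesis by (simp add: a_def)
  qed
  have sM: "summable M"
  proof (rule summable_comparison_test_ev)
    \<comment> \<open>One half of the geometric decay absorbs the polynomial factor, the other half
      is summed.\<close>
    define q where "q = sqrt R"
    have q: "q > 1" "R = q * q" using R by (auto simp: q_def)
    have "(\<lambda>i. 2 * (C + 1) * ((real i + 1) powr p * (1 / q) ^ i)) \<longlonglongrightarrow> 2 * (C + 1) * 0"
      using q by (intro tendsto_mult_left) real_asymp
    then have "\<forall>\<^sub>F i in sequentially. 2 * (C + 1) * ((real i + 1) powr p * (1 / q) ^ i) < 1"
      by (rule order_tendstoD) simp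
    then show "\<forall>\<^sub>F i in sequentially. norm (M i) \<le> (1 / q) ^ i"
    proof eventually_elim
      case (elim i)
      have "M i = 2 * (C + 1) * ((real i + 1) powr p * (1 / q) ^ i) * (1 / q) ^ i"
        by (simp add: M_def q(2) power_mult_distrib power_divide)
      also have "\<dots> \<le> 1 * (1 / q) ^ i" by (rule mult_right_mono) (use elim q in auto)
      finally have "M i \<le> (1 / q) ^ i" by simp
      moreover have "M i \<ge> 0" using C R by (simp add: M_def)
      ultimately show ?case by simp
    qed
    show "summable (\<lambda>i. (1 / q) ^ i)" by (rule summable_geometric) (use q in simp)
  qed
  have "eventually (\<lambda>n. summable (\<lambda>k. norm (a k n))) sequentially \<and>
        summable (\<lambda>j::nat. norm (0::real)) \<and> ((\<lambda>n. suminf (\<lambda>k. a k n)) \<longlonglongrightarrow> suminf (\<lambda>j. 0))"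
  proof (rule tannerys_theorem)
    fix i
    have 1: "(\<lambda>n. e n * (real n + real i) powr (1 - \<theta>)) \<longlonglongrightarrow> rGamma \<theta> * 1"
    proof (rule Lim_transform_eventually)
      show "(\<lambda>n. (e n * real n powr (1 - \<theta>)) * ((real n + real i) powr (1 - \<theta>) / real n powr (1 - \<theta>))) \<longlonglongrightarrow> rGamma \<theta> * 1"
        by (intro tendsto_mult elim) real_asymp
      show "\<forall>\<^sub>F n in sequentially. (e n * real n powr (1 - \<theta>)) * ((real n + real i) powr (1 - \<theta>) / real n powr (1 - \<theta>)) = e n * (real n + real i) powr (1 - \<theta>)"
        using eventually_gt_at_top[of 0] by eventually_elim simp
    qed
    have 2: "(\<lambda>n. e (n + i) * real (n + i) powr (1 - \<theta>)) \<longlonglongrightarrow> rGamma \<theta>"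
      by (rule LIMSEQ_ignore_initial_segment[OF elim])
    have "(\<lambda>n. \<bar>e n * (real n + real i) powr (1 - \<theta>) - e (n + i) * real (n + i) powr (1 - \<theta>)\<bar> / R ^ i) \<longlonglongrightarrow> \<bar>rGamma \<theta> * 1 - rGamma \<theta>\<bar> / R ^ i"
      by (intro tendsto_intros 1 2) (use R in auto)
    then have "(\<lambda>n. \<bar>e n * (real n + real i) powr (1 - \<theta>) - e (n + i) * real (n + i) powr (1 - \<theta>)\<bar> / R ^ i) \<longlonglongrightarrow> 0" by simp
    moreover have "a i (n + i) = \<bar>e n * (real n + real i) powr (1 - \<theta>) - e (n + i) * real (n + i) powr (1 - \<theta>)\<bar> / R ^ i" for n
    proof -
      have "\<bar>e n * (real n + real i) powr (1 - \<theta>) - e (n + i) * real (n + i) powr (1 - \<theta>)\<bar> = \<bar>e n - e (n + i)\<bar> * (real n + real i) powr (1 - \<theta>)"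
        by (simp add: abs_mult flip: left_diff_distrib)
      then show ?thesis by (simp add: a_def)
    qed
    ultimately have "(\<lambda>n. a i (n + i)) \<longlonglongrightarrow> 0" by simp
    then show "(\<lambda>n. a i n) \<longlonglongrightarrow> 0" by (rule LIMSEQ_offset)
  next
    have "\<forall>\<^sub>F p in at_top \<times>\<^sub>F sequentially. snd p \<ge> (1::nat)"
      by (rule eventually_compose_filterlim[OF eventually_ge_at_top filterlim_snd])
    then show "\<forall>\<^sub>F (k, n) in at_top \<times>\<^sub>F sequentially. norm (a k n) \<le> M k"
      unfolding case_prod_beta by (rule eventually_mono) (rule bd)
  qed (use sM in auto)
  then have "(\<lambda>n. suminf (\<lambda>k. a k n)) \<longlonglongrightarrow> 0" by simp
  moreover have "suminf (\<lambda>i. a i n) = real n powr (1 - \<theta>) * (\<Sum>i. (if i \<le> n then \<bar>e (n - i) - e n\<bar> else e n) / R ^ i)" for n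
    unfolding a_def
  proof (rule suminf_mult, rule summable_comparison_test_ev)
    have "summable (\<lambda>i. (1 / R) ^ i)" using R by (intro summable_geometric) auto
    then show "summable (\<lambda>i. e n * (1 / R) ^ i)" by (rule summable_mult)
    show "\<forall>\<^sub>F i in sequentially. norm ((if i \<le> n then \<bar>e (n - i) - e n\<bar> else e n) / R ^ i) \<le> e n * (1 / R) ^ i"
      using eventually_gt_at_top[of n]
      by eventually_elim (use e0[of n] R in \<open>simp add: power_divide\<close>)
  qed
  ultimately show ?thesis by simp
qed


lemma compose_pow_coeff_sums:
  fixes P :: "real fps" and z :: complex
  assumes P: "\<And>n. fps_nth P n \<ge> 0" and s: "s > 0"
    and z: "ereal (norm z) < fps_conv_radius P" and P1: "eval_fps P (norm z) < 1"
  shows "(\<lambda>n. of_real (\<Sum>k. pow_coeff (-s) k * fps_nth (P ^ k) n) * z ^ n) sums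
           ((1 - eval_fps (cfps P) z) powr of_real (-s))"
    and "z \<noteq> 0 \<Longrightarrow> summable (\<lambda>k. pow_coeff (-s) k * fps_nth (P ^ k) n)"
    and "norm (eval_fps (cfps P) z) < 1"
proof -
  have sP: "summable (\<lambda>n. fps_nth P n * norm z ^ n)" by (rule summable_fps) (use z in simp)
  have h0: "0 \<le> eval_fps P (norm z)" by (rule eval_fps_nonneg[OF P _ sP]) simp
  have "norm (eval_fps (cfps P) z) \<le> eval_fps P (norm z)"
    unfolding eval_fps_def
    by (rule norm_suminf_le[OF _ sP]) (use P in \<open>simp add: norm_mult norm_power\<close>)
  then show w: "norm (eval_fps (cfps P) z) < 1" using P1 by simp
  have sm: "summable (\<lambda>k. pow_coeff (-s) k * eval_fps P (norm z) ^ k)"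
    using pow_coeff_sums_real[of "eval_fps P (norm z)" "-s"] h0 P1 by (auto simp: sums_iff)
  note pos = less_imp_le[OF pow_coeff_neg_pos[OF s]]
  show "(\<lambda>n. of_real (\<Sum>k. pow_coeff (-s) k * fps_nth (P ^ k) n) * z ^ n) sums
           ((1 - eval_fps (cfps P) z) powr of_real (-s))"
    using compose_coeffs_sums[OF pos P z sm] pow_coeff_sums[OF w, of "-s"] by (simp add: sums_iff)
  show "z \<noteq> 0 \<Longrightarrow> summable (\<lambda>k. pow_coeff (-s) k * fps_nth (P ^ k) n)"
    by (rule compose_coeffs(1)[OF pos P _ z sm])
qed

section \<open>Exponentially tilted series and a uniform renewal estimate\<close>

lemma scale_fps_mult: "scale_fps s (F * G) = scale_fps s F * scale_fps s G"
proof (rule fps_ext)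
  fix n
  have "s ^ n * (\<Sum>i=0..n. fps_nth F i * fps_nth G (n - i)) = (\<Sum>i=0..n. (s ^ i * fps_nth F i) * (s ^ (n - i) * fps_nth G (n - i)))"
    unfolding sum_distrib_left
  proof (rule sum.cong)
    fix i assume "i \<in> {0..n}"
    then have "s ^ n = s ^ i * s ^ (n - i)" by (simp flip: power_add)
    then show "s ^ n * (fps_nth F i * fps_nth G (n - i)) = (s ^ i * fps_nth F i) * (s ^ (n - i) * fps_nth G (n - i))" by simp
  qed simp
  then show "fps_nth (scale_fps s (F * G)) n = fps_nth (scale_fps s F * scale_fps s G) n"
    by (simp add: fps_mult_nth)
qed

lemma scale_fps_power: "scale_fps s (F ^ k) = scale_fps s F ^ k"
proof (induction k)
  case 0
  show ?case by (rule fps_ext) simp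
qed (simp add: scale_fps_mult)

text \<open>The probability generating function \<open>H(sz)/H(s)\<close> of the Boltzmann law with
  parameter \<open>s\<close>.\<close>

definition tilted_fps :: "real fps \<Rightarrow> real \<Rightarrow> real fps" where
  "tilted_fps H s = fps_const (1 / eval_fps H s) * scale_fps s H"

lemma tilted_fps_power_nth:
  "fps_nth (tilted_fps H s ^ k) n = fps_nth (H ^ k) n * s ^ n / eval_fps H s ^ k"
  by (simp add: tilted_fps_def power_mult_distrib fps_const_power power_divide flip: scale_fps_power)

lemma eval_fps_strict_mono:
  fixes F :: "real fps"
  assumes "\<And>n. fps_nth F n \<ge> 0" "0 \<le> x" "x < y" "ereal y < fps_conv_radius F" "m > 0" "fps_nth F m \<noteq> 0"
  shows "eval_fps F x < eval_fps F y"
proof -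
  have sy: "summable (\<lambda>n. fps_nth F n * y ^ n)" by (rule summable_fps) (use assms in simp)
  have "ereal x < fps_conv_radius F" using assms by (meson ereal_less_eq(3) le_less_trans less_imp_le)
  then have sx: "summable (\<lambda>n. fps_nth F n * x ^ n)" by (intro summable_fps) (use assms in simp)
  have nn: "fps_nth F n * y ^ n - fps_nth F n * x ^ n \<ge> 0" for n
    using mult_left_mono[OF power_mono[of x y n] assms(1)[of n]] assms by simp
  have "fps_nth F m > 0" using le_neq_trans[OF assms(1) assms(6)[symmetric]] .
  moreover have "x ^ m < y ^ m" using assms by (intro power_strict_mono) auto
  ultimately have "0 < fps_nth F m * y ^ m - fps_nth F m * x ^ m" by (simp flip: right_diff_distrib)
  also have "\<dots> \<le> (\<Sum>n. fps_nth F n * y ^ n - fps_nth F n * x ^ n)"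
    using sum_le_suminf[OF summable_diff[OF sy sx], of "{m}"] nn by simp
  also have "\<dots> = eval_fps F y - eval_fps F x" unfolding eval_fps_def by (rule suminf_diff[OF sy sx, symmetric])
  finally show ?thesis by simp
qed

lemma tilted_fps_facts:
  assumes H: "delta_singular H \<rho> lam c" and s: "0 < s" "s < \<rho>"
  shows "eval_fps H s > 0" and "fps_nth (tilted_fps H s) n \<ge> 0"
    and "fps_conv_radius (tilted_fps H s) = ereal (\<rho> / s)"
    and "norm (of_real s * z) < \<rho> \<Longrightarrow> eval_fps (cfps (tilted_fps H s)) z = eval_fps (cfps H) (of_real s * z) / of_real (eval_fps H s)"
    and "\<bar>s * x\<bar> < \<rho> \<Longrightarrow> eval_fps (tilted_fps H s) x = eval_fps H (s * x) / eval_fps H s"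
    and "norm z \<le> 1 \<Longrightarrow> z \<noteq> 1 \<Longrightarrow> norm (eval_fps (cfps (tilted_fps H s)) z) < 1"
proof -
  have nn: "\<And>n. fps_nth H n \<ge> 0" and ap: "aperiodic_fps H" and rad: "fps_conv_radius H = ereal \<rho>"
    using H by (auto simp: delta_singular_def)
  obtain m where m: "fps_nth H m \<noteq> 0" using delta_singular_nonpoly[OF H] by blast
  show h: "eval_fps H s > 0" by (rule eval_fps_pos[OF nn s(1) _ m]) (use s rad in simp)
  show "fps_nth (tilted_fps H s) n \<ge> 0" using nn h s by (simp add: tilted_fps_def)
  show "fps_conv_radius (tilted_fps H s) = ereal (\<rho> / s)"
    unfolding tilted_fps_def using h scale_fps_radius[OF s(1) rad] by (simp add: fps_conv_radius_const_mult)
  show ev: "eval_fps (cfps (tilted_fps H s)) z = eval_fps (cfps H) (of_real s * z) / of_real (eval_fps H s)"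
    if z: "norm (of_real s * z) < \<rho>" for z
  proof -
    have "summable (\<lambda>n. fps_nth (cfps H) n * (of_real s * z) ^ n)" by (rule summable_fps) (use z rad in simp)
    from suminf_divide[OF this, of "of_real (eval_fps H s)"]
    have "(\<Sum>n. fps_nth (cfps H) n * (of_real s * z) ^ n / of_real (eval_fps H s)) = eval_fps (cfps H) (of_real s * z) / of_real (eval_fps H s)"
      by (simp only: eval_fps_def)
    moreover have "fps_nth (cfps (tilted_fps H s)) n * z ^ n = fps_nth (cfps H) n * (of_real s * z) ^ n / of_real (eval_fps H s)" for n
      using tilted_fps_power_nth[of H s 1 n] by (simp add: power_mult_distrib)
    ultimately show ?thesis by (simp only: eval_fps_def[of "cfps (tilted_fps H s)"])
  qed
  show "\<bar>s * x\<bar> < \<rho> \<Longrightarrow> eval_fps (tilted_fps H s) x = eval_fps H (s * x) / eval_fps H s"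
    unfolding tilted_fps_def by (subst eval_const_scale_fps) (use rad in auto)
  show "norm (eval_fps (cfps (tilted_fps H s)) z) < 1" if z: "norm z \<le> 1" "z \<noteq> 1"
  proof -
    have nz: "norm (of_real s * z) \<le> s" using z s by (simp add: norm_mult)
    have sm: "summable (\<lambda>n. fps_nth H n * s ^ n)" by (rule summable_fps) (use s rad in simp)
    have "norm (\<Sum>n. of_real (fps_nth H n) * (of_real s * z) ^ n) < (\<Sum>n. fps_nth H n * s ^ n)"
      by (rule aperiodic_strict[OF ap nn s(1) sm nz]) (use z s in simp)
    then show ?thesis using ev[of z] nz s h by (simp add: eval_fps_def[of "cfps H"] eval_fps_def[of H] norm_divide)
  qed
qed

lemma tilted_fps_disc:
  fixes z :: complex
  assumes H: "delta_singular H \<rho> lam c" and s: "0 < s" "s < \<rho>" and z: "norm z < 1"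
  shows "ereal (norm z) < fps_conv_radius (tilted_fps H s)" and "eval_fps (tilted_fps H s) (norm z) < 1"
proof -
  have "1 < \<rho> / s" using s by simp
  then show r1: "ereal (norm z) < fps_conv_radius (tilted_fps H s)" using z tilted_fps_facts(3)[OF H s] by simp
  have "norm (eval_fps (cfps (tilted_fps H s)) (of_real (norm z))) < 1"
    by (rule tilted_fps_facts(6)[OF H s]) (use z in auto)
  then show "eval_fps (tilted_fps H s) (norm z) < 1" using eval_cfps_of_real[of "norm z" "tilted_fps H s"] r1 by simp
qed

lemma eval_fps_isCont_real:
  fixes F :: "real fps"
  assumes "ereal \<bar>x\<bar> < fps_conv_radius F"
  shows "isCont (eval_fps F) x"
  by (rule DERIV_isCont[OF has_field_derivative_eval_fps]) (use assms in simp)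

text \<open>The quotient \<open>(1 - H(sz)/H(s)) / (1 - z)\<close> with its removable singularity at
  1 filled in.\<close>

definition tilt_quotient :: "real fps \<Rightarrow> real \<Rightarrow> complex \<Rightarrow> complex" where
  "tilt_quotient H s z = (let G = eval_fps (cfps (tilted_fps H s)) in
     if z = 1 then deriv G 1 else (G z - G 1) / (z - 1))"

text \<open>There is no zero on the closed unit disc: away from 1 because aperiodicity keeps the
  tilted series below 1 in modulus, and at 1 because the value is the mean of the tilted law, which
  is positive.\<close>

lemma tilt_quotient_facts:
  assumes H: "delta_singular H \<rho> lam c" and s: "0 < s" "s < \<rho>"
  shows "s * R \<le> \<rho> \<Longrightarrow> tilt_quotient H s holomorphic_on ball 0 R"
    and "tilt_quotient H s 1 = of_real (s * eval_fps (fps_deriv H) s / eval_fps H s)"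
    and "norm z < 1 \<Longrightarrow> 1 - eval_fps (cfps (tilted_fps H s)) z = (1 - z) * tilt_quotient H s z"
    and "norm z \<le> 1 \<Longrightarrow> tilt_quotient H s z \<noteq> 0"
    and "eval_fps (fps_deriv H) s > 0"
proof -
  let ?G = "eval_fps (cfps (tilted_fps H s))"
  have nn: "\<And>n. fps_nth H n \<ge> 0" and rad: "fps_conv_radius H = ereal \<rho>"
    using H by (auto simp: delta_singular_def)
  note T = tilted_fps_facts[OF H s]
  have G1: "?G 1 = 1" using T(4)[of 1] T(1) s eval_cfps_of_real[of s H] rad by simp
  show "tilt_quotient H s holomorphic_on ball 0 R" if sR: "s * R \<le> \<rho>"
  proof -
    have "ball (0::complex) R \<subseteq> eball 0 (fps_conv_radius (cfps (tilted_fps H s)))"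
    proof
      fix z :: complex assume "z \<in> ball 0 R"
      then have "norm z < R" by simp
      also have "R \<le> \<rho> / s" using sR s by (simp add: field_simps)
      finally show "z \<in> eball 0 (fps_conv_radius (cfps (tilted_fps H s)))" using T(3) by simp
    qed
    then have "?G holomorphic_on ball 0 R" by (intro holomorphic_intros)
    from pole_lemma_open[OF this open_ball, of 1]
    show ?thesis unfolding tilt_quotient_def[abs_def] Let_def .
  qed
  have rad1: "ereal s < fps_conv_radius (fps_deriv H)"
    using s rad fps_conv_radius_deriv[of H] by (metis less_ereal.simps(1) less_le_trans)
  obtain m where m: "m \<ge> 1" "fps_nth H m \<noteq> 0" using delta_singular_nonpoly[OF H, of 1] by auto
  then have m': "fps_nth (fps_deriv H) (m - 1) \<noteq> 0" by simp
  show h': "eval_fps (fps_deriv H) s > 0"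
    by (rule eval_fps_pos[OF _ s(1) rad1 m']) (use nn in simp)
  show K1: "tilt_quotient H s 1 = of_real (s * eval_fps (fps_deriv H) s / eval_fps H s)"
  proof -
    have U: "open (ball 0 (\<rho> / s))" "1 \<in> ball (0::complex) (\<rho> / s)" using s by (auto simp: field_simps)
    have "(eval_fps (cfps H) has_field_derivative eval_fps (fps_deriv (cfps H)) (of_real s * 1)) (at (of_real s * 1))"
      by (rule has_field_derivative_eval_fps) (use s rad in simp)
    then have "((\<lambda>z. eval_fps (cfps H) (of_real s * z)) has_field_derivative eval_fps (fps_deriv (cfps H)) (of_real s * 1) * of_real s) (at 1)"
      by (rule DERIV_chain2) (auto intro!: derivative_eq_intros)
    then have "((\<lambda>z. eval_fps (cfps H) (of_real s * z) / of_real (eval_fps H s)) has_field_derivative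
        eval_fps (fps_deriv (cfps H)) (of_real s * 1) * of_real s / of_real (eval_fps H s)) (at 1)"
      by (rule DERIV_cdivide)
    then have "(?G has_field_derivative eval_fps (fps_deriv (cfps H)) (of_real s * 1) * of_real s / of_real (eval_fps H s)) (at 1)"
    proof (rule has_field_derivative_transform_within_open[OF _ U])
      fix z :: complex assume "z \<in> ball 0 (\<rho> / s)"
      then have "norm (of_real s * z) < \<rho>" using s by (simp add: norm_mult field_simps)
      then show "eval_fps (cfps H) (of_real s * z) / of_real (eval_fps H s) = ?G z" using T(4) by simp
    qed
    then have "deriv ?G 1 = eval_fps (fps_deriv (cfps H)) (of_real s * 1) * of_real s / of_real (eval_fps H s)"
      by (rule DERIV_imp_deriv)
    also have "eval_fps (fps_deriv (cfps H)) (of_real s * 1) = of_real (eval_fps (fps_deriv H) s)"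
      using eval_cfps_of_real[of s "fps_deriv H"] rad1 s by (simp add: cfps_deriv)
    finally show ?thesis by (simp add: tilt_quotient_def mult.commute)
  qed
  show "1 - ?G z = (1 - z) * tilt_quotient H s z" if "norm z < 1"
    using that by (auto simp: tilt_quotient_def Let_def G1 divide_simps) (simp_all add: algebra_simps)
  show "tilt_quotient H s z \<noteq> 0" if "norm z \<le> 1"
  proof (cases "z = 1")
    case True
    then show ?thesis using K1 s h' T(1) by simp
  next
    case False
    have "?G z \<noteq> 1" using T(6)[OF that False] by auto
    then show ?thesis using False by (simp add: tilt_quotient_def Let_def G1)
  qed
qed

text \<open>For given \<open>x\<close> and \<open>y\<close> the differences
  \<open>x ^ n - y ^ n\<close> all have one sign. Summing moduli over nonnegative coefficients thus
  gives the modulus of a single real difference.\<close>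

lemma eval_cfps_diff_bound:
  assumes nn: "\<And>n. fps_nth H n \<ge> 0" and xy: "0 \<le> x" "0 \<le> y" "0 < R" "norm z \<le> R"
    and rad: "ereal (x * R) < fps_conv_radius H" "ereal (y * R) < fps_conv_radius H"
  shows "norm (eval_fps (cfps H) (of_real x * z) - eval_fps (cfps H) (of_real y * z)) \<le> \<bar>eval_fps H (x * R) - eval_fps H (y * R)\<bar>"
proof -
  have le: "ereal (norm (of_real t * z)) < fps_conv_radius (cfps H)" if "0 \<le> t" "ereal (t * R) < fps_conv_radius H" for t
  proof -
    have "norm (of_real t * z) \<le> t * R" using that xy by (simp add: norm_mult mult_left_mono)
    then show ?thesis using that by (simp add: le_less_trans[of _ "ereal (t * R)"])
  qed
  have sz: "(\<lambda>n. fps_nth (cfps H) n * (of_real t * z) ^ n) sums eval_fps (cfps H) (of_real t * z)" if "0 \<le> t" "ereal (t * R) < fps_conv_radius H" for t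
    by (rule sums_eval_fps[OF le[OF that]])
  have sr: "(\<lambda>n. fps_nth H n * (t * R) ^ n) sums eval_fps H (t * R)" if "0 \<le> t" "ereal (t * R) < fps_conv_radius H" for t
    using sums_eval_fps[of "t * R" H] that xy by simp
  have S: "(\<lambda>n. fps_nth (cfps H) n * (of_real x * z) ^ n - fps_nth (cfps H) n * (of_real y * z) ^ n) sums (eval_fps (cfps H) (of_real x * z) - eval_fps (cfps H) (of_real y * z))"
    by (intro sums_diff sz xy rad)
  define \<epsilon> :: real where "\<epsilon> = (if x \<le> y then -1 else 1)"
  have D: "(\<lambda>n. \<epsilon> * (fps_nth H n * (x * R) ^ n - fps_nth H n * (y * R) ^ n)) sums (\<epsilon> * (eval_fps H (x * R) - eval_fps H (y * R)))"
    by (intro sums_mult sums_diff sr xy rad)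
  have b: "norm (fps_nth (cfps H) n * (of_real x * z) ^ n - fps_nth (cfps H) n * (of_real y * z) ^ n) \<le> \<epsilon> * (fps_nth H n * (x * R) ^ n - fps_nth H n * (y * R) ^ n)" for n
  proof -
    have "fps_nth (cfps H) n * (of_real x * z) ^ n - fps_nth (cfps H) n * (of_real y * z) ^ n = of_real (fps_nth H n * (x ^ n - y ^ n)) * z ^ n"
      by (simp add: power_mult_distrib algebra_simps)
    also have "norm \<dots> = fps_nth H n * \<bar>x ^ n - y ^ n\<bar> * norm z ^ n"
      using nn[of n] by (simp only: norm_mult norm_power norm_of_real abs_mult abs_of_nonneg[OF nn])
    also have "\<dots> \<le> fps_nth H n * \<bar>x ^ n - y ^ n\<bar> * R ^ n"
      by (intro mult_left_mono power_mono) (use nn[of n] xy in auto)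
    also have "\<bar>x ^ n - y ^ n\<bar> = \<epsilon> * (x ^ n - y ^ n)"
    proof (cases "x \<le> y")
      case True
      then show ?thesis using power_mono[OF True xy(1), of n] by (simp add: \<epsilon>_def)
    next
      case False
      then show ?thesis using power_mono[OF _ xy(2), of x n] by (simp add: \<epsilon>_def)
    qed
    also have "fps_nth H n * (\<epsilon> * (x ^ n - y ^ n)) * R ^ n = \<epsilon> * (fps_nth H n * (x * R) ^ n - fps_nth H n * (y * R) ^ n)"
      by (simp add: power_mult_distrib algebra_simps)
    finally show ?thesis .
  qed
  have "norm (eval_fps (cfps H) (of_real x * z) - eval_fps (cfps H) (of_real y * z)) \<le> \<epsilon> * (eval_fps H (x * R) - eval_fps H (y * R))"
    using norm_suminf_le[OF b sums_summable[OF D]] unfolding sums_unique[OF S, symmetric] sums_unique[OF D, symmetric] .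
  also have "\<dots> \<le> \<bar>eval_fps H (x * R) - eval_fps H (y * R)\<bar>"
  proof -
    have "\<epsilon> * A \<le> \<bar>A\<bar>" for A :: real by (simp add: \<epsilon>_def abs_if)
    then show ?thesis .
  qed
  finally show ?thesis .
qed

text \<open>Compactness extends the absence of zeros at the limit parameter \<open>r\<close> from
  the closed unit disc to a larger one. The quotients for \<open>rn n\<close> converge uniformly on
  it, so eventually half of the minimum is a common lower bound.\<close>

lemma tilt_quotient_lower_bound:
  fixes rn :: "nat \<Rightarrow> real"
  assumes H: "delta_singular H \<rho> lam c" and r: "0 < r" "r < \<rho>"
    and rn: "rn \<longlonglongrightarrow> r" "\<And>n. 0 < rn n" "\<And>n. rn n < \<rho>"
  obtains R c0 where "R > 1" "c0 > 0"
    "\<forall>\<^sub>F n in sequentially. rn n * R \<le> \<rho> \<and> (\<forall>z\<in>ball 0 R. norm (tilt_quotient H (rn n) z) \<ge> c0)"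
proof -
  have nn: "\<And>n. fps_nth H n \<ge> 0" and rad: "fps_conv_radius H = ereal \<rho>"
    using H by (auto simp: delta_singular_def)
  let ?K = "tilt_quotient H"
  \<comment> \<open>An upper bound for \<open>rn n\<close> that will hold eventually; with
    \<open>R2 = \<rho> / r1\<close> every parameter below \<open>r1\<close> has its tilted series
    defined on the disc of radius \<open>R2\<close>.\<close>
  define r1 where "r1 = (r + \<rho>) / 2"
  have r1: "r < r1" "r1 < \<rho>" "0 < r1" using r by (auto simp: r1_def)
  define R2 where "R2 = \<rho> / r1"
  have R2: "R2 > 1" "r1 * R2 = \<rho>" using r1 by (auto simp: R2_def)
  have rR2: "r * R2 \<le> \<rho>"
  proof -
    have "r * R2 \<le> r1 * R2" using r1 R2 by (intro mult_right_mono) auto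
    then show ?thesis using R2 by simp
  qed
  have holK: "?K r holomorphic_on ball 0 R2" by (rule tilt_quotient_facts(1)[OF H r rR2])
  define U where "U = ball 0 R2 \<inter> ?K r -` (- {0})"
  have oU: "open U" unfolding U_def
    by (rule continuous_open_preimage[OF holomorphic_on_imp_continuous_on[OF holK] open_ball]) auto
  have subU: "cball 0 1 \<subseteq> U" using tilt_quotient_facts(4)[OF H r] R2 by (auto simp: U_def)
  obtain \<epsilon> where \<epsilon>: "\<epsilon> > 0" "(\<Union>x\<in>cball (0::complex) 1. ball x \<epsilon>) \<subseteq> U"
    using compact_subset_open_imp_ball_epsilon_subset[OF compact_cball oU subU] by blast
  define R where "R = min ((1 + R2) / 2) (1 + \<epsilon> / 2)"
  have R: "1 < R" "R < R2" "R < 1 + \<epsilon>" using R2 \<epsilon> unfolding R_def by (simp_all add: min_def)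
  have cbU: "cball 0 R \<subseteq> U"
  proof
    fix z :: complex assume z: "z \<in> cball 0 R"
    show "z \<in> U"
    proof (cases "norm z \<le> 1")
      case True then show ?thesis using subU by auto
    next
      case False
      define w where "w = z / of_real (norm z)"
      have "z \<noteq> 0" using False by auto
      then have "norm w = 1" by (simp add: w_def norm_divide)
      moreover have "z - w = of_real (norm z - 1) * w" using \<open>z \<noteq> 0\<close> by (simp add: w_def field_simps)
      then have "norm (z - w) = norm z - 1" using False calculation by (simp add: norm_mult del: of_real_diff)
      then have "dist w z = norm z - 1" by (metis dist_commute dist_norm)
      ultimately have "w \<in> cball 0 1" "z \<in> ball w \<epsilon>" using z R by auto
      then show ?thesis using \<epsilon>(2) by blast
    qed
  qed
  have contK: "continuous_on (cball 0 R) (\<lambda>z. norm (?K r z))"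
    by (intro continuous_on_norm continuous_on_subset[OF holomorphic_on_imp_continuous_on[OF holK]]) (use R in auto)
  obtain z0 where z0: "z0 \<in> cball 0 R" "\<And>z. z \<in> cball 0 R \<Longrightarrow> norm (?K r z0) \<le> norm (?K r z)"
    using continuous_attains_inf[OF compact_cball _ contK] R by auto
  define c0 where "c0 = norm (?K r z0) / 2"
  have c0: "c0 > 0" using z0(1) cbU by (auto simp: c0_def U_def)
  have Kc: "norm (?K r z) \<ge> 2 * c0" if "z \<in> cball 0 R" for z using z0(2)[OF that] by (simp add: c0_def)
  \<comment> \<open>Bounds the difference of the two quotients on the circle of radius
    \<open>R\<close>, where the denominator \<open>z - 1\<close> has modulus at least
    \<open>R - 1\<close>.\<close>
  define D where "D n = (\<bar>eval_fps H (rn n * R) - eval_fps H (r * R)\<bar> / eval_fps H (rn n)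
      + eval_fps H (r * R) * \<bar>1 / eval_fps H (rn n) - 1 / eval_fps H r\<bar>) / (R - 1)" for n
  have rR: "r * R < \<rho>"
  proof -
    have "r * R < r1 * R2" by (rule mult_strict_mono) (use r r1 R in auto)
    then show ?thesis using R2 by simp
  qed
  have hr: "eval_fps H r > 0" by (rule tilted_fps_facts(1)[OF H r])
  have l1: "(\<lambda>n. eval_fps H (rn n)) \<longlonglongrightarrow> eval_fps H r"
    by (rule isCont_tendsto_compose[OF eval_fps_isCont_real rn(1)]) (use r rad in simp)
  have l2: "(\<lambda>n. eval_fps H (rn n * R)) \<longlonglongrightarrow> eval_fps H (r * R)"
    by (rule isCont_tendsto_compose[OF eval_fps_isCont_real]) (use r R rR rad in \<open>auto intro!: tendsto_intros rn(1) simp: abs_mult\<close>)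
  have "D \<longlonglongrightarrow> (\<bar>eval_fps H (r * R) - eval_fps H (r * R)\<bar> / eval_fps H r + eval_fps H (r * R) * \<bar>1 / eval_fps H r - 1 / eval_fps H r\<bar>) / (R - 1)"
    unfolding D_def by (intro tendsto_intros l1 l2) (use hr R in auto)
  then have "D \<longlonglongrightarrow> 0" by simp
  then have evD: "\<forall>\<^sub>F n in sequentially. D n < c0" by (rule order_tendstoD) (use c0 in simp)
  have evr: "\<forall>\<^sub>F n in sequentially. rn n < r1" by (rule order_tendstoD(2)[OF rn(1) r1(1)])
  show ?thesis
  proof (rule that[OF R(1) c0])
    show "\<forall>\<^sub>F n in sequentially. rn n * R \<le> \<rho> \<and> (\<forall>z\<in>ball 0 R. norm (?K (rn n) z) \<ge> c0)"
      using evD evr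
    proof eventually_elim
      case (elim n)
      let ?s = "rn n"
      have s: "0 < ?s" "?s < \<rho>" using rn by auto
      have sR: "?s * R < \<rho>"
      proof -
        have "?s * R < r1 * R2" by (rule mult_strict_mono) (use s elim r1 R in auto)
        then show ?thesis using R2 by simp
      qed
      have sR2: "?s * R2 \<le> \<rho>"
      proof -
        have "?s * R2 \<le> r1 * R2" by (rule mult_right_mono) (use elim R2 in auto)
        then show ?thesis using R2 by simp
      qed
      have holKn: "?K ?s holomorphic_on ball 0 R2" by (rule tilt_quotient_facts(1)[OF H s sR2])
      have hs: "eval_fps H ?s > 0" by (rule tilted_fps_facts(1)[OF H s])
      have sph: "norm (?K ?s z - ?K r z) \<le> D n" if z: "norm z = R" for z
      proof -
        have z1: "z \<noteq> 1" using z R by auto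
        let ?A = "eval_fps (cfps H) (of_real ?s * z)" and ?B = "eval_fps (cfps H) (of_real r * z)"
        have Gs: "eval_fps (cfps (tilted_fps H ?s)) z = ?A / of_real (eval_fps H ?s)"
          by (rule tilted_fps_facts(4)[OF H s]) (use z sR s in \<open>simp add: norm_mult\<close>)
        have Gr: "eval_fps (cfps (tilted_fps H r)) z = ?B / of_real (eval_fps H r)"
          by (rule tilted_fps_facts(4)[OF H r]) (use z rR r in \<open>simp add: norm_mult\<close>)
        have one: "eval_fps (cfps (tilted_fps H t)) 1 = 1" if "0 < t" "t < \<rho>" for t
          using tilted_fps_facts(1)[OF H that] tilted_fps_facts(4)[OF H that, of 1] eval_cfps_of_real[of t H] rad that by simp
        have "?K ?s z - ?K r z = (?A / of_real (eval_fps H ?s) - ?B / of_real (eval_fps H r)) / (z - 1)"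
          using z1 by (simp add: tilt_quotient_def Let_def Gs Gr one[OF s] one[OF r] flip: diff_divide_distrib)
        also have "?A / of_real (eval_fps H ?s) - ?B / of_real (eval_fps H r) = (?A - ?B) / of_real (eval_fps H ?s) + ?B * of_real (1 / eval_fps H ?s - 1 / eval_fps H r)"
          using hs hr by (simp add: field_simps)
        finally have "norm (?K ?s z - ?K r z) = norm ((?A - ?B) / of_real (eval_fps H ?s) + ?B * of_real (1 / eval_fps H ?s - 1 / eval_fps H r)) / norm (z - 1)"
          by (simp add: norm_divide)
        also have "\<dots> \<le> (\<bar>eval_fps H (?s * R) - eval_fps H (r * R)\<bar> / eval_fps H ?s
            + eval_fps H (r * R) * \<bar>1 / eval_fps H ?s - 1 / eval_fps H r\<bar>) / (R - 1)"
        proof (rule frac_le)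
          have "norm ((?A - ?B) / of_real (eval_fps H ?s)) \<le> \<bar>eval_fps H (?s * R) - eval_fps H (r * R)\<bar> / eval_fps H ?s"
            using eval_cfps_diff_bound[OF nn, of ?s r R z] s r R z sR rR rad hs by (simp add: norm_divide divide_right_mono)
          moreover have "norm ?B \<le> eval_fps H (r * R)"
          proof -
            have "norm (eval_fps (cfps H) (of_real r * z) - eval_fps (cfps H) (of_real 0 * z)) \<le> \<bar>eval_fps H (r * R) - eval_fps H (0 * R)\<bar>"
              by (rule eval_cfps_diff_bound[OF nn]) (use r R z rR rad in auto)
            then have "norm (?B - of_real (fps_nth H 0)) \<le> \<bar>eval_fps H (r * R) - fps_nth H 0\<bar>" by (simp add: eval_fps_at_0)
            moreover have "eval_fps H (r * R) \<ge> fps_nth H 0"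
            proof -
              have "summable (\<lambda>n. fps_nth H n * (r * R) ^ n)" by (rule summable_fps) (use r R rR rad in \<open>simp add: abs_mult\<close>)
              from sum_le_suminf[OF this, of "{0}"] show ?thesis using nn r R by (simp add: eval_fps_def)
            qed
            moreover have "norm ?B \<le> norm (?B - of_real (fps_nth H 0)) + norm (complex_of_real (fps_nth H 0))"
              by (metis diff_add_cancel norm_triangle_ineq)
            ultimately show ?thesis using nn[of 0] by simp
          qed
          then have "norm (?B * of_real (1 / eval_fps H ?s - 1 / eval_fps H r)) \<le> eval_fps H (r * R) * \<bar>1 / eval_fps H ?s - 1 / eval_fps H r\<bar>"
            unfolding norm_mult norm_of_real by (rule mult_right_mono) simp
          ultimately show "norm ((?A - ?B) / of_real (eval_fps H ?s) + ?B * of_real (1 / eval_fps H ?s - 1 / eval_fps H r)) \<le> \<bar>eval_fps H (?s * R) - eval_fps H (r * R)\<bar> / eval_fps H ?s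
            + eval_fps H (r * R) * \<bar>1 / eval_fps H ?s - 1 / eval_fps H r\<bar>"
            by (rule norm_triangle_le[OF add_mono])
          show "R - 1 \<le> norm (z - 1)" using norm_triangle_ineq2[of z 1] z by simp
          have "0 \<le> norm ?B" by simp
          then have "0 \<le> eval_fps H (r * R)" using \<open>norm ?B \<le> eval_fps H (r * R)\<close> by linarith
          then show "0 \<le> \<bar>eval_fps H (?s * R) - eval_fps H (r * R)\<bar> / eval_fps H ?s + eval_fps H (r * R) * \<bar>1 / eval_fps H ?s - 1 / eval_fps H r\<bar>"
            using hs by (intro add_nonneg_nonneg mult_nonneg_nonneg divide_nonneg_nonneg) auto
        qed (use R in simp)
        finally show ?thesis by (simp add: D_def)
      qed
      \<comment> \<open>Near 1 the denominator is small, so the estimate is made on the circle only;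
        the maximum modulus principle carries it inside.\<close>
      have "norm (?K ?s z - ?K r z) \<le> D n" if z: "z \<in> cball 0 R" for z
      proof (rule maximum_modulus_frontier[of "\<lambda>z. ?K ?s z - ?K r z" "cball 0 R"])
        show "(\<lambda>z. ?K ?s z - ?K r z) holomorphic_on interior (cball 0 R)"
          by (intro holomorphic_intros holomorphic_on_subset[OF holKn] holomorphic_on_subset[OF holK]) (use R in auto)
        show "continuous_on (closure (cball 0 R)) (\<lambda>z. ?K ?s z - ?K r z)"
          by (intro continuous_intros continuous_on_subset[OF holomorphic_on_imp_continuous_on[OF holKn]]
              continuous_on_subset[OF holomorphic_on_imp_continuous_on[OF holK]]) (use R in auto)
        show "norm (?K ?s w - ?K r w) \<le> D n" if "w \<in> frontier (cball 0 R)" for w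
          by (rule sph) (use that R in \<open>simp add: frontier_cball\<close>)
      qed (use z in auto)
      then have "norm (?K ?s z) \<ge> c0" if "z \<in> ball 0 R" for z
        using that elim Kc[of z] norm_triangle_ineq2[of "?K r z" "?K ?s z"] by (smt (verit) ball_subset_cball norm_minus_commute subsetD)
      then show ?case using sR by simp
    qed
  qed
qed

text \<open>A diagonal limit: the parameter \<open>rn n\<close> varies together with the index
  \<open>n\<close>. The error bound of \<open>fractional_power_coeffs\<close> sees the parameter
  only through the common \<open>c0\<close> and \<open>R'\<close>. For \<theta> = 1 the limit is the
  reciprocal mean, as in the renewal theorem.\<close>

lemma renewal_coeff_asymp:
  fixes rn :: "nat \<Rightarrow> real"
  assumes H: "delta_singular H \<rho> lam c" and r: "0 < r" "r < \<rho>"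
    and rn: "rn \<longlonglongrightarrow> r" "\<And>n. 0 < rn n" "\<And>n. rn n < \<rho>" and \<theta>: "\<theta> > 0"
  shows "(\<lambda>n. (\<Sum>k. pow_coeff (-\<theta>) k * fps_nth (tilted_fps H (rn n) ^ k) n) * real n powr (1 - \<theta>)) \<longlonglongrightarrow>
       rGamma \<theta> * (r * eval_fps (fps_deriv H) r / eval_fps H r) powr (- \<theta>)"
proof -
  have nn: "\<And>n. fps_nth H n \<ge> 0" and rad: "fps_conv_radius H = ereal \<rho>"
    using H by (auto simp: delta_singular_def)
  define e where "e = pow_coeff (- \<theta>)"
  define a where "a n = (\<Sum>k. pow_coeff (-\<theta>) k * fps_nth (tilted_fps H (rn n) ^ k) n)" for n
  define \<kappa> where "\<kappa> s = s * eval_fps (fps_deriv H) s / eval_fps H s" for s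
  obtain R c0 where R: "R > 1" "c0 > 0"
    "\<forall>\<^sub>F n in sequentially. rn n * R \<le> \<rho> \<and> (\<forall>z\<in>ball 0 R. norm (tilt_quotient H (rn n) z) \<ge> c0)"
    by (rule tilt_quotient_lower_bound[OF H r rn]) blast
  define R' where "R' = (1 + R) / 2"
  have R': "1 < R'" "R' < R" using R by (auto simp: R'_def)
  define S where "S n = (\<Sum>i. (if i \<le> n then \<bar>e (n - i) - e n\<bar> else e n) / R' ^ i)" for n
  have \<kappa>pos: "\<kappa> s > 0" if "0 < s" "s < \<rho>" for s
    using tilt_quotient_facts(5)[OF H that] tilted_fps_facts(1)[OF H that] that by (simp add: \<kappa>_def)
  have bd: "\<forall>\<^sub>F n in sequentially. \<bar>a n - e n * \<kappa> (rn n) powr (- \<theta>)\<bar> \<le> c0 powr (- \<theta>) * S n"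
    using R(3)
  proof eventually_elim
    case (elim n)
    have s: "0 < rn n" "rn n < \<rho>" using rn by auto
    let ?P = "tilted_fps H (rn n)"
    let ?F = "\<lambda>z. 1 - eval_fps (cfps ?P) z"
    note P1 = tilted_fps_disc[OF H s]
    have "\<bar>a n - pow_coeff (-\<theta>) n * norm (tilt_quotient H (rn n) 1) powr (- \<theta>)\<bar> \<le>
      c0 powr (- \<theta>) * (\<Sum>i. (if i \<le> n then \<bar>pow_coeff (-\<theta>) (n - i) - pow_coeff (-\<theta>) n\<bar> else pow_coeff (-\<theta>) n) / R' ^ i)"
      unfolding a_def
    proof (rule fractional_power_coeffs(2)[OF R' _ R(2), where F = ?F and K = "tilt_quotient H (rn n)"
          and a = "\<lambda>m. \<Sum>k. pow_coeff (-\<theta>) k * fps_nth (tilted_fps H (rn n) ^ k) m"])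
      show "tilt_quotient H (rn n) holomorphic_on ball 0 R" by (rule tilt_quotient_facts(1)[OF H s]) (use elim in simp)
      show "norm (tilt_quotient H (rn n) z) \<ge> c0" if "z \<in> ball 0 R" for z using elim that by blast
      show "?F z = (1 - z) * tilt_quotient H (rn n) z" if "norm z < 1" for z by (rule tilt_quotient_facts(3)[OF H s that])
      show "Re (?F z) > 0" if z: "norm z < 1" for z
      proof -
        have "norm (eval_fps (cfps ?P) z) < 1" by (rule tilted_fps_facts(6)[OF H s]) (use z in auto)
        then show ?thesis using complex_Re_le_cmod[of "eval_fps (cfps ?P) z"] by simp
      qed
      show "Im (?F (of_real x)) = 0" if x: "0 < x" "x < 1" for x :: real
        using eval_cfps_of_real[of x ?P] P1(1)[of "of_real x"] x by simp
      show "(\<lambda>m. of_real (\<Sum>k. pow_coeff (-\<theta>) k * fps_nth (?P ^ k) m) * z ^ m) sums (?F z powr of_real (- \<theta>))"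
        if z: "norm z < 1" for z
        by (rule compose_pow_coeff_sums(1)[OF tilted_fps_facts(2)[OF H s] \<theta> P1[OF z]])
    qed (rule \<theta>)
    moreover have "norm (tilt_quotient H (rn n) 1) = \<kappa> (rn n)"
      unfolding tilt_quotient_facts(2)[OF H s] norm_of_real \<kappa>_def[symmetric] using \<kappa>pos[OF s] by simp
    ultimately show ?case by (simp only: e_def S_def)
  qed
  have Sl: "(\<lambda>n. c0 powr (- \<theta>) * (real n powr (1 - \<theta>) * S n)) \<longlonglongrightarrow> c0 powr (- \<theta>) * 0"
    unfolding S_def e_def by (intro tendsto_mult_left pow_coeff_increments_vanish \<theta> R'(1))
  have "(\<lambda>n. (a n - e n * \<kappa> (rn n) powr (- \<theta>)) * real n powr (1 - \<theta>)) \<longlonglongrightarrow> 0"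
  proof (rule Lim_null_comparison)
    show "\<forall>\<^sub>F n in sequentially. norm ((a n - e n * \<kappa> (rn n) powr (- \<theta>)) * real n powr (1 - \<theta>)) \<le> c0 powr (- \<theta>) * (real n powr (1 - \<theta>) * S n)"
      using bd
    proof eventually_elim
      case (elim n)
      from mult_right_mono[OF this, of "real n powr (1 - \<theta>)"] show ?case by (simp add: abs_mult mult_ac)
    qed
  qed (use Sl in simp)
  moreover have "(\<lambda>n. (e n * real n powr (1 - \<theta>)) * \<kappa> (rn n) powr (- \<theta>)) \<longlonglongrightarrow> rGamma \<theta> * \<kappa> r powr (- \<theta>)"
  proof (intro tendsto_mult tendsto_powr tendsto_const)
    show "(\<lambda>n. e n * real n powr (1 - \<theta>)) \<longlonglongrightarrow> rGamma \<theta>" using pow_coeff_asymp[of "- \<theta>"] by (simp add: e_def)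
    have rad1: "ereal r < fps_conv_radius (fps_deriv H)"
      using r rad fps_conv_radius_deriv[of H] by (metis less_ereal.simps(1) less_le_trans)
    show "(\<lambda>n. \<kappa> (rn n)) \<longlonglongrightarrow> \<kappa> r"
      unfolding \<kappa>_def
      by (intro tendsto_divide tendsto_mult rn(1) isCont_tendsto_compose[OF eval_fps_isCont_real rn(1)])
         (use r rad rad1 tilted_fps_facts(1)[OF H r] in auto)
    show "\<kappa> r \<noteq> 0" using \<kappa>pos[OF r] by simp
  qed
  ultimately have "(\<lambda>n. (a n - e n * \<kappa> (rn n) powr (- \<theta>)) * real n powr (1 - \<theta>) + (e n * real n powr (1 - \<theta>)) * \<kappa> (rn n) powr (- \<theta>)) \<longlonglongrightarrow> 0 + rGamma \<theta> * \<kappa> r powr (- \<theta>)"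
    by (rule tendsto_add)
  then show ?thesis by (simp add: a_def \<kappa>_def algebra_simps)
qed

lemma fps_power_nth_le:
  fixes F :: "real fps"
  assumes nn: "\<And>n. fps_nth F n \<ge> 0" and x: "0 \<le> x" "ereal x < fps_conv_radius F"
  shows "fps_nth (F ^ k) n * x ^ n \<le> eval_fps F x ^ k"
proof -
  have rad: "ereal (norm x) < fps_conv_radius (F ^ k)"
    using x less_le_trans[OF _ fps_conv_radius_power[of F k]] by simp
  have "sum (\<lambda>n. fps_nth (F ^ k) n * x ^ n) {n} \<le> (\<Sum>n. fps_nth (F ^ k) n * x ^ n)"
    by (rule sum_le_suminf[OF summable_fps[OF rad]]) (use nonneg_fps_power[OF nn] x in auto)
  also have "\<dots> = eval_fps (F ^ k) x" by (simp add: eval_fps_def)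
  also have "\<dots> = eval_fps F x ^ k" by (rule eval_fps_power) (use x in simp)
  finally show ?thesis by simp
qed

text \<open>The exchange of weights for the moving parameter. A single \<open>k\<close> is
  negligible because the coefficient of a fixed power decays exponentially, the tilted series having
  a radius of convergence above 1.\<close>

lemma tilted_sum_asymp:
  fixes rn :: "nat \<Rightarrow> real"
  assumes G: "delta_singular G \<rho>G lamG cG" and lamG: "lamG < 0"
    and H: "delta_singular H \<rho> lam c" and r: "0 < r" "r < \<rho>"
    and rn: "rn \<longlonglongrightarrow> r" "\<And>n. 0 < rn n" "\<And>n. rn n < \<rho>"
  shows "(\<lambda>n. (\<Sum>k. fps_nth G k * \<rho>G ^ k * fps_nth (tilted_fps H (rn n) ^ k) n) * real n powr (1 + lamG)) \<longlonglongrightarrow>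
       cG * rGamma (- lamG) * (r * eval_fps (fps_deriv H) r / eval_fps H r) powr lamG"
    and "summable (\<lambda>k. fps_nth G k * \<rho>G ^ k * fps_nth (tilted_fps H (rn n) ^ k) n)"
    and "cG * rGamma (- lamG) * (r * eval_fps (fps_deriv H) r / eval_fps H r) powr lamG > 0"
proof -
  have nn: "\<And>n. fps_nth H n \<ge> 0" and rad: "fps_conv_radius H = ereal \<rho>"
    using H by (auto simp: delta_singular_def)
  define \<kappa> where "\<kappa> = r * eval_fps (fps_deriv H) r / eval_fps H r"
  define w where "w n k = fps_nth (tilted_fps H (rn n) ^ k) n" for n k
  define b where "b = pow_coeff (- (- lamG))"
  define B where "B n = (\<Sum>k. b k * w n k)" for n
  have hr: "eval_fps H r > 0" by (rule tilted_fps_facts(1)[OF H r])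
  have \<kappa>: "\<kappa> > 0" using tilt_quotient_facts(5)[OF H r] r hr by (simp add: \<kappa>_def)
  have rG: "rGamma (- lamG) > 0" using lamG by (simp add: rGamma_inverse_Gamma Gamma_real_pos)
  have Blim: "(\<lambda>n. B n * real n powr (1 + lamG)) \<longlonglongrightarrow> rGamma (- lamG) * \<kappa> powr lamG"
    using renewal_coeff_asymp[OF H r rn, of "- lamG"] lamG by (simp add: B_def b_def w_def \<kappa>_def)
  have Lpos: "rGamma (- lamG) * \<kappa> powr lamG > 0" using rG \<kappa> by simp
  have bpos: "b k > 0" for k unfolding b_def by (rule pow_coeff_neg_pos) (use lamG in simp)
  have wnn: "w n k \<ge> 0" for n k
    unfolding w_def by (rule nonneg_fps_power[OF tilted_fps_facts(2)[OF H rn(2,3)]])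
  have smb: "summable (\<lambda>k. b k * w n k)" for n
    unfolding b_def w_def
    by (rule compose_pow_coeff_sums(2)[OF tilted_fps_facts(2)[OF H rn(2,3)] _ tilted_fps_disc[OF H rn(2,3)], where z = "1 / 2"])
       (use lamG in simp_all)
  have pos: "\<forall>\<^sub>F n in sequentially. B n > 0"
    using order_tendstoD(1)[OF Blim Lpos]
  proof eventually_elim
    case (elim n)
    then show ?case by (simp add: zero_less_mult_iff)
  qed
  \<comment> \<open>Eventually \<open>rn n < r2\<close>, and bounding the coefficients of
    \<open>H ^ k\<close> at the larger radius \<open>r1\<close> leaves the factor
    \<open>(r2 / r1) ^ n\<close>.\<close>
  define r1 where "r1 = (r + \<rho>) / 2"
  define r2 where "r2 = (r + r1) / 2"
  have r12: "r < r2" "r2 < r1" "r1 < \<rho>" "0 < r1" "0 < r2" using r by (simp_all add: r1_def r2_def field_simps)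
  have hlim: "(\<lambda>n. eval_fps H (rn n)) \<longlonglongrightarrow> eval_fps H r"
    by (rule isCont_tendsto_compose[OF eval_fps_isCont_real rn(1)]) (use r rad in simp)
  have ev: "\<forall>\<^sub>F n in sequentially. rn n < r2 \<and> eval_fps H r / 2 < eval_fps H (rn n)"
    using order_tendstoD(2)[OF rn(1) r12(1)] order_tendstoD(1)[OF hlim, of "eval_fps H r / 2"] hr
    by (auto elim: eventually_elim2)
  have wlim: "(\<lambda>n. w n k * real n powr (1 + lamG)) \<longlonglongrightarrow> 0" for k
  proof (rule Lim_null_comparison)
    show "\<forall>\<^sub>F n in sequentially. norm (w n k * real n powr (1 + lamG)) \<le>
        (2 * eval_fps H r1 / eval_fps H r) ^ k * ((r2 / r1) ^ n * real n powr (1 + lamG))"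
      using ev
    proof eventually_elim
      case (elim n)
      have h1: "eval_fps H r1 > 0" by (rule tilted_fps_facts(1)[OF H r12(4,3)])
      have e: "fps_nth (H ^ k) n * r1 ^ n \<le> eval_fps H r1 ^ k"
        by (rule fps_power_nth_le[OF nn]) (use r12 rad in auto)
      have "w n k = (fps_nth (H ^ k) n * r1 ^ n) * (rn n / r1) ^ n * (1 / eval_fps H (rn n)) ^ k"
        using r12 by (simp add: w_def tilted_fps_power_nth power_divide)
      also have "\<dots> \<le> eval_fps H r1 ^ k * (r2 / r1) ^ n * (1 / (eval_fps H r / 2)) ^ k"
      proof (intro mult_mono e power_mono)
        show "rn n / r1 \<le> r2 / r1" using elim r12 by (intro divide_right_mono) auto
        show "1 / eval_fps H (rn n) \<le> 1 / (eval_fps H r / 2)" using elim hr by (intro divide_left_mono) auto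
      qed (use rn(2)[of n] r12 h1 hr elim in \<open>auto intro!: divide_nonneg_pos less_imp_le[OF rn(2)] tilted_fps_facts(1)[OF H rn(2,3), THEN less_imp_le]\<close>)
      also have "\<dots> = (2 * eval_fps H r1 / eval_fps H r) ^ k * (r2 / r1) ^ n"
        by (simp add: power_mult_distrib power_divide mult_ac)
      finally show ?case using wnn[of n k] by (simp add: mult_right_mono flip: mult.assoc)
    qed
    define C where "C = ln (r1 / r2)"
    have C: "C > 0" using r12 by (simp add: C_def)
    have "(r2 / r1) ^ n = exp (- C * real n)" for n
      using r12 by (simp add: C_def exp_minus mult.commute exp_of_nat_mult field_simps)
    moreover have "(\<lambda>n. exp (- C * real n) * real n powr (1 + lamG)) \<longlonglongrightarrow> 0" using C by real_asymp
    ultimately have "(\<lambda>n. (r2 / r1) ^ n * real n powr (1 + lamG)) \<longlonglongrightarrow> 0" by simp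
    from tendsto_mult_right_zero[OF this]
    show "(\<lambda>n. (2 * eval_fps H r1 / eval_fps H r) ^ k * ((r2 / r1) ^ n * real n powr (1 + lamG))) \<longlonglongrightarrow> 0" .
  qed
  have neg: "(\<lambda>n. w n k / B n) \<longlonglongrightarrow> 0" for k
  proof -
    have "(\<lambda>n. (w n k * real n powr (1 + lamG)) / (B n * real n powr (1 + lamG))) \<longlonglongrightarrow> 0 / (rGamma (- lamG) * \<kappa> powr lamG)"
      by (rule tendsto_divide[OF wlim Blim less_imp_neq[OF Lpos, symmetric]])
    moreover have "\<forall>\<^sub>F n in sequentially. (w n k * real n powr (1 + lamG)) / (B n * real n powr (1 + lamG)) = w n k / B n"
      using eventually_gt_at_top[of 0] by eventually_elim simp
    ultimately show ?thesis using tendsto_cong by fastforce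
  qed
  have ab: "(\<lambda>k. fps_nth G k * \<rho>G ^ k / b k) \<longlonglongrightarrow> cG * rGamma (- lamG) * Gamma (- lamG)"
  proof (rule Lim_transform_eventually)
    show "(\<lambda>k. fps_nth G k * \<rho>G ^ k * real k ^ 0 / b k) \<longlonglongrightarrow> cG * rGamma (- lamG) * Gamma (- lamG)"
      using singular_coeff_ratio[OF G lamG, of 0] by (simp add: b_def)
  qed simp
  note W = weighted_ratio_limit[OF bpos ab wnn smb pos[unfolded B_def] neg[unfolded B_def]]
  show "summable (\<lambda>k. fps_nth G k * \<rho>G ^ k * fps_nth (tilted_fps H (rn n) ^ k) n)"
    using W(2)[of n] by (simp add: w_def)
  have "(\<lambda>n. ((\<Sum>k. fps_nth G k * \<rho>G ^ k * w n k) / B n) * (B n * real n powr (1 + lamG))) \<longlonglongrightarrow>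
      (cG * rGamma (- lamG) * Gamma (- lamG)) * (rGamma (- lamG) * \<kappa> powr lamG)"
    by (rule tendsto_mult[OF W(1)[folded B_def] Blim])
  moreover have "\<forall>\<^sub>F n in sequentially. ((\<Sum>k. fps_nth G k * \<rho>G ^ k * w n k) / B n) * (B n * real n powr (1 + lamG)) =
      (\<Sum>k. fps_nth G k * \<rho>G ^ k * w n k) * real n powr (1 + lamG)"
    using pos by eventually_elim simp
  ultimately have "(\<lambda>n. (\<Sum>k. fps_nth G k * \<rho>G ^ k * w n k) * real n powr (1 + lamG)) \<longlonglongrightarrow>
      (cG * rGamma (- lamG) * Gamma (- lamG)) * (rGamma (- lamG) * \<kappa> powr lamG)"
    by (rule Lim_transform_eventually)
  moreover have "(cG * rGamma (- lamG) * Gamma (- lamG)) * (rGamma (- lamG) * \<kappa> powr lamG) = cG * rGamma (- lamG) * \<kappa> powr lamG"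
    using Gamma_real_pos[of "- lamG"] lamG by (simp add: rGamma_inverse_Gamma field_simps)
  ultimately show "(\<lambda>n. (\<Sum>k. fps_nth G k * \<rho>G ^ k * fps_nth (tilted_fps H (rn n) ^ k) n) * real n powr (1 + lamG)) \<longlonglongrightarrow>
       cG * rGamma (- lamG) * (r * eval_fps (fps_deriv H) r / eval_fps H r) powr lamG"
    unfolding w_def \<kappa>_def by (simp only:)
  have "cG * rGamma (- lamG) > 0" by (rule delta_singular_coeff_const_pos[OF G]) (use lamG in simp)
  then show "cG * rGamma (- lamG) * (r * eval_fps (fps_deriv H) r / eval_fps H r) powr lamG > 0"
    using mult_pos_pos[of "cG * rGamma (- lamG)" "\<kappa> powr lamG"] \<kappa> by (simp only: \<kappa>_def powr_gt_zero)
qed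

section \<open>The saddle point and its expansion\<close>

lemma saddle_point_unique:
  assumes H: "delta_singular H \<rho> lam c" and lam: "0 < lam" "lam < 1"
    and q: "y < eval_fps H \<rho>" "fps_nth H 0 < y"
  shows "\<exists>!r. 0 < r \<and> r < \<rho> \<and> eval_fps H r = y"
proof -
  have nn: "\<And>n. fps_nth H n \<ge> 0" and rad: "fps_conv_radius H = ereal \<rho>" and \<rho>: "\<rho> > 0"
    using H by (auto simp: delta_singular_def)
  have sm: "summable (\<lambda>n. fps_nth H n * \<rho> ^ n)" by (rule delta_singular_boundary[OF H lam]) blast
  \<comment> \<open>A partial sum already exceeds \<open>y\<close> at \<rho>. Being a polynomial it
    still does so slightly to the left, so continuity of the series at \<rho> itself is
    avoided.\<close>
  have "(\<lambda>N. \<Sum>n<N. fps_nth H n * \<rho> ^ n) \<longlonglongrightarrow> eval_fps H \<rho>"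
    using summable_LIMSEQ[OF sm] by (simp add: eval_fps_def)
  from order_tendstoD(1)[OF this q(1)] obtain N where N: "y < (\<Sum>n<N. fps_nth H n * \<rho> ^ n)"
    by (auto simp: eventually_sequentially)
  have "((\<lambda>x. \<Sum>n<N. fps_nth H n * x ^ n) \<longlongrightarrow> (\<Sum>n<N. fps_nth H n * \<rho> ^ n)) (at_left \<rho>)"
    by (intro tendsto_intros)
  from order_tendstoD(1)[OF this N] eventually_at_left_real[OF \<rho>]
  have "\<forall>\<^sub>F x in at_left \<rho>. y < (\<Sum>n<N. fps_nth H n * x ^ n) \<and> x \<in> {0<..<\<rho>}" by (rule eventually_conj)
  then obtain x where x: "y < (\<Sum>n<N. fps_nth H n * x ^ n)" "0 < x" "x < \<rho>"
    using eventually_happens[of _ "at_left \<rho>"] trivial_limit_at_left_real by fastforce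
  have "(\<Sum>n<N. fps_nth H n * x ^ n) \<le> eval_fps H x"
    unfolding eval_fps_def by (rule sum_le_suminf[OF summable_fps]) (use x rad nn in auto)
  with x have hx: "y < eval_fps H x" by simp
  have "\<exists>r\<ge>0. r \<le> x \<and> eval_fps H r = y"
  proof (rule IVT)
    show "\<forall>t. 0 \<le> t \<and> t \<le> x \<longrightarrow> isCont (eval_fps H) t"
      using x rad by (auto intro!: eval_fps_isCont_real)
  qed (use q hx x in \<open>auto simp: eval_fps_at_0\<close>)
  then obtain r where r: "0 \<le> r" "r \<le> x" "eval_fps H r = y" by blast
  have "r \<noteq> 0" using r q by (auto simp: eval_fps_at_0)
  show ?thesis
  proof (rule ex1I[of _ r])
    show "0 < r \<and> r < \<rho> \<and> eval_fps H r = y" using r x \<open>r \<noteq> 0\<close> by auto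
    obtain m where m: "m \<ge> 1" "fps_nth H m \<noteq> 0" using delta_singular_nonpoly[OF H, of 1] by auto
    fix s assume s: "0 < s \<and> s < \<rho> \<and> eval_fps H s = y"
    show "s = r"
      using eval_fps_strict_mono[OF nn, of s r m] eval_fps_strict_mono[OF nn, of r s m] s r x m rad
      by (cases s r rule: linorder_cases) auto
  qed
qed

text \<open>The operator \<open>z d/dz\<close>, which is \<open>d/dt\<close> in the variable \<open>z = r exp t\<close> of the saddle point.\<close>

definition euler_fps :: "real fps \<Rightarrow> real fps" where
  "euler_fps F = fps_X * fps_deriv F"

lemma fps_nth_euler_fps [simp]: "fps_nth (euler_fps F) n = real n * fps_nth F n"
  by (cases n) (simp_all add: euler_fps_def)

lemma euler_fps_radius: "fps_conv_radius F \<le> fps_conv_radius (euler_fps F)"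
proof -
  have "fps_conv_radius F \<le> min (fps_conv_radius (fps_X :: real fps)) (fps_conv_radius (fps_deriv F))"
    by (simp add: fps_conv_radius_deriv)
  also have "\<dots> \<le> fps_conv_radius (euler_fps F)" unfolding euler_fps_def by (rule fps_conv_radius_mult)
  finally show ?thesis .
qed

lemma eval_euler_fps:
  assumes "ereal \<bar>x\<bar> < fps_conv_radius F"
  shows "eval_fps (euler_fps F) x = x * eval_fps (fps_deriv F) x"
proof -
  have "ereal (norm x) < fps_conv_radius (fps_deriv F)" using assms less_le_trans[OF _ fps_conv_radius_deriv[of F]] by simp
  then show ?thesis unfolding euler_fps_def by (subst eval_fps_mult) simp_all
qed

lemma deriv_eval_fps_exp:
  assumes "0 < r" "ereal (r * exp t) < fps_conv_radius F"
  shows "((\<lambda>t. eval_fps F (r * exp t)) has_real_derivative eval_fps (euler_fps F) (r * exp t)) (at t)"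
proof -
  have D: "(eval_fps F has_real_derivative eval_fps (fps_deriv F) (r * exp t)) (at (r * exp t))"
    by (rule has_field_derivative_eval_fps) (use assms in simp)
  have "((\<lambda>t. eval_fps F (r * exp t)) has_real_derivative eval_fps (fps_deriv F) (r * exp t) * (r * exp t)) (at t)"
    by (rule DERIV_chain2[of "eval_fps F" _ "\<lambda>t. r * exp t", OF D]) (auto intro!: derivative_eq_intros)
  then show ?thesis using assms by (simp add: eval_euler_fps mult.commute)
qed

text \<open>Multiplied by \<open>H(r)\<close>, the quantity is the sum of
  \<open>(n - \<kappa>)^2 h_n r^n\<close>, that is, an unnormalised variance of the tilted law. Two
  support points make it positive, since at most one of them equals \<kappa>.\<close>

lemma saddle_variance_pos:
  assumes nn: "\<And>n. fps_nth H n \<ge> 0" and r: "0 < r" "ereal r < fps_conv_radius H" and i: "i \<noteq> j" "fps_nth H i \<noteq> 0" "fps_nth H j \<noteq> 0"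
  shows "eval_fps (euler_fps (euler_fps H)) r / eval_fps H r - (eval_fps (euler_fps H) r / eval_fps H r)\<^sup>2 > 0"
proof -
  let ?h = "eval_fps H r" and ?h1 = "eval_fps (euler_fps H) r" and ?h2 = "eval_fps (euler_fps (euler_fps H)) r"
  have h: "?h > 0" by (rule eval_fps_pos[OF nn r i(2)])
  define \<kappa> where "\<kappa> = ?h1 / ?h"
  have r1: "ereal r < fps_conv_radius (euler_fps H)" by (rule less_le_trans[OF r(2) euler_fps_radius])
  have r2: "ereal r < fps_conv_radius (euler_fps (euler_fps H))" by (rule less_le_trans[OF r1 euler_fps_radius])
  have S: "(\<lambda>n. fps_nth F n * r ^ n) sums eval_fps F r" if "ereal r < fps_conv_radius F" for F
    by (rule sums_eval_fps) (use that r in simp)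
  have "(\<lambda>n. fps_nth (euler_fps (euler_fps H)) n * r ^ n - 2 * \<kappa> * (fps_nth (euler_fps H) n * r ^ n) + \<kappa>\<^sup>2 * (fps_nth H n * r ^ n)) sums
      (?h2 - 2 * \<kappa> * ?h1 + \<kappa>\<^sup>2 * ?h)"
    by (intro sums_add sums_diff sums_mult S r r1 r2)
  moreover have "fps_nth (euler_fps (euler_fps H)) n * r ^ n - 2 * \<kappa> * (fps_nth (euler_fps H) n * r ^ n) + \<kappa>\<^sup>2 * (fps_nth H n * r ^ n) =
      (real n - \<kappa>)\<^sup>2 * (fps_nth H n * r ^ n)" for n
    by (simp add: power2_eq_square algebra_simps)
  ultimately have V: "(\<lambda>n. (real n - \<kappa>)\<^sup>2 * (fps_nth H n * r ^ n)) sums (?h2 - 2 * \<kappa> * ?h1 + \<kappa>\<^sup>2 * ?h)" by simp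
  have tn: "(real n - \<kappa>)\<^sup>2 * (fps_nth H n * r ^ n) \<ge> 0" for n using nn r by simp
  obtain l where l: "fps_nth H l \<noteq> 0" "real l \<noteq> \<kappa>" using i by (metis of_nat_eq_iff)
  then have "fps_nth H l > 0" using nn[of l] by linarith
  then have "0 < (real l - \<kappa>)\<^sup>2 * (fps_nth H l * r ^ l)" using l r by simp
  then have "0 < ?h2 - 2 * \<kappa> * ?h1 + \<kappa>\<^sup>2 * ?h"
    using suminf_pos2[OF sums_summable[OF V] tn, of l] sums_unique[OF V] by simp
  also have "\<dots> = ?h * (?h2 / ?h - (?h1 / ?h)\<^sup>2)" using h by (simp add: \<kappa>_def power2_eq_square field_simps)
  finally show ?thesis using h by (simp add: zero_less_mult_iff)
qed

text \<open>With \<open>rn n = r * exp (\<delta> n)\<close> and \<open>A t = ln H(r exp t)\<close>,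
  the condition on \<open>rn\<close> reads \<open>A (\<delta> n) = A 0 - s / sqrt n\<close>. The
  derivatives of \<open>A\<close> at 0 are \<kappa> and \<open>V\<close>, so a second-order Taylor
  formula determines \<open>n * \<delta> n\<close> up to o(1).\<close>

lemma saddle_sequence:
  fixes s :: real
  assumes H: "delta_singular H \<rho> lam c" and r: "0 < r" "r < \<rho>"
  defines "\<kappa> \<equiv> eval_fps (euler_fps H) r / eval_fps H r"
  defines "V \<equiv> eval_fps (euler_fps (euler_fps H)) r / eval_fps H r - \<kappa>\<^sup>2"
  assumes \<kappa>: "\<kappa> > 0"
  obtains rn :: "nat \<Rightarrow> real" where "rn \<longlonglongrightarrow> r" "\<And>n. 0 < rn n" "\<And>n. rn n < \<rho>"
    "\<forall>\<^sub>F n in sequentially. eval_fps H r / eval_fps H (rn n) = exp (s / sqrt (real n))"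
    "(\<lambda>n. exp (- (s * sqrt (real n) / \<kappa>)) * (r / rn n) ^ n) \<longlonglongrightarrow> exp (V / \<kappa> ^ 3 * s\<^sup>2 / 2)"
proof -
  have nn: "\<And>n. fps_nth H n \<ge> 0" and rad: "fps_conv_radius H = ereal \<rho>"
    using H by (auto simp: delta_singular_def)
  define r1 where "r1 = (r + \<rho>) / 2"
  have r1: "r < r1" "r1 < \<rho>" "0 < r1" using r by (auto simp: r1_def)
  define d where "d = ln (r1 / r)"
  have d: "d > 0" using r r1 by (simp add: d_def)
  have xd: "r * exp t < \<rho>" if "t \<le> d" for t
  proof -
    have "r * exp t \<le> r * exp d" using that r by simp
    also have "\<dots> = r1" using r r1 by (simp add: d_def)
    finally show ?thesis using r1 by simp
  qed
  have x0: "0 < r * exp t" for t using r by simp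
  have hpos: "eval_fps H (r * exp t) > 0" if "t \<le> d" for t by (rule tilted_fps_facts(1)[OF H x0 xd[OF that]])
  have rd0: "ereal (r * exp t) < fps_conv_radius H" if "t \<le> d" for t using rad xd[OF that] by simp
  have rd1: "ereal (r * exp t) < fps_conv_radius (euler_fps H)" if "t \<le> d" for t
    by (rule less_le_trans[OF rd0[OF that] euler_fps_radius])
  have rd2: "ereal (r * exp t) < fps_conv_radius (euler_fps (euler_fps H))" if "t \<le> d" for t
    by (rule less_le_trans[OF rd1[OF that] euler_fps_radius])
  define A where "A t = ln (eval_fps H (r * exp t))" for t
  define A1 where "A1 t = eval_fps (euler_fps H) (r * exp t) / eval_fps H (r * exp t)" for t
  define A2 where "A2 t = eval_fps (euler_fps (euler_fps H)) (r * exp t) / eval_fps H (r * exp t) - (A1 t)\<^sup>2" for t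
  have DA: "(A has_real_derivative A1 t) (at t)" if "t \<le> d" for t
    unfolding A_def A1_def
    by (rule derivative_eq_intros deriv_eval_fps_exp[OF r(1) rd0[OF that]] hpos[OF that] refl)+ (simp add: divide_inverse)
  have DA1: "(A1 has_real_derivative A2 t) (at t)" if "t \<le> d" for t
  proof -
    have "(A1 has_real_derivative (eval_fps (euler_fps (euler_fps H)) (r * exp t) * eval_fps H (r * exp t)
        - eval_fps (euler_fps H) (r * exp t) * eval_fps (euler_fps H) (r * exp t)) / (eval_fps H (r * exp t) * eval_fps H (r * exp t))) (at t)"
      unfolding A1_def
      by (rule DERIV_divide[OF deriv_eval_fps_exp[OF r(1) rd1[OF that]] deriv_eval_fps_exp[OF r(1) rd0[OF that]]])
         (use hpos[OF that] in simp)
    then show ?thesis using hpos[OF that]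
      by (simp add: A2_def A1_def diff_divide_distrib power2_eq_square)
  qed
  obtain m where m: "m \<ge> 1" "fps_nth H m \<noteq> 0" using delta_singular_nonpoly[OF H, of 1] by auto
  have Amono: "A t < A t'" if "t < t'" "t' \<le> d" for t t'
  proof -
    have "eval_fps H (r * exp t) < eval_fps H (r * exp t')"
      by (rule eval_fps_strict_mono[OF nn _ _ rd0[OF that(2)] _ m(2)]) (use that r m in auto)
    then show ?thesis using hpos[of t] hpos[of t'] that by (simp add: A_def)
  qed
  have taylor: "\<exists>\<xi>. \<bar>\<xi>\<bar> \<le> \<bar>t\<bar> \<and> A t = A 0 + A1 0 * t + A2 \<xi> / 2 * t\<^sup>2" if "\<bar>t\<bar> \<le> d" for t
  proof -
    define D where "D = (\<lambda>m::nat. if m = 0 then A else if m = 1 then A1 else A2)"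
    have "\<exists>\<xi>. \<bar>\<xi>\<bar> \<le> \<bar>t\<bar> \<and> A t = (\<Sum>m<2. D m 0 / fact m * t ^ m) + D 2 \<xi> / fact 2 * t ^ 2"
    proof (rule Maclaurin_bi_le)
      show "\<forall>m u. m < 2 \<and> \<bar>u\<bar> \<le> \<bar>t\<bar> \<longrightarrow> (D m has_real_derivative D (Suc m) u) (at u)"
      proof (intro allI impI)
        fix m :: nat and u :: real assume "m < 2 \<and> \<bar>u\<bar> \<le> \<bar>t\<bar>"
        moreover from this have "u \<le> d" using that by linarith
        ultimately show "(D m has_real_derivative D (Suc m) u) (at u)"
          using DA[of u] DA1[of u] by (cases "m = 0") (auto simp: D_def less_2_cases_iff)
      qed
    qed (simp add: D_def)
    then show ?thesis by (simp add: D_def eval_nat_numeral)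
  qed
  define T where "T n = A 0 - s / sqrt (real n)" for n
  have Tlim: "T \<longlonglongrightarrow> A 0" unfolding T_def by real_asymp
  \<comment> \<open>Outside the range of \<open>A\<close> on \<open>{-d..d}\<close> the choice is
    arbitrary (0 serves); eventually \<open>T n\<close> lies in that range.\<close>
  have "\<exists>\<delta>. \<bar>\<delta>\<bar> \<le> d \<and> (A (-d) \<le> T n \<and> T n \<le> A d \<longrightarrow> A \<delta> = T n)" for n
  proof (cases "A (-d) \<le> T n \<and> T n \<le> A d")
    case True
    have "\<exists>\<delta>\<ge>-d. \<delta> \<le> d \<and> A \<delta> = T n"
      by (rule IVT) (use True d DA DERIV_isCont in auto)
    then show ?thesis by (auto simp: abs_le_iff)
  next
    case False
    then show ?thesis using d by (intro exI[of _ 0]) auto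
  qed
  then obtain \<delta> where \<delta>: "\<And>n. \<bar>\<delta> n\<bar> \<le> d" "\<And>n. A (-d) \<le> T n \<Longrightarrow> T n \<le> A d \<Longrightarrow> A (\<delta> n) = T n" by metis
  have "A (-d) < A 0" "A 0 < A d" using Amono d by auto
  then have evA: "\<forall>\<^sub>F n in sequentially. A (\<delta> n) = T n"
    using eventually_conj[OF order_tendstoD(1)[OF Tlim, of "A (-d)"] order_tendstoD(2)[OF Tlim, of "A d"]] \<delta>(2)
    by (auto elim!: eventually_mono)
  have \<delta>0: "\<delta> \<longlonglongrightarrow> 0"
  proof (rule tendstoI)
    fix e :: real assume e: "e > 0"
    define f where "f = min e d"
    have f: "0 < f" "f \<le> d" "f \<le> e" using e d by (auto simp: f_def)
    have "A (-f) < A 0" "A 0 < A f" using Amono f by auto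
    from evA order_tendstoD(1)[OF Tlim this(1)] order_tendstoD(2)[OF Tlim this(2)]
    show "\<forall>\<^sub>F n in sequentially. dist (\<delta> n) 0 < e"
    proof eventually_elim
      case (elim n)
      have dn: "\<delta> n \<le> d" using \<delta>(1)[of n] by linarith
      have "\<delta> n < f"
      proof (rule ccontr)
        assume "\<not> \<delta> n < f"
        then have "A f \<le> A (\<delta> n)" using Amono[of f "\<delta> n"] dn by (cases "\<delta> n = f") auto
        then show False using elim by simp
      qed
      moreover have "- f < \<delta> n"
      proof (rule ccontr)
        assume "\<not> - f < \<delta> n"
        then have "A (\<delta> n) \<le> A (-f)" using Amono[of "\<delta> n" "-f"] f d by (cases "\<delta> n = -f") auto
        then show False using elim by simp
      qed
      ultimately show ?case using f by auto
    qed
  qed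
  have "\<exists>\<xi>. \<bar>\<xi>\<bar> \<le> \<bar>\<delta> n\<bar> \<and> A (\<delta> n) = A 0 + A1 0 * \<delta> n + A2 \<xi> / 2 * (\<delta> n)\<^sup>2" for n by (rule taylor[OF \<delta>(1)])
  then obtain \<xi> where \<xi>: "\<And>n. \<bar>\<xi> n\<bar> \<le> \<bar>\<delta> n\<bar>" "\<And>n. A (\<delta> n) = A 0 + A1 0 * \<delta> n + A2 (\<xi> n) / 2 * (\<delta> n)\<^sup>2" by metis
  have \<xi>0: "\<xi> \<longlonglongrightarrow> 0"
    by (rule Lim_null_comparison[of _ "\<lambda>n. \<bar>\<delta> n\<bar>"]) (use \<xi>(1) tendsto_rabs_zero[OF \<delta>0] in auto)
  define k where "k n = A2 (\<xi> n) / 2" for n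
  have V0: "A2 0 = V" "A1 0 = \<kappa>" by (simp_all add: A2_def A1_def V_def \<kappa>_def)
  have klim: "k \<longlonglongrightarrow> V / 2"
  proof -
    have E: "isCont (\<lambda>t. eval_fps F (r * exp t)) 0" if "ereal (r * exp 0) < fps_conv_radius F" for F :: "real fps"
      by (rule DERIV_isCont[OF deriv_eval_fps_exp[OF r(1) that]])
    have "isCont A2 0" unfolding A2_def A1_def
      by (intro continuous_intros E rd0 rd1 rd2) (use hpos[of 0] d in auto)
    from isCont_tendsto_compose[OF this \<xi>0] show ?thesis unfolding k_def V0 by (intro tendsto_divide) auto
  qed
  define y where "y n = sqrt (real n) * \<delta> n" for n
  have eq: "\<forall>\<^sub>F n in sequentially. \<kappa> * \<delta> n + k n * (\<delta> n)\<^sup>2 = - (s / sqrt (real n))"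
    using evA by eventually_elim (use \<xi>(2) in \<open>simp add: T_def k_def V0\<close>)
  have den: "(\<lambda>n. \<kappa> + k n * \<delta> n) \<longlonglongrightarrow> \<kappa> + V / 2 * 0" by (intro tendsto_intros klim \<delta>0)
  have ylim: "y \<longlonglongrightarrow> - s / \<kappa>"
  proof (rule Lim_transform_eventually)
    show "(\<lambda>n. - s / (\<kappa> + k n * \<delta> n)) \<longlonglongrightarrow> - s / \<kappa>"
      using tendsto_divide[OF tendsto_const[of "- s"] den] \<kappa> by simp
    have "\<forall>\<^sub>F n in sequentially. \<kappa> + k n * \<delta> n > 0" using order_tendstoD(1)[OF den, of 0] \<kappa> by simp
    with eq eventually_gt_at_top[of 0] show "\<forall>\<^sub>F n in sequentially. - s / (\<kappa> + k n * \<delta> n) = y n"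
    proof eventually_elim
      case (elim n)
      have "y n * (\<kappa> + k n * \<delta> n) = sqrt (real n) * (\<kappa> * \<delta> n + k n * (\<delta> n)\<^sup>2)"
        by (simp add: y_def power2_eq_square algebra_simps)
      also have "\<dots> = - s" using elim by simp
      finally show ?case using elim by (simp add: field_simps)
    qed
  qed
  define rn where "rn n = r * exp (\<delta> n)" for n
  have dn: "\<delta> n \<le> d" for n using \<delta>(1)[of n] by linarith
  show ?thesis
  proof (rule that)
    have "rn \<longlonglongrightarrow> r * exp 0" unfolding rn_def by (intro tendsto_intros \<delta>0)
    then show "rn \<longlonglongrightarrow> r" by simp
    show "0 < rn n" "rn n < \<rho>" for n using x0 xd[OF dn] by (simp_all add: rn_def)
    show "\<forall>\<^sub>F n in sequentially. eval_fps H r / eval_fps H (rn n) = exp (s / sqrt (real n))"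
      using evA
    proof eventually_elim
      case (elim n)
      then have "s / sqrt (real n) = A 0 - A (\<delta> n)" by (simp add: T_def)
      then show ?case using hpos[of 0] hpos[OF dn[of n]] d by (simp add: A_def rn_def exp_diff)
    qed
    \<comment> \<open>Multiplying the Taylor relation by \<open>n\<close> and dividing by \<kappa>
      gives \<open>n \<delta> = - s sqrt n / \<kappa> - k y^2 / \<kappa>\<close>. The diverging term
      cancels against the centring, and \<open>y\<close> tends to
      \<open>- s / \<kappa>\<close>.\<close>
    show "(\<lambda>n. exp (- (s * sqrt (real n) / \<kappa>)) * (r / rn n) ^ n) \<longlonglongrightarrow> exp (V / \<kappa> ^ 3 * s\<^sup>2 / 2)"
    proof (rule Lim_transform_eventually)
      have "(\<lambda>n. exp (k n * (y n)\<^sup>2 / \<kappa>)) \<longlonglongrightarrow> exp (V / 2 * (- s / \<kappa>)\<^sup>2 / \<kappa>)"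
        by (intro tendsto_intros klim ylim) (use \<kappa> in simp)
      also have "V / 2 * (- s / \<kappa>)\<^sup>2 / \<kappa> = V / \<kappa> ^ 3 * s\<^sup>2 / 2"
        by (simp add: power_divide power2_eq_square power3_eq_cube)
      finally show "(\<lambda>n. exp (k n * (y n)\<^sup>2 / \<kappa>)) \<longlonglongrightarrow> exp (V / \<kappa> ^ 3 * s\<^sup>2 / 2)" .
      show "\<forall>\<^sub>F n in sequentially. exp (k n * (y n)\<^sup>2 / \<kappa>) = exp (- (s * sqrt (real n) / \<kappa>)) * (r / rn n) ^ n"
        using eq eventually_gt_at_top[of 0]
      proof eventually_elim
        case (elim n)
        have nd: "real n / sqrt (real n) = sqrt (real n)" by (rule real_div_sqrt) simp
        have "\<kappa> * (real n * \<delta> n) + k n * (y n)\<^sup>2 = real n * (\<kappa> * \<delta> n + k n * (\<delta> n)\<^sup>2)"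
          by (simp add: y_def power_mult_distrib algebra_simps)
        also have "\<dots> = - s * (real n / sqrt (real n))" using elim by simp
        finally have "\<kappa> * (real n * \<delta> n) + k n * (y n)\<^sup>2 = - s * sqrt (real n)" by (simp only: nd)
        then have "k n * (y n)\<^sup>2 = \<kappa> * (- (s * sqrt (real n) / \<kappa>) - real n * \<delta> n)"
          using \<kappa> by (simp add: right_diff_distrib)
        then have "k n * (y n)\<^sup>2 / \<kappa> = - (s * sqrt (real n) / \<kappa>) - real n * \<delta> n" using \<kappa> by simp
        moreover have "(r / rn n) ^ n = exp (- (real n * \<delta> n))"
        proof -
          have "r / rn n = exp (- \<delta> n)" using r by (simp add: rn_def exp_minus field_simps)
          then show ?thesis by (simp flip: exp_of_nat_mult)
        qed
        ultimately show ?case by (simp flip: exp_add)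
      qed
    qed
  qed
qed


text \<open>The Gibbs law has weights \<open>B k\<close> times the \<open>n\<close>-th coefficient
  of the \<open>k\<close>-th power of the series tilted at \<open>r\<close>. Multiplication by
  \<open>exp (s k / sqrt n)\<close> moves the tilt to \<open>rn n\<close>, so the moment generating
  function is an explicit factor times a quotient of two sums with the same asymptotics.\<close>

lemma supercritical_regime:
  assumes G: "delta_singular G \<rho>G lamG cG" and lamG: "lamG < 0"
    and H: "delta_singular H \<rho> lam c" and r: "0 < r" "r < \<rho>" and q: "0 < q" "q * eval_fps H r = \<rho>G"
  defines "p \<equiv> gibbs_pmf G H q"
  defines "\<mu> \<equiv> \<lambda>n. measure_pmf.expectation (p n) real"
  defines "v \<equiv> \<lambda>n. measure_pmf.variance (p n) real"
  defines "\<kappa> \<equiv> eval_fps (euler_fps H) r / eval_fps H r"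
  defines "V \<equiv> eval_fps (euler_fps (euler_fps H)) r / eval_fps H r - \<kappa>\<^sup>2"
  shows "weak_conv_m (\<lambda>n. distr (p n) borel (\<lambda>k. (real k - \<mu> n) / sqrt (v n))) std_normal_distribution"
    and "\<mu> \<sim>[sequentially] (\<lambda>n. 1 / \<kappa> * real n)" and "v \<sim>[sequentially] (\<lambda>n. V / \<kappa> ^ 3 * real n)"
proof -
  have nnG: "\<And>n. fps_nth G n \<ge> 0" and nn: "\<And>n. fps_nth H n \<ge> 0" and rad: "fps_conv_radius H = ereal \<rho>"
    using G H by (auto simp: delta_singular_def)
  have hr: "eval_fps H r > 0" by (rule tilted_fps_facts(1)[OF H r])
  have \<kappa>e: "\<kappa> = r * eval_fps (fps_deriv H) r / eval_fps H r"
    using r rad by (simp add: \<kappa>_def eval_euler_fps)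
  have \<kappa>: "\<kappa> > 0" unfolding \<kappa>e using tilt_quotient_facts(5)[OF H r] r hr by simp
  obtain i where i: "fps_nth H i \<noteq> 0" using delta_singular_nonpoly[OF H] by blast
  obtain j where j: "j \<ge> Suc i" "fps_nth H j \<noteq> 0" using delta_singular_nonpoly[OF H, of "Suc i"] by blast
  have V: "V > 0" unfolding V_def \<kappa>_def
    by (rule saddle_variance_pos[OF nn r(1) _ _ i j(2)]) (use r rad j in auto)
  define B where "B k = fps_nth G k * \<rho>G ^ k" for k
  define Z where "Z n s = (\<Sum>k. B k * fps_nth (tilted_fps H s ^ k) n)" for n s
  define L where "L = cG * rGamma (- lamG) * \<kappa> powr lamG"
  have Zlim: "(\<lambda>n. Z n (rn n) * real n powr (1 + lamG)) \<longlonglongrightarrow> L" "summable (\<lambda>k. B k * fps_nth (tilted_fps H (rn n) ^ k) n)"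
    if "rn \<longlonglongrightarrow> r" "\<And>n. 0 < rn n" "\<And>n. rn n < \<rho>" for rn :: "nat \<Rightarrow> real" and n
    using tilted_sum_asymp(1,2)[OF G lamG H r that] by (simp_all only: Z_def B_def L_def \<kappa>e)
  have L: "L > 0"
    using tilted_sum_asymp(3)[OF G lamG H r tendsto_const[of r] r] by (simp only: L_def \<kappa>e)
  note Zr = Zlim[OF tendsto_const[of r] r]
  have Zpos: "\<forall>\<^sub>F n in sequentially. Z n r > 0"
    using order_tendstoD(1)[OF Zr(1) L]
  proof eventually_elim
    case (elim n)
    then show ?case by (simp add: zero_less_mult_iff)
  qed
  have pmf: "pmf (p n) k = B k * fps_nth (tilted_fps H r ^ k) n / Z n r" if Z0: "Z n r > 0" for n k
  proof -
    \<comment> \<open>Uses \<open>q * H(r) = \<rho>G\<close>: the factor \<open>q ^ k\<close> equals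
      \<open>\<rho>G ^ k / H(r) ^ k\<close>, and \<open>r ^ n\<close> does not depend on
      \<open>k\<close>.\<close>
    have t: "q ^ k * fps_nth G k * fps_nth (H ^ k) n = B k * fps_nth (tilted_fps H r ^ k) n / r ^ n" for k
      using r hr by (simp add: B_def tilted_fps_power_nth power_mult_distrib flip: q(2))
    have S: "(\<lambda>k. q ^ k * fps_nth G k * fps_nth (H ^ k) n) sums (Z n r / r ^ n)"
      unfolding t Z_def by (intro sums_divide summable_sums Zr(2))
    have "pmf (p n) k = q ^ k * fps_nth G k * fps_nth (H ^ k) n / (\<Sum>k. q ^ k * fps_nth G k * fps_nth (H ^ k) n)"
      unfolding p_def by (rule gibbs_pmf_nth[OF nnG nn q(1) sums_summable[OF S]]) (unfold sums_unique[OF S, symmetric], use Z0 r in simp)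
    then show ?thesis using r unfolding sums_unique[OF S, symmetric] unfolding t by simp
  qed
  define Y where "Y n k = (real k - real n / \<kappa>) / sqrt (real n)" for n k
  define \<sigma> where "\<sigma> = sqrt (V / \<kappa> ^ 3)"
  have \<sigma>: "\<sigma> > 0" "\<sigma>\<^sup>2 = V / \<kappa> ^ 3" using V \<kappa> by (simp_all add: \<sigma>_def)
  have mgf: "(\<forall>\<^sub>F n in sequentially. summable (\<lambda>k. pmf (p n) k * exp (s * Y n k))) \<and>
      (\<lambda>n. \<Sum>k. pmf (p n) k * exp (s * Y n k)) \<longlonglongrightarrow> exp (\<sigma>\<^sup>2 * s\<^sup>2 / 2)" for s
  proof -
    obtain rn where rn: "rn \<longlonglongrightarrow> r" "\<And>n. 0 < rn n" "\<And>n. rn n < \<rho>"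
      and e: "\<forall>\<^sub>F n in sequentially. eval_fps H r / eval_fps H (rn n) = exp (s / sqrt (real n))"
      and ex: "(\<lambda>n. exp (- (s * sqrt (real n) / \<kappa>)) * (r / rn n) ^ n) \<longlonglongrightarrow> exp (V / \<kappa> ^ 3 * s\<^sup>2 / 2)"
      by (rule saddle_sequence[OF H r \<kappa>[unfolded \<kappa>_def], of s, folded \<kappa>_def, folded V_def]) (rule that)
    note Zn = Zlim[OF rn]
    \<comment> \<open>The three factors come from the centring by \<open>n / \<kappa>\<close>, from
      \<open>s ^ n\<close> in the two tilts, and from the two normalising sums.\<close>
    define M where "M n = exp (- (s * sqrt (real n) / \<kappa>)) * (r / rn n) ^ n * (Z n (rn n) / Z n r)" for n
    have S: "\<forall>\<^sub>F n in sequentially. (\<lambda>k. pmf (p n) k * exp (s * Y n k)) sums M n"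
      using e Zpos
    proof eventually_elim
      case (elim n)
      have hn: "eval_fps H (rn n) > 0" by (rule tilted_fps_facts(1)[OF H rn(2,3)])
      have "pmf (p n) k * exp (s * Y n k) =
          exp (- (s * sqrt (real n) / \<kappa>)) * (r / rn n) ^ n * (B k * fps_nth (tilted_fps H (rn n) ^ k) n / Z n r)" for k
      proof -
        have "s * Y n k = real k * (s / sqrt (real n)) + - (s * sqrt (real n) / \<kappa>)"
        proof -
          have "real n / sqrt (real n) = sqrt (real n)" by (rule real_div_sqrt) simp
          then have "real n / \<kappa> / sqrt (real n) = sqrt (real n) / \<kappa>" by (metis divide_divide_eq_left mult.commute)
          then show ?thesis by (simp add: Y_def diff_divide_distrib right_diff_distrib)
        qed
        then have X: "exp (s * Y n k) = exp (- (s * sqrt (real n) / \<kappa>)) * (eval_fps H r / eval_fps H (rn n)) ^ k"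
          using elim by (simp only: exp_add exp_of_nat_mult mult.commute)
        show ?thesis unfolding X pmf[OF elim(2)]
          using hr hn r rn(2)[of n]
          by (simp add: tilted_fps_power_nth power_divide field_simps)
      qed
      then show ?case unfolding M_def Z_def[of n "rn n"]
        by (simp only:) (intro sums_mult sums_divide summable_sums Zn(2))
    qed
    have Q: "(\<lambda>n. Z n (rn n) / Z n r) \<longlonglongrightarrow> 1"
    proof (rule Lim_transform_eventually)
      show "(\<lambda>n. (Z n (rn n) * real n powr (1 + lamG)) / (Z n r * real n powr (1 + lamG))) \<longlonglongrightarrow> 1"
        using tendsto_divide[OF Zn(1) Zr(1) less_imp_neq[OF L, symmetric]] L by simp
      show "\<forall>\<^sub>F n in sequentially. (Z n (rn n) * real n powr (1 + lamG)) / (Z n r * real n powr (1 + lamG)) = Z n (rn n) / Z n r"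
        using eventually_gt_at_top[of 0] by eventually_elim simp
    qed
    have "M \<longlonglongrightarrow> exp (\<sigma>\<^sup>2 * s\<^sup>2 / 2)" unfolding M_def using tendsto_mult[OF ex Q] by (simp add: \<sigma>(2))
    moreover have "\<forall>\<^sub>F n in sequentially. M n = (\<Sum>k. pmf (p n) k * exp (s * Y n k))"
      using S by eventually_elim (rule sums_unique)
    ultimately have "(\<lambda>n. \<Sum>k. pmf (p n) k * exp (s * Y n k)) \<longlonglongrightarrow> exp (\<sigma>\<^sup>2 * s\<^sup>2 / 2)"
      by (rule Lim_transform_eventually)
    moreover have "\<forall>\<^sub>F n in sequentially. summable (\<lambda>k. pmf (p n) k * exp (s * Y n k))"
      using S by eventually_elim (rule sums_summable)
    ultimately show ?thesis by blast
  qed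
  note clt = clt_from_mgf[of \<sigma> p Y, OF \<sigma>(1) conjunct1[OF mgf] conjunct2[OF mgf]]
  define E where "E n = measure_pmf.expectation (p n) (Y n)" for n
  define W where "W n = measure_pmf.expectation (p n) (\<lambda>k. (Y n k - E n)\<^sup>2)" for n
  have Elim: "E \<longlonglongrightarrow> 0" and Wlim: "W \<longlonglongrightarrow> \<sigma>\<^sup>2" using clt(1,2) by (simp_all only: E_def[abs_def] W_def[abs_def])
  \<comment> \<open>\<open>Y\<close> is centred by \<open>n / \<kappa>\<close> instead of the mean.
    The difference is \<open>sqrt n * E n\<close>, hence of smaller order than
    \<open>sqrt n\<close>.\<close>
  have mean: "\<forall>\<^sub>F n in sequentially. n > 0 \<and> \<mu> n = sqrt (real n) * E n + real n / \<kappa>"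
    using clt(3) eventually_gt_at_top[of 0]
  proof eventually_elim
    case (elim n)
    have "\<mu> n = measure_pmf.expectation (p n) (\<lambda>k. sqrt (real n) * Y n k + real n / \<kappa>)"
      unfolding \<mu>_def Y_def using elim by simp
    also have "\<dots> = sqrt (real n) * E n + real n / \<kappa>"
      using elim(1) by (subst Bochner_Integration.integral_add) (auto simp: E_def)
    finally show ?case using elim by simp
  qed
  have dev: "\<forall>\<^sub>F n in sequentially. n > 0 \<and> (\<forall>k. real k - \<mu> n = sqrt (real n) * (Y n k - E n))"
    using mean
  proof eventually_elim
    case (elim n)
    have "real k - \<mu> n = sqrt (real n) * (Y n k - E n)" for k
    proof -
      have "sqrt (real n) * Y n k = real k - real n / \<kappa>" using elim by (simp add: Y_def)
      then show ?thesis using elim by (simp add: right_diff_distrib)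
    qed
    then show ?case using elim by blast
  qed
  have var: "\<forall>\<^sub>F n in sequentially. v n = real n * W n"
    using dev
  proof eventually_elim
    case (elim n)
    have "v n = measure_pmf.expectation (p n) (\<lambda>k. (real k - \<mu> n)\<^sup>2)" by (simp add: v_def \<mu>_def)
    also have "\<dots> = measure_pmf.expectation (p n) (\<lambda>k. real n * (Y n k - E n)\<^sup>2)"
      using elim by (simp add: power_mult_distrib)
    finally show ?case by (simp add: W_def)
  qed
  have ev: "\<forall>\<^sub>F n in sequentially. distr (p n) borel (\<lambda>k. (Y n k - E n) / sqrt (W n)) = distr (p n) borel (\<lambda>k. (real k - \<mu> n) / sqrt (v n))"
    using dev var by eventually_elim (simp add: real_sqrt_mult)
  have wc: "weak_conv_m (\<lambda>n. distr (p n) borel (\<lambda>k. (Y n k - E n) / sqrt (W n))) std_normal_distribution"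
    using clt(4) by (simp only: E_def W_def)
  show "weak_conv_m (\<lambda>n. distr (p n) borel (\<lambda>k. (real k - \<mu> n) / sqrt (v n))) std_normal_distribution"
    unfolding weak_conv_m_def weak_conv_def
  proof (intro allI impI)
    fix x assume "isCont (cdf std_normal_distribution) x"
    then have "(\<lambda>n. cdf (distr (p n) borel (\<lambda>k. (Y n k - E n) / sqrt (W n))) x) \<longlonglongrightarrow> cdf std_normal_distribution x"
      using wc by (simp add: weak_conv_m_def weak_conv_def)
    then show "(\<lambda>n. cdf (distr (p n) borel (\<lambda>k. (real k - \<mu> n) / sqrt (v n))) x) \<longlonglongrightarrow> cdf std_normal_distribution x"
      by (rule Lim_transform_eventually) (use ev in \<open>eventually_elim, simp\<close>)
  qed
  show "\<mu> \<sim>[sequentially] (\<lambda>n. 1 / \<kappa> * real n)"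
  proof (rule asymp_equivI', rule Lim_transform_eventually)
    have "(\<lambda>n. 1 / sqrt (real n)) \<longlonglongrightarrow> 0" by real_asymp
    then have "(\<lambda>n. \<kappa> * (E n * (1 / sqrt (real n))) + 1) \<longlonglongrightarrow> \<kappa> * (0 * 0) + 1" by (intro tendsto_intros Elim)
    then show "(\<lambda>n. \<kappa> * (E n * (1 / sqrt (real n))) + 1) \<longlonglongrightarrow> 1" by simp
    show "\<forall>\<^sub>F n in sequentially. \<kappa> * (E n * (1 / sqrt (real n))) + 1 = \<mu> n / (1 / \<kappa> * real n)"
      using mean
    proof eventually_elim
      case (elim n)
      have "sqrt (real n) * sqrt (real n) = real n" by simp
      then have "1 / sqrt (real n) = sqrt (real n) / real n" using elim by (simp add: field_simps)
      then show ?case using elim \<kappa> by (simp add: field_simps)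
    qed
  qed
  show "v \<sim>[sequentially] (\<lambda>n. V / \<kappa> ^ 3 * real n)"
  proof (rule asymp_equivI', rule Lim_transform_eventually)
    have "\<sigma>\<^sup>2 \<noteq> 0" using \<sigma>(1) by simp
    from tendsto_divide[OF Wlim tendsto_const this] this show "(\<lambda>n. W n / \<sigma>\<^sup>2) \<longlonglongrightarrow> 1" by simp
    show "\<forall>\<^sub>F n in sequentially. W n / \<sigma>\<^sup>2 = v n / (V / \<kappa> ^ 3 * real n)"
      using var eventually_gt_at_top[of 0] by eventually_elim (simp add: \<sigma>(2))
  qed
qed

text \<open>Substitutes \<open>H(r) = \<rho>G / q\<close>, \<open>r H'(r)\<close> for the first
  Euler derivative and \<open>r (H'(r) + r H''(r))\<close> for the second.\<close>

lemma saddle_parameters: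
  fixes \<rho>G q r h :: real
  assumes r: "0 < r" "ereal r < fps_conv_radius H" and q: "q > 0" "q * eval_fps H r = \<rho>G"
    and h: "eval_fps H r > 0" "eval_fps (fps_deriv H) r > 0"
  defines "\<kappa> \<equiv> eval_fps (euler_fps H) r / eval_fps H r"
  defines "V \<equiv> eval_fps (euler_fps (euler_fps H)) r / eval_fps H r - \<kappa>\<^sup>2"
  shows "1 / \<kappa> = \<rho>G / (q * r * eval_fps (fps_deriv H) r)"
    and "V / \<kappa> ^ 3 = \<rho>G\<^sup>2 / (q\<^sup>2 * r\<^sup>2 * (eval_fps (fps_deriv H) r)\<^sup>2)
           - \<rho>G / (q * r * eval_fps (fps_deriv H) r)
           + \<rho>G\<^sup>2 * eval_fps (fps_deriv (fps_deriv H)) r / (q\<^sup>2 * r * (eval_fps (fps_deriv H) r) ^ 3)"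
proof -
  let ?h1 = "eval_fps (fps_deriv H) r" and ?h2 = "eval_fps (fps_deriv (fps_deriv H)) r"
  have r1: "ereal (norm r) < fps_conv_radius (fps_deriv H)" using r less_le_trans[OF _ fps_conv_radius_deriv[of H]] by simp
  have r2: "ereal (norm r) < fps_conv_radius (fps_deriv (fps_deriv H))" by (rule less_le_trans[OF r1 fps_conv_radius_deriv])
  have r3: "ereal (norm r) < fps_conv_radius (fps_X * fps_deriv (fps_deriv H))"
    using less_le_trans[OF r2, of "fps_conv_radius (fps_X * fps_deriv (fps_deriv H))"] fps_conv_radius_mult[of fps_X "fps_deriv (fps_deriv H)"] by simp
  have e1: "eval_fps (euler_fps H) r = r * ?h1" by (rule eval_euler_fps) (use r in simp)
  have "eval_fps (euler_fps (euler_fps H)) r = r * eval_fps (fps_deriv (euler_fps H)) r"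
    by (rule eval_euler_fps) (use r less_le_trans[OF _ euler_fps_radius[of H]] in simp)
  also have "fps_deriv (euler_fps H) = fps_deriv H + fps_X * fps_deriv (fps_deriv H)" by (simp add: euler_fps_def)
  also have "eval_fps \<dots> r = ?h1 + r * ?h2" using r1 r2 r3 by (simp add: eval_fps_add eval_fps_mult)
  finally have e2: "eval_fps (euler_fps (euler_fps H)) r = r * (?h1 + r * ?h2)" .
  show "1 / \<kappa> = \<rho>G / (q * r * ?h1)" using q h r by (simp add: \<kappa>_def e1 flip: q(2))
  show "V / \<kappa> ^ 3 = \<rho>G\<^sup>2 / (q\<^sup>2 * r\<^sup>2 * ?h1\<^sup>2) - \<rho>G / (q * r * ?h1) + \<rho>G\<^sup>2 * ?h2 / (q\<^sup>2 * r * ?h1 ^ 3)"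
    using q(1) h r by (simp add: V_def \<kappa>_def e1 e2 flip: q(2)) (simp add: field_simps power2_eq_square power3_eq_cube)
qed

theorem theorem6:
  fixes G H :: "real fps"
    and \<rho>G \<rho>H lamG lamH cG cH \<tau>H qc :: real
    and X :: "real \<Rightarrow> nat \<Rightarrow> nat pmf"
    and \<mu> var :: "real \<Rightarrow> nat \<Rightarrow> real"
  assumes G: "delta_singular G \<rho>G lamG cG" and lamG: "lamG < 0"
    and H: "delta_singular H \<rho>H lamH cH" and lamH: "0 < lamH" "lamH < 1"
    and \<tau>H: "\<tau>H = eval_fps H \<rho>H"
    and qc: "qc = \<rho>G / \<tau>H"
    and X: "X = gibbs_pmf G H"
    and \<mu>: "\<mu> = (\<lambda>q n. measure_pmf.expectation (X q n) real)"
    and var: "var = (\<lambda>q n. measure_pmf.variance (X q n) real)"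
  shows
      "(\<forall>q. 0 < q \<and> q < qc \<longrightarrow>
         weak_conv_m (\<lambda>n. distr (X q n) borel (\<lambda>k. real k - 1))
                     (distr (boltzmann_pmf G (q * \<tau>H)) borel real) \<and>
         (\<forall>k::nat. (\<lambda>n. measure_pmf.prob (X q n) {j. real j - 1 = real k}) \<longlonglongrightarrow>
            fps_nth (fps_deriv G oo (fps_const (q * \<tau>H) * fps_X)) k
              / eval_fps (fps_deriv G) (q * \<tau>H)) \<and>
         (\<forall>m::real. G = fps_binomial (- m) oo (- fps_X) \<longrightarrow>
            weak_conv_m (\<lambda>n. distr (X q n) borel (\<lambda>k. real k - 1))
                        (distr (negbin_pmf (m + 1) (1 - q * \<tau>H)) borel real)) \<and>
         \<mu> q \<sim>[sequentially]
           (\<lambda>n. 1 + q * \<tau>H * eval_fps (fps_deriv (fps_deriv G)) (q * \<tau>H)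
                      / eval_fps (fps_deriv G) (q * \<tau>H)))
     \<and>
      (weak_conv_m
         (\<lambda>n. distr (X qc n) borel (\<lambda>k. - cH * real k / (\<tau>H * real n powr lamH)))
         (mittag_leffler_distribution lamH (- lamG * lamH)) \<and>
       real_distribution (mittag_leffler_distribution lamH (- lamG * lamH)) \<and>
       (\<forall>r::nat. integrable (mittag_leffler_distribution lamH (- lamG * lamH)) (\<lambda>x. x ^ r) \<and>
          (\<integral>x. x ^ r \<partial>mittag_leffler_distribution lamH (- lamG * lamH)) =
            mittag_leffler_moment lamH (- lamG * lamH) r) \<and>
       (\<forall>M. real_distribution M \<and>
          (\<forall>r::nat. integrable M (\<lambda>x. x ^ r) \<and>
             (\<integral>x. x ^ r \<partial>M) = mittag_leffler_moment lamH (- lamG * lamH) r) \<longrightarrow>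
          M = mittag_leffler_distribution lamH (- lamG * lamH)) \<and>
       (lamG = - 1 \<and> lamH = 1 / 2 \<longrightarrow>
          mittag_leffler_distribution lamH (- lamG * lamH) = rayleigh_distribution (sqrt 2)) \<and>
       \<mu> qc \<sim>[sequentially]
         (\<lambda>n. lamG * \<tau>H * Gamma (- lamG * lamH) / (cH * Gamma ((1 - lamG) * lamH))
                * real n powr lamH))
     \<and>
      (\<forall>q. q > qc \<and> q * fps_nth H 0 < \<rho>G \<longrightarrow>
         (\<exists>\<rho>. 0 < \<rho> \<and> \<rho> < \<rho>H \<and> q * eval_fps H \<rho> = \<rho>G \<and>
            (\<forall>\<rho>'. 0 < \<rho>' \<and> \<rho>' < \<rho>H \<and> q * eval_fps H \<rho>' = \<rho>G \<longrightarrow> \<rho>' = \<rho>) \<and>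
            weak_conv_m
              (\<lambda>n. distr (X q n) borel (\<lambda>k. (real k - \<mu> q n) / sqrt (var q n)))
              std_normal_distribution \<and>
            \<mu> q \<sim>[sequentially]
              (\<lambda>n. \<rho>G / (q * \<rho> * eval_fps (fps_deriv H) \<rho>) * real n) \<and>
            var q \<sim>[sequentially]
              (\<lambda>n. (\<rho>G\<^sup>2 / (q\<^sup>2 * \<rho>\<^sup>2 * (eval_fps (fps_deriv H) \<rho>)\<^sup>2)
                     - \<rho>G / (q * \<rho> * eval_fps (fps_deriv H) \<rho>)
                     + \<rho>G\<^sup>2 * eval_fps (fps_deriv (fps_deriv H)) \<rho>
                         / (q\<^sup>2 * \<rho> * (eval_fps (fps_deriv H) \<rho>) ^ 3)) * real n)))"
proof -
  have mlparam: "- lamG * lamH > 0" using lamG lamH by (simp add: mult_neg_pos)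
  note crit = critical_regime[OF G lamG H lamH]
  note ml = mittag_leffler_moments[OF lamH mlparam]
  note mld = real_distribution_mittag_leffler[OF lamH mlparam]
  show ?thesis
    unfolding X \<mu> var qc \<tau>H
  proof (intro conjI allI impI, goal_cases)
    case (1 q)
    then show ?case by (intro subcritical_regime(1)[OF G lamG H lamH]) auto
  next
    case (2 q k)
    then show ?case by (intro subcritical_regime(2)[OF G lamG H lamH]) auto
  next
    case (3 q m)
    then show ?case by (intro subcritical_regime(3)[OF G lamG H lamH]) auto
  next
    case (4 q)
    then show ?case by (intro subcritical_regime(4)[OF G lamG H lamH]) auto
  next
    case 5
    show ?case by (rule crit(1))
  next
    case 6
    show ?case by (rule mld)
  next
    case (7 r)
    show ?case by (rule integrable.intros[OF ml])
  next
    case (8 r)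
    show ?case by (rule has_bochner_integral_integral_eq[OF ml])
  next
    case (9 M)
    \<comment> \<open>The growth bound on the moments makes them determine the law.\<close>
    show ?case
      by (rule moments_determine[OF _ mld _ _ _ _ mittag_leffler_moment_growth[OF lamH(1) mlparam]])
         (use 9 ml has_bochner_integral_integral_eq[OF ml] in \<open>auto simp: has_bochner_integral_iff\<close>)
  next
    case 10
    then have "lamH = 1 / 2" "- lamG * lamH = 1 / 2" by simp_all
    then show ?case by (simp only: mittag_leffler_rayleigh)
  next
    case 11
    show ?case by (rule crit(2))
  next
    case (12 q)
    have \<tau>: "eval_fps H \<rho>H > 0" by (rule critical_moments(3)[OF G lamG H lamH])
    have rho: "\<rho>G > 0" "fps_conv_radius H = ereal \<rho>H" using G H by (auto simp: delta_singular_def)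
    have "0 < \<rho>G / eval_fps H \<rho>H" using rho \<tau> by simp
    with 12 have q: "q > 0" by linarith
    \<comment> \<open>\<open>q > qc\<close> puts the level \<open>\<rho>G / q\<close> below the
      value of \<open>H\<close> at \<open>\<rho>H\<close>, and
      \<open>q * fps_nth H 0 < \<rho>G\<close> puts it above the value at 0.\<close>
    have "\<exists>!r. 0 < r \<and> r < \<rho>H \<and> eval_fps H r = \<rho>G / q"
      by (rule saddle_point_unique[OF H lamH]) (use 12 q \<tau> in \<open>simp_all add: field_simps\<close>)
    then have "\<exists>!r. 0 < r \<and> r < \<rho>H \<and> q * eval_fps H r = \<rho>G"
      using q by (simp add: field_simps)
    then obtain r where r: "0 < r" "r < \<rho>H" "q * eval_fps H r = \<rho>G"
      and u: "\<And>s. 0 < s \<and> s < \<rho>H \<and> q * eval_fps H s = \<rho>G \<Longrightarrow> s = r" by blast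
    have r': "ereal r < fps_conv_radius H" using r rho by simp
    note par = saddle_parameters[OF r(1) r' q r(3) tilted_fps_facts(1)[OF H r(1,2)] tilt_quotient_facts(5)[OF H r(1,2)]]
    note sup = supercritical_regime[OF G lamG H r(1,2) q r(3), unfolded par]
    show ?case
      by (rule exI[of _ r], intro conjI r sup) (use u in blast)
  qed
qed

end
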